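(* Let $\rho_o,\sigma_o\in L^\infty(\mathbb{R},[0,1])$. Let $(q_i)_{1\le i\le J}$ and $(\tilde q_i)_{1\le i\le J}$ be two families of constraints with $q_i,\tilde q_i\in L^\infty((s_i,T_i),\mathbb{R})$ for all $i$, both satisfying the standing assumption (Q) of the context. Let $\rho$ (resp. $\sigma$) be a $\mathcal{G}$-entropy solution to the multiple trajectory problem with initial datum $\rho_o$ (resp. $\sigma_o$) and constraints $(q_i)_{i}$ (resp. $(\tilde q_i)_i$), for the same trajectories $(y_i)_{1\le i\le J}$. Then for all $T>0$, $$\|\rho(T)-\sigma(T)\|_{L^1(\mathbb{R})}\le \|\rho_o-\sigma_o\|_{L^1(\mathbb{R})}+\sum_{i=1}^J 2\int_{s_i}^{T_i}|q_i(t)-\tilde q_i(t)|\,dt .$$ In particular, the multiple trajectory problem admits at most one $\mathcal{G}$-entropy solution.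
   Context: Flux. $f\in C^2([0,1],[0,\infty))$ is concave, $f(0)=f(1)=0$, and there is a unique $\overline\rho\in(0,1)$ with $f'(\rho)(\overline\rho-\rho)>0$ for a.e. $\rho\in(0,1)$. For $s\in\mathbb{R}$ and $a,b\in[0,1]$: $F_s(a)=f(a)-sa$, $\Phi_s(a,b)=\operatorname{sgn}(a-b)(F_s(a)-F_s(b))$, $\Phi:=\Phi_0$. $\Omega=\mathbb{R}\times(0,\infty)$, $\overline\Omega=\mathbb{R}\times[0,\infty)$. Interfaces. For $1\le i\le J$: $0\le s_i<T_i$, $y_i\in W^{1,\infty}((s_i,T_i),\mathbb{R})$ (extended continuously to $[s_i,T_i]$), $\Gamma_i=\{(y_i(t),t):t\in[s_i,T_i]\}$. Distinct $\Gamma_i$ may meet only at endpoints (crossing points are regarded as endpoints). Assumption (Q) on a constraint $q_i$: for a.e. $t\in(s_i,T_i)$, $q_i(t)\in[0,\max F_{\dot y_i(t)})$ if $\dot y_i(t)\ge0$ and $q_i(t)\in[-\dot y_i(t),\max F_{\dot y_i(t)})$ if $\dot y_i(t)<0$. Problem. $\partial_t\rho+\partial_xf(\rho)=0$ in $\Omega$, $\rho(\cdot,0)=\rho_o$, and $(f(\rho)-\dot y_i(t)\rho)|_{x=y_i(t)}\le q_i(t)$ for $t\in(s_i,T_i)$, $1\le i\le J$. Germ. For $s\ge0$, $q\in[0,\max F_s)$, or $s\le0$, $q\in[-s,\max F_s)$, let $\widehat\rho_s(q)>\check\rho_s(q)$ be the two solutions in $[0,1]$ of $F_s(\rho)=q$,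 and $$\mathcal{G}_s(q)=\{(\widehat\rho_s(q),\check\rho_s(q))\}\cup\{(\kappa,\kappa):F_s(\kappa)\le q\}\cup\{(k_l,k_r):k_l<k_r,\ F_s(k_l)=F_s(k_r)\le q\}\subset[0,1]^2 .$$ Definition. $\rho\in L^\infty(\Omega,[0,1])$ is a $\mathcal{G}$-entropy solution if: (i) for all $\varphi\in C_c^\infty(\overline\Omega\setminus\bigcup_{i=1}^J\Gamma_i,[0,\infty))$ and $\kappa\in[0,1]$, $$\int_0^\infty\!\!\int_{\mathbb{R}}\big(|\rho-\kappa|\partial_t\varphi+\Phi(\rho,\kappa)\partial_x\varphi\big)\,dx\,dt+\int_{\mathbb{R}}|\rho_o(x)-\kappa|\varphi(x,0)\,dx\ge0;$$ (ii) for all $i$ and a.e. $t\in(s_i,T_i)$, $(\rho(y_i(t)-,t),\rho(y_i(t)+,t))\in\mathcal{G}_{\dot y_i(t)}(q_i(t))$, where $\rho(y_i(t)\pm,t)$ are the one-sided strong ($L^1_{loc}$) traces of $\rho$ along $\Gamma_i$. It is a standing assumption that functions satisfying (i) admit such traces. $\rho(T)$ denotes $\rho(\cdot,T)$, for the representative of $\rho$ in $C([0,\infty);L^1_{loc}(\mathbb{R}))$. *)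

theory Defs
  imports "HOL-Analysis.Analysis"
begin

section \<open>Function spaces\<close>

definition Linf :: "'a::euclidean_space set \<Rightarrow> ('a \<Rightarrow> real) \<Rightarrow> bool" where
  "Linf A u \<longleftrightarrow>
     u \<in> borel_measurable (lebesgue_on A) \<and> (\<exists>C. AE x in lebesgue_on A. \<bar>u x\<bar> \<le> C)"

definition Linf_in :: "'a::euclidean_space set \<Rightarrow> real set \<Rightarrow> ('a \<Rightarrow> real) \<Rightarrow> bool" where
  "Linf_in A B u \<longleftrightarrow> Linf A u \<and> (AE x in lebesgue_on A. u x \<in> B)"

text \<open>One-sided derivatives at boundary points of an interval \<open>A\<close>.\<close>

definition C2_on :: "real set \<Rightarrow> (real \<Rightarrow> real) \<Rightarrow> bool" where
  "C2_on A f \<longleftrightarrow>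
     (\<exists>f' f''. (\<forall>x\<in>A. (f has_real_derivative f' x) (at x within A) \<and>
                     (f' has_real_derivative f'' x) (at x within A)) \<and>
              continuous_on A f'')"

primrec Ck :: "nat \<Rightarrow> ('a::euclidean_space \<Rightarrow> real) \<Rightarrow> bool" where
  "Ck 0 g \<longleftrightarrow> continuous_on UNIV g"
| "Ck (Suc k) g \<longleftrightarrow>
     (\<forall>x. g differentiable (at x)) \<and> (\<forall>v. Ck k (\<lambda>x. frechet_derivative g (at x) v))"

definition Cinf :: "('a::euclidean_space \<Rightarrow> real) \<Rightarrow> bool" where
  "Cinf g \<longleftrightarrow> (\<forall>k. Ck k g)"

definition test_on :: "real set \<Rightarrow> (real \<Rightarrow> real) \<Rightarrow> bool" where
  "test_on U g \<longleftrightarrow> Cinf g \<and> compact (closure {t. g t \<noteq> 0}) \<and> closure {t. g t \<noteq> 0} \<subseteq> U"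

definition weak_derivative :: "real set \<Rightarrow> (real \<Rightarrow> real) \<Rightarrow> (real \<Rightarrow> real) \<Rightarrow> bool" where
  "weak_derivative U y dy \<longleftrightarrow>
     (\<forall>g. test_on U g \<longrightarrow>
        (LINT t|lebesgue_on U. y t * deriv g t) = - (LINT t|lebesgue_on U. dy t * g t))"

text \<open>\<open>y\<close> is the continuous representative, on \<open>[a, b]\<close>, of an element of \<open>W\<^sup>1\<^sup>,\<^sup>\<infinity>((a, b))\<close>,
  and \<open>dy\<close> is (a representative of) its derivative.\<close>

definition W1inf :: "real \<Rightarrow> real \<Rightarrow> (real \<Rightarrow> real) \<Rightarrow> (real \<Rightarrow> real) \<Rightarrow> bool" where
  "W1inf a b y dy \<longleftrightarrow>
     continuous_on {a..b} y \<and> Linf {a<..<b} y \<and> Linf {a<..<b} dy \<and>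
     weak_derivative {a<..<b} y dy"

section \<open>Flux and germ\<close>

definition flux :: "(real \<Rightarrow> real) \<Rightarrow> bool" where
  "flux f \<longleftrightarrow>
     C2_on {0..1} f \<and> (\<forall>r\<in>{0..1}. 0 \<le> f r) \<and> concave_on {0..1} f \<and> f 0 = 0 \<and> f 1 = 0 \<and>
     (\<exists>!rbar. rbar \<in> {0<..<1} \<and>
        (AE r in lebesgue_on {0<..<1}. deriv f r * (rbar - r) > 0))"

definition Fs :: "(real \<Rightarrow> real) \<Rightarrow> real \<Rightarrow> real \<Rightarrow> real" where
  "Fs f s a = f a - s * a"

definition Phis :: "(real \<Rightarrow> real) \<Rightarrow> real \<Rightarrow> real \<Rightarrow> real \<Rightarrow> real" where
  "Phis f s a b = sgn (a - b) * (Fs f s a - Fs f s b)"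

definition maxF :: "(real \<Rightarrow> real) \<Rightarrow> real \<Rightarrow> real" where
  "maxF f s = (SUP a\<in>{0..1}. Fs f s a)"

text \<open>The larger and the smaller of the two solutions of \<open>F\<^sub>s(r) = q\<close> in \<open>[0, 1]\<close>. These (and
  hence the germ) are meaningful only when there are exactly two, in particular for
  \<open>max(0, -s) \<le> q < max F\<^sub>s\<close>.\<close>

definition rho_hat :: "(real \<Rightarrow> real) \<Rightarrow> real \<Rightarrow> real \<Rightarrow> real" where
  "rho_hat f s q = Max {r \<in> {0..1}. Fs f s r = q}"

definition rho_check :: "(real \<Rightarrow> real) \<Rightarrow> real \<Rightarrow> real \<Rightarrow> real" where
  "rho_check f s q = Min {r \<in> {0..1}. Fs f s r = q}"

definition germ :: "(real \<Rightarrow> real) \<Rightarrow> real \<Rightarrow> real \<Rightarrow> (real \<times> real) set" where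
  "germ f s q =
     {(rho_hat f s q, rho_check f s q)}
     \<union> {(k, k) | k. k \<in> {0..1} \<and> Fs f s k \<le> q}
     \<union> {(kl, kr) | kl kr. kl \<in> {0..1} \<and> kr \<in> {0..1} \<and> kl < kr \<and>
                         Fs f s kl = Fs f s kr \<and> Fs f s kr \<le> q}"

section \<open>Interfaces and constraints\<close>

text \<open>Points of the plane are pairs \<open>(x, t)\<close>.\<close>

definition Omega :: "(real \<times> real) set" where
  "Omega = UNIV \<times> {0<..}"

definition Omega_bar :: "(real \<times> real) set" where
  "Omega_bar = UNIV \<times> {0..}"

definition Gam :: "real \<Rightarrow> real \<Rightarrow> (real \<Rightarrow> real) \<Rightarrow> (real \<times> real) set" where
  "Gam a b y = (\<lambda>t. (y t, t)) ` {a..b}"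

definition endpoints :: "real \<Rightarrow> real \<Rightarrow> (real \<Rightarrow> real) \<Rightarrow> (real \<times> real) set" where
  "endpoints a b y = {(y a, a), (y b, b)}"

definition trajectories ::
  "nat \<Rightarrow> (nat \<Rightarrow> real) \<Rightarrow> (nat \<Rightarrow> real) \<Rightarrow> (nat \<Rightarrow> real \<Rightarrow> real) \<Rightarrow> (nat \<Rightarrow> real \<Rightarrow> real) \<Rightarrow> bool" where
  "trajectories J s T y dy \<longleftrightarrow>
     (\<forall>i\<in>{1..J}. 0 \<le> s i \<and> s i < T i \<and> W1inf (s i) (T i) (y i) (dy i)) \<and>
     (\<forall>i\<in>{1..J}. \<forall>j\<in>{1..J}. i \<noteq> j \<longrightarrow>
        Gam (s i) (T i) (y i) \<inter> Gam (s j) (T j) (y j)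
          \<subseteq> endpoints (s i) (T i) (y i) \<inter> endpoints (s j) (T j) (y j))"

definition assumption_Q ::
  "(real \<Rightarrow> real) \<Rightarrow> real \<Rightarrow> real \<Rightarrow> (real \<Rightarrow> real) \<Rightarrow> (real \<Rightarrow> real) \<Rightarrow> bool" where
  "assumption_Q f a b dy q \<longleftrightarrow>
     (AE t in lebesgue_on {a<..<b}.
        (dy t \<ge> 0 \<longrightarrow> q t \<in> {0..<maxF f (dy t)}) \<and>
        (dy t < 0 \<longrightarrow> q t \<in> {- dy t..<maxF f (dy t)}))"

definition constraints ::
  "(real \<Rightarrow> real) \<Rightarrow> nat \<Rightarrow> (nat \<Rightarrow> real) \<Rightarrow> (nat \<Rightarrow> real) \<Rightarrow> (nat \<Rightarrow> real \<Rightarrow> real)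
    \<Rightarrow> (nat \<Rightarrow> real \<Rightarrow> real) \<Rightarrow> bool" where
  "constraints f J s T dy q \<longleftrightarrow>
     (\<forall>i\<in>{1..J}. Linf {s i<..<T i} (q i) \<and> assumption_Q f (s i) (T i) (dy i) (q i))"

section \<open>Entropy solutions\<close>

text \<open>Nonnegative elements of \<open>C\<^sub>c\<^sup>\<infinity>(Omega_bar - G)\<close>: functions smooth up to the boundary
  \<open>t = 0\<close> are represented by smooth functions on the whole plane, of which only the restriction
  to \<open>Omega_bar\<close> matters.\<close>

definition test_half_plane :: "(real \<times> real) set \<Rightarrow> (real \<times> real \<Rightarrow> real) \<Rightarrow> bool" where
  "test_half_plane G g \<longleftrightarrow>
     Cinf g \<and> (\<forall>p\<in>Omega_bar. 0 \<le> g p) \<and>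
     compact (closure {p \<in> Omega_bar. g p \<noteq> 0}) \<and>
     closure {p \<in> Omega_bar. g p \<noteq> 0} \<inter> G = {}"

definition partial_x :: "(real \<times> real \<Rightarrow> real) \<Rightarrow> real \<times> real \<Rightarrow> real" where
  "partial_x g p = deriv (\<lambda>x. g (x, snd p)) (fst p)"

definition partial_t :: "(real \<times> real \<Rightarrow> real) \<Rightarrow> real \<times> real \<Rightarrow> real" where
  "partial_t g p = deriv (\<lambda>t. g (fst p, t)) (snd p)"

definition entropy_ineq ::
  "(real \<Rightarrow> real) \<Rightarrow> (real \<times> real) set \<Rightarrow> (real \<Rightarrow> real) \<Rightarrow> (real \<times> real \<Rightarrow> real) \<Rightarrow> bool" where
  "entropy_ineq f G \<rho>o \<rho> \<longleftrightarrow>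
     (\<forall>g \<kappa>. test_half_plane G g \<and> \<kappa> \<in> {0..1} \<longrightarrow>
        (LINT p|lebesgue_on Omega.
            \<bar>\<rho> p - \<kappa>\<bar> * partial_t g p + Phis f 0 (\<rho> p) \<kappa> * partial_x g p)
        + (LINT x|lebesgue. \<bar>\<rho>o x - \<kappa>\<bar> * g (x, 0)) \<ge> 0)"

text \<open>\<open>\<gamma>\<close> is the strong trace of \<open>\<rho>\<close> along the curve \<open>x = y(t)\<close>, \<open>t \<in> (a, b)\<close>, from the right if
  \<open>\<epsilon> = 1\<close> and from the left if \<open>\<epsilon> = -1\<close>: the essential limit, as \<open>h \<rightarrow> 0+\<close>, of
  \<open>t \<mapsto> \<rho>(y(t) + \<epsilon> h, t)\<close> in \<open>L\<^sup>1\<^sub>l\<^sub>o\<^sub>c((a, b))\<close>.\<close>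

definition strong_trace ::
  "real \<Rightarrow> real \<Rightarrow> real \<Rightarrow> (real \<Rightarrow> real) \<Rightarrow> (real \<times> real \<Rightarrow> real) \<Rightarrow> (real \<Rightarrow> real) \<Rightarrow> bool" where
  "strong_trace \<epsilon> a b y \<rho> \<gamma> \<longleftrightarrow>
     Linf {a<..<b} \<gamma> \<and>
     (\<forall>K. compact K \<and> K \<subseteq> {a<..<b} \<longrightarrow>
        (\<forall>\<eta>>0. \<exists>\<delta>>0. AE h in lebesgue. 0 < h \<and> h < \<delta> \<longrightarrow>
           (\<integral>\<^sup>+t\<in>K. ennreal \<bar>\<rho> (y t + \<epsilon> * h, t) - \<gamma> t\<bar> \<partial>lebesgue) \<le> ennreal \<eta>))"

definition G_entropy_solution ::
  "(real \<Rightarrow> real) \<Rightarrow> nat \<Rightarrow> (nat \<Rightarrow> real) \<Rightarrow> (nat \<Rightarrow> real) \<Rightarrow> (nat \<Rightarrow> real \<Rightarrow> real)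
    \<Rightarrow> (nat \<Rightarrow> real \<Rightarrow> real) \<Rightarrow> (nat \<Rightarrow> real \<Rightarrow> real) \<Rightarrow> (real \<Rightarrow> real) \<Rightarrow> (real \<times> real \<Rightarrow> real) \<Rightarrow> bool" where
  "G_entropy_solution f J s T y dy q \<rho>o \<rho> \<longleftrightarrow>
     Linf_in Omega {0..1} \<rho> \<and>
     entropy_ineq f (\<Union>i\<in>{1..J}. Gam (s i) (T i) (y i)) \<rho>o \<rho> \<and>
     (\<forall>i\<in>{1..J}. \<exists>\<gamma>l \<gamma>r.
        strong_trace (-1) (s i) (T i) (y i) \<rho> \<gamma>l \<and>
        strong_trace 1 (s i) (T i) (y i) \<rho> \<gamma>r \<and>
        (AE t in lebesgue_on {s i<..<T i}. (\<gamma>l t, \<gamma>r t) \<in> germ f (dy i t) (q i t)))"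

text \<open>\<open>R t\<close> plays the role of \<open>\<rho>(\<cdot>, t)\<close>: \<open>R\<close> is the representative of \<open>\<rho>\<close> in
  \<open>C([0, \<infinity>); L\<^sup>1\<^sub>l\<^sub>o\<^sub>c)\<close>.\<close>

definition continuous_L1loc :: "(real \<Rightarrow> real \<Rightarrow> real) \<Rightarrow> bool" where
  "continuous_L1loc R \<longleftrightarrow>
     (\<forall>t\<ge>0. \<forall>K. compact K \<longrightarrow>
        integrable (lebesgue_on K) (R t) \<and>
        ((\<lambda>\<tau>. LINT x|lebesgue_on K. \<bar>R \<tau> x - R t x\<bar>) \<longlongrightarrow> 0) (at t within {0..}))"

definition time_representative :: "(real \<times> real \<Rightarrow> real) \<Rightarrow> (real \<Rightarrow> real \<Rightarrow> real) \<Rightarrow> bool" where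
  "time_representative \<rho> R \<longleftrightarrow>
     continuous_L1loc R \<and> (AE p in lebesgue_on Omega. R (snd p) (fst p) = \<rho> p)"

end

theory Submission
  imports Defs
begin

text \<open>
  Away from the interfaces, doubling of variables gives Kato's inequality
  \<open>\<partial>\<^sub>t |\<rho> - \<sigma>| + \<partial>\<^sub>x \<Phi>(\<rho>, \<sigma>) \<le> 0\<close>. The mollified entropy inequalities are weighted with a test function \<open>g\<close>
  evaluated at the centre of the mollifier, so that only difference quotients of \<open>g\<close> survive and no
  regularity of \<open>\<rho>\<close>, \<open>\<sigma>\<close> beyond continuity of translations in \<open>L\<^sup>1\<close> is used. To let \<open>g\<close> charge an interface,
  one subtracts from it a strip of width \<open>h\<close> around a mollification of the trajectory; as \<open>h \<rightarrow> 0\<close>, strong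
  traces turn the strip into the jump of \<open>\<Phi>\<^sub>s(\<rho>, \<sigma>)\<close>, with \<open>s\<close> the speed of the interface, and the germ bounds that jump by
  \<open>2 |q - q'|\<close>. Neighbourhoods of end points are negligible since points have zero capacity, and the
  initial datum is attained in an averaged \<open>L\<^sup>1\<close> sense. Testing with a cutoff of the backward cone of
  slope \<open>Lip f\<close> then yields the estimate.
\<close>

section \<open>Smooth test functions\<close>

text \<open>The entropy inequality is tested off the curves only; at a curve nothing is known but
  traces. Kato's inequality is thus available only for test functions vanishing near all curves and
  near t = 0, and each restriction has to be lifted at a controlled price. The order is forced.
  Traces and weak derivatives live on the open time interval of a trajectory, so a curve can be
  charged only while its end points stay excluded. The initial trace needs mollifiers that avoid the
  curves, and these reach t = 0 only at end points. End points come last: a square of side of order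
  \<delta> has gradient 1/\<delta> on area \<delta>^2. A trajectory is not C1, hence neither is a
  strip around it. Its mollification converges uniformly, but its speed only in L1, and the strip
  has slope 1/h; so h is fixed before the mollification index. The factor 2 is the largest
  difference of two signs: each solution has the same moving flux on both sides of an interface, so
  the jump of the Kruzhkov flux is a sign difference times a flux difference. All data are replaced
  by Borel versions bounded everywhere, and the flux by a globally Lipschitz one, so that the
  analysis rarely meets null sets.\<close>

lemma Ck_down: "Ck (Suc k) g \<Longrightarrow> Ck k g"
proof (induction k arbitrary: g)
  case 0
  then show ?case
    by (auto simp: intro!: differentiable_imp_continuous_on differentiable_at_imp_differentiable_on)
next
  case (Suc k)
  then show ?case by (metis Ck.simps(2))
qed

lemma Ck_const: "Ck k (\<lambda>x::'a::euclidean_space. c)"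
proof (induction k arbitrary: c)
  case (Suc k)
  show ?case by (auto simp: frechet_derivative_const Suc)
qed simp

lemma Ck_continuous: "Ck k g \<Longrightarrow> continuous_on UNIV g"
  by (induction k) (use Ck_down in \<open>auto simp del: Ck.simps(2)\<close>)

lemma Ck_add: "Ck k g \<Longrightarrow> Ck k h \<Longrightarrow> Ck k (\<lambda>x::'a::euclidean_space. g x + h x)"
proof (induction k arbitrary: g h)
  case 0
  then show ?case by (auto intro: continuous_intros)
next
  case (Suc k)
  have "frechet_derivative (\<lambda>x. g x + h x) (at x) v =
      frechet_derivative g (at x) v + frechet_derivative h (at x) v" for x v
    using Suc.prems frechet_derivative_works by (subst frechet_derivative_at[OF has_derivative_add, symmetric]) auto
  then show ?case using Suc by auto
qed

lemma Ck_mult: "Ck k g \<Longrightarrow> Ck k h \<Longrightarrow> Ck k (\<lambda>x::'a::euclidean_space. g x * h x)"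
proof (induction k arbitrary: g h)
  case 0
  then show ?case by (auto intro: continuous_intros)
next
  case (Suc k)
  have *: "frechet_derivative (\<lambda>x. g x * h x) (at x) v =
      g x * frechet_derivative h (at x) v + frechet_derivative g (at x) v * h x" for x v
    using Suc.prems frechet_derivative_works by (subst frechet_derivative_at[OF has_derivative_mult, symmetric]) auto
  show ?case using Suc.IH Suc.prems Ck_down[OF Suc.prems(1)] Ck_down[OF Suc.prems(2)]
    by (auto simp: * intro!: Ck_add)
qed

lemma Ck_affine:
  fixes g :: "'a::euclidean_space \<Rightarrow> real" and A :: "'b::euclidean_space \<Rightarrow> 'a"
  assumes A: "bounded_linear A"
  shows "Ck k g \<Longrightarrow> Ck k (\<lambda>x. g (A x + c))"
proof (induction k arbitrary: g)
  case 0
  have "continuous_on UNIV (\<lambda>x. A x + c)"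
    using linear_continuous_on[OF A] by (intro continuous_intros)
  then show ?case using 0 continuous_on_compose2[of UNIV g] by auto
next
  case (Suc k)
  have d: "((\<lambda>x. g (A x + c)) has_derivative (\<lambda>v. frechet_derivative g (at (A x + c)) (A v))) (at x)" for x
  proof -
    have "((\<lambda>x. A x + c) has_derivative A) (at x)"
      using bounded_linear_imp_has_derivative[OF A] by (auto intro!: derivative_eq_intros)
    moreover have "(g has_derivative frechet_derivative g (at (A x + c))) (at (A x + c))"
      using Suc.prems frechet_derivative_works by auto
    ultimately show ?thesis by (rule has_derivative_compose)
  qed
  then have *: "frechet_derivative (\<lambda>x. g (A x + c)) (at x) v = frechet_derivative g (at (A x + c)) (A v)" for x v
    by (metis frechet_derivative_at)
  show ?case using Suc d by (auto simp: * differentiable_def)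
qed

text \<open>On the line every directional derivative is a multiple of the ordinary one, so the
  quantifier over directions in \<open>Ck\<close> is discharged by a single function.\<close>

lemma Ck_SucI:
  fixes g :: "real \<Rightarrow> real"
  assumes "\<And>x. (g has_real_derivative g' x) (at x)" "Ck k g'"
  shows "Ck (Suc k) g"
proof -
  have d: "(g has_derivative (\<lambda>v. g' x * v)) (at x)" for x
    using assms(1) by (simp add: has_field_derivative_def)
  then have *: "frechet_derivative g (at x) v = g' x * v" for x v
    by (metis frechet_derivative_at)
  show ?thesis using d assms(2) by (auto simp: * differentiable_def intro!: Ck_mult Ck_const)
qed

lemma CinfI: "(\<And>k. Ck k g) \<Longrightarrow> Cinf g"
  by (simp add: Cinf_def)

lemma CinfD: "Cinf g \<Longrightarrow> Ck k g"
  by (simp add: Cinf_def)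

lemma Cinf_deriv:
  fixes g :: "real \<Rightarrow> real"
  assumes "Cinf g"
  shows "(g has_real_derivative deriv g x) (at x)" "Cinf (deriv g)"
proof -
  have diff: "g differentiable (at x)" for x
    using CinfD[OF assms, of "Suc 0"] by simp
  then show "(g has_real_derivative deriv g x) (at x)"
    by (simp add: DERIV_deriv_iff_real_differentiable)
  have "deriv g = (\<lambda>x. frechet_derivative g (at x) 1)"
    using diff by (auto simp: fun_eq_iff frechet_derivative_works[symmetric] real_differentiable_def
      DERIV_deriv_iff_real_differentiable)
      (metis DERIV_imp_deriv frechet_derivative_works has_derivative_at_within has_field_derivative_def differentiable_def frechet_derivative_at mult.right_neutral)
  then show "Cinf (deriv g)"
    using CinfD[OF assms, of "Suc k" for k] by (auto intro!: CinfI)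
qed

text \<open>The power of 1/x makes the family closed under differentiation up to linear
  combinations, so one induction gives smoothness of all members.\<close>

definition flatexp :: "nat \<Rightarrow> real \<Rightarrow> real" where
  "flatexp n x = (if x > 0 then inverse x ^ n * exp (- inverse x) else 0)"

lemma flatexp_tendsto: "((flatexp n) \<longlongrightarrow> 0) (at_right 0)"
proof -
  have "((\<lambda>y. y ^ n / exp y :: real) \<longlongrightarrow> 0) at_top"
    by (rule tendsto_power_div_exp_0)
  then have "((\<lambda>x. inverse x ^ n / exp (inverse x)) \<longlongrightarrow> 0) (at_right (0::real))"
    by (rule filterlim_compose) (rule filterlim_inverse_at_top_right)
  then show ?thesis
    by (rule tendsto_cong[THEN iffD1, rotated])
       (auto simp: flatexp_def exp_minus field_simps eventually_at_right_less intro!: eventually_at_rightI[of 0 1])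
qed

lemma flatexp_deriv:
  "(flatexp n has_real_derivative (- real n * flatexp (Suc n) x + flatexp (n + 2) x)) (at x)"
proof (cases x "0::real" rule: linorder_cases)
  case less
  have "((\<lambda>x. 0::real) has_real_derivative 0) (at x)" by simp
  then have "(flatexp n has_real_derivative 0) (at x)"
    by (rule has_field_derivative_transform_within_open[of _ _ _ "{..<0}"])
       (use less in \<open>auto simp: flatexp_def\<close>)
  then show ?thesis using less by (simp add: flatexp_def)
next
  case greater
  have "((\<lambda>x. inverse x ^ n * exp (- inverse x)) has_real_derivative
     (- real n * flatexp (Suc n) x + flatexp (n + 2) x)) (at x)"
  proof -
    have i: "(inverse has_real_derivative - (inverse x * inverse x)) (at x)"
      using DERIV_inverse[of x] greater by (simp add: power2_eq_square)
    have "((\<lambda>x. inverse x ^ n) has_real_derivative - real n * inverse x ^ Suc n) (at x)"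
      using DERIV_power[OF i, of n] by (cases n) (auto simp: algebra_simps)
    moreover have "((\<lambda>x. exp (- inverse x)) has_real_derivative exp (- inverse x) * (inverse x * inverse x)) (at x)"
      using DERIV_chain2[OF DERIV_exp DERIV_minus[OF i]] by simp
    ultimately show ?thesis
      using DERIV_mult[of "\<lambda>x. inverse x ^ n" _ x UNIV "\<lambda>x. exp (- inverse x)"] greater
      by (force simp: flatexp_def algebra_simps)
  qed
  then show ?thesis
    by (rule has_field_derivative_transform_within_open[of _ _ _ "{0<..}"])
       (use greater in \<open>auto simp: flatexp_def\<close>)
next
  case equal
  \<comment> \<open>Right of 0 the difference quotient is \<open>flatexp (Suc n)\<close>, which
    tends to 0; left of 0 it vanishes.\<close>
  have r: "((\<lambda>h. flatexp n h / h) \<longlongrightarrow> 0) (at_right 0)"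
    by (rule tendsto_cong[THEN iffD1, OF _ flatexp_tendsto[of "Suc n"]])
       (auto simp: flatexp_def field_simps intro!: eventually_at_rightI[of 0 1])
  have l: "((\<lambda>h. flatexp n h / h) \<longlongrightarrow> 0) (at_left 0)"
    by (rule tendsto_eventually)
       (auto simp: flatexp_def intro!: eventually_at_leftI[of "-1"])
  have "((\<lambda>h. flatexp n h / h) \<longlongrightarrow> 0) (at 0)"
    using l r filterlim_at_split by blast
  then show ?thesis using equal by (auto simp: DERIV_def flatexp_def)
qed

lemma Cinf_flatexp: "Cinf (flatexp n)"
proof (rule CinfI)
  show "Ck k (flatexp n)" for k
  proof (induction k arbitrary: n)
    case 0
    have "continuous_on UNIV (flatexp n)"
      by (rule DERIV_continuous_on) (use flatexp_deriv in blast)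
    then show ?case by simp
  next
    case (Suc k)
    show ?case
      by (rule Ck_SucI[OF flatexp_deriv]) (intro Ck_add Ck_mult Ck_const Suc)
  qed
qed

lemma Cinf_mult: "Cinf g \<Longrightarrow> Cinf h \<Longrightarrow> Cinf (\<lambda>x. g x * h x)"
  by (auto intro!: CinfI Ck_mult dest: CinfD)

lemma Cinf_affine:
  "bounded_linear A \<Longrightarrow> Cinf g \<Longrightarrow> Cinf (\<lambda>x. g (A x + c))"
  by (auto intro!: CinfI Ck_affine dest: CinfD)

lemma Cinf_const: "Cinf (\<lambda>x. c)"
  by (auto intro!: CinfI Ck_const)

lemma Cinf_scale: "Cinf g \<Longrightarrow> Cinf (\<lambda>x. g (a * x + c :: real))"
  using Cinf_affine[OF bounded_linear_mult_right] .

lemma Cinf_continuous: "Cinf g \<Longrightarrow> continuous_on A g"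
  by (metis CinfD Ck_continuous continuous_on_subset subset_UNIV)

text \<open>The bump \<open>w\<close> lives on \<open>[1, 2]\<close>; the cutoff \<open>wcut\<close> decreases from 1 to 0 there, with
  derivative \<open>- w\<close>; \<open>moll\<close> is the same bump moved to \<open>[-1, 1]\<close>.\<close>

definition w0 :: "real \<Rightarrow> real" where
  "w0 t = flatexp 0 (t - 1) * flatexp 0 (2 - t)"

definition w :: "real \<Rightarrow> real" where
  "w t = w0 t / integral {1..2} w0"

definition wcut :: "real \<Rightarrow> real" where
  "wcut t = 1 - integral {0..t} w"

definition moll :: "real \<Rightarrow> real" where
  "moll r = w ((3 + r) / 2) / 2"

section \<open>Properties of the bump, the cutoff and the mollifier\<close>

lemma Cinf_w0: "Cinf w0"
  unfolding w0_def using Cinf_mult[OF Cinf_scale[of _ 1 "-1", OF Cinf_flatexp[of 0]] Cinf_scale[of _ "-1" 2, OF Cinf_flatexp[of 0]]]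
  by (simp add: w0_def[abs_def])

lemma w0_pos: "1 < t \<Longrightarrow> t < 2 \<Longrightarrow> 0 < w0 t"
  by (simp add: w0_def flatexp_def)

lemma w0_zero: "t \<le> 1 \<or> 2 \<le> t \<Longrightarrow> w0 t = 0"
  by (auto simp: w0_def flatexp_def)

lemma w0_integral: "0 < integral {1..2} w0"
proof -
  have c: "continuous_on {1..2} w0" using Cinf_continuous Cinf_w0 by blast
  have nn: "0 \<le> w0 x" for x by (simp add: w0_def flatexp_def)
  have "0 \<le> integral {1..2} w0" 
    by (rule integral_nonneg) (auto intro!: integrable_continuous_real c nn)
  moreover have "integral {1..2} w0 \<noteq> 0"
  proof
    assume "integral {1..2} w0 = 0"
    then have "\<forall>x\<in>{1..2}. w0 x = 0"
      using integral_eq_0_iff[OF c] nn by auto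
    then show False using w0_pos[of "3/2"] by auto
  qed
  ultimately show ?thesis by simp
qed

lemma Cinf_w: "Cinf w"
  using Cinf_mult[OF Cinf_w0 Cinf_const[of "1 / integral {1..2} w0"]] by (simp add: w_def[abs_def])

lemma w_pos: "1 < t \<Longrightarrow> t < 2 \<Longrightarrow> 0 < w t"
  using w0_pos w0_integral by (simp add: w_def)

lemma w_zero: "t \<le> 1 \<or> 2 \<le> t \<Longrightarrow> w t = 0"
  using w0_zero by (simp add: w_def)

lemma w_nonneg: "0 \<le> w t"
  using w_pos[of t] w_zero[of t] by (cases "1 < t \<and> t < 2") auto

lemma w_sym: "w (3 - t) = w t"
  by (simp add: w_def w0_def)

lemma w_continuous: "continuous_on A w"
  using Cinf_continuous Cinf_w by blast

lemma integral_w: "integral {1..2} w = 1"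
  using w0_integral by (simp add: w_def[abs_def])

lemma integral_w_ext: assumes "a \<le> 1" "2 \<le> b" shows "integral {a..b} w = 1"
proof -
  have "(w has_integral 1) {1..2}"
    using integral_w integrable_continuous_real[OF w_continuous[of "{1..2}"]] integrable_integral by metis
  then have "(w has_integral 1) {a..b}"
    by (rule has_integral_on_superset) (use assms in \<open>auto simp: w_zero\<close>)
  then show ?thesis by (rule integral_unique)
qed

lemma wcut_deriv: "(wcut has_real_derivative - w t) (at t)"
\<comment> \<open>For t < 0 the interval {0..t} is empty, so the fundamental theorem is applied only
  from 1 on; below 1 the cutoff is locally constant.\<close>
proof (cases "t < 1")
  case True
  have z: "integral {0..r} w = 0" if "r < 1" for r
    using that by (subst integral_cong[where g="\<lambda>x. 0"]) (auto simp: w_zero)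
  have "((\<lambda>x. 1::real) has_real_derivative 0) (at t)" by simp
  then have "(wcut has_real_derivative 0) (at t)"
    by (rule has_field_derivative_transform_within_open[of _ _ _ "{..<1}"])
       (use True z in \<open>auto simp: wcut_def\<close>)
  then show ?thesis using True by (simp add: w_zero)
next
  case False
  have "((\<lambda>u. integral {0..u} w) has_vector_derivative w t) (at t within {0..t+1})"
    using False by (intro integral_has_vector_derivative w_continuous) auto
  then have "((\<lambda>u. integral {0..u} w) has_real_derivative w t) (at t within {0..t+1})"
    by (simp add: has_real_derivative_iff_has_vector_derivative)
  moreover have "at t within {0..t+1} = at t"
    using False by (intro at_within_interior) auto
  ultimately show ?thesis unfolding wcut_def
    by (auto intro!: derivative_eq_intros)
qed

lemma wcut_one: "t \<le> 1 \<Longrightarrow> wcut t = 1"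
  unfolding wcut_def
  by (subst integral_cong[where g="\<lambda>x. 0"]) (auto simp: w_zero)

lemma wcut_zero: "2 \<le> t \<Longrightarrow> wcut t = 0"
  unfolding wcut_def using integral_w_ext[of 0 t] by simp

lemma wcut_antimono: "s \<le> t \<Longrightarrow> wcut t \<le> wcut s"
  by (rule DERIV_nonpos_imp_nonincreasing[of s t wcut]) (use wcut_deriv w_nonneg in fastforce)+

lemma wcut_bounds: "0 \<le> wcut t" "wcut t \<le> 1"
  using wcut_antimono[of t "max t 2"] wcut_zero[of "max t 2"] wcut_antimono[of "min t 1" t] wcut_one[of "min t 1"]
  by auto

lemma Cinf_wcut: "Cinf wcut"
proof (rule CinfI)
  have m: "Cinf (\<lambda>t. - w t)" using Cinf_mult[OF Cinf_const[of "-1"] Cinf_w] by simp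
  show "Ck k wcut" for k
    using Ck_down Ck_SucI[OF wcut_deriv, of k] CinfD[OF m] by blast
qed

lemma Cinf_moll: "Cinf moll"
  using Cinf_mult[OF Cinf_scale[of w "1/2" "3/2", OF Cinf_w] Cinf_const[of "1/2"]]
  by (simp add: moll_def[abs_def] add_divide_distrib add.commute)

lemma moll_zero: "1 \<le> \<bar>r\<bar> \<Longrightarrow> moll r = 0"
  by (auto simp: moll_def w_zero abs_if split: if_splits)

lemma moll_nonneg: "0 \<le> moll r"
  by (simp add: moll_def w_nonneg)

lemma moll_even: "moll (- r) = moll r"
  using w_sym[of "(3 + r) / 2"] by (simp add: moll_def field_simps)

lemma moll_deriv: "(moll has_real_derivative deriv moll r) (at r)"
  using Cinf_deriv(1)[OF Cinf_moll] .

text \<open>Beyond the support the mollifier is locally zero; the two boundary points are limits of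
  such points, and the derivative is continuous.\<close>

lemma moll'_zero: "1 \<le> \<bar>r\<bar> \<Longrightarrow> deriv moll r = 0"
proof -
  have c: "continuous_on UNIV (deriv moll)" using Cinf_deriv(2)[OF Cinf_moll] Cinf_continuous by blast
  have *: "deriv moll r = 0" if "1 < \<bar>r\<bar>" for r
  proof -
    have "((\<lambda>x. 0::real) has_real_derivative 0) (at r)" by simp
    then have "(moll has_real_derivative 0) (at r)"
      by (rule has_field_derivative_transform_within_open[of _ _ _ "- {-1..1}"])
         (use that in \<open>auto simp: moll_zero open_Compl\<close>)
    then show ?thesis by (rule DERIV_imp_deriv)
  qed
  have "deriv moll r = 0" if "\<bar>r\<bar> = 1"
  proof -
    have "closed {x. deriv moll x = 0}"
      using continuous_closed_vimage[of "{0}" "deriv moll"] c by (simp add: vimage_def continuous_on_eq_continuous_at)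
    moreover have "r \<in> closure {x. deriv moll x = 0}"
      unfolding closure_approachable
    proof (intro allI impI)
      fix e :: real assume "e > 0"
      then show "\<exists>y\<in>{x. deriv moll x = 0}. dist y r < e"
        \<comment> \<open>Since |r| = 1, this witness lies outside the support, at distance e/2 from
          r.\<close>
        using that by (intro bexI[of _ "r + r * (e/2)"]) (auto simp: dist_norm abs_if split: if_splits intro!: *)
    qed
    ultimately show ?thesis by (simp add: closure_closed)
  qed
  then show "1 \<le> \<bar>r\<bar> \<Longrightarrow> deriv moll r = 0" using * by force
qed

section \<open>Bounded Borel functions with bounded support\<close>

definition bb :: "('a::euclidean_space \<Rightarrow> real) \<Rightarrow> bool" where
  "bb g \<longleftrightarrow> g \<in> borel_measurable borel \<and> (\<exists>C. \<forall>x. \<bar>g x\<bar> \<le> C)"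

text \<open>Because measurability is Borel and the bounds hold everywhere, sections, shifts and
  shears of such functions stay in the class, and Fubini and the changes of variables need no
  exceptional null sets.\<close>

definition bcs :: "('a::euclidean_space \<Rightarrow> real) \<Rightarrow> bool" where
  "bcs f \<longleftrightarrow> bb f \<and> (\<exists>B. \<forall>x. norm x > B \<longrightarrow> f x = 0)"

lemma bbI: "g \<in> borel_measurable borel \<Longrightarrow> (\<And>x. \<bar>g x\<bar> \<le> C) \<Longrightarrow> bb g"
  by (auto simp: bb_def)

lemma bcsI: "g \<in> borel_measurable borel \<Longrightarrow> (\<And>x. \<bar>g x\<bar> \<le> C) \<Longrightarrow> (\<And>x. norm x > B \<Longrightarrow> g x = 0) \<Longrightarrow> bcs g"
  by (auto simp: bcs_def bb_def)

lemma bcsI2: "bb g \<Longrightarrow> (\<And>x. norm x > B \<Longrightarrow> g x = 0) \<Longrightarrow> bcs g"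
  by (auto simp: bcs_def)

lemma bb_measurable: "bb g \<Longrightarrow> g \<in> borel_measurable borel"
  by (simp add: bb_def)

lemma bcs_bb: "bcs f \<Longrightarrow> bb f"
  by (simp add: bcs_def)

lemma bcs_measurable: "bcs g \<Longrightarrow> g \<in> borel_measurable borel"
  by (simp add: bcs_def bb_def)

lemma bb_bound: "bb g \<Longrightarrow> \<exists>C>0. \<forall>x. \<bar>g x\<bar> \<le> C"
  by (force simp: bb_def intro: exI[of _ "max 1 C" for C] simp: le_max_iff_disj)
    
lemma bcs_bound: 
  assumes "bcs g" 
  obtains C where "C > 0" "\<And>x. \<bar>g x\<bar> \<le> C" "\<And>x. norm x > C \<Longrightarrow> g x = 0"
proof -
  obtain C B where "C > 0" "\<forall>x. \<bar>g x\<bar> \<le> C" "\<forall>x. norm x > B \<longrightarrow> g x = 0"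
    using assms bb_bound[of g] by (auto simp: bcs_def)
  then show ?thesis using that[of "max C B"] by (auto simp: le_max_iff_disj less_max_iff_disj)
qed

lemma bb_const: "bb (\<lambda>x. c)"
  by (rule bbI[of _ "\<bar>c\<bar>"]) auto

lemma bb_indicator: "A \<in> sets borel \<Longrightarrow> bb (indicator A)"
  by (rule bbI[of _ 1]) (auto simp: indicator_def)

lemma bb_add: assumes "bb f" "bb g" shows "bb (\<lambda>x. f x + g x)"
proof -
  obtain C D where C: "\<forall>x. \<bar>f x\<bar> \<le> C" "\<forall>x. \<bar>g x\<bar> \<le> D" using assms by (auto simp: bb_def)
  have "\<bar>f x + g x\<bar> \<le> C + D" for x using C[rule_format, of x] by linarith
  then show ?thesis using assms by (intro bbI[of _ "C + D"]) (auto simp: bb_def)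
qed

lemma bb_mult: assumes "bb f" "bb g" shows "bb (\<lambda>x. f x * g x)"
proof -
  obtain C D where C: "\<forall>x. \<bar>f x\<bar> \<le> C" "\<forall>x. \<bar>g x\<bar> \<le> D" using assms by (auto simp: bb_def)
  have "0 \<le> C" using C(1)[rule_format, of 0] by linarith
  then have "\<bar>f x * g x\<bar> \<le> C * D" for x using C by (auto simp: abs_mult intro!: mult_mono)
  then show ?thesis using assms by (intro bbI[of _ "C * D"]) (auto simp: bb_def)
qed

lemma bb_uminus: "bb f \<Longrightarrow> bb (\<lambda>x. - f x)"
  using bb_mult[OF bb_const[of "-1"]] by auto

lemma bb_diff: "bb f \<Longrightarrow> bb g \<Longrightarrow> bb (\<lambda>x. f x - g x)"
  using bb_add[OF _ bb_uminus] by auto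

lemma bb_abs: "bb f \<Longrightarrow> bb (\<lambda>x. \<bar>f x\<bar>)"
  by (auto simp: bb_def)

lemma bb_compose: "bb g \<Longrightarrow> h \<in> borel_measurable borel \<Longrightarrow> bb (\<lambda>x. g (h x))"
  by (auto simp: bb_def)

lemma bcs_mult1: "bcs f \<Longrightarrow> bb g \<Longrightarrow> bcs (\<lambda>x. f x * g x)"
  using bb_mult[of f g] by (auto simp: bcs_def)

lemma bcs_mult2: "bb f \<Longrightarrow> bcs g \<Longrightarrow> bcs (\<lambda>x. f x * g x)"
  using bb_mult[of f g] by (auto simp: bcs_def)

lemma borel_fst_snd [measurable]:
  "(fst :: 'a::euclidean_space \<times> 'b::euclidean_space \<Rightarrow> 'a) \<in> borel_measurable borel"
  "(snd :: 'a::euclidean_space \<times> 'b::euclidean_space \<Rightarrow> 'b) \<in> borel_measurable borel"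
  by (intro borel_measurable_continuous_onI continuous_intros)+

lemma bcs_add: assumes "bcs f" "bcs g" shows "bcs (\<lambda>x. f x + g x)"
proof -
  obtain B B' where "\<forall>x. norm x > B \<longrightarrow> f x = 0" "\<forall>x. norm x > B' \<longrightarrow> g x = 0" using assms by (auto simp: bcs_def)
  then have "\<forall>x. norm x > max B B' \<longrightarrow> f x + g x = 0" by auto
  then show ?thesis using bb_add[of f g] assms unfolding bcs_def by blast
qed

lemma bcs_uminus: "bcs f \<Longrightarrow> bcs (\<lambda>x. - f x)"
  using bcs_mult2[OF bb_const[of "-1"]] by auto

lemma bcs_diff: "bcs f \<Longrightarrow> bcs g \<Longrightarrow> bcs (\<lambda>x. f x - g x)"
  using bcs_add[OF _ bcs_uminus] by auto

lemma bcs_abs: "bcs f \<Longrightarrow> bcs (\<lambda>x. \<bar>f x\<bar>)"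
  using bb_abs by (auto simp: bcs_def)

lemma bcs_indicator: "A \<in> sets borel \<Longrightarrow> bounded A \<Longrightarrow> bcs (indicator A)"
proof -
  assume A: "A \<in> sets borel" "bounded A"
  obtain B where "\<forall>x\<in>A. norm x \<le> B" using A(2) by (auto simp: bounded_iff)
  then show "bcs (indicator A)" using A(1) by (intro bcsI2[where B=B] bb_indicator) (auto simp: indicator_def)
qed

lemma bcs_shift: assumes "bcs f" shows "bcs (\<lambda>x. f (c + x))"
proof -
  obtain B where B: "\<forall>x. norm x > B \<longrightarrow> f x = 0" using assms by (auto simp: bcs_def)
  have "f (c + x) = 0" if "norm x > B + norm c" for x
  proof -
    have "norm x \<le> norm (c + x) + norm c" using norm_triangle_ineq4[of "c + x" c] by simp
    then show ?thesis using B that by auto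
  qed
  moreover have "bb (\<lambda>x. f (c + x))" 
    by (rule bb_compose[OF bcs_bb[OF assms]]) measurable
  ultimately show ?thesis by (metis bcsI2)
qed

lemma bcs_product: 
  fixes f :: "'a::euclidean_space \<Rightarrow> real" and g :: "'b::euclidean_space \<Rightarrow> real"
  assumes "bcs f" "bcs g" shows "bcs (\<lambda>p. f (fst p) * g (snd p))"
proof -
  obtain B where B: "\<And>x. norm x > B \<Longrightarrow> f x = 0" using assms(1) by (auto simp: bcs_def)
  obtain B' where B': "\<And>x. norm x > B' \<Longrightarrow> g x = 0" using assms(2) by (auto simp: bcs_def)
  have "bb (\<lambda>p::'a\<times>'b. f (fst p))" "bb (\<lambda>p::'a\<times>'b. g (snd p))"
    by (rule bb_compose[OF bcs_bb[OF assms(1)] borel_fst_snd(1)] bb_compose[OF bcs_bb[OF assms(2)] borel_fst_snd(2)])+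
  moreover have "f (fst p) * g (snd p) = 0" if "norm p > \<bar>B\<bar> + \<bar>B'\<bar>" for p :: "'a\<times>'b"
  proof (rule ccontr)
    assume "f (fst p) * g (snd p) \<noteq> 0"
    then have "\<not> norm (fst p) > B" "\<not> norm (snd p) > B'" using B[of "fst p"] B'[of "snd p"] by auto
    moreover have "norm p \<le> norm (fst p) + norm (snd p)" using norm_Pair_le[of "fst p" "snd p"] by simp
    ultimately show False using that by linarith
  qed
  ultimately show ?thesis by (intro bcsI2[where B="\<bar>B\<bar> + \<bar>B'\<bar>"] bb_mult)
qed

lemma bcs_section1: 
  fixes f :: "'a::euclidean_space \<times> 'b::euclidean_space \<Rightarrow> real"
  assumes "bcs f" shows "bcs (\<lambda>y. f (x, y))"
proof -
  note [measurable] = bcs_measurable[OF assms]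
  obtain C where C: "\<And>x. \<bar>f x\<bar> \<le> C" "\<And>x. norm x > C \<Longrightarrow> f x = 0" using bcs_bound[OF assms] by metis
  have n: "norm y > C \<Longrightarrow> norm (x, y) > C" for y using norm_snd_le[of y x] by (auto intro: less_le_trans)
  show ?thesis using C(1) C(2)[OF n]
    by (intro bcsI[where C=C and B=C]) auto
qed

lemma bcs_swap:
  fixes f :: "'a::euclidean_space \<times> 'b::euclidean_space \<Rightarrow> real"
  assumes "bcs f" shows "bcs (\<lambda>p. f (snd p, fst p))"
proof -
  note [measurable] = bcs_measurable[OF assms]
  obtain C where C: "\<And>x. \<bar>f x\<bar> \<le> C" "\<And>x. norm x > C \<Longrightarrow> f x = 0" using bcs_bound[OF assms] by metis
  have "norm p = norm (snd p, fst p)" for p :: "'b \<times> 'a" by (simp add: norm_prod_def add.commute)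
  then show ?thesis using C
    by (intro bcsI[where C=C and B=C]) auto
qed

lemma bcs_section2: 
  fixes f :: "'a::euclidean_space \<times> 'b::euclidean_space \<Rightarrow> real"
  assumes "bcs f" shows "bcs (\<lambda>x. f (x, y))"
  using bcs_section1[OF bcs_swap[OF assms]] by auto

lemma bcs_integrable: assumes "bcs f" shows "integrable lborel f"
proof -
  obtain C where C: "\<And>x. \<bar>f x\<bar> \<le> C" "\<And>x. norm x > C \<Longrightarrow> f x = 0" using bcs_bound[OF assms] by metis
  show ?thesis
    using bcs_measurable[OF assms] C
    by (intro integrableI_bounded_set[of "cball 0 C" _ _ C]) (auto simp: emeasure_lborel_cball_finite[unfolded infinity_ennreal_def])
qed

lemma bcs_integral_bound:
  fixes f :: "'a::euclidean_space \<Rightarrow> real"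
  assumes "f \<in> borel_measurable borel" "\<And>x. \<bar>f x\<bar> \<le> C" "\<And>x. norm x > B \<Longrightarrow> f x = 0"
  shows "\<bar>LBINT x. f x\<bar> \<le> C * measure lborel (cball (0::'a) B)"
proof -
  have i: "integrable lborel f" using assms by (intro bcs_integrable bcsI)
  have j: "integrable lborel (\<lambda>x. C * indicator (cball (0::'a) B) x)"
    by (auto simp: emeasure_lborel_cball_finite[unfolded infinity_ennreal_def])
  have "\<bar>LBINT x. f x\<bar> \<le> (LBINT x. \<bar>f x\<bar>)" by (rule integral_abs_bound)
  also have "\<dots> \<le> (LBINT x. C * indicator (cball (0::'a) B) x)"
  proof (rule Bochner_Integration.integral_mono[OF _ j])
    show "integrable lborel (\<lambda>x. \<bar>f x\<bar>)" using i by (rule Bochner_Integration.integrable_abs)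
    show "\<bar>f x\<bar> \<le> C * indicator (cball 0 B) x" for x
      using assms(2)[of x] assms(3)[of x] by (auto simp: indicator_def)
  qed
  also have "\<dots> = C * measure lborel (cball (0::'a) B)" by simp
  finally show ?thesis .
qed

section \<open>Fubini and changes of variables\<close>

lemma bcs_fubini:
  fixes f :: "'a::euclidean_space \<times> 'b::euclidean_space \<Rightarrow> real"
  assumes f: "bcs f"
  shows "(LBINT p. f p) = (LBINT x. LBINT y. f (x, y))"
    and "(LBINT p. f p) = (LBINT y. LBINT x. f (x, y))"
proof -
  have i: "integrable (lborel \<Otimes>\<^sub>M lborel) f" using bcs_integrable[OF f] by (simp add: lborel_prod)
  show "(LBINT p. f p) = (LBINT x. LBINT y. f (x, y))"
    using lborel_pair.integral_fst'[OF i] by (simp add: lborel_prod)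
  show "(LBINT p. f p) = (LBINT y. LBINT x. f (x, y))"
    using lborel_pair.integral_snd[of "\<lambda>x y. f (x, y)"] i by (simp add: lborel_prod)
qed

text \<open>Closes the class under inner integrals, so that iterated integrals can be integrated
  again without a separate measurability argument.\<close>

lemma bcs_inner:
  fixes f :: "'a::euclidean_space \<times> 'b::euclidean_space \<Rightarrow> real"
  assumes f: "bcs f"
  shows "bcs (\<lambda>x. LBINT y. f (x, y))"
proof -
  obtain C where C: "\<And>x. \<bar>f x\<bar> \<le> C" "\<And>x. norm x > C \<Longrightarrow> f x = 0" using bcs_bound[OF f] by metis
  have [measurable]: "f \<in> borel_measurable (borel \<Otimes>\<^sub>M borel)" using f by (simp add: borel_prod bcs_measurable)
  have n: "norm (x, y) > C" if "norm x > C \<or> norm y > C" for x :: 'a and y :: 'b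
    using that norm_fst_le[of x y] norm_snd_le[of y x] by auto
  show ?thesis
  proof (rule bcsI[where C="C * measure lborel (cball (0::'b) C)" and B=C])
    show "(\<lambda>x. LBINT y. f (x, y)) \<in> borel_measurable borel" by measurable
    fix x
    show "\<bar>LBINT y. f (x, y)\<bar> \<le> C * measure lborel (cball (0::'b) C)"
      by (rule bcs_integral_bound) (use C n in auto)
    show "norm x > C \<Longrightarrow> (LBINT y. f (x, y)) = 0"
      using C(2) n by simp
  qed
qed

lemma integral_shift:
  fixes f :: "'a::euclidean_space \<Rightarrow> real"
  assumes "f \<in> borel_measurable borel"
  shows "(LBINT x. f (c + x)) = (LBINT x. f x)"
proof -
  have "(LBINT x. f x) = (\<integral>x. f x \<partial>distr lborel borel ((+) c))"
    by (simp add: lborel_distr_plus)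
  also have "\<dots> = (LBINT x. f (c + x))"
    using assms by (subst integral_distr) auto
  finally show ?thesis by simp
qed

lemma bcs_affine2:
  fixes g :: "real \<times> real \<Rightarrow> real"
  assumes g: "bcs g" and ab: "a \<noteq> 0" "b \<noteq> 0"
  shows "bcs (\<lambda>z. g (x0 + a * fst z, t0 + b * snd z))"
proof -
  obtain C where C: "C > 0" "\<And>x. \<bar>g x\<bar> \<le> C" "\<And>x. norm x > C \<Longrightarrow> g x = 0" using bcs_bound[OF g] by metis
  define D where "D = (C + \<bar>x0\<bar>) / \<bar>a\<bar> + (C + \<bar>t0\<bar>) / \<bar>b\<bar>"
  have "g (x0 + a * fst z, t0 + b * snd z) = 0" if z: "norm z > D" for z
  proof (rule ccontr)
    assume "g (x0 + a * fst z, t0 + b * snd z) \<noteq> 0"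
    then have n: "norm (x0 + a * fst z, t0 + b * snd z) \<le> C" using C(3) by force
    have "\<bar>x0 + a * fst z\<bar> \<le> C" "\<bar>t0 + b * snd z\<bar> \<le> C"
      using order_trans[OF norm_fst_le n] order_trans[OF norm_snd_le n] by auto
    then have "\<bar>a * fst z\<bar> \<le> C + \<bar>x0\<bar>" "\<bar>b * snd z\<bar> \<le> C + \<bar>t0\<bar>" by linarith+
    then have "\<bar>fst z\<bar> \<le> (C + \<bar>x0\<bar>) / \<bar>a\<bar>" "\<bar>snd z\<bar> \<le> (C + \<bar>t0\<bar>) / \<bar>b\<bar>"
      using ab by (auto simp: abs_mult field_simps)
    moreover have "norm z \<le> \<bar>fst z\<bar> + \<bar>snd z\<bar>" using norm_Pair_le[of "fst z" "snd z"] by simp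
    ultimately show False using z by (auto simp: D_def)
  qed
  moreover have "(\<lambda>z. g (x0 + a * fst z, t0 + b * snd z)) \<in> borel_measurable borel"
    using bcs_measurable[OF g] by measurable
  ultimately show ?thesis using C by (intro bcsI[where C=C and B=D]) auto
qed

text \<open>The scales may be negative: the doubling argument also uses a mollifier of width
  -e.\<close>

lemma integral_affine2:
  fixes g :: "real \<times> real \<Rightarrow> real"
  assumes g: "bcs g" and ab: "a \<noteq> 0" "b \<noteq> 0"
  shows "(LBINT p. g p) = \<bar>a\<bar> * \<bar>b\<bar> * (LBINT z. g (x0 + a * fst z, t0 + b * snd z))"
proof -
  have "(LBINT p. g p) = (LBINT x. LBINT t. g (x, t))" by (rule bcs_fubini(1)[OF g])
  also have "\<dots> = \<bar>a\<bar> * (LBINT x. LBINT t. g (x0 + a * x, t))"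
    using ab lborel_integral_real_affine[of a "\<lambda>x. LBINT t. g (x, t)" x0] by simp
  also have "(LBINT x. LBINT t. g (x0 + a * x, t)) = (LBINT x. \<bar>b\<bar> * (LBINT t. g (x0 + a * x, t0 + b * t)))"
    using ab lborel_integral_real_affine[of b "\<lambda>t. g (x0 + a * x, t)" t0 for x] by simp
  also have "\<dots> = \<bar>b\<bar> * (LBINT z. g (x0 + a * fst z, t0 + b * snd z))"
    using bcs_fubini(1)[OF bcs_affine2[OF g ab]] by simp
  finally show ?thesis by simp
qed

lemma bcs_dct:
  fixes f :: "nat \<Rightarrow> 'a::euclidean_space \<Rightarrow> real"
  assumes "\<And>n. f n \<in> borel_measurable borel" "g \<in> borel_measurable borel"
    and "\<And>n x. \<bar>f n x\<bar> \<le> C" "\<And>n x. norm x > B \<Longrightarrow> f n x = 0"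
    and "\<And>x. (\<lambda>n. f n x) \<longlonglongrightarrow> g x"
  shows "(\<lambda>n. LBINT x. f n x) \<longlonglongrightarrow> (LBINT x. g x)"
proof (rule integral_dominated_convergence[where w="\<lambda>x. C * indicator (cball 0 B) x"])
  show "integrable lborel (\<lambda>x. C * indicator (cball (0::'a) B) x)"
    by (auto simp: emeasure_lborel_cball_finite[unfolded infinity_ennreal_def])
  show "AE x in lborel. norm (f n x) \<le> C * indicator (cball 0 B) x" for n
    using assms(3,4) by (intro AE_I2) (force simp: indicator_def not_le[symmetric])
qed (use assms in auto)

text \<open>Pointwise limits of continuous functions are dense in \<open>L\<^sup>1\<close> by dominated convergence, which
  reduces continuity of translations to uniform continuity on compact sets.\<close>

lemma bb_approx_continuous:
  fixes u :: "'a::euclidean_space \<Rightarrow> real"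
  assumes u: "u \<in> borel_measurable borel" "\<And>x. \<bar>u x\<bar> \<le> C" and e: "e > 0"
  obtains g where "continuous_on UNIV g" "\<And>x. \<bar>g x\<bar> \<le> C"
    "(LBINT x. indicator (cball 0 B) x * \<bar>u x - g x\<bar>) < e"
proof -
  \<comment> \<open>\<open>measurable_on\<close> provides continuous functions converging to u off a
    negligible set.\<close>
  have "u measurable_on UNIV"
    using u(1) by (intro lebesgue_measurable_imp_measurable_on_real) (auto intro: measurable_completion)
  then obtain N h where N: "negligible N" and h: "\<And>n. continuous_on UNIV (h n)"
    and lim: "\<And>x. x \<notin> N \<Longrightarrow> (\<lambda>n. h n x) \<longlonglongrightarrow> u x"
    by (auto simp: measurable_on_def)
  \<comment> \<open>Truncation at height C preserves the limit, because |u| is at most C, and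
    supplies the dominating function.\<close>
  define k where "k n x = max (- C) (min C (h n x))" for n x
  have C: "0 \<le> C" using u(2)[of 0] by linarith
  have kc: "continuous_on UNIV (k n)" for n
    unfolding k_def by (intro continuous_intros h)
  then have km [measurable]: "k n \<in> borel_measurable borel" for n by (rule borel_measurable_continuous_onI)
  have kb: "\<bar>k n x\<bar> \<le> C" for n x using C by (auto simp: k_def)
  have klim: "(\<lambda>n. k n x) \<longlonglongrightarrow> u x" if "x \<notin> N" for x
  proof -
    have "(\<lambda>n. k n x) \<longlonglongrightarrow> max (- C) (min C (u x))"
      unfolding k_def by (intro tendsto_intros lim that)
    moreover have "max (- C) (min C (u x)) = u x" using u(2)[of x] by auto
    ultimately show ?thesis by simp
  qed
  note [measurable] = u(1)
  have "(\<lambda>n. LBINT x. indicator (cball 0 B) x * \<bar>u x - k n x\<bar>) \<longlonglongrightarrow> (\<integral>x. 0 \<partial>(lborel::'a measure))"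
  proof (rule integral_dominated_convergence[where w="\<lambda>x. (2*C) * indicator (cball 0 B) x"])
    show "integrable lborel (\<lambda>x. (2*C) * indicator (cball (0::'a) B) x)"
      by (auto simp: emeasure_lborel_cball_finite[unfolded infinity_ennreal_def])
    have "\<bar>u x - k n x\<bar> \<le> 2 * C" for n x using u(2)[of x] kb[of n x] by linarith
    then show "AE x in lborel. norm (indicator (cball 0 B) x * \<bar>u x - k n x\<bar>) \<le> (2*C) * indicator (cball 0 B) x" for n
      by (intro AE_I2) (auto simp: indicator_def)
    have "AE x in lebesgue. x \<notin> N"
      using N by (simp add: negligible_iff_null_sets AE_not_in)
    then have "AE x in lborel. x \<notin> N" by (simp add: AE_completion_iff)
    then show "AE x in lborel. (\<lambda>n. indicator (cball 0 B) x * \<bar>u x - k n x\<bar>) \<longlonglongrightarrow> 0"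
    proof eventually_elim
      case (elim x)
      have "(\<lambda>n. indicator (cball 0 B) x * \<bar>u x - k n x\<bar>) \<longlonglongrightarrow> indicator (cball 0 B) x * \<bar>u x - u x\<bar>"
        by (intro tendsto_intros klim elim)
      then show ?case by simp
    qed
  qed (use u(1) km bcs_measurable[OF bcs_indicator[of "cball 0 B"]] in \<open>auto intro!: borel_measurable_times\<close>)
  then have "\<forall>\<^sub>F n in sequentially. (LBINT x. indicator (cball 0 B) x * \<bar>u x - k n x\<bar>) < e"
    using e by (intro order_tendstoD(2)) auto
  then obtain n where "(LBINT x. indicator (cball 0 B) x * \<bar>u x - k n x\<bar>) < e"
    by (auto simp: eventually_sequentially)
  then show ?thesis using that[OF kc kb] by blast
qed

lemma L1_translation:
  fixes u :: "'a::euclidean_space \<Rightarrow> real"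
  assumes u: "bb u" and e: "e > 0"
  obtains d where "d > 0" "\<And>v. norm v < d \<Longrightarrow> (LBINT x. indicator (cball 0 B) x * \<bar>u (x + v) - u x\<bar>) < e"
proof -
  obtain C where C: "C > 0" "\<And>x. \<bar>u x\<bar> \<le> C" using bb_bound[OF u] by auto
  \<comment> \<open>The ball grows by 1 because the shifts have length below 1. The errors u - g at
    x + v, g(x + v) - g(x), and u - g at x get e/3 each.\<close>
  obtain g where g: "continuous_on UNIV g" "\<And>x. \<bar>g x\<bar> \<le> C"
    and ug: "(LBINT x. indicator (cball 0 (B + 1)) x * \<bar>u x - g x\<bar>) < e / 3"
    using bb_approx_continuous[OF bb_measurable[OF u] C(2), of "e/3" "B+1"] e by auto
  have bg: "bb g" using g by (intro bbI[where C=C] borel_measurable_continuous_onI)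
  have bi: "bcs (indicator (cball (0::'a) B))" for B by (rule bcs_indicator) auto
  \<comment> \<open>The added 1 keeps the quotient \<open>e / (3 * V)\<close> meaningful when the
    ball has measure zero.\<close>
  define V where "V = measure lborel (cball (0::'a) B) + 1"
  have V: "V > 0" by (simp add: V_def add_nonneg_pos)
  have eV: "e / (3 * V) > 0" using e V by simp
  have uc: "uniformly_continuous_on (cball 0 (B+1)) g"
    using g(1) by (intro compact_uniformly_continuous) (auto intro: continuous_on_subset)
  obtain d where d: "d > 0" "\<And>x x'. x \<in> cball 0 (B+1) \<Longrightarrow> x' \<in> cball 0 (B+1) \<Longrightarrow> dist x' x < d \<Longrightarrow> dist (g x') (g x) < e / (3 * V)"
    by (rule uniformly_continuous_onE[OF uc eV]) blast
  have su: "bb (\<lambda>x. u (x + v))" "bb (\<lambda>x. g (x + v))" for v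
    by (rule bb_compose[OF u] bb_compose[OF bg]; measurable)+
  show ?thesis
  proof (rule that[of "min d 1"])
    show "min d 1 > 0" using d by auto
    fix v :: 'a assume v: "norm v < min d 1"
    let ?I = "\<lambda>x. indicator (cball (0::'a) B) x :: real"
    have i1: "integrable lborel (\<lambda>x. ?I x * \<bar>u (x + v) - g (x + v)\<bar>)"
      and i2: "integrable lborel (\<lambda>x. ?I x * \<bar>g (x + v) - g x\<bar>)"
      and i3: "integrable lborel (\<lambda>x. ?I x * \<bar>u x - g x\<bar>)"
      and i4: "integrable lborel (\<lambda>x. ?I x * \<bar>u (x + v) - u x\<bar>)"
      by (intro bcs_integrable bcs_mult1 bi bb_abs bb_diff su u bg)+
    have big: "integrable lborel (\<lambda>x. indicator (cball 0 (B+1)) x * \<bar>u x - g x\<bar>)"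
      by (intro bcs_integrable bcs_mult1 bi bb_abs bb_diff su u bg)
    have bigs: "integrable lborel (\<lambda>x. indicator (cball 0 (B+1)) (v + x) * \<bar>u (v + x) - g (v + x)\<bar>)"
      by (intro bcs_integrable bcs_shift[where f="\<lambda>x. indicator (cball 0 (B+1)) x * \<bar>u x - g x\<bar>"] bcs_mult1 bi bb_abs bb_diff u bg)
    have "(LBINT x. ?I x * \<bar>u (x + v) - u x\<bar>) \<le>
       (LBINT x. (?I x * \<bar>u (x + v) - g (x + v)\<bar> + ?I x * \<bar>g (x + v) - g x\<bar>) + ?I x * \<bar>u x - g x\<bar>)"
      by (rule Bochner_Integration.integral_mono[OF i4 Bochner_Integration.integrable_add[OF Bochner_Integration.integrable_add[OF i1 i2] i3]]) (auto simp: indicator_def)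
    also have "\<dots> = (LBINT x. ?I x * \<bar>u (x + v) - g (x + v)\<bar>) + (LBINT x. ?I x * \<bar>g (x + v) - g x\<bar>)
       + (LBINT x. ?I x * \<bar>u x - g x\<bar>)"
      using i1 i2 i3 by (simp add: Bochner_Integration.integral_add Bochner_Integration.integrable_add)
    also have "(LBINT x. ?I x * \<bar>u (x + v) - g (x + v)\<bar>) \<le>
        (LBINT x. indicator (cball 0 (B+1)) (v + x) * \<bar>u (v + x) - g (v + x)\<bar>)"
    proof (rule Bochner_Integration.integral_mono[OF i1 bigs])
      fix x
      have "norm (v + x) \<le> B + 1" if "norm x \<le> B" using that v norm_triangle_ineq[of v x] by linarith
      then show "?I x * \<bar>u (x + v) - g (x + v)\<bar> \<le> indicator (cball 0 (B+1)) (v + x) * \<bar>u (v + x) - g (v + x)\<bar>"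
        by (auto simp: indicator_def add.commute)
    qed
    also have "\<dots> = (LBINT x. indicator (cball 0 (B+1)) x * \<bar>u x - g x\<bar>)"
      by (rule integral_shift[where f="\<lambda>x. indicator (cball 0 (B+1)) x * \<bar>u x - g x\<bar>"])
        (use big in auto)
    also have "\<dots> < e / 3" by (rule ug)
    also have "(LBINT x. ?I x * \<bar>g (x + v) - g x\<bar>) \<le> e / (3 * V) * measure lborel (cball (0::'a) B)"
    proof (rule order_trans[OF abs_ge_self bcs_integral_bound])
      show "(\<lambda>x. ?I x * \<bar>g (x + v) - g x\<bar>) \<in> borel_measurable borel" using i2 by auto
      fix x
      have "\<bar>g (x + v) - g x\<bar> < e / (3 * V)" if "norm x \<le> B"
      proof -
        have "norm (x + v) \<le> B + 1" using that v norm_triangle_ineq[of x v] by linarith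
        then have "x \<in> cball 0 (B+1)" "x + v \<in> cball 0 (B+1)" using that by (auto simp only: mem_cball_0)
        moreover have "dist (x + v) x < d" using v by (simp add: dist_norm)
        ultimately show ?thesis using d(2)[of x "x + v"] by (simp only: dist_real_def)
      qed
      then show "\<bar>?I x * \<bar>g (x + v) - g x\<bar>\<bar> \<le> e / (3 * V)"
        using e V by (auto simp: indicator_def intro: less_imp_le)
    qed (auto simp: indicator_def)
    also have "\<dots> \<le> e / 3" using e V by (auto simp: V_def field_simps)
    also have "(LBINT x. ?I x * \<bar>u x - g x\<bar>) \<le> (LBINT x. indicator (cball 0 (B+1)) x * \<bar>u x - g x\<bar>)"
      by (rule Bochner_Integration.integral_mono[OF i3 big]) (auto simp: indicator_def)
    also have "\<dots> < e / 3" by (rule ug)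
    finally show "(LBINT x. ?I x * \<bar>u (x + v) - u x\<bar>) < e" by simp
  qed
qed

lemma L1_translation_seq:
  fixes u :: "'a::euclidean_space \<Rightarrow> real"
  assumes u: "bb u" and v: "v \<longlonglongrightarrow> 0"
  shows "(\<lambda>n. LBINT x. indicator (cball 0 B) x * \<bar>u (x + v n) - u x\<bar>) \<longlonglongrightarrow> 0"
proof (rule LIMSEQ_I)
  fix e :: real assume "e > 0"
  then obtain d where d: "d > 0" "\<And>v. norm v < d \<Longrightarrow> (LBINT x. indicator (cball 0 B) x * \<bar>u (x + v) - u x\<bar>) < e"
    using L1_translation[OF u] by metis
  obtain N where N: "\<And>n. n \<ge> N \<Longrightarrow> norm (v n) < d" using LIMSEQ_D[OF v d(1)] by auto
  have nn: "0 \<le> (LBINT x. indicator (cball 0 B) x * \<bar>u (x + w) - u x\<bar>)" for w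
    by (rule integral_nonneg_AE) (auto simp: indicator_def)
  show "\<exists>no. \<forall>n\<ge>no. norm ((LBINT x. indicator (cball 0 B) x * \<bar>u (x + v n) - u x\<bar>) - 0) < e"
    using N d(2) nn by (intro exI[of _ N]) auto
qed

lemma bcs_continuous:
  assumes "continuous_on UNIV (f :: 'a::euclidean_space \<Rightarrow> real)" "\<And>x. norm x > B \<Longrightarrow> f x = 0"
  shows "bcs f"
proof -
  have "compact (f ` cball 0 B)" using assms(1) by (intro compact_continuous_image) (auto intro: continuous_on_subset)
  then obtain C where C: "\<And>x. x \<in> cball 0 B \<Longrightarrow> \<bar>f x\<bar> \<le> C" "C > 0"
    using compact_imp_bounded bounded_pos by (metis image_eqI real_norm_def)
  have "\<bar>f x\<bar> \<le> C" for x using C assms(2)[of x] by (cases "norm x > B") auto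
  then show ?thesis using assms by (intro bcsI[where C=C and B=B] borel_measurable_continuous_onI) auto
qed

section \<open>Integrals and moments of the mollifier\<close>

lemma bcs_moll: "bcs moll" "bcs (deriv moll)"
  using Cinf_continuous[OF Cinf_moll] Cinf_continuous[OF Cinf_deriv(2)[OF Cinf_moll]] moll_zero moll'_zero
  by (auto intro!: bcs_continuous[where B=1])

lemma bcs_w: "bcs w"
  using w_continuous by (intro bcs_continuous[where B=2]) (auto intro: w_zero simp: abs_if split: if_splits)

lemma integral_FTC_cs:
  fixes F f :: "real \<Rightarrow> real"
  assumes "\<And>x. (F has_real_derivative f x) (at x)" "continuous_on UNIV f" "\<And>x. \<bar>x\<bar> > B \<Longrightarrow> f x = 0" "0 \<le> B"
  shows "(LBINT x. f x) = F B - F (- B)"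
proof -
  have "(LBINT x. f x) = (LBINT x. f x * indicator {-B..B} x)"
    by (rule Bochner_Integration.integral_cong) (use assms(3) in \<open>force simp: indicator_def\<close>)+
  also have "\<dots> = F B - F (- B)"
    by (rule integral_FTC_Icc_real) (use assms in \<open>auto simp: continuous_on_eq_continuous_at\<close>)
  finally show ?thesis .
qed

lemma integral_w_lborel: "(LBINT x. w x) = 1"
proof -
  have "(LBINT x. w x) = (- wcut 2) - (- wcut (- 2))"
    by (rule integral_FTC_cs) (auto intro!: derivative_eq_intros wcut_deriv w_continuous simp: w_zero abs_if split: if_splits)
  then show ?thesis by (simp add: wcut_one wcut_zero)
qed

lemma integral_moll: "(LBINT x. moll x) = 1"
proof -
  have "(LBINT x. w x) = (1/2) * (LBINT x. w (3/2 + (1/2) * x))"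
    using lborel_integral_real_affine[of "1/2" w "3/2"] by simp
  also have "\<dots> = (LBINT x. moll x)"
    by (simp add: moll_def field_simps)
  finally show ?thesis using integral_w_lborel by simp
qed

lemma integral_moll': "(LBINT x. deriv moll x) = 0"
  using integral_FTC_cs[OF moll_deriv Cinf_continuous[OF Cinf_deriv(2)[OF Cinf_moll]], of 1]
  by (simp add: moll'_zero moll_zero)

text \<open>Integrate the derivative of x times \<open>moll x\<close>, whose boundary values vanish.
  This moment is what returns the gradient of the test function in the doubling limit.\<close>

lemma integral_id_moll': "(LBINT x. x * deriv moll x) = -1"
proof -
  have "(LBINT x. moll x + x * deriv moll x) = 1 * moll 1 - (-1) * moll (-1)"
    by (rule integral_FTC_cs) 
      (auto intro!: derivative_eq_intros moll_deriv continuous_intros Cinf_continuous[OF Cinf_moll] Cinf_continuous[OF Cinf_deriv(2)[OF Cinf_moll]] simp: moll_zero moll'_zero)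
  moreover have "(LBINT x. moll x + x * deriv moll x) = (LBINT x. moll x) + (LBINT x. x * deriv moll x)"
    by (intro Bochner_Integration.integral_add bcs_integrable bcs_moll bcs_continuous[where B=1] continuous_intros Cinf_continuous[OF Cinf_deriv(2)[OF Cinf_moll]])
       (simp add: moll'_zero)
  ultimately show ?thesis by (simp add: moll_zero integral_moll)
qed

section \<open>Kato's inequality away from the interfaces\<close>

text \<open>The partial derivatives are carried along as explicit functions, so that gradients of
  products and cutoffs are written down rather than recomputed from \<open>deriv\<close>.\<close>

definition C1 :: "(real \<times> real \<Rightarrow> real) \<Rightarrow> (real \<times> real \<Rightarrow> real) \<Rightarrow> (real \<times> real \<Rightarrow> real) \<Rightarrow> bool" where
  "C1 g gx gt \<longleftrightarrow> (\<forall>p. (g has_derivative (\<lambda>v. gx p * fst v + gt p * snd v)) (at p)) \<and>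
     continuous_on UNIV gx \<and> continuous_on UNIV gt"

definition C1c :: "(real \<times> real \<Rightarrow> real) \<Rightarrow> (real \<times> real \<Rightarrow> real) \<Rightarrow> (real \<times> real \<Rightarrow> real) \<Rightarrow> bool" where
  "C1c g gx gt \<longleftrightarrow> C1 g gx gt \<and> (\<exists>B. \<forall>p. norm p > B \<longrightarrow> g p = 0 \<and> gx p = 0 \<and> gt p = 0)"

lemma C1_deriv: "C1 g gx gt \<Longrightarrow> (g has_derivative (\<lambda>v. gx p * fst v + gt p * snd v)) (at p)"
  by (simp add: C1_def del: split_paired_All)

lemma C1I: "(\<And>p. (g has_derivative (\<lambda>v. gx p * fst v + gt p * snd v)) (at p)) \<Longrightarrow>
    continuous_on UNIV gx \<Longrightarrow> continuous_on UNIV gt \<Longrightarrow> C1 g gx gt"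
  by (simp add: C1_def del: split_paired_All)

lemma C1_continuous: "C1 g gx gt \<Longrightarrow> continuous_on A g" "C1 g gx gt \<Longrightarrow> continuous_on A gx" "C1 g gx gt \<Longrightarrow> continuous_on A gt"
proof -
  assume g: "C1 g gx gt"
  show "continuous_on A g"
    by (rule has_derivative_continuous_on) (rule has_derivative_at_withinI[OF C1_deriv[OF g]])
qed (auto simp: C1_def intro: continuous_on_subset simp del: split_paired_All)

lemma C1_borel: "C1 g gx gt \<Longrightarrow> g \<in> borel_measurable borel" "C1 g gx gt \<Longrightarrow> gx \<in> borel_measurable borel" "C1 g gx gt \<Longrightarrow> gt \<in> borel_measurable borel"
  using C1_continuous borel_measurable_continuous_onI by blast+

lemma C1_mult:
  assumes "C1 g gx gt" "C1 h hx ht"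
  shows "C1 (\<lambda>p. g p * h p) (\<lambda>p. gx p * h p + g p * hx p) (\<lambda>p. gt p * h p + g p * ht p)"
proof -
  have "((\<lambda>p. g p * h p) has_derivative (\<lambda>v. (gx p * h p + g p * hx p) * fst v + (gt p * h p + g p * ht p) * snd v)) (at p)" for p
    by (rule has_derivative_eq_rhs, (rule derivative_intros C1_deriv[OF assms(1)] C1_deriv[OF assms(2)])+)
      (auto simp: algebra_simps)
  then show ?thesis using assms C1_continuous[OF assms(1)] C1_continuous[OF assms(2)]
    by (auto intro!: C1I continuous_intros)
qed

lemma C1_diff:
  assumes "C1 g gx gt" "C1 h hx ht"
  shows "C1 (\<lambda>p. g p - h p) (\<lambda>p. gx p - hx p) (\<lambda>p. gt p - ht p)"
proof -
  have "((\<lambda>p. g p - h p) has_derivative (\<lambda>v. (gx p - hx p) * fst v + (gt p - ht p) * snd v)) (at p)" for p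
    by (rule has_derivative_eq_rhs, (rule derivative_intros C1_deriv[OF assms(1)] C1_deriv[OF assms(2)])+)
      (auto simp: algebra_simps)
  then show ?thesis using assms C1_continuous[OF assms(1)] C1_continuous[OF assms(2)]
    by (auto intro!: C1I continuous_intros)
qed

lemma C1_compose:
  assumes "C1 g gx gt" "\<And>r. (h has_real_derivative h' r) (at r)" "continuous_on UNIV h'"
  shows "C1 (\<lambda>p. h (g p)) (\<lambda>p. h' (g p) * gx p) (\<lambda>p. h' (g p) * gt p)"
proof -
  have "((\<lambda>p. h (g p)) has_derivative (\<lambda>v. h' (g p) * gx p * fst v + h' (g p) * gt p * snd v)) (at p)" for p
  proof -
    have "((\<lambda>p. h (g p)) has_derivative (\<lambda>v. h' (g p) * (gx p * fst v + gt p * snd v))) (at p)"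
      using has_derivative_compose[OF C1_deriv[OF assms(1)] assms(2)[unfolded has_field_derivative_def]] .
    then show ?thesis by (simp add: algebra_simps)
  qed
  moreover have "continuous_on UNIV (\<lambda>p. h' (g p))"
    using continuous_on_compose2[OF assms(3) C1_continuous(1)[OF assms(1)]] by auto
  ultimately show ?thesis using C1_continuous[OF assms(1)]
    by (auto intro!: C1I continuous_intros)
qed

lemma C1_snd:
  assumes "\<And>r. (h has_real_derivative h' r) (at r)" "continuous_on UNIV h'"
  shows "C1 (\<lambda>p. h (snd p)) (\<lambda>p. 0) (\<lambda>p. h' (snd p))"
proof -
  have "C1 snd (\<lambda>p. 0) (\<lambda>p. 1)" by (auto simp: C1_def intro!: derivative_eq_intros)
  from C1_compose[OF this assms] show ?thesis by simp
qed

lemma C1_affine: "C1 (\<lambda>p. a * fst p + b * snd p + c) (\<lambda>p. a) (\<lambda>p. b)"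
  by (auto simp: C1_def intro!: derivative_eq_intros)

lemma C1c_C1: "C1c g gx gt \<Longrightarrow> C1 g gx gt"
  by (simp add: C1c_def)

lemma C1_local_zero:
  assumes "C1 g gx gt" "open U" "\<And>p. p \<in> U \<Longrightarrow> g p = 0" "p \<in> U"
  shows "gx p = 0" "gt p = 0"
proof -
  have "((\<lambda>p. 0::real) has_derivative (\<lambda>v. 0)) (at p)" by simp
  then have "(g has_derivative (\<lambda>v. 0)) (at p)"
    by (rule has_derivative_transform_within_open[of _ _ _ _ U]) (use assms in auto)
  moreover have "(g has_derivative (\<lambda>v. gx p * fst v + gt p * snd v)) (at p)"
    using assms(1) by (rule C1_deriv)
  ultimately have *: "(\<lambda>v::real\<times>real. 0) = (\<lambda>v. gx p * fst v + gt p * snd v)"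
    using has_derivative_unique by blast
  show "gx p = 0" using fun_cong[OF *, of "(1, 0)"] by simp
  show "gt p = 0" using fun_cong[OF *, of "(0, 1)"] by simp
qed

lemma C1cI:
  assumes "C1 g gx gt" "\<And>p. norm p > B \<Longrightarrow> g p = 0"
  shows "C1c g gx gt"
proof -
  have o: "open {p::real\<times>real. norm p > B}" by (intro open_Collect_less continuous_intros)
  show ?thesis unfolding C1c_def using assms C1_local_zero[OF assms(1) o] by blast
qed

lemma C1c_mult:
  assumes "C1c g gx gt" "C1 h hx ht"
  shows "C1c (\<lambda>p. g p * h p) (\<lambda>p. gx p * h p + g p * hx p) (\<lambda>p. gt p * h p + g p * ht p)"
proof -
  obtain B where "\<And>p. norm p > B \<Longrightarrow> g p = 0" using assms(1) by (auto simp: C1c_def)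
  then show ?thesis using C1_mult[OF C1c_C1[OF assms(1)] assms(2)] by (intro C1cI[where B=B]) auto
qed

lemma C1c_bcs: assumes "C1c g gx gt" shows "bcs g" "bcs gx" "bcs gt"
proof -
  obtain B where "\<And>p. norm p > B \<Longrightarrow> g p = 0 \<and> gx p = 0 \<and> gt p = 0" using assms by (auto simp: C1c_def)
  then show "bcs g" "bcs gx" "bcs gt" using C1_continuous[OF C1c_C1[OF assms]]
    by (auto intro!: bcs_continuous[where B=B])
qed

lemma C1c_lipschitz:
  assumes "C1c g gx gt"
  obtains C where "C > 0" "\<And>p q. \<bar>g p - g q\<bar> \<le> C * norm (p - q)"
proof -
  obtain C1 where C1: "C1 > 0" "\<And>p. \<bar>gx p\<bar> \<le> C1" using bcs_bound[OF C1c_bcs(2)[OF assms]] by metis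
  obtain C2 where C2: "C2 > 0" "\<And>p. \<bar>gt p\<bar> \<le> C2" using bcs_bound[OF C1c_bcs(3)[OF assms]] by metis
  have "norm (g p - g q) \<le> (C1 + C2) * norm (p - q)" for p q
  proof (rule differentiable_bound[of UNIV g "\<lambda>p v. gx p * fst v + gt p * snd v"])
    show "(g has_derivative (\<lambda>v. gx x * fst v + gt x * snd v)) (at x within UNIV)" for x
      using C1_deriv[OF C1c_C1[OF assms]] by simp
    show "onorm (\<lambda>v. gx x * fst v + gt x * snd v) \<le> C1 + C2" for x
    proof (rule onorm_le)
      fix v :: "real \<times> real"
      have "\<bar>gx x * fst v + gt x * snd v\<bar> \<le> \<bar>gx x\<bar> * \<bar>fst v\<bar> + \<bar>gt x\<bar> * \<bar>snd v\<bar>"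
        by (metis abs_mult abs_triangle_ineq)
      also have "\<dots> \<le> C1 * norm v + C2 * norm v"
        using C1 C2 norm_fst_le[of "fst v" "snd v"] norm_snd_le[of "snd v" "fst v"]
        by (intro add_mono mult_mono) auto
      finally show "norm (gx x * fst v + gt x * snd v) \<le> (C1 + C2) * norm v" by (simp add: algebra_simps)
    qed
  qed auto
  then show ?thesis using that[of "C1 + C2"] C1 C2 by auto
qed

lemma C1_quotient:
  assumes "C1 g gx gt" "e \<longlonglongrightarrow> 0" "\<And>n. e n \<noteq> 0"
  shows "(\<lambda>n. (g (p + e n *\<^sub>R v) - g p) / e n) \<longlonglongrightarrow> gx p * fst v + gt p * snd v"
proof -
  have "((\<lambda>h. p + h *\<^sub>R v) has_derivative (\<lambda>h. h *\<^sub>R v)) (at 0)"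
    by (auto intro!: derivative_eq_intros)
  moreover have "(g has_derivative (\<lambda>v. gx p * fst v + gt p * snd v)) (at (p + 0 *\<^sub>R v))"
    using C1_deriv[OF assms(1), of p] by simp
  ultimately have "((\<lambda>h. g (p + h *\<^sub>R v)) has_derivative (\<lambda>h. gx p * fst (h *\<^sub>R v) + gt p * snd (h *\<^sub>R v))) (at 0)"
    by (rule has_derivative_compose)
  then have "((\<lambda>h. g (p + h *\<^sub>R v)) has_real_derivative (gx p * fst v + gt p * snd v)) (at 0)"
    unfolding has_field_derivative_def by (rule has_derivative_eq_rhs) (auto simp: algebra_simps)
  then have "((\<lambda>h. (g (p + h *\<^sub>R v) - g p) / h) \<longlongrightarrow> gx p * fst v + gt p * snd v) (at 0)"
    by (simp add: DERIV_def)
  then show ?thesis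
    by (rule filterlim_compose) (use assms in \<open>auto simp: filterlim_at\<close>)
qed

section \<open>Scaled mollifiers, unit-valued functions and the kernels used for doubling\<close>

lemma moll_scale_deriv:
  "e \<noteq> 0 \<Longrightarrow> ((\<lambda>x. moll ((x - c) / e)) has_real_derivative deriv moll ((x - c) / e) / e) (at x)"
  by (rule DERIV_cong[OF DERIV_chain2[OF moll_deriv]]) (auto intro!: derivative_eq_intros)

lemma Cinf_moll_scale: "e \<noteq> 0 \<Longrightarrow> Cinf (\<lambda>x. moll ((x - c) / e))"
  using Cinf_scale[OF Cinf_moll, of "1/e" "- c / e"] by (simp add: diff_divide_distrib)

definition unitb :: "('a::euclidean_space \<Rightarrow> real) \<Rightarrow> bool" where
  "unitb u \<longleftrightarrow> u \<in> borel_measurable borel \<and> (\<forall>x. 0 \<le> u x \<and> u x \<le> 1)"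

lemma unitbD: "unitb u \<Longrightarrow> u \<in> borel_measurable borel" "unitb u \<Longrightarrow> 0 \<le> u x" "unitb u \<Longrightarrow> u x \<le> 1" "unitb u \<Longrightarrow> u x \<in> {0..1}"
  by (auto simp: unitb_def)

lemma unitb_bb: "unitb u \<Longrightarrow> bb u"
  by (auto simp: unitb_def intro!: bbI[where C=1])

lemma unitb_compose: "unitb u \<Longrightarrow> h \<in> borel_measurable borel \<Longrightarrow> unitb (\<lambda>x. u (h x))"
  by (auto simp: unitb_def)

lemma unitb_abs_diff: "unitb u \<Longrightarrow> unitb v \<Longrightarrow> \<bar>u x - v y\<bar> \<le> 1"
  using unitbD(2,3)[of u x] unitbD(2,3)[of v y] by auto

lemma bb_unitb_diff: "unitb u \<Longrightarrow> unitb v \<Longrightarrow> bb (\<lambda>x. \<bar>u x - v x\<bar>)"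
  using unitb_abs_diff[of u v] by (intro bbI[where C=1] borel_measurable_abs borel_measurable_diff unitbD(1)) auto

lemma unitb_const: "c \<in> {0..1} \<Longrightarrow> unitb (\<lambda>x. c)"
  by (auto simp: unitb_def)

definition moll_t :: "real \<times> real \<Rightarrow> real" where "moll_t z = moll (fst z) * deriv moll (snd z)"
definition moll_x :: "real \<times> real \<Rightarrow> real" where "moll_x z = deriv moll (fst z) * moll (snd z)"
lemma bcs_kernel: "bcs moll_t" "bcs moll_x"
  unfolding moll_t_def[abs_def] moll_x_def[abs_def] by (intro bcs_product bcs_moll)+

text \<open>\<open>moll_t\<close> and \<open>moll_x\<close> are the partial derivatives of the
  product mollifier. Their first moments form minus the identity matrix, which is how the gradient
  of the test function reappears once the mollifier variable is integrated out.\<close>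

lemma integral_kernel:
  "(LBINT z. fst z * moll_t z) = 0" "(LBINT z. snd z * moll_t z) = -1"
  "(LBINT z. fst z * moll_x z) = -1" "(LBINT z. snd z * moll_x z) = 0"
  "bcs (\<lambda>z. fst z * moll_t z)" "bcs (\<lambda>z. snd z * moll_t z)" "bcs (\<lambda>z. fst z * moll_x z)" "bcs (\<lambda>z. snd z * moll_x z)"
proof -
  have c: "continuous_on UNIV moll" "continuous_on UNIV (deriv moll)"
    using Cinf_continuous[OF Cinf_moll] Cinf_continuous[OF Cinf_deriv(2)[OF Cinf_moll]] .
  have b: "bcs (\<lambda>r. r * moll r)" "bcs (\<lambda>r. r * deriv moll r)"
    using c by (auto intro!: bcs_continuous[where B=1] continuous_intros simp: moll_zero moll'_zero)
  have P: "bcs (\<lambda>z. a (fst z) * b (snd z))" "(LBINT z. a (fst z) * b (snd z)) = (LBINT x. a x) * (LBINT x. b x)"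
    if "bcs a" "bcs b" for a b :: "real \<Rightarrow> real"
    using bcs_product[OF that] bcs_fubini(1)[OF bcs_product[OF that]] by auto
  show "(LBINT z. fst z * moll_t z) = 0" "bcs (\<lambda>z. fst z * moll_t z)"
    using P[OF b(1) bcs_moll(2)] by (auto simp: moll_t_def integral_moll' mult.assoc)
  show "(LBINT z. snd z * moll_t z) = -1" "bcs (\<lambda>z. snd z * moll_t z)"
    using P[OF bcs_moll(1) b(2)] by (auto simp: moll_t_def integral_moll integral_id_moll' mult.left_commute)
  show "(LBINT z. fst z * moll_x z) = -1" "bcs (\<lambda>z. fst z * moll_x z)"
    using P[OF b(2) bcs_moll(1)] by (auto simp: moll_x_def integral_moll integral_id_moll' mult.assoc)
  show "(LBINT z. snd z * moll_x z) = 0" "bcs (\<lambda>z. snd z * moll_x z)"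
    using P[OF bcs_moll(2) b(1)] by (auto simp: moll_x_def integral_moll' mult.left_commute)
qed

text \<open>Doubling, the initial trace and finite speed of propagation use the flux through its
  Lipschitz constant alone. The bound is global, so that estimates carry no side conditions; the
  given flux enters later through \<open>clampf\<close>.\<close>

locale lipschitz_flux =
  fixes f :: "real \<Rightarrow> real" and L :: real
  assumes L_nonneg: "0 \<le> L" and lip: "\<bar>f a - f b\<bar> \<le> L * \<bar>a - b\<bar>"
begin

definition Phi :: "real \<Rightarrow> real \<Rightarrow> real" where
  "Phi a b = sgn (a - b) * (f a - f b)"

text \<open>Removes the sign function: symmetry, measurability and the Lipschitz bound are read off
  from max and min.\<close>

lemma Phi_max_min: "Phi a b = f (max a b) - f (min a b)"
  by (auto simp: Phi_def sgn_real_def max_def min_def)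

lemma Phi_sym: "Phi a b = Phi b a"
  by (simp add: Phi_max_min max.commute min.commute)

lemma Phi_bound: "\<bar>Phi a b\<bar> \<le> L * \<bar>a - b\<bar>"
  using lip[of a b] L_nonneg by (auto simp: Phi_def sgn_real_def abs_mult)

lemma Phi_lip: "\<bar>Phi a b - Phi a c\<bar> \<le> L * \<bar>b - c\<bar>"
proof -
  have "\<bar>Phi a b - Phi a c\<bar> \<le> \<bar>f (max a b) - f (max a c)\<bar> + \<bar>f (min a b) - f (min a c)\<bar>"
    unfolding Phi_max_min by linarith
  also have "\<dots> \<le> L * \<bar>max a b - max a c\<bar> + L * \<bar>min a b - min a c\<bar>"
    by (intro add_mono lip)
  also have "\<dots> = L * (\<bar>max a b - max a c\<bar> + \<bar>min a b - min a c\<bar>)" by (simp add: algebra_simps)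
  \<comment> \<open>The increments of max and min add up to |b - c| exactly, so the constant stays L
    instead of 2 L.\<close>
  also have "\<bar>max a b - max a c\<bar> + \<bar>min a b - min a c\<bar> = \<bar>b - c\<bar>" by (auto simp: max_def min_def)
  finally show ?thesis .
qed

lemma Phi_lip2: "\<bar>Phi a b - Phi a' b'\<bar> \<le> L * (\<bar>a - a'\<bar> + \<bar>b - b'\<bar>)"
  using Phi_lip[of a b b'] Phi_lip[of b' a a'] by (simp add: Phi_sym[of a b'] Phi_sym[of a' b'] algebra_simps)

lemma f_borel [measurable]: "f \<in> borel_measurable borel"
proof (intro borel_measurable_continuous_onI)
  have "L-lipschitz_on UNIV f" using lip L_nonneg by (auto simp: lipschitz_on_def dist_real_def)
  then show "continuous_on UNIV f" by (rule lipschitz_on_continuous_on)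
qed

lemma Phi_borel [measurable (raw)]: "u \<in> borel_measurable M \<Longrightarrow> v \<in> borel_measurable M \<Longrightarrow> (\<lambda>x. Phi (u x) (v x)) \<in> borel_measurable M"
  unfolding Phi_max_min by (intro borel_measurable_diff measurable_compose[OF _ f_borel] borel_measurable_max borel_measurable_min)

lemma unitb_Phi: assumes "unitb u" "unitb v" shows "\<bar>Phi (u x) (v y)\<bar> \<le> L"
proof -
  have "L * \<bar>u x - v y\<bar> \<le> L * 1" using unitb_abs_diff[OF assms] L_nonneg by (intro mult_left_mono) auto
  then show ?thesis using Phi_bound[of "u x" "v y"] by linarith
qed

lemma bb_unitb_Phi: "unitb u \<Longrightarrow> unitb v \<Longrightarrow> bb (\<lambda>x. Phi (u x) (v x))"
  using unitb_Phi[of u v] by (intro bbI[where C=L] Phi_borel unitbD(1)) auto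

text \<open>Tensor products of one-dimensional test functions suffice. The factor \<open>b\<close> is constrained
  for \<open>t \<ge> 0\<close> only, so that it may be constant for negative times.\<close>

definition entropic :: "(real \<times> real) set \<Rightarrow> (real \<Rightarrow> real) \<Rightarrow> (real \<times> real \<Rightarrow> real) \<Rightarrow> bool" where
  "entropic G u0 u \<longleftrightarrow> unitb u \<and> unitb u0 \<and>
     (\<forall>a b \<kappa> X1 X2 T1 T2.
        Cinf a \<and> Cinf b \<and> (\<forall>x. 0 \<le> a x) \<and> (\<forall>t. 0 \<le> b t) \<and> (\<forall>x. x \<notin> {X1..X2} \<longrightarrow> a x = 0) \<and>
        (\<forall>t\<ge>0. t \<notin> {T1..T2} \<longrightarrow> b t = 0) \<and> {X1..X2} \<times> {max 0 T1..T2} \<inter> G = {} \<and> \<kappa> \<in> {0..1} \<longrightarrow>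
        0 \<le> (LBINT p. indicator {0<..} (snd p) * (\<bar>u p - \<kappa>\<bar> * (a (fst p) * deriv b (snd p))
                 + Phi (u p) \<kappa> * (deriv a (fst p) * b (snd p))))
           + (LBINT x. \<bar>u0 x - \<kappa>\<bar> * (a x * b 0)))"

text \<open>The Kruzhkov entropy pair of the states a and b, paired with the gradient of the
  mollifier at z.\<close>

definition Kruzhkov :: "real \<Rightarrow> real \<Rightarrow> real \<times> real \<Rightarrow> real" where
  "Kruzhkov a b z = \<bar>a - b\<bar> * moll_t z + Phi a b * moll_x z"

text \<open>The test function is the mollifier of width |e| centred at p. After the substitution q =
  p + e z the Jacobian e^2 and the factor 1/e from differentiating leave one factor e, with its
  sign: a negative e reverses the inequality for the integral.\<close>

lemma entropic_mollified:
  assumes u: "entropic G u0 u" and e: "e \<noteq> 0" "\<bar>e\<bar> < snd p" and \<kappa>: "\<kappa> \<in> {0..1}"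
    and G: "\<And>q. q \<in> G \<Longrightarrow> dist p q > 2 * \<bar>e\<bar>"
  shows "0 \<le> e * (LBINT z. Kruzhkov (u (p + e *\<^sub>R z)) \<kappa> z)"
proof -
  define a where "a x = moll ((x - fst p) / e)" for x
  define b where "b t = moll ((t - snd p) / e)" for t
  have uu: "unitb u" using u by (simp add: entropic_def)
  have da: "deriv a x = deriv moll ((x - fst p) / e) / e" for x
    unfolding a_def using moll_scale_deriv[OF e(1)] by (rule DERIV_imp_deriv)
  have db: "deriv b x = deriv moll ((x - snd p) / e) / e" for x
    unfolding b_def using moll_scale_deriv[OF e(1)] by (rule DERIV_imp_deriv)
  have za: "a x = 0" if "x \<notin> {fst p - \<bar>e\<bar>..fst p + \<bar>e\<bar>}" for x
    unfolding a_def using that e by (intro moll_zero) (auto simp: abs_divide field_simps)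
  have zb: "b x = 0" if "x \<notin> {snd p - \<bar>e\<bar>..snd p + \<bar>e\<bar>}" for x
    unfolding b_def using that e by (intro moll_zero) (auto simp: abs_divide field_simps)
  \<comment> \<open>The mollifier does not reach t = 0, so the initial term of the entropy
    inequality drops out.\<close>
  have b0: "b 0 = 0" using e zb by auto
  define g where "g q = indicator {0<..} (snd q) * (\<bar>u q - \<kappa>\<bar> * (a (fst q) * deriv b (snd q))
                 + Phi (u q) \<kappa> * (deriv a (fst q) * b (snd q)))" for q
  have "0 \<le> (LBINT q. g q) + (LBINT x. \<bar>u0 x - \<kappa>\<bar> * (a x * b 0))"
    unfolding g_def
  proof (rule u[unfolded entropic_def, THEN conjunct2, THEN conjunct2, rule_format], intro conjI allI impI)
    show "Cinf a" "Cinf b" unfolding a_def b_def using Cinf_moll_scale e by auto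
    show "{fst p - \<bar>e\<bar>..fst p + \<bar>e\<bar>} \<times> {max 0 (snd p - \<bar>e\<bar>)..snd p + \<bar>e\<bar>} \<inter> G = {}"
    proof (rule ccontr)
      assume "\<not> ?thesis"
      then obtain q where "q \<in> {fst p - \<bar>e\<bar>..fst p + \<bar>e\<bar>} \<times> {max 0 (snd p - \<bar>e\<bar>)..snd p + \<bar>e\<bar>}" and q1: "q \<in> G"
        by blast
      then have q: "q \<in> G" "fst q \<in> {fst p - \<bar>e\<bar>..fst p + \<bar>e\<bar>}" "snd q \<in> {snd p - \<bar>e\<bar>..snd p + \<bar>e\<bar>}"
        by auto
      \<comment> \<open>The support is a square of half side |e|; bounding the Euclidean distance by
        the sum of the coordinate distances gives 2 |e|.\<close>
      have "dist p q \<le> dist (fst p) (fst q) + dist (snd p) (snd q)"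
        using sqrt_sum_squares_le_sum[of "dist (fst p) (fst q)" "dist (snd p) (snd q)"] by (simp add: dist_prod_def)
      also have "\<dots> \<le> 2 * \<bar>e\<bar>" using q by (auto simp: dist_real_def abs_le_iff)
      finally show False using G[OF q(1)] by simp
    qed
  qed (use za zb \<kappa> in \<open>auto simp: a_def b_def moll_nonneg\<close>)
  then have "0 \<le> (LBINT q. g q)" by (simp add: b0)
  also have "(LBINT q. g q) = \<bar>e\<bar> * \<bar>e\<bar> * (LBINT z. g (fst p + e * fst z, snd p + e * snd z))"
  proof (rule integral_affine2)
    have k: "moll_t ((fst q - fst p) / e, (snd q - snd p) / e) / e = a (fst q) * deriv b (snd q)"
         "moll_x ((fst q - fst p) / e, (snd q - snd p) / e) / e = deriv a (fst q) * b (snd q)" for q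
      by (auto simp: moll_t_def moll_x_def a_def b_def da db)
    have bk: "bcs (\<lambda>q. moll_t ((fst q - fst p) / e, (snd q - snd p) / e))" "bcs (\<lambda>q. moll_x ((fst q - fst p) / e, (snd q - snd p) / e))"
      using bcs_affine2[OF bcs_kernel(1), of "1/e" "1/e" "- fst p / e" "- snd p / e"] 
          bcs_affine2[OF bcs_kernel(2), of "1/e" "1/e" "- fst p / e" "- snd p / e"] e
      by (auto simp: diff_divide_distrib)
    have [measurable]: "u \<in> borel_measurable borel" using uu by (simp add: unitb_def)
    have bind: "bb (\<lambda>q::real\<times>real. indicator {0<..} (snd q) :: real)"
      by (rule bbI[where C=1]) (auto simp: indicator_def)
    have "bcs (\<lambda>q. indicator {0<..} (snd q) * (\<bar>u q - \<kappa>\<bar> * ((1/e) * moll_t ((fst q - fst p) / e, (snd q - snd p) / e))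
                 + Phi (u q) \<kappa> * ((1/e) * moll_x ((fst q - fst p) / e, (snd q - snd p) / e))))"
      by (intro bcs_mult2[OF bind] bcs_add bcs_mult2[OF bb_unitb_diff[OF uu unitb_const[OF \<kappa>]]]
          bcs_mult2[OF bb_unitb_Phi[OF uu unitb_const[OF \<kappa>]]] bcs_mult2[OF bb_const] bk)
    then show "bcs g" unfolding g_def[abs_def] using k by simp
  qed (use e in auto)
  also have "(LBINT z. g (fst p + e * fst z, snd p + e * snd z)) = (LBINT z. Kruzhkov (u (p + e *\<^sub>R z)) \<kappa> z / e)"
  proof (rule Bochner_Integration.integral_cong[OF refl])
    fix z :: "real \<times> real"
    have p: "(fst p + e * fst z, snd p + e * snd z) = p + e *\<^sub>R z" by (simp add: prod_eq_iff)
    show "g (fst p + e * fst z, snd p + e * snd z) = Kruzhkov (u (p + e *\<^sub>R z)) \<kappa> z / e"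
    \<comment> \<open>On the support of the kernel the time is positive, so the indicator is 1;
      elsewhere both sides vanish.\<close>
    proof (cases "\<bar>snd z\<bar> < 1")
      case True
      then have "\<bar>e * snd z\<bar> \<le> \<bar>e\<bar> * 1" unfolding abs_mult by (intro mult_left_mono) auto
      then have "snd p + e * snd z > 0" using e by linarith
      then show ?thesis using e by (simp add: g_def Kruzhkov_def a_def b_def da db moll_t_def moll_x_def p[symmetric] field_simps)
    next
      case False
      then show ?thesis using e by (simp add: g_def Kruzhkov_def a_def b_def da db moll_t_def moll_x_def p[symmetric] moll_zero moll'_zero)
    qed
  qed
  also have "\<bar>e\<bar> * \<bar>e\<bar> * \<dots> = e * (LBINT z. Kruzhkov (u (p + e *\<^sub>R z)) \<kappa> z)"
    using e by (simp add: abs_mult_self_eq)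
  finally show ?thesis .
qed

section \<open>Doubling of variables\<close>

lemma bcs_Kruzhkov:
  assumes g: "bcs g" and U: "unitb U" and V: "unitb V"
  shows "bcs (\<lambda>q. g (fst q) * Kruzhkov (U q) (V q) (snd q))"
proof -
  have "bcs (\<lambda>q. (g (fst q) * moll_t (snd q)) * \<bar>U q - V q\<bar> + (g (fst q) * moll_x (snd q)) * Phi (U q) (V q))"
    by (intro bcs_add bcs_mult1 bcs_product g bcs_kernel bb_unitb_diff bb_unitb_Phi U V)
  then show ?thesis by (simp add: Kruzhkov_def algebra_simps)
qed

lemma Kruzhkov_zero: "norm z > 2 \<Longrightarrow> Kruzhkov a b z = 0"
proof -
  assume z: "norm z > 2"
  have "norm z \<le> \<bar>fst z\<bar> + \<bar>snd z\<bar>" using norm_Pair_le[of "fst z" "snd z"] by simp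
  then have "1 \<le> \<bar>fst z\<bar> \<or> 1 \<le> \<bar>snd z\<bar>" using z by linarith
  then show "Kruzhkov a b z = 0" by (auto simp: Kruzhkov_def moll_t_def moll_x_def moll_zero moll'_zero)
qed

lemma Kruzhkov_bound: 
  obtains C where "C > 0" "\<And>a b z. a \<in> {0..1} \<Longrightarrow> b \<in> {0..1} \<Longrightarrow> \<bar>Kruzhkov a b z\<bar> \<le> C"
    "\<And>a b c z. \<bar>Kruzhkov a b z - Kruzhkov a c z\<bar> \<le> C * \<bar>b - c\<bar>"
proof -
  obtain C1 where C1: "C1 > 0" "\<And>p. \<bar>moll_t p\<bar> \<le> C1" using bcs_bound[OF bcs_kernel(1)] by metis
  obtain C2 where C2: "C2 > 0" "\<And>p. \<bar>moll_x p\<bar> \<le> C2" using bcs_bound[OF bcs_kernel(2)] by metis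
  define C where "C = C1 + L * C2"
  have C: "C > 0" using C1 C2 L_nonneg by (auto simp: C_def add_pos_nonneg)
  have lip: "\<bar>Kruzhkov a b z - Kruzhkov a c z\<bar> \<le> C * \<bar>b - c\<bar>" for a b c z
  proof -
    have "Kruzhkov a b z - Kruzhkov a c z = (\<bar>a - b\<bar> - \<bar>a - c\<bar>) * moll_t z + (Phi a b - Phi a c) * moll_x z"
      by (simp add: Kruzhkov_def algebra_simps)
    also have "\<bar>\<dots>\<bar> \<le> \<bar>\<bar>a - b\<bar> - \<bar>a - c\<bar>\<bar> * \<bar>moll_t z\<bar> + \<bar>Phi a b - Phi a c\<bar> * \<bar>moll_x z\<bar>"
      by (metis abs_mult abs_triangle_ineq)
    also have "\<dots> \<le> \<bar>b - c\<bar> * C1 + (L * \<bar>b - c\<bar>) * C2"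
      using C1 C2 Phi_lip L_nonneg by (intro add_mono mult_mono) auto
    finally show ?thesis by (simp add: C_def algebra_simps)
  qed
  have "\<bar>Kruzhkov a b z\<bar> \<le> C" if "a \<in> {0..1}" "b \<in> {0..1}" for a b z
  proof -
    have "Kruzhkov a a z = 0" by (simp add: Kruzhkov_def Phi_def)
    then have "\<bar>Kruzhkov a b z\<bar> \<le> C * \<bar>b - a\<bar>" using lip[of a b z a] by simp
    also have "\<dots> \<le> C * 1" using that C by (intro mult_left_mono) auto
    finally show ?thesis by simp
  qed
  then show ?thesis using that C lip by blast
qed

text \<open>Kato's distribution on t > 0, evaluated on a test function that enters only through its
  gradient; the expression is linear in that gradient, so cutoffs can be subtracted.\<close>

definition weak_form :: "(real \<times> real \<Rightarrow> real) \<Rightarrow> (real \<times> real \<Rightarrow> real) \<Rightarrow> (real \<times> real \<Rightarrow> real) \<Rightarrow> (real \<times> real \<Rightarrow> real) \<Rightarrow> real" where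
  "weak_form u v gx gt = (LBINT p. indicator {0<..} (snd p) * (\<bar>u p - v p\<bar> * gt p + Phi (u p) (v p) * gx p))"

text \<open>Doubling of variables: each solution is tested, at the points \<open>p\<close> in the support of \<open>g\<close>, against
  the mollifier of width \<open>e\<close> centred at \<open>p\<close>, with the value of the other solution as Kruzhkov constant.
  Adding the two inequalities leaves difference quotients of \<open>g\<close> only.\<close>

lemma doubling:
  assumes u: "entropic G u0 u" and v: "entropic G v0 v" and g: "bcs g" and g0: "\<And>p. 0 \<le> g p"
    and e: "e > 0" and eG: "\<And>p q. g p \<noteq> 0 \<Longrightarrow> q \<in> G \<Longrightarrow> dist p q > 2 * e"
    and et: "\<And>p. g p \<noteq> 0 \<Longrightarrow> e < snd p"
  shows "0 \<le> (LBINT z. LBINT p. (g (p - e *\<^sub>R z) - g p) / e * Kruzhkov (u p) (v (p - e *\<^sub>R z)) z)"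
    and "(\<lambda>z. LBINT p. (g (p - e *\<^sub>R z) - g p) / e * Kruzhkov (u p) (v (p - e *\<^sub>R z)) z) \<in> borel_measurable borel"
proof -
  have uu: "unitb u" and vv: "unitb v" using u v by (auto simp: entropic_def)
  have um: "unitb (\<lambda>q. u (fst q + e *\<^sub>R snd q))" "unitb (\<lambda>q. v (fst q))" 
      "unitb (\<lambda>q. u (fst q))" "unitb (\<lambda>q. v (fst q - e *\<^sub>R snd q))"
    by (rule unitb_compose[OF uu] unitb_compose[OF vv]; measurable)+
  define F1 where "F1 q = g (fst q) * Kruzhkov (u (fst q + e *\<^sub>R snd q)) (v (fst q)) (snd q)" for q
  define F2 where "F2 q = g (fst q) * Kruzhkov (u (fst q)) (v (fst q - e *\<^sub>R snd q)) (snd q)" for q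
  have b1: "bcs F1" unfolding F1_def[abs_def] using bcs_Kruzhkov[OF g um(1,2)] by simp
  have b2: "bcs F2" unfolding F2_def[abs_def] using bcs_Kruzhkov[OF g um(3,4)] by simp
  have p1: "0 \<le> (LBINT z. F1 (p, z))" for p
  proof (cases "g p = 0")
    case False
    have "0 \<le> e * (LBINT z. Kruzhkov (u (p + e *\<^sub>R z)) (v p) z)"
      using eG[OF False] et[OF False] e unitbD(4)[OF vv]
      by (intro entropic_mollified[OF u]) auto
    then show ?thesis using e g0[of p] by (simp add: F1_def zero_le_mult_iff)
  qed (simp add: F1_def)
  \<comment> \<open>By symmetry in the states, the same kernel serves when v is the tested solution
    and the value of u is the Kruzhkov constant.\<close>
  have Mks: "Kruzhkov a b z = Kruzhkov b a z" for a b z by (simp add: Kruzhkov_def Phi_sym abs_minus_commute)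
  have p2: "(LBINT z. F2 (p, z)) \<le> 0" for p
  proof (cases "g p = 0")
    case False
    \<comment> \<open>Testing v with width -e evaluates it at p - e z; the negative prefactor
      reverses the sign of the integral.\<close>
    have "0 \<le> (- e) * (LBINT z. Kruzhkov (v (p + (- e) *\<^sub>R z)) (u p) z)"
      using eG[OF False] et[OF False] e unitbD(4)[OF uu]
      by (intro entropic_mollified[OF v]) auto
    then have "(LBINT z. Kruzhkov (u p) (v (p - e *\<^sub>R z)) z) \<le> 0" 
      using e by (simp add: zero_le_mult_iff Mks[of "u p"] mult_le_0_iff)
    then show ?thesis using g0[of p] by (simp add: F2_def mult_nonneg_nonpos)
  qed (simp add: F2_def)
  have i1: "0 \<le> (LBINT z. LBINT p. F1 (p, z))"
    unfolding bcs_fubini(2)[OF b1, symmetric] bcs_fubini(1)[OF b1]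
    using p1 by (intro integral_nonneg_AE) auto
  have i2: "(LBINT z. LBINT p. F2 (p, z)) \<le> 0"
    unfolding bcs_fubini(2)[OF b2, symmetric] bcs_fubini(1)[OF b2]
  proof -
    have "0 \<le> (LBINT p. - (LBINT z. F2 (p, z)))"
      using p2 by (intro integral_nonneg_AE) auto
    then show "(LBINT p. LBINT z. F2 (p, z)) \<le> 0" by simp
  qed
  have eq: "(LBINT p. (g (p - e *\<^sub>R z) - g p) / e * Kruzhkov (u p) (v (p - e *\<^sub>R z)) z)
     = ((LBINT p. F1 (p, z)) - (LBINT p. F2 (p, z))) / e" for z
  proof -
    \<comment> \<open>After moving p by -e z, \<open>F1\<close> contains the same values u(p) and
      v(p - e z) as \<open>F2\<close>; the difference retains only the increment of g.\<close>
    have s: "(LBINT p. F1 (p, z)) = (LBINT p. F1 (- (e *\<^sub>R z) + p, z))"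
      using integral_shift[OF bcs_measurable[OF bcs_section2[OF b1]], of "- (e *\<^sub>R z)" z] by simp
    have "(LBINT p. F1 (p, z)) - (LBINT p. F2 (p, z))
       = (LBINT p. F1 (- (e *\<^sub>R z) + p, z) - F2 (p, z))"
      unfolding s using bcs_integrable[OF bcs_shift[OF bcs_section2[OF b1], of "- (e *\<^sub>R z)"]] bcs_integrable[OF bcs_section2[OF b2]]
      by (intro Bochner_Integration.integral_diff[symmetric]) auto
    also have "\<dots> = (LBINT p. e * ((g (p - e *\<^sub>R z) - g p) / e * Kruzhkov (u p) (v (p - e *\<^sub>R z)) z))"
      using e by (intro Bochner_Integration.integral_cong) (auto simp: F1_def F2_def left_diff_distrib)
    finally show ?thesis using e by simp
  qed
  have c: "bcs (\<lambda>z. LBINT p. F1 (p, z))" "bcs (\<lambda>z. LBINT p. F2 (p, z))"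
    using bcs_inner[OF bcs_swap[OF b1]] bcs_inner[OF bcs_swap[OF b2]] by simp_all
  show "0 \<le> (LBINT z. LBINT p. (g (p - e *\<^sub>R z) - g p) / e * Kruzhkov (u p) (v (p - e *\<^sub>R z)) z)"
    unfolding eq using i1 i2 e c[THEN bcs_integrable] by simp
  show "(\<lambda>z. LBINT p. (g (p - e *\<^sub>R z) - g p) / e * Kruzhkov (u p) (v (p - e *\<^sub>R z)) z) \<in> borel_measurable borel"
    unfolding eq using c[THEN bcs_measurable] by simp
qed

text \<open>The difference quotients of g are bounded by its Lipschitz constant and converge
  pointwise, while v at shifted points converges only in L1; the two errors are therefore separated.
  The bound uniform in z prepares dominated convergence in the mollifier variable.\<close>

lemma doubling_limit:
  assumes uu: "unitb u" and vv: "unitb v" and g: "C1c g gx gt"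
    and e: "e \<longlonglongrightarrow> 0" "\<And>n. 0 < e n" "\<And>n. e n \<le> 1"
  shows "(\<lambda>n. LBINT p. (g (p - e n *\<^sub>R z) - g p) / e n * Kruzhkov (u p) (v (p - e n *\<^sub>R z)) z)
     \<longlonglongrightarrow> (LBINT p. - (gx p * fst z + gt p * snd z) * Kruzhkov (u p) (v p) z)"
    and "\<exists>C. \<forall>n z. \<bar>LBINT p. (g (p - e n *\<^sub>R z) - g p) / e n * Kruzhkov (u p) (v (p - e n *\<^sub>R z)) z\<bar> \<le> C"
proof -
  let ?A = "\<lambda>n z. LBINT p. (g (p - e n *\<^sub>R z) - g p) / e n * Kruzhkov (u p) (v (p - e n *\<^sub>R z)) z"
  let ?AA = "\<lambda>z. LBINT p. - (gx p * fst z + gt p * snd z) * Kruzhkov (u p) (v p) z"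
  obtain B where B: "\<And>p. norm p > B \<Longrightarrow> g p = 0" "\<And>p. norm p > B \<Longrightarrow> gx p = 0" "\<And>p. norm p > B \<Longrightarrow> gt p = 0"
    using g unfolding C1c_def by metis
  obtain Cl where Cl: "Cl > 0" "\<And>p q. \<bar>g p - g q\<bar> \<le> Cl * norm (p - q)" using C1c_lipschitz[OF g] by metis
  obtain Cm where Cm: "Cm > 0" "\<And>a b z. a \<in> {0..1} \<Longrightarrow> b \<in> {0..1} \<Longrightarrow> \<bar>Kruzhkov a b z\<bar> \<le> Cm"
    "\<And>a b c z. \<bar>Kruzhkov a b z - Kruzhkov a c z\<bar> \<le> Cm * \<bar>b - c\<bar>" using Kruzhkov_bound by metis
  note [measurable] = unitbD(1)[OF uu] unitbD(1)[OF vv] C1_borel[OF C1c_C1[OF g]] bcs_measurable[OF bcs_kernel(1)] bcs_measurable[OF bcs_kernel(2)]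
  define D where "D n z p = (g (p - e n *\<^sub>R z) - g p) / e n" for n z p
  have Mkm [measurable]: "(\<lambda>x. Kruzhkov (a x) (b x) z) \<in> borel_measurable borel" if "a \<in> borel_measurable borel" "b \<in> borel_measurable borel" 
    for a b :: "real \<times> real \<Rightarrow> real" and z
    unfolding Kruzhkov_def using that by measurable
  have Db: "\<bar>D n z p\<bar> \<le> Cl * norm z" for n z p
  proof -
    have "\<bar>g (p - e n *\<^sub>R z) - g p\<bar> \<le> Cl * (e n * norm z)" using Cl(2)[of "p - e n *\<^sub>R z" p] e(2)[of n] by simp
    then show ?thesis using e(2)[of n] by (simp add: D_def abs_divide field_simps)
  qed
  have Dz: "D n z p = 0" if "norm p > B + norm z" for n z p
  proof -
    have "norm (e n *\<^sub>R z) \<le> 1 * norm z" using e(2,3)[of n] unfolding norm_scaleR by (intro mult_right_mono) auto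
    moreover have "norm p \<le> norm (p - e n *\<^sub>R z) + norm (e n *\<^sub>R z)"
      using norm_triangle_ineq[of "p - e n *\<^sub>R z" "e n *\<^sub>R z"] by simp
    ultimately have "norm (p - e n *\<^sub>R z) > B" using that by linarith
    moreover have "norm p > B" using that norm_ge_zero[of z] by linarith
    ultimately show ?thesis using B by (simp add: D_def)
  qed
  have Dm [measurable]: "D n z \<in> borel_measurable borel" for n z unfolding D_def[abs_def] by measurable
  show "\<exists>C. \<forall>n z. \<bar>?A n z\<bar> \<le> C"
  proof (intro exI allI)
    fix n z
    show "\<bar>?A n z\<bar> \<le> (Cl * 2 * Cm) * measure lborel (cball (0::real\<times>real) (B + 2))"
    \<comment> \<open>The kernel vanishes for |z| > 2, which makes the Lipschitz bound on the
      difference quotient uniform in z.\<close>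
    proof (cases "norm z > 2")
      case True
      then show ?thesis using Cl Cm by (simp add: Kruzhkov_zero)
    next
      case False
      show ?thesis unfolding D_def[symmetric]
      proof (rule bcs_integral_bound)
        fix p
        have "\<bar>D n z p\<bar> \<le> Cl * 2" using order_trans[OF Db[of n z p] mult_left_mono[of "norm z" 2 Cl]] False Cl(1) by simp
        then show "\<bar>D n z p * Kruzhkov (u p) (v (p - e n *\<^sub>R z)) z\<bar> \<le> (Cl * 2) * Cm"
          unfolding abs_mult using Cm(1,2) Cl unitbD(4)[OF uu] unitbD(4)[OF vv] by (intro mult_mono) auto
        show "B + 2 < norm p \<Longrightarrow> D n z p * Kruzhkov (u p) (v (p - e n *\<^sub>R z)) z = 0"
          using Dz[of z p n] False by simp
      qed measurable
    qed
  qed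
  show "(\<lambda>n. ?A n z) \<longlonglongrightarrow> ?AA z"
  proof -
    define D0 where "D0 p = - (gx p * fst z + gt p * snd z)" for p
    have lim: "(\<lambda>n. D n z p) \<longlonglongrightarrow> D0 p" for p
      using C1_quotient[OF C1c_C1[OF g] e(1), of p "- z"] e(2) by (simp add: D_def D0_def less_imp_neq[symmetric])
    have D0b: "\<bar>D0 p\<bar> \<le> Cl * norm z" for p
      using tendsto_upperbound[OF tendsto_rabs[OF lim[of p]], of "Cl * norm z"] Db by auto
    have D0m [measurable]: "D0 \<in> borel_measurable borel" unfolding D0_def[abs_def] by measurable
    have nz: "norm p > B" if "norm p > B + norm z" for p :: "real \<times> real" using that norm_ge_zero[of z] by linarith
    have D0z: "D0 p = 0" if "norm p > B" for p using B that by (simp add: D0_def)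
    let ?w = "\<lambda>n. - (e n *\<^sub>R z)"
    \<comment> \<open>\<open>?R1\<close> compares the difference quotient with its limit (dominated
      convergence), \<open>?R2\<close> compares v with its shift (continuity of
      translations).\<close>
    let ?R1 = "\<lambda>n p. Cm * \<bar>D n z p - D0 p\<bar>"
    let ?R2 = "\<lambda>n p. (Cl * norm z * Cm) * (indicator (cball 0 B) p * \<bar>v (p + ?w n) - v p\<bar>)"
    have r1: "(\<lambda>n. LBINT p. ?R1 n p) \<longlonglongrightarrow> (\<integral>p. 0 \<partial>(lborel :: (real\<times>real) measure))"
    proof (rule bcs_dct)
      show "\<bar>?R1 n p\<bar> \<le> Cm * (2 * (Cl * norm z))" for n p
        using Cm(1) Db[of n z p] D0b[of p] by (simp add: abs_mult)
      show "B + norm z < norm p \<Longrightarrow> ?R1 n p = 0" for n p using Dz[of z p n] D0z nz by simp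
      show "(\<lambda>n. ?R1 n p) \<longlonglongrightarrow> 0" for p
        using tendsto_mult[OF tendsto_const[of Cm] tendsto_rabs[OF tendsto_diff[OF lim[of p] tendsto_const[of "D0 p"]]]] by simp
    qed measurable
    have w0: "?w \<longlonglongrightarrow> 0" using tendsto_minus[OF tendsto_scaleR[OF e(1) tendsto_const[of z]]] by simp
    have r2: "(\<lambda>n. LBINT p. ?R2 n p) \<longlonglongrightarrow> (Cl * norm z * Cm) * 0"
      unfolding integral_mult_right_zero by (intro tendsto_mult tendsto_const L1_translation_seq[OF unitb_bb[OF vv] w0])
    have i1: "integrable lborel (?R1 n)" for n
      by (rule bcs_integrable, rule bcsI[where C="Cm * (2 * (Cl * norm z))" and B="B + norm z"])
         (use Cm(1) Db[of n z] D0b Dz[of z _ n] D0z nz in \<open>auto simp: abs_mult intro!: mult_left_mono\<close>, smt (verit))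
    have i2: "integrable lborel (?R2 n)" for n
    proof (intro bcs_integrable bcs_mult2[OF bb_const] bcs_mult1 bcs_indicator bb_abs bb_diff unitb_bb[OF vv])
      show "bb (\<lambda>x. v (x + ?w n))" by (rule bb_compose[OF unitb_bb[OF vv]]) measurable
    qed auto
    have Mb: "\<bar>Kruzhkov (u p) (v q) z\<bar> \<le> Cm" for p q
      by (rule Cm(2)[OF unitbD(4)[OF uu] unitbD(4)[OF vv]])
    have in1: "integrable lborel (\<lambda>p. D n z p * Kruzhkov (u p) (v (p - e n *\<^sub>R z)) z)" for n
      by (rule bcs_integrable, rule bcsI[where C="(Cl * norm z) * Cm" and B="B + norm z"])
         (use Cl(1) Db[of n z] Dz[of z _ n] in \<open>auto simp: abs_mult intro!: mult_mono Mb\<close>)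
    have in2: "integrable lborel (\<lambda>p. D0 p * Kruzhkov (u p) (v p) z)"
      by (rule bcs_integrable, rule bcsI[where C="(Cl * norm z) * Cm" and B="B"])
         (use Cl(1) D0b D0z in \<open>auto simp: abs_mult intro!: mult_mono Mb\<close>)
    have pt: "\<bar>D n z p * Kruzhkov (u p) (v (p - e n *\<^sub>R z)) z - D0 p * Kruzhkov (u p) (v p) z\<bar> \<le> ?R1 n p + ?R2 n p" for n p
    proof -
      have "\<bar>D0 p * (Kruzhkov (u p) (v (p - e n *\<^sub>R z)) z - Kruzhkov (u p) (v p) z)\<bar> \<le> ?R2 n p"
      proof (cases "norm p > B")
        case False
        have "\<bar>D0 p * (Kruzhkov (u p) (v (p - e n *\<^sub>R z)) z - Kruzhkov (u p) (v p) z)\<bar> \<le> (Cl * norm z) * (Cm * \<bar>v (p - e n *\<^sub>R z) - v p\<bar>)"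
          unfolding abs_mult using Cm(3) D0b Cl by (intro mult_mono) auto
        then show ?thesis using False by (simp add: indicator_def)
      qed (simp add: D0z indicator_def)
      moreover have "\<bar>(D n z p - D0 p) * Kruzhkov (u p) (v (p - e n *\<^sub>R z)) z\<bar> \<le> ?R1 n p"
        unfolding abs_mult mult.commute[of "\<bar>D n z p - D0 p\<bar>"] by (intro mult_right_mono Mb) auto
      moreover have "D n z p * Kruzhkov (u p) (v (p - e n *\<^sub>R z)) z - D0 p * Kruzhkov (u p) (v p) z =
         (D n z p - D0 p) * Kruzhkov (u p) (v (p - e n *\<^sub>R z)) z + D0 p * (Kruzhkov (u p) (v (p - e n *\<^sub>R z)) z - Kruzhkov (u p) (v p) z)"
        by (simp add: algebra_simps)
      ultimately show ?thesis by linarith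
    qed
    have "norm (?A n z - ?AA z) \<le> (LBINT p. ?R1 n p) + (LBINT p. ?R2 n p)" for n
    proof -
      have eq: "?A n z - ?AA z = (LBINT p. D n z p * Kruzhkov (u p) (v (p - e n *\<^sub>R z)) z - D0 p * Kruzhkov (u p) (v p) z)"
        using in1[of n] in2 by (simp add: D_def D0_def)
      have "norm (?A n z - ?AA z) \<le> (LBINT p. \<bar>D n z p * Kruzhkov (u p) (v (p - e n *\<^sub>R z)) z - D0 p * Kruzhkov (u p) (v p) z\<bar>)"
        unfolding eq real_norm_def by (rule integral_abs_bound)
      also have "\<dots> \<le> (LBINT p. ?R1 n p + ?R2 n p)"
        using in1[of n] in2 by (intro Bochner_Integration.integral_mono Bochner_Integration.integrable_abs Bochner_Integration.integrable_diff Bochner_Integration.integrable_add i1 i2 pt) auto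
      also have "\<dots> = (LBINT p. ?R1 n p) + (LBINT p. ?R2 n p)"
        by (rule Bochner_Integration.integral_add[OF i1 i2])
      finally show ?thesis .
    qed
    then have "\<forall>\<^sub>F n in sequentially. norm (?A n z - ?AA z) \<le> (LBINT p. ?R1 n p) + (LBINT p. ?R2 n p)"
      by (rule always_eventually[OF allI])
    moreover have "(\<lambda>n. (LBINT p. ?R1 n p) + (LBINT p. ?R2 n p)) \<longlonglongrightarrow> 0"
      using tendsto_add[OF r1 r2] unfolding integral_zero mult_zero_right add_0 .
    ultimately have "(\<lambda>n. ?A n z - ?AA z) \<longlonglongrightarrow> 0"
      by (rule Lim_null_comparison)
    then show ?thesis by (rule LIM_zero_cancel)
  qed
qed

theorem kato:
  assumes u: "entropic G u0 u" and v: "entropic G v0 v" and G: "compact G"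
    and g: "C1c g gx gt" and g0: "\<And>p. 0 \<le> g p"
    and U: "open U" "G \<subseteq> U" "\<And>p. p \<in> U \<Longrightarrow> g p = 0" and t0: "t0 > 0" "\<And>p. snd p < t0 \<Longrightarrow> g p = 0"
  shows "0 \<le> weak_form u v gx gt"
proof -
  have uu: "unitb u" and vv: "unitb v" using u v by (auto simp: entropic_def)
  obtain d where d: "d > 0" "(\<Union>x\<in>G. ball x d) \<subseteq> U"
    using compact_subset_open_imp_ball_epsilon_subset[OF G U(1,2)] by metis
  \<comment> \<open>d / 3 gives 2 e0 < d, so the squares around the support of g avoid G; t0 / 2
    keeps them at positive times.\<close>
  define e0 where "e0 = min 1 (min (d / 3) (t0 / 2))"
  define e where "e n = e0 / real (Suc n)" for n
  have e0: "0 < e0" "e0 \<le> 1" "2 * e0 < d" "e0 < t0" using d t0 by (auto simp: e0_def min_def)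
  have el: "e \<longlonglongrightarrow> 0" unfolding e_def using LIMSEQ_Suc[OF lim_const_over_n[of e0]] by simp
  have e1: "0 < e n" for n using e0 by (simp add: e_def)
  have e2: "e n \<le> e0" for n using e0 by (simp add: e_def field_simps)
  let ?A = "\<lambda>n z. LBINT p. (g (p - e n *\<^sub>R z) - g p) / e n * Kruzhkov (u p) (v (p - e n *\<^sub>R z)) z"
  let ?AA = "\<lambda>z. LBINT p. - (gx p * fst z + gt p * snd z) * Kruzhkov (u p) (v p) z"
  have sep: "dist p q > 2 * e n" if "g p \<noteq> 0" "q \<in> G" for p q n
  proof (rule ccontr)
    assume "\<not> dist p q > 2 * e n"
    then have "p \<in> ball q d" using e2[of n] e0 by (simp add: dist_commute)
    then have "p \<in> U" using d(2) that(2) by blast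
    then show False using U that by auto
  qed
  have sept: "e n < snd p" if "g p \<noteq> 0" for p n
    using t0(2)[of p] that e2[of n] e0 by (meson le_less_trans less_le_trans not_le)
  have pos: "0 \<le> (LBINT z. ?A n z)" and meas: "?A n \<in> borel_measurable borel" for n
    using doubling[OF u v C1c_bcs(1)[OF g] g0 e1 sep sept, of n] by auto
  obtain C where C: "\<And>n z. \<bar>?A n z\<bar> \<le> C"
    using doubling_limit(2)[OF uu vv g el e1] e2 e0 by (meson order_trans)
  have lim: "(\<lambda>n. ?A n z) \<longlonglongrightarrow> ?AA z" for z
    using doubling_limit(1)[OF uu vv g el e1] e2 e0 by (meson order_trans)
  have "(\<lambda>n. LBINT z. ?A n z) \<longlonglongrightarrow> (LBINT z. ?AA z)"
  proof (rule bcs_dct[OF _ _ C _ lim])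
    show "?AA \<in> borel_measurable borel" using borel_measurable_LIMSEQ_metric[OF meas lim] .
    show "2 < norm z \<Longrightarrow> ?A n z = 0" for n z by (simp add: Kruzhkov_zero)
  qed (rule meas)
  then have "0 \<le> (LBINT z. ?AA z)"
    using pos by (intro LIMSEQ_le_const) auto
  also have "(LBINT z. ?AA z) = weak_form u v gx gt"
  proof -
    let ?I = "\<lambda>q. - (gx (fst q) * fst (snd q) + gt (fst q) * snd (snd q)) * Kruzhkov (u (fst q)) (v (fst q)) (snd q)"
    have um: "unitb (\<lambda>q. u (fst q) :: real)" "unitb (\<lambda>q. v (fst q))"
      by (rule unitb_compose[OF uu] unitb_compose[OF vv]; measurable)+
    note cg = C1c_bcs[OF g]
    have "bcs (\<lambda>q. (- 1) * (((gx (fst q) * (fst (snd q) * moll_t (snd q)) + gt (fst q) * (snd (snd q) * moll_t (snd q))) * \<bar>u (fst q) - v (fst q)\<bar>)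
        + ((gx (fst q) * (fst (snd q) * moll_x (snd q)) + gt (fst q) * (snd (snd q) * moll_x (snd q))) * Phi (u (fst q)) (v (fst q)))))"
      by (intro bcs_mult2[OF bb_const] bcs_add bcs_mult1[OF _ bb_unitb_diff[OF um]] bcs_mult1[OF _ bb_unitb_Phi[OF um]]
          bcs_product[OF cg(2) integral_kernel(5)] bcs_product[OF cg(3) integral_kernel(6)] bcs_product[OF cg(2) integral_kernel(7)] bcs_product[OF cg(3) integral_kernel(8)])
    then have b: "bcs ?I" by (simp add: Kruzhkov_def algebra_simps)
    have "(LBINT z. ?AA z) = (LBINT p. LBINT z. ?I (p, z))"
      using bcs_fubini[OF b] by simp
    also have "\<dots> = (LBINT p. indicator {0<..} (snd p) * (\<bar>u p - v p\<bar> * gt p + Phi (u p) (v p) * gx p))"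
    proof (rule Bochner_Integration.integral_cong[OF refl])
      fix p
      \<comment> \<open>With p fixed, only first moments of the kernel remain; being minus the
        identity, they cancel the minus sign that came from the shift by -e z.\<close>
      have "(LBINT z. ?I (p, z)) = (LBINT z. - (gx p * \<bar>u p - v p\<bar>) * (fst z * moll_t z) + (- (gt p * \<bar>u p - v p\<bar>) * (snd z * moll_t z)
          + (- (gx p * Phi (u p) (v p)) * (fst z * moll_x z) + - (gt p * Phi (u p) (v p)) * (snd z * moll_x z))))"
        by (intro Bochner_Integration.integral_cong) (auto simp: Kruzhkov_def algebra_simps)
      also have "\<dots> = \<bar>u p - v p\<bar> * gt p + Phi (u p) (v p) * gx p"
        using integral_kernel(5-8)[THEN bcs_integrable]
        by (simp add: Bochner_Integration.integral_add Bochner_Integration.integrable_add integral_kernel)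
      \<comment> \<open>At nonpositive times the gradient is zero, because g vanishes on the open
        set of times below t0.\<close>
      also have "\<dots> = indicator {0<..} (snd p) * (\<bar>u p - v p\<bar> * gt p + Phi (u p) (v p) * gx p)"
      proof (cases "snd p > 0")
        case False
        have "open {p::real\<times>real. snd p < t0}" by (intro open_Collect_less continuous_intros)
        from C1_local_zero[OF C1c_C1[OF g] this] show ?thesis using t0 False by (auto simp: indicator_def)
      qed simp
      finally show "(LBINT z. ?I (p, z)) = indicator {0<..} (snd p) * (\<bar>u p - v p\<bar> * gt p + Phi (u p) (v p) * gx p)" .
    qed
    finally show ?thesis by (simp add: weak_form_def)
  qed
  finally show ?thesis .
qed

end

section \<open>Mollified trajectories\<close>

lemma integral_cs_lborel:
  fixes f :: "real \<Rightarrow> real"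
  assumes "continuous_on UNIV f" "\<And>r. r \<notin> {s..T} \<Longrightarrow> f r = 0"
  shows "integral {s..T} f = (LBINT r. f r)" "bcs f"
proof -
  show b: "bcs f"
    by (rule bcs_continuous[OF assms(1), of "\<bar>s\<bar> + \<bar>T\<bar>"]) (use assms(2) in force)
  have "integral {s..T} f = integral UNIV (\<lambda>r. if r \<in> {s..T} then f r else 0)"
    by (rule integral_restrict_UNIV[symmetric])
  also have "(\<lambda>r. if r \<in> {s..T} then f r else 0) = f" using assms(2) by auto
  also have "integral UNIV f = (LBINT r. f r)" by (rule integral_lborel[OF bcs_integrable[OF b]])
  finally show "integral {s..T} f = (LBINT r. f r)" .
qed

lemma moll_average_bound:
  fixes g :: "real \<Rightarrow> real"
  assumes "g \<in> borel_measurable borel" "\<And>r. \<bar>r\<bar> < 1 \<Longrightarrow> \<bar>g r\<bar> \<le> e"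
  shows "\<bar>LBINT r. moll r * g r\<bar> \<le> e"
proof -
  have e: "0 \<le> e" using assms(2)[of 0] by simp
  have b: "\<bar>moll r * g r\<bar> \<le> moll r * e" for r
    using assms(2)[of r] moll_zero[of r] moll_nonneg[of r] by (cases "\<bar>r\<bar> < 1") (auto simp: abs_mult intro!: mult_left_mono)
  have im: "integrable lborel (\<lambda>r. moll r * e)" using bcs_integrable[OF bcs_moll(1)] by simp
  have [measurable]: "moll \<in> borel_measurable borel" using bcs_measurable[OF bcs_moll(1)] .
  note [measurable] = assms(1)
  have i: "integrable lborel (\<lambda>r. moll r * g r)"
    by (rule Bochner_Integration.integrable_bound[OF im]) (use b e moll_nonneg in \<open>auto simp: abs_mult\<close>)
  have "\<bar>LBINT r. moll r * g r\<bar> \<le> (LBINT r. \<bar>moll r * g r\<bar>)" by (rule integral_abs_bound)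
  also have "\<dots> \<le> (LBINT r. moll r * e)"
    by (rule Bochner_Integration.integral_mono[OF Bochner_Integration.integrable_abs[OF i] im b])
  also have "\<dots> = e" by (simp add: integral_moll)
  finally show ?thesis .
qed

text \<open>Here c is the weak derivative of y, tested against mollifiers. On {a..b} the derivative
  of the mollified curve is the mollified c, so it converges only in L1, while continuity of y gives
  uniform convergence of the curves. Uniform closeness places the strip; L1 closeness controls its
  speed.\<close>

lemma mollify_curve:
  fixes y c :: "real \<Rightarrow> real"
  assumes y: "continuous_on UNIV y" and c: "bb c" and ab: "s < a" "b < T" "a \<le> b"
    and wd: "\<And>t e. 0 < e \<Longrightarrow> s < t - e \<Longrightarrow> t + e < T \<Longrightarrow>
      (LBINT r. y r * (deriv moll ((t - r) / e) / e)) = (LBINT r. c r * moll ((t - r) / e))"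
  obtains Y dY :: "nat \<Rightarrow> real \<Rightarrow> real"
  where "\<And>n t. (Y n has_real_derivative dY n t) (at t)" "\<And>n. continuous_on UNIV (dY n)"
    "\<And>\<eta>. \<eta> > 0 \<Longrightarrow> \<exists>N. \<forall>n\<ge>N. \<forall>t\<in>{a..b}. \<bar>Y n t - y t\<bar> < \<eta>"
    "(\<lambda>n. LBINT t. indicator {a..b} t * \<bar>dY n t - c t\<bar>) \<longlonglongrightarrow> 0"
proof -
  \<comment> \<open>Half of the distance to the end points keeps every mollifier centred in {a..b}
    inside the open interval, where the weak derivative may be tested.\<close>
  define e0 where "e0 = min (a - s) (T - b) / 2"
  define e where "e n = e0 / real (Suc n)" for n
  have e0: "0 < e0" "s < a - e0" "b + e0 < T" using ab by (auto simp: e0_def min_def field_simps)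
  have el: "e \<longlonglongrightarrow> 0" unfolding e_def using LIMSEQ_Suc[OF lim_const_over_n[of e0]] by simp
  have e1: "0 < e n" for n using e0 by (simp add: e_def)
  have e2: "e n \<le> e0" for n using e0 by (simp add: e_def field_simps)
  have mc: "continuous_on UNIV moll" "continuous_on UNIV (deriv moll)"
    using Cinf_continuous[OF Cinf_moll] Cinf_continuous[OF Cinf_deriv(2)[OF Cinf_moll]] .
  \<comment> \<open>Integrating over a compact interval makes the Leibniz rule available at every t,
    so \<open>Y n\<close> is C1 on the line. For t in {a..b} the kernel is supported inside it and
    the full average is recovered.\<close>
  define Y where "Y n t = integral (cbox s T) (\<lambda>r. y r * (moll ((t - r) / e n) / e n))" for n t
  define dY where "dY n t = integral (cbox s T) (\<lambda>r. y r * (deriv moll ((t - r) / e n) / e n / e n))" for n t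
  have yc: "continuous_on A y" for A using y continuous_on_subset by blast
  have mc2: "continuous_on A (\<lambda>x. moll (h x))" "continuous_on A (\<lambda>x. deriv moll (h x))" if "continuous_on A h" for h :: "'z::topological_space \<Rightarrow> real" and A
    using continuous_on_compose2[OF mc(1) that] continuous_on_compose2[OF mc(2) that] by auto
  have "(Y n has_real_derivative dY n t) (at t within UNIV)" for n t
    unfolding Y_def dY_def
  proof (rule leibniz_rule_field_derivative)
    show "((\<lambda>t. y r * (moll ((t - r) / e n) / e n)) has_field_derivative y r * (deriv moll ((t - r) / e n) / e n / e n)) (at t within UNIV)" for t r
      using DERIV_cmult[OF moll_scale_deriv[of "e n" r t], of "y r / e n"] e1[of n] by (simp add: less_imp_neq[symmetric])
    show "(\<lambda>r. y r * (moll ((t - r) / e n) / e n)) integrable_on cbox s T" for t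
      using e1[of n] by (intro integrable_continuous continuous_intros yc mc2) auto
    have "continuous_on A (\<lambda>x. y (snd x))" for A :: "(real \<times> real) set"
      using continuous_on_compose2[OF y, of A snd] by (simp add: continuous_on_snd)
    then show "continuous_on (UNIV \<times> cbox s T) (\<lambda>(t, r). y r * (deriv moll ((t - r) / e n) / e n / e n))"
      using e1[of n] unfolding case_prod_unfold by (intro continuous_intros mc2) auto
  qed auto
  then have Yd: "(Y n has_real_derivative dY n t) (at t)" for n t by simp
  have dYc: "continuous_on UNIV (dY n)" for n
    unfolding dY_def
  proof (rule integral_continuous_on_param)
    have "continuous_on A (\<lambda>x. y (snd x))" for A :: "(real \<times> real) set"
      using continuous_on_compose2[OF y, of A snd] by (simp add: continuous_on_snd)
    then show "continuous_on (UNIV \<times> cbox s T) (\<lambda>(t, r). y r * (deriv moll ((t - r) / e n) / e n / e n))"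
      using e1[of n] unfolding case_prod_unfold by (intro continuous_intros mc2) auto
  qed
  have [measurable]: "c \<in> borel_measurable borel" using bb_measurable[OF c] .
  have [measurable]: "y \<in> borel_measurable borel" using borel_measurable_continuous_onI[OF y] .
  have [measurable]: "moll \<in> borel_measurable borel" using bcs_measurable[OF bcs_moll(1)] .
  have far: "\<bar>(t - r) / e n\<bar> \<ge> 1" if "t \<in> {a..b}" "r \<notin> {s..T}" for t r n
    using that e0 e1[of n] e2[of n] by (auto simp: abs_divide field_simps)
  have sc: "(LBINT r. g r * moll ((t - r) / e n)) = e n * (LBINT x. moll x * g (t + e n * x))" for g t n
    using lborel_integral_real_affine[of "e n" "\<lambda>r. g r * moll ((t - r) / e n)" t] e1[of n]
    by (simp add: moll_even mult.commute)
  have YI: "Y n t = (LBINT x. moll x * y (t + e n * x))" if t: "t \<in> {a..b}" for n t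
  proof -
    have "Y n t = (LBINT r. y r * (moll ((t - r) / e n) / e n))"
      unfolding Y_def box_real
      by (rule integral_cs_lborel(1)) (use e1[of n] moll_zero[OF far[OF t]] in \<open>auto intro!: continuous_intros y mc2 simp del: atLeastAtMost_iff\<close>)
    also have "\<dots> = (LBINT r. y r * moll ((t - r) / e n)) / e n" by simp
    finally show ?thesis using sc[of y t n] e1[of n] by simp
  qed
  have dYI: "dY n t = (LBINT x. moll x * c (t + e n * x))" if t: "t \<in> {a..b}" for n t
  proof -
    have "dY n t = (LBINT r. y r * (deriv moll ((t - r) / e n) / e n / e n))"
      unfolding dY_def box_real
      by (rule integral_cs_lborel(1)) (use e1[of n] moll'_zero[OF far[OF t]] in \<open>auto intro!: continuous_intros y mc2 simp del: atLeastAtMost_iff\<close>)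
    also have "\<dots> = (LBINT r. y r * (deriv moll ((t - r) / e n) / e n)) / e n" by simp
    also have "\<dots> = (LBINT r. c r * moll ((t - r) / e n)) / e n"
      using t e0 e1[of n] e2[of n] by (subst wd) auto
    finally show ?thesis using sc[of c t n] e1[of n] by simp
  qed
  have avg: "(LBINT x. moll x * k) = k" for k by (simp add: integral_moll)
  have im: "integrable lborel (\<lambda>x. moll x * k)" for k using bcs_integrable[OF bcs_moll(1)] by simp
  have unif: "\<exists>N. \<forall>n\<ge>N. \<forall>t\<in>{a..b}. \<bar>Y n t - y t\<bar> < \<eta>" if \<eta>: "\<eta> > 0" for \<eta>
  proof -
    have uc: "uniformly_continuous_on {a - e0..b + e0} y" by (intro compact_uniformly_continuous yc) auto
    have "\<eta> / 2 > 0" using \<eta> by simp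
    then obtain d where d: "d > 0" "\<And>x x'. x \<in> {a - e0..b + e0} \<Longrightarrow> x' \<in> {a - e0..b + e0} \<Longrightarrow> dist x' x < d \<Longrightarrow> dist (y x') (y x) < \<eta> / 2"
      by (rule uniformly_continuous_onE[OF uc]) blast
    obtain N where N: "\<And>n. n \<ge> N \<Longrightarrow> norm (e n - 0) < d" using LIMSEQ_D[OF el d(1)] by auto
    have "\<bar>Y n t - y t\<bar> < \<eta>" if n: "n \<ge> N" and t: "t \<in> {a..b}" for n t
    proof -
      have pt: "\<bar>y (t + e n * x) - y t\<bar> \<le> \<eta> / 2" if "\<bar>x\<bar> < 1" for x
      proof -
        have ex: "\<bar>e n * x\<bar> \<le> e n" using that e1[of n] by (simp add: abs_mult)
        then have "t + e n * x \<in> {a - e0..b + e0}" "t \<in> {a - e0..b + e0}" using t e2[of n] e0 by auto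
        moreover have "dist (t + e n * x) t < d" using N[OF n] ex by (simp add: dist_real_def)
        ultimately show ?thesis using d(2)[of t "t + e n * x"] by (simp add: dist_real_def)
      qed
      have ic: "integrable lborel (\<lambda>x. moll x * y (t + e n * x))"
        by (rule integral_cs_lborel(2)[of _ "-1" 1, THEN bcs_integrable])
           (auto intro!: continuous_intros mc(1) continuous_on_compose2[OF y] moll_zero)
      have "Y n t - y t = (LBINT x. moll x * y (t + e n * x) - moll x * y t)"
        using ic im[of "y t"] by (subst Bochner_Integration.integral_diff) (auto simp: YI[OF t] integral_moll)
      also have "\<dots> = (LBINT x. moll x * (y (t + e n * x) - y t))" by (simp add: right_diff_distrib)
      finally have "\<bar>Y n t - y t\<bar> \<le> \<eta> / 2"
        using moll_average_bound[of "\<lambda>x. y (t + e n * x) - y t" "\<eta>/2"] pt by simp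
      then show ?thesis using \<eta> by simp
    qed
    then show ?thesis by blast
  qed
  have L1: "(\<lambda>n. LBINT t. indicator {a..b} t * \<bar>dY n t - c t\<bar>) \<longlonglongrightarrow> 0"
  proof (rule LIMSEQ_I)
    fix \<eta> :: real assume \<eta>: "\<eta> > 0"
    define B where "B = \<bar>a\<bar> + \<bar>b\<bar>"
    have sub: "indicator {a..b} t \<le> (indicator (cball 0 B) t :: real)" for t
      by (auto simp: indicator_def B_def)
    have "\<eta> / 2 > 0" using \<eta> by simp
    then obtain d where d: "d > 0" "\<And>v. norm v < d \<Longrightarrow> (LBINT x. indicator (cball 0 B) x * \<bar>c (x + v) - c x\<bar>) < \<eta> / 2"
      using L1_translation[OF c] by metis
    obtain N where N: "\<And>n. n \<ge> N \<Longrightarrow> norm (e n - 0) < d" using LIMSEQ_D[OF el d(1)] by auto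
    have "norm ((LBINT t. indicator {a..b} t * \<bar>dY n t - c t\<bar>) - 0) < \<eta>" if n: "n \<ge> N" for n
    proof -
      let ?F = "\<lambda>q. (indicator {a..b} (fst q) * moll (snd q)) * \<bar>c (fst q + e n * snd q) - c (fst q)\<bar>"
      have cs: "bb (\<lambda>q. c (fst q + e n * snd q))" "bb (\<lambda>q::real\<times>real. c (fst q))" 
        by (rule bb_compose[OF c]; measurable)+
      have bF: "bcs ?F"
        by (intro bcs_mult1 bcs_product bcs_indicator bcs_moll bb_abs bb_diff cs) auto
      have pt: "indicator {a..b} t * \<bar>dY n t - c t\<bar> \<le> (LBINT x. ?F (t, x))" for t
      proof (cases "t \<in> {a..b}")
        case True
        have "bb (\<lambda>x. c (t + e n * x))" by (rule bb_compose[OF c]) measurable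
        then have ic: "integrable lborel (\<lambda>x. moll x * c (t + e n * x))"
          by (intro bcs_integrable bcs_mult1 bcs_moll)
        have "dY n t - c t = (LBINT x. moll x * c (t + e n * x) - moll x * c t)"
          using ic im[of "c t"] by (subst Bochner_Integration.integral_diff) (auto simp: dYI[OF True] integral_moll)
        then have "\<bar>dY n t - c t\<bar> \<le> (LBINT x. \<bar>moll x * c (t + e n * x) - moll x * c t\<bar>)"
          by (simp only: integral_abs_bound)
        also have "\<dots> = (LBINT x. ?F (t, x))"
          using True by (intro Bochner_Integration.integral_cong) (auto simp: right_diff_distrib[symmetric] abs_mult moll_nonneg)
        finally show ?thesis using True by simp
      qed simp
      have dm [measurable]: "dY n \<in> borel_measurable borel" using borel_measurable_continuous_onI[OF dYc] .
      have nn: "0 \<le> (LBINT t. indicator {a..b} t * \<bar>dY n t - c t\<bar>)"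
        by (intro integral_nonneg_AE) auto
      have "(LBINT t. indicator {a..b} t * \<bar>dY n t - c t\<bar>) \<le> (LBINT t. LBINT x. ?F (t, x))"
      proof (rule integral_mono_AE')
        show "integrable lborel (\<lambda>t. LBINT x. ?F (t, x))" by (rule bcs_integrable[OF bcs_inner[OF bF]])
        show "AE t in lborel. 0 \<le> (LBINT x. ?F (t, x))"
          by (intro AE_I2 integral_nonneg_AE) (auto simp: moll_nonneg)
      qed (use pt in auto)
      \<comment> \<open>Exchanging the integrals leaves, for each mollifier variable x, the L1 error
        of the translation by \<open>e n * x\<close>.\<close>
      also have "\<dots> = (LBINT x. LBINT t. ?F (t, x))" using bcs_fubini[OF bF] by simp
      also have "\<dots> = (LBINT x. moll x * (LBINT t. indicator {a..b} t * \<bar>c (t + e n * x) - c t\<bar>))"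
        unfolding integral_mult_right_zero[symmetric] by (simp add: mult_ac)
      also have "\<dots> \<le> \<eta> / 2"
      proof (rule order_trans[OF abs_ge_self moll_average_bound])
        show "(\<lambda>x. LBINT t. indicator {a..b} t * \<bar>c (t + e n * x) - c t\<bar>) \<in> borel_measurable borel" by measurable
        fix x :: real assume x: "\<bar>x\<bar> < 1"
        have i: "integrable lborel (\<lambda>t. indicator (cball 0 B) t * \<bar>c (t + e n * x) - c t\<bar>)"
          by (intro bcs_integrable bcs_mult1 bcs_indicator bb_abs bb_diff c bb_compose[OF c]) auto
        have ex: "\<bar>e n * x\<bar> \<le> e n" using x e1[of n] by (simp add: abs_mult)
        have nn: "0 \<le> (LBINT t. indicator {a..b} t * \<bar>c (t + e n * x) - c t\<bar>)"
          by (intro integral_nonneg_AE) auto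
        have "(LBINT t. indicator {a..b} t * \<bar>c (t + e n * x) - c t\<bar>)
            \<le> (LBINT t. indicator (cball 0 B) t * \<bar>c (t + e n * x) - c t\<bar>)"
          by (rule integral_mono_AE'[OF i]) (auto intro!: mult_right_mono sub)
        also have "\<dots> < \<eta> / 2" using d(2)[of "e n * x"] ex N[OF n] by simp
        finally show "\<bar>LBINT t. indicator {a..b} t * \<bar>c (t + e n * x) - c t\<bar>\<bar> \<le> \<eta> / 2" using nn by simp
      qed
      finally show ?thesis using nn \<eta> by simp
    qed
    then show "\<exists>no. \<forall>n\<ge>no. norm ((LBINT t. indicator {a..b} t * \<bar>dY n t - c t\<bar>) - 0) < \<eta>" by blast
  qed
  show ?thesis using that[OF Yd dYc unif L1] .
qed

section \<open>Contribution of one interface\<close>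

text \<open>A plateau: 1 on [-1, 1] and 0 beyond distance 2. Thanks to the plateau, subtracting the
  strip kills a test function on a whole neighbourhood of a curve.\<close>

definition strip :: "real \<Rightarrow> real" where "strip r = wcut r * wcut (- r)"
definition dstrip :: "real \<Rightarrow> real" where "dstrip r = w (- r) - w r"

lemma strip_deriv: "(strip has_real_derivative dstrip r) (at r)"
proof -
  have m: "((\<lambda>r. wcut (- r)) has_real_derivative w (- r)) (at r)"
    using DERIV_chain2[OF wcut_deriv[of "- r"] DERIV_minus[OF DERIV_ident]] by simp
  have "(strip has_real_derivative - w r * wcut (- r) + w (- r) * wcut r) (at r)"
    unfolding strip_def[abs_def] using DERIV_mult[OF wcut_deriv[of r] m] by simp
  moreover have "w r * wcut (- r) = w r" using wcut_one[of "- r"] w_zero[of r] by (cases "r \<le> 1") auto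
  moreover have "w (- r) * wcut r = w (- r)" using wcut_one[of r] w_zero[of "- r"] by (cases "- r \<le> 1") auto
  ultimately show ?thesis by (simp add: dstrip_def)
qed

lemma dstrip_continuous: "continuous_on A dstrip"
  unfolding dstrip_def[abs_def] by (intro continuous_intros continuous_on_compose2[OF w_continuous[of UNIV]]) auto

lemma strip_continuous: "continuous_on A strip"
  by (meson DERIV_continuous_on strip_deriv has_field_derivative_at_within)

lemma strip_bounds: "0 \<le> strip r" "strip r \<le> 1"
  using wcut_bounds[of r] wcut_bounds[of "- r"] by (auto simp: strip_def mult_le_one)

lemma strip_one: "\<bar>r\<bar> \<le> 1 \<Longrightarrow> strip r = 1"
  by (auto simp: strip_def wcut_one)

lemma strip_zero: "\<bar>r\<bar> \<ge> 2 \<Longrightarrow> strip r = 0"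
  by (auto simp: strip_def wcut_zero abs_if split: if_splits)

lemma bcs_strip: "bcs strip" "bcs dstrip"
  using strip_continuous dstrip_continuous
  by (auto intro!: bcs_continuous[where B=2] strip_zero simp: dstrip_def w_zero abs_if split: if_splits)

lemma w_reflect: "bcs (\<lambda>r. w (- r))" "(LBINT r. w (- r)) = 1"
proof -
  show "bcs (\<lambda>r. w (- r))"
    by (rule bcs_continuous[where B=2]) (auto intro!: continuous_on_compose2[OF w_continuous[of UNIV]] continuous_intros w_zero simp: abs_if split: if_splits)
  show "(LBINT r. w (- r)) = 1" using lborel_integral_real_affine[of "-1" w 0] integral_w_lborel by simp
qed

text \<open>The derivative has mass 1 on the left and -1 on the right, so it reads off the left
  value minus the right value of a function constant on each side.\<close>

lemma integral_dstrip:
  "(LBINT r. \<bar>dstrip r\<bar>) = 2"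
  "(LBINT r. dstrip r * (if r > 0 then A else B)) = B - A"
proof -
  have 1: "\<bar>dstrip r\<bar> = w (- r) + w r" for r
    using w_nonneg[of r] w_nonneg[of "- r"] w_zero[of r] w_zero[of "- r"] by (cases "r > 0") (auto simp: dstrip_def)
  have 2: "dstrip r * (if r > 0 then A else B) = w (- r) * B - w r * A" for r
    using w_zero[of r] w_zero[of "- r"] by (cases "r > 0") (auto simp: dstrip_def algebra_simps)
  have i: "integrable lborel w" "integrable lborel (\<lambda>r. w (- r))" using bcs_w w_reflect(1) bcs_integrable by auto
  show "(LBINT r. \<bar>dstrip r\<bar>) = 2" unfolding 1 using i by (simp add: w_reflect integral_w_lborel)
  show "(LBINT r. dstrip r * (if r > 0 then A else B)) = B - A" unfolding 2 using i by (simp add: w_reflect integral_w_lborel)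
qed

text \<open>Straightens a curve to the line x = 0. Each horizontal section is merely translated, so
  continuity of Y suffices and there is no Jacobian.\<close>

lemma bcs_shear:
  fixes g :: "real \<times> real \<Rightarrow> real"
  assumes g: "bcs g" and Y: "continuous_on UNIV (Y :: real \<Rightarrow> real)"
  shows "bcs (\<lambda>p. g (Y (snd p) + fst p, snd p))"
    and "(LBINT p. g p) = (LBINT p. g (Y (snd p) + fst p, snd p))"
proof -
  obtain C where C: "C > 0" "\<And>x. \<bar>g x\<bar> \<le> C" "\<And>x. norm x > C \<Longrightarrow> g x = 0" using bcs_bound[OF g] by metis
  note [measurable] = bcs_measurable[OF g] borel_measurable_continuous_onI[OF Y]
  have "compact (Y ` {-C..C})" using Y by (intro compact_continuous_image) (auto intro: continuous_on_subset)
  then obtain M where M: "\<And>t. t \<in> {-C..C} \<Longrightarrow> \<bar>Y t\<bar> \<le> M"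
    using compact_imp_bounded bounded_pos by (metis image_eqI real_norm_def)
  show b: "bcs (\<lambda>p. g (Y (snd p) + fst p, snd p))"
  proof (rule bcsI[where C=C and B="(C + M) + C"])
    fix p :: "real \<times> real" assume p: "norm p > (C + M) + C"
    show "g (Y (snd p) + fst p, snd p) = 0"
    proof (rule ccontr)
      assume "g (Y (snd p) + fst p, snd p) \<noteq> 0"
      then have n: "norm (Y (snd p) + fst p, snd p) \<le> C" using C(3) by force
      have "\<bar>Y (snd p) + fst p\<bar> \<le> C" "\<bar>snd p\<bar> \<le> C"
        using order_trans[OF norm_fst_le n] order_trans[OF norm_snd_le n] by auto
      moreover have "\<bar>Y (snd p)\<bar> \<le> M" using calculation by (intro M) auto
      moreover have "norm p \<le> \<bar>fst p\<bar> + \<bar>snd p\<bar>" using norm_Pair_le[of "fst p" "snd p"] by simp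
      ultimately show False using p by linarith
    qed
  qed (use C in measurable)
  have "(LBINT p. g p) = (LBINT t. LBINT x. g (x, t))" by (rule bcs_fubini(2)[OF g])
  also have "\<dots> = (LBINT t. LBINT x. g (Y t + x, t))"
    using integral_shift[of "\<lambda>x. g (x, t)" "Y t" for t] by simp
  also have "\<dots> = (LBINT p. g (Y (snd p) + fst p, snd p))" using bcs_fubini(2)[OF b] by simp
  finally show "(LBINT p. g p) = (LBINT p. g (Y (snd p) + fst p, snd p))" .
qed

lemma bcs_indicator_continuous:
  fixes h :: "real \<Rightarrow> real"
  assumes "continuous_on UNIV h" shows "bcs (\<lambda>t. indicator {a..b} t * h t)"
proof -
  have "compact (h ` {a..b})" using assms by (intro compact_continuous_image) (auto intro: continuous_on_subset)
  then obtain M where M: "M > 0" "\<And>t. t \<in> {a..b} \<Longrightarrow> \<bar>h t\<bar> \<le> M"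
    using compact_imp_bounded bounded_pos by (metis image_eqI real_norm_def)
  show ?thesis
    by (rule bcsI[where C=M and B="\<bar>a\<bar> + \<bar>b\<bar>"]) (use M borel_measurable_continuous_onI[OF assms] in \<open>auto simp: indicator_def\<close>)
qed

lemma bcs_product_integral:
  fixes f :: "real \<Rightarrow> real" and g :: "real \<Rightarrow> real"
  assumes "bcs f" "bcs g"
  shows "(LBINT p. f (fst p) * g (snd p)) = (LBINT x. f x) * (LBINT x. g x)"
  using bcs_fubini(1)[OF bcs_product[OF assms]] by auto

text \<open>The offset \<xi> is signed and \<sigma> selects its sign, so that both sides are later
  integrated in the same variable against \<open>dstrip\<close>.\<close>

definition one_sided_trace :: "real \<Rightarrow> real \<Rightarrow> real \<Rightarrow> (real \<Rightarrow> real) \<Rightarrow> (real \<times> real \<Rightarrow> real) \<Rightarrow> (real \<Rightarrow> real) \<Rightarrow> bool" where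
  "one_sided_trace \<sigma> a b y u \<gamma> \<longleftrightarrow> (\<forall>\<eta>>0. \<exists>\<delta>>0. AE \<xi> in lborel. 0 < \<sigma> * \<xi> \<and> \<sigma> * \<xi> < \<delta> \<longrightarrow>
     (LBINT t. indicator {a..b} t * \<bar>u (y t + \<xi>, t) - \<gamma> t\<bar>) \<le> \<eta>)"

lemma C1_strip:
  assumes "\<And>t. (Y has_real_derivative dY t) (at t)" "continuous_on UNIV dY" "h > 0"
  shows "C1 (\<lambda>p. strip ((fst p - Y (snd p)) / h)) (\<lambda>p. dstrip ((fst p - Y (snd p)) / h) * (1 / h))
     (\<lambda>p. dstrip ((fst p - Y (snd p)) / h) * (- dY (snd p) / h))"
proof -
  have "C1 (\<lambda>p. (1/h) * fst p + 0 * snd p + 0 - Y (snd p) / h) (\<lambda>p. 1/h - 0) (\<lambda>p. 0 - dY (snd p) / h)"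
    by (intro C1_diff C1_affine C1_snd DERIV_cdivide assms continuous_intros) 
       (use assms in auto)
  from C1_compose[OF this strip_deriv dstrip_continuous] show ?thesis by (simp add: diff_divide_distrib)
qed

context lipschitz_flux begin

text \<open>The Kruzhkov flux seen in a frame moving with speed s.\<close>

definition PhiS :: "real \<Rightarrow> real \<Rightarrow> real \<Rightarrow> real" where
  "PhiS s a b = Phi a b - s * \<bar>a - b\<bar>"

lemma PhiS_lip: "\<bar>PhiS s a b - PhiS s a' b'\<bar> \<le> (L + \<bar>s\<bar>) * (\<bar>a - a'\<bar> + \<bar>b - b'\<bar>)"
proof -
  have "PhiS s a b - PhiS s a' b' = (Phi a b - Phi a' b') - s * (\<bar>a - b\<bar> - \<bar>a' - b'\<bar>)"
    by (simp add: PhiS_def algebra_simps)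
  also have "\<bar>\<dots>\<bar> \<le> \<bar>Phi a b - Phi a' b'\<bar> + \<bar>s\<bar> * \<bar>\<bar>a - b\<bar> - \<bar>a' - b'\<bar>\<bar>"
    by (metis abs_mult abs_triangle_ineq4)
  also have "\<dots> \<le> L * (\<bar>a - a'\<bar> + \<bar>b - b'\<bar>) + \<bar>s\<bar> * (\<bar>a - a'\<bar> + \<bar>b - b'\<bar>)"
    by (intro add_mono mult_left_mono Phi_lip2) auto
  finally show ?thesis by (simp add: algebra_simps)
qed

lemma PhiS_bound: "a \<in> {0..1} \<Longrightarrow> b \<in> {0..1} \<Longrightarrow> \<bar>PhiS s a b\<bar> \<le> L + \<bar>s\<bar>"
proof -
  assume ab: "a \<in> {0..1}" "b \<in> {0..1}"
  have "PhiS s b b = 0" by (simp add: PhiS_def Phi_def)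
  then have "\<bar>PhiS s a b\<bar> \<le> (L + \<bar>s\<bar>) * \<bar>a - b\<bar>" using PhiS_lip[of s a b b b] by simp
  also have "\<dots> \<le> (L + \<bar>s\<bar>) * 1" using ab L_nonneg by (intro mult_left_mono) auto
  finally show ?thesis by simp
qed

lemma PhiS_bb: 
  assumes "bb c" "unitb u" "unitb v" shows "bb (\<lambda>q. PhiS (c q) (u q) (v q))"
  unfolding PhiS_def by (intro bb_diff bb_mult bb_unitb_diff bb_unitb_Phi assms)

lemma one_sided_limit:
  assumes uu: "unitb u" "unitb v" and gg: "unitb \<gamma>u" "unitb \<gamma>v" and c: "bb c" and y: "continuous_on UNIV y"
    and tr: "one_sided_trace \<sigma> a b y u \<gamma>u" "one_sided_trace \<sigma> a b y v \<gamma>v" and \<sigma>: "\<bar>\<sigma>\<bar> = 1" and ab: "a \<le> b"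
    and g: "C1c g gx gt" and gz: "\<And>p. snd p \<notin> {a..b} \<Longrightarrow> g p = 0" and \<eta>: "\<eta> > 0"
  shows "\<exists>\<delta>>0. AE \<xi> in lborel. 0 < \<sigma> * \<xi> \<and> \<sigma> * \<xi> < \<delta> \<longrightarrow>
     \<bar>(LBINT t. g (y t + \<xi>, t) * PhiS (c t) (u (y t + \<xi>, t)) (v (y t + \<xi>, t)))
       - (LBINT t. g (y t, t) * PhiS (c t) (\<gamma>u t) (\<gamma>v t))\<bar> \<le> \<eta>"
proof -
  obtain Cc where Cc: "Cc > 0" "\<And>t. \<bar>c t\<bar> \<le> Cc" using bb_bound[OF c] by metis
  obtain Cg where Cg: "Cg > 0" "\<And>t. \<bar>g t\<bar> \<le> Cg" using bcs_bound[OF C1c_bcs(1)[OF g]] by metis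
  obtain Cl where Cl: "Cl > 0" "\<And>p q. \<bar>g p - g q\<bar> \<le> Cl * norm (p - q)" using C1c_lipschitz[OF g] by metis
  define Cs where "Cs = L + Cc"
  have Cs: "Cs > 0" using Cc L_nonneg by (simp add: Cs_def)
  \<comment> \<open>Each of the two trace errors is multiplied by \<open>Cg * Cs\<close>; together
    they cost \<eta>/2.\<close>
  define \<eta>1 where "\<eta>1 = \<eta> / (4 * Cg * Cs)"
  have \<eta>1: "\<eta>1 > 0" using \<eta> Cg Cs by (simp add: \<eta>1_def)
  obtain d1 where d1: "d1 > 0" "AE \<xi> in lborel. 0 < \<sigma> * \<xi> \<and> \<sigma> * \<xi> < d1 \<longrightarrow>
     (LBINT t. indicator {a..b} t * \<bar>u (y t + \<xi>, t) - \<gamma>u t\<bar>) \<le> \<eta>1" using tr(1) \<eta>1 unfolding one_sided_trace_def by blast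
  obtain d2 where d2: "d2 > 0" "AE \<xi> in lborel. 0 < \<sigma> * \<xi> \<and> \<sigma> * \<xi> < d2 \<longrightarrow>
     (LBINT t. indicator {a..b} t * \<bar>v (y t + \<xi>, t) - \<gamma>v t\<bar>) \<le> \<eta>1" using tr(2) \<eta>1 unfolding one_sided_trace_def by blast
  \<comment> \<open>Displacing the argument of g by less than \<open>d3\<close> costs at most
    \<eta>/2; the added 1 keeps the denominator positive.\<close>
  define d3 where "d3 = \<eta> / (2 * (Cl * Cs * (b - a) + 1))"
  have pos: "Cl * Cs * (b - a) + 1 > 0" using Cl Cs ab by (simp add: add_nonneg_pos)
  have d3: "d3 > 0" using \<eta> pos by (simp add: d3_def)
  note [measurable] = unitbD(1)[OF uu(1)] unitbD(1)[OF uu(2)] borel_measurable_continuous_onI[OF y]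
  have us: "unitb (\<lambda>t. u (y t + \<xi>, t))" "unitb (\<lambda>t. v (y t + \<xi>, t))" for \<xi>
    by (rule unitb_compose[OF uu(1)] unitb_compose[OF uu(2)]; measurable)+
  have gs: "bcs (\<lambda>t. g (y t + \<xi>, t))" for \<xi>
  proof (rule bcsI[where C=Cg and B="\<bar>a\<bar> + \<bar>b\<bar>"])
    have [measurable]: "g \<in> borel_measurable borel" using bcs_measurable[OF C1c_bcs(1)[OF g]] .
    show "(\<lambda>t. g (y t + \<xi>, t)) \<in> borel_measurable borel" by measurable
    show "g (y t + \<xi>, t) = 0" if "norm t > \<bar>a\<bar> + \<bar>b\<bar>" for t using that by (intro gz) auto
  qed (use Cg in auto)
  have gs0: "bcs (\<lambda>t. g (y t, t))" using gs[of 0] by simp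
  have main: "\<bar>(LBINT t. g (y t + \<xi>, t) * PhiS (c t) (u (y t + \<xi>, t)) (v (y t + \<xi>, t)))
       - (LBINT t. g (y t, t) * PhiS (c t) (\<gamma>u t) (\<gamma>v t))\<bar> \<le> \<eta>"
    if \<xi>: "\<bar>\<xi>\<bar> < d3" and 
      s: "(LBINT t. indicator {a..b} t * \<bar>u (y t + \<xi>, t) - \<gamma>u t\<bar>) \<le> \<eta>1"
       "(LBINT t. indicator {a..b} t * \<bar>v (y t + \<xi>, t) - \<gamma>v t\<bar>) \<le> \<eta>1" for \<xi>
  proof -
    let ?P = "\<lambda>t. PhiS (c t) (u (y t + \<xi>, t)) (v (y t + \<xi>, t))"
    let ?Q = "\<lambda>t. PhiS (c t) (\<gamma>u t) (\<gamma>v t)"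
    let ?U = "\<lambda>t. indicator {a..b} t * \<bar>u (y t + \<xi>, t) - \<gamma>u t\<bar>"
    let ?V = "\<lambda>t. indicator {a..b} t * \<bar>v (y t + \<xi>, t) - \<gamma>v t\<bar>"
    have i: "integrable lborel (\<lambda>t. g (y t + \<xi>, t) * ?P t)" "integrable lborel (\<lambda>t. g (y t, t) * ?Q t)"
      by (intro bcs_integrable bcs_mult1 gs gs0 PhiS_bb c us gg)+
    have iu: "integrable lborel ?U" "integrable lborel ?V"
      by (intro bcs_integrable bcs_mult1 bcs_indicator bb_unitb_diff us gg; simp)+
    have ii: "integrable lborel (\<lambda>t. (indicator {a..b} t :: real) * (Cl * d3 * Cs))"
      by (intro bcs_integrable bcs_mult1 bcs_indicator bb_const) auto
    have pt: "\<bar>g (y t + \<xi>, t) * ?P t - g (y t, t) * ?Q t\<bar> \<le> indicator {a..b} t * (Cl * d3 * Cs) + (Cg * Cs) * (?U t + ?V t)" for t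
    proof (cases "t \<in> {a..b}")
      case True
      have s: "L + \<bar>c t\<bar> \<le> Cs" using Cc by (simp add: Cs_def)
      have "\<bar>(g (y t + \<xi>, t) - g (y t, t)) * ?P t\<bar> \<le> (Cl * d3) * Cs"
        unfolding abs_mult
      proof (rule mult_mono)
        have "\<bar>g (y t + \<xi>, t) - g (y t, t)\<bar> \<le> Cl * norm ((y t + \<xi>, t) - (y t, t))" by (rule Cl(2))
        also have "\<dots> = Cl * \<bar>\<xi>\<bar>" by (simp add: norm_Pair)
        also have "\<dots> \<le> Cl * d3" using Cl \<xi> by (intro mult_left_mono) auto
        finally show "\<bar>g (y t + \<xi>, t) - g (y t, t)\<bar> \<le> Cl * d3" .
        show "\<bar>?P t\<bar> \<le> Cs" by (rule order_trans[OF PhiS_bound s]) (use unitbD(4)[OF us(1)] unitbD(4)[OF us(2)] in auto)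
      qed (use Cl d3 in auto)
      moreover have "\<bar>g (y t, t) * (?P t - ?Q t)\<bar> \<le> Cg * (Cs * (\<bar>u (y t + \<xi>, t) - \<gamma>u t\<bar> + \<bar>v (y t + \<xi>, t) - \<gamma>v t\<bar>))"
        unfolding abs_mult
        by (intro mult_mono Cg order_trans[OF PhiS_lip mult_right_mono[OF s]]) (use Cg in auto)
      moreover have "g (y t + \<xi>, t) * ?P t - g (y t, t) * ?Q t = (g (y t + \<xi>, t) - g (y t, t)) * ?P t + g (y t, t) * (?P t - ?Q t)"
        by (simp add: algebra_simps)
      ultimately show ?thesis using True by (simp add: mult.assoc)
    qed (use gz in simp)
    have "\<bar>(LBINT t. g (y t + \<xi>, t) * ?P t) - (LBINT t. g (y t, t) * ?Q t)\<bar>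
       = \<bar>LBINT t. g (y t + \<xi>, t) * ?P t - g (y t, t) * ?Q t\<bar>" using i by simp
    also have "\<dots> \<le> (LBINT t. \<bar>g (y t + \<xi>, t) * ?P t - g (y t, t) * ?Q t\<bar>)" by (rule integral_abs_bound)
    also have "\<dots> \<le> (LBINT t. indicator {a..b} t * (Cl * d3 * Cs) + (Cg * Cs) * (?U t + ?V t))"
      using i iu ii pt by (intro Bochner_Integration.integral_mono) auto
    also have "\<dots> = (b - a) * (Cl * d3 * Cs) + (Cg * Cs) * ((LBINT t. ?U t) + (LBINT t. ?V t))"
      using iu ii ab by (simp add: Bochner_Integration.integral_add)
    also have "\<dots> \<le> (b - a) * (Cl * d3 * Cs) + (Cg * Cs) * (\<eta>1 + \<eta>1)"
      using s Cg Cs by (intro add_left_mono mult_left_mono add_mono) auto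
    also have "(Cg * Cs) * (\<eta>1 + \<eta>1) = \<eta> / 2" using Cg Cs by (simp add: \<eta>1_def field_simps)
    also have "(b - a) * (Cl * d3 * Cs) \<le> \<eta> / 2"
    proof -
      have "(b - a) * (Cl * d3 * Cs) = (Cl * Cs * (b - a)) * d3" by simp
      also have "\<dots> \<le> (Cl * Cs * (b - a) + 1) * d3" using d3 by (intro mult_right_mono) auto
      also have "\<dots> = \<eta> / 2"
      proof -
        have "k * (\<eta> / (2 * k)) = \<eta> / 2" if "k > 0" for k using that by simp
        from this[OF pos] show ?thesis unfolding d3_def .
      qed
      finally show ?thesis .
    qed
    finally show ?thesis by simp
  qed
  show ?thesis
  proof (intro exI conjI)
    show "min d1 (min d2 d3) > 0" using d1 d2 d3 by simp
    show "AE \<xi> in lborel. 0 < \<sigma> * \<xi> \<and> \<sigma> * \<xi> < min d1 (min d2 d3) \<longrightarrow>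
     \<bar>(LBINT t. g (y t + \<xi>, t) * PhiS (c t) (u (y t + \<xi>, t)) (v (y t + \<xi>, t)))
       - (LBINT t. g (y t, t) * PhiS (c t) (\<gamma>u t) (\<gamma>v t))\<bar> \<le> \<eta>"
      using d1(2) d2(2)
    proof eventually_elim
      case (elim \<xi>)
      show ?case
      proof
        assume *: "0 < \<sigma> * \<xi> \<and> \<sigma> * \<xi> < min d1 (min d2 d3)"
        have "\<bar>\<sigma> * \<xi>\<bar> = \<bar>\<xi>\<bar>" using \<sigma> by (simp add: abs_mult)
        then have "\<bar>\<xi>\<bar> < d3" using * by linarith
        then show "\<bar>(LBINT t. g (y t + \<xi>, t) * PhiS (c t) (u (y t + \<xi>, t)) (v (y t + \<xi>, t)))
           - (LBINT t. g (y t, t) * PhiS (c t) (\<gamma>u t) (\<gamma>v t))\<bar> \<le> \<eta>"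
          using main elim * by simp
      qed
    qed
  qed
qed

text \<open>The weak form of g times a strip has two parts. The gradient of g acts on a set of width
  O(h) and is negligible. The gradient of the strip, in straightened coordinates, averages the
  moving flux over offsets between h and 2h with opposite signs on the two sides, hence is close to
  left trace minus right trace, which the germ bounds from below.\<close>

lemma interface_limit:
  assumes uu: "unitb u" "unitb v" and gg: "unitb ul" "unitb ur" "unitb vl" "unitb vr" and c: "bb c" and y: "continuous_on UNIV y"
    and trl: "one_sided_trace (-1) a b y u ul" "one_sided_trace (-1) a b y v vl" and trr: "one_sided_trace 1 a b y u ur" "one_sided_trace 1 a b y v vr"
    and ab: "0 \<le> s" "s < a" "a \<le> b" "b < T"
    and wd: "\<And>t e. 0 < e \<Longrightarrow> s < t - e \<Longrightarrow> t + e < T \<Longrightarrow>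
      (LBINT r. y r * (deriv moll ((t - r) / e) / e)) = (LBINT r. c r * moll ((t - r) / e))"
    and m: "bb m" and germ: "AE t in lborel. t \<in> {a..b} \<longrightarrow> PhiS (c t) (ur t) (vr t) - PhiS (c t) (ul t) (vl t) \<le> m t"
    and g: "C1c g gx gt" and g0: "\<And>p. 0 \<le> g p" and gz: "\<And>p. snd p \<notin> {a..b} \<Longrightarrow> g p = 0" and \<eta>: "\<eta> > 0"
  obtains Y dY h where "h > 0" "\<And>t. (Y has_real_derivative dY t) (at t)" "continuous_on UNIV dY"
    "\<And>t. t \<in> {a..b} \<Longrightarrow> \<bar>Y t - y t\<bar> < h"
    "- (LBINT t. g (y t, t) * m t) - \<eta> \<le>
       weak_form u v (\<lambda>p. gx p * strip ((fst p - Y (snd p)) / h) + g p * (dstrip ((fst p - Y (snd p)) / h) * (1 / h)))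
             (\<lambda>p. gt p * strip ((fst p - Y (snd p)) / h) + g p * (dstrip ((fst p - Y (snd p)) / h) * (- dY (snd p) / h)))"
proof -
  obtain Cc where Cc: "Cc > 0" "\<And>t. \<bar>c t\<bar> \<le> Cc" using bb_bound[OF c] by metis
  obtain B where B: "B > 0" "\<And>p. norm p > B \<Longrightarrow> g p = 0" "\<And>p. norm p > B \<Longrightarrow> gx p = 0" "\<And>p. norm p > B \<Longrightarrow> gt p = 0"
  proof -
    obtain B where "\<And>p. norm p > B \<Longrightarrow> g p = 0 \<and> gx p = 0 \<and> gt p = 0" using g unfolding C1c_def by metis
    then show ?thesis using that[of "max B 1"] by auto
  qed
  note cg = C1c_bcs[OF g]
  obtain Cg where Cg: "Cg > 0" "\<And>t. \<bar>g t\<bar> \<le> Cg" using bcs_bound[OF cg(1)] by metis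
  obtain Cx where Cx: "Cx > 0" "\<And>t. \<bar>gx t\<bar> \<le> Cx" using bcs_bound[OF cg(2)] by metis
  obtain Ct where Ct: "Ct > 0" "\<And>t. \<bar>gt t\<bar> \<le> Ct" using bcs_bound[OF cg(3)] by metis
  obtain Cz where Cz: "Cz > 0" "\<And>t. \<bar>dstrip t\<bar> \<le> Cz" using bcs_bound[OF bcs_strip(2)] by metis
  have [measurable]: "g \<in> borel_measurable borel" "gx \<in> borel_measurable borel" "gt \<in> borel_measurable borel"
    "u \<in> borel_measurable borel" "v \<in> borel_measurable borel" "strip \<in> borel_measurable borel" "dstrip \<in> borel_measurable borel"
    "y \<in> borel_measurable borel" "c \<in> borel_measurable borel"
    using cg bcs_measurable uu unitbD(1) bcs_strip borel_measurable_continuous_onI[OF y] bb_measurable[OF c] by auto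
  define D where "D p = \<bar>u p - v p\<bar>" for p
  define P where "P p = Phi (u p) (v p)" for p
  have Db: "bb D" "\<bar>D p\<bar> \<le> 1" for p unfolding D_def[abs_def] using bb_unitb_diff[OF uu] unitb_abs_diff[OF uu, of p p] by auto
  have Pb: "bb P" "\<bar>P p\<bar> \<le> L" for p unfolding P_def[abs_def] using bb_unitb_Phi[OF uu] unitb_Phi[OF uu, of p p] by auto
  have [measurable]: "D \<in> borel_measurable borel" "P \<in> borel_measurable borel" using Db Pb bb_measurable by auto
  \<comment> \<open>\<open>CA * h\<close> bounds the part with the gradient of g: its size, times
    the time span 2B, times the area h times the mass of \<open>strip\<close> in space.\<close>
  define CA where "CA = (Ct + L * Cx) * (2 * B) * (LBINT r. strip r)"
  have intZ: "0 \<le> (LBINT r. strip r)" using strip_bounds by (intro integral_nonneg_AE) auto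
  have CA0: "CA \<ge> 0" using Ct Cx B L_nonneg intZ by (auto simp: CA_def)

  let ?Il = "LBINT t. g (y t, t) * PhiS (c t) (ul t) (vl t)"
  let ?Ir = "LBINT t. g (y t, t) * PhiS (c t) (ur t) (vr t)"
  have gyb: "bcs (\<lambda>t. g (y t, t))"
  proof (rule bcsI[where C=Cg and B="\<bar>a\<bar> + \<bar>b\<bar>"])
    show "g (y t, t) = 0" if "norm t > \<bar>a\<bar> + \<bar>b\<bar>" for t using that by (intro gz) auto
  qed (use Cg in \<open>auto\<close>)
  have J0: "- (LBINT t. g (y t, t) * m t) \<le> ?Il - ?Ir"
  proof -
    have i: "integrable lborel (\<lambda>t. g (y t, t) * PhiS (c t) (ul t) (vl t))" "integrable lborel (\<lambda>t. g (y t, t) * PhiS (c t) (ur t) (vr t))"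
       "integrable lborel (\<lambda>t. g (y t, t) * m t)"
      by (intro bcs_integrable bcs_mult1 gyb PhiS_bb c gg m)+
    have "?Ir - ?Il = (LBINT t. g (y t, t) * PhiS (c t) (ur t) (vr t) - g (y t, t) * PhiS (c t) (ul t) (vl t))"
      using i by simp
    also have "\<dots> \<le> (LBINT t. g (y t, t) * m t)"
    proof (rule integral_mono_AE)
      show "AE t in lborel. g (y t, t) * PhiS (c t) (ur t) (vr t) - g (y t, t) * PhiS (c t) (ul t) (vl t) \<le> g (y t, t) * m t"
        using germ
      proof eventually_elim
        case (elim t)
        show ?case
        proof (cases "t \<in> {a..b}")
          case True
          then show ?thesis using mult_left_mono[OF mp[OF elim True] g0[of "(y t, t)"]] by (simp add: right_diff_distrib)
        qed (simp add: gz)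
      qed
    qed (use i in auto)
    finally show ?thesis by simp
  qed
  have "\<eta> / 16 > 0" using \<eta> by simp
  from one_sided_limit[OF uu gg(1,3) c y trl _ ab(3) g gz this]
  obtain dl where dl: "dl > 0" "AE \<xi> in lborel. 0 < - \<xi> \<and> - \<xi> < dl \<longrightarrow>
     \<bar>(LBINT t. g (y t + \<xi>, t) * PhiS (c t) (u (y t + \<xi>, t)) (v (y t + \<xi>, t))) - ?Il\<bar> \<le> \<eta> / 16" by auto
  have "\<eta> / 16 > 0" using \<eta> by simp
  from one_sided_limit[OF uu gg(2,4) c y trr _ ab(3) g gz this]
  obtain dr where dr: "dr > 0" "AE \<xi> in lborel. 0 < \<xi> \<and> \<xi> < dr \<longrightarrow>
     \<bar>(LBINT t. g (y t + \<xi>, t) * PhiS (c t) (u (y t + \<xi>, t)) (v (y t + \<xi>, t))) - ?Ir\<bar> \<le> \<eta> / 16" by auto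
  \<comment> \<open>The slopes of the strip lie at offsets below 2h, which must be smaller than both
    trace distances; the second bound makes \<open>CA * h\<close> at most \<eta>/4.\<close>
  define h where "h = min (min dl dr / 4) (\<eta> / (4 * (CA + 1)))"
  have h: "h > 0" "2 * h < dl" "2 * h < dr" "CA * h \<le> \<eta> / 4"
  proof -
    show "h > 0" using dl dr \<eta> CA0 by (simp add: h_def)
    have "4 * h \<le> dl" "4 * h \<le> dr" by (auto simp: h_def)
    then show "2 * h < dl" "2 * h < dr" using \<open>h > 0\<close> by linarith+
    have "CA * h \<le> (CA + 1) * (\<eta> / (4 * (CA + 1)))" using CA0 \<eta> \<open>h > 0\<close> by (intro mult_mono) (auto simp: h_def)
    moreover have "k * (\<eta> / (4 * k)) = \<eta> / 4" if "k > 0" for k using that by simp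
    then have "(CA + 1) * (\<eta> / (4 * (CA + 1))) = \<eta> / 4" using CA0 by (metis add_nonneg_pos zero_less_one)
    ultimately show "CA * h \<le> \<eta> / 4" by linarith
  qed
  have scale: "bcs (\<lambda>\<xi>. k (\<xi> / h))" "(LBINT \<xi>. k (\<xi> / h)) = h * (LBINT r. k r)" if k: "bcs k" for k :: "real \<Rightarrow> real"
  proof -
    obtain C where C: "C > 0" "\<And>x. \<bar>k x\<bar> \<le> C" "\<And>x. norm x > C \<Longrightarrow> k x = 0" using bcs_bound[OF k] by metis
    show "bcs (\<lambda>\<xi>. k (\<xi> / h))"
      by (rule bcsI[where C=C and B="C * h"]) (use bcs_measurable[OF k] C h in \<open>auto simp: abs_divide field_simps\<close>)
    show "(LBINT \<xi>. k (\<xi> / h)) = h * (LBINT r. k r)"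
      using lborel_integral_real_affine[of h "\<lambda>\<xi>. k (\<xi> / h)" 0] h by simp
  qed
  \<comment> \<open>The slope term for the exact curve with the almost everywhere speed c. It comes
    from no C1 test function, but is the limit of the terms for mollified curves.\<close>
  define J where "J = (LBINT p. g p * (dstrip ((fst p - y (snd p)) / h) / h) * (P p - c (snd p) * D p))"
  have bcY: "bb (\<lambda>p. k ((fst p - Y (snd p)) / h))" if "bcs k" "continuous_on UNIV Y" for k :: "real \<Rightarrow> real" and Y :: "real \<Rightarrow> real"
  proof (rule bb_compose[OF bcs_bb[OF that(1)]])
    have [measurable]: "Y \<in> borel_measurable borel" using that(2) by (rule borel_measurable_continuous_onI)
    show "(\<lambda>p. (fst p - Y (snd p)) / h) \<in> borel_measurable borel" by measurable
  qed
  have bcsnd: "bb (\<lambda>p::real\<times>real. c (snd p))" by (rule bb_compose[OF c]) measurable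
  have JJ: "\<bar>J - (?Il - ?Ir)\<bar> \<le> \<eta> / 8"
  proof -
    let ?F = "\<lambda>p. g p * (dstrip ((fst p - y (snd p)) / h) / h) * (P p - c (snd p) * D p)"
    have bF: "bcs ?F"
      using bcs_mult1[OF bcs_mult1[OF cg(1) bb_mult[OF bcY[OF bcs_strip(2) y] bb_const[of "1/h"]]] bb_diff[OF Pb(1) bb_mult[OF bcsnd Db(1)]]] by simp
    let ?G = "\<lambda>p. ?F (y (snd p) + fst p, snd p)"
    have bG: "bcs ?G" using bcs_shear(1)[OF bF y] .
    let ?I = "\<lambda>\<xi>. LBINT t. g (y t + \<xi>, t) * PhiS (c t) (u (y t + \<xi>, t)) (v (y t + \<xi>, t))"
    have inner: "(LBINT t. ?G (\<xi>, t)) = (dstrip (\<xi> / h) / h) * ?I \<xi>" for \<xi>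
      unfolding integral_mult_right_zero[symmetric]
      by (intro Bochner_Integration.integral_cong) (auto simp: PhiS_def P_def D_def)
    have "J = (LBINT p. ?G p)" unfolding J_def by (rule bcs_shear(2)[OF bF y])
    also have "\<dots> = (LBINT \<xi>. LBINT t. ?G (\<xi>, t))" by (rule bcs_fubini(1)[OF bG])
    finally have JI: "J = (LBINT \<xi>. (dstrip (\<xi> / h) / h) * ?I \<xi>)" unfolding inner .
    have iI: "integrable lborel (\<lambda>\<xi>. (dstrip (\<xi> / h) / h) * ?I \<xi>)"
      using bcs_integrable[OF bcs_inner[OF bG]] unfolding inner .
    \<comment> \<open>The limiting one-sided values. The choice at offset 0 is immaterial, since
      \<open>dstrip\<close> vanishes near 0.\<close>
    let ?E = "\<lambda>\<xi>::real. if \<xi> > 0 then ?Ir else ?Il"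
    have "bb ?E" by (rule bbI[where C="\<bar>?Ir\<bar> + \<bar>?Il\<bar>"]) auto
    then have "bcs (\<lambda>\<xi>. dstrip (\<xi> / h) * ((1/h) * ?E \<xi>))"
      by (intro bcs_mult1 scale(1) bcs_strip bb_mult bb_const)
    then have iE: "integrable lborel (\<lambda>\<xi>. (dstrip (\<xi> / h) / h) * ?E \<xi>)" using bcs_integrable by force
    have "(LBINT \<xi>. (dstrip (\<xi> / h) / h) * ?E \<xi>) = h * (LBINT r. (dstrip r / h) * (if r > 0 then ?Ir else ?Il))"
      using lborel_integral_real_affine[of h "\<lambda>\<xi>. (dstrip (\<xi> / h) / h) * ?E \<xi>" 0] h by (simp add: zero_less_mult_iff)
    also have "\<dots> = (LBINT r. dstrip r * (if r > 0 then ?Ir else ?Il))"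
      unfolding integral_mult_right_zero[symmetric] using h by (intro Bochner_Integration.integral_cong) auto
    also have "\<dots> = ?Il - ?Ir" by (rule integral_dstrip(2))
    finally have E: "(LBINT \<xi>. (dstrip (\<xi> / h) / h) * ?E \<xi>) = ?Il - ?Ir" .
    have iz: "integrable lborel (\<lambda>\<xi>. \<bar>dstrip (\<xi> / h)\<bar> * (\<eta> / (16 * h)))"
      using bcs_integrable[OF bcs_abs[OF scale(1)[OF bcs_strip(2)]]] by simp
    have diff: "J - (?Il - ?Ir) = (LBINT \<xi>. (dstrip (\<xi> / h) / h) * ?I \<xi> - (dstrip (\<xi> / h) / h) * ?E \<xi>)"
      unfolding JI E[symmetric] using iI iE by (rule Bochner_Integration.integral_diff[symmetric])
    have "\<bar>J - (?Il - ?Ir)\<bar> \<le> (LBINT \<xi>. \<bar>(dstrip (\<xi> / h) / h) * ?I \<xi> - (dstrip (\<xi> / h) / h) * ?E \<xi>\<bar>)"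
      unfolding diff by (rule integral_abs_bound)
    also have "\<dots> \<le> (LBINT \<xi>. \<bar>dstrip (\<xi> / h)\<bar> * (\<eta> / (16 * h)))"
    proof (rule integral_mono_AE[OF _ iz])
      show "integrable lborel (\<lambda>\<xi>. \<bar>(dstrip (\<xi> / h) / h) * ?I \<xi> - (dstrip (\<xi> / h) / h) * ?E \<xi>\<bar>)"
        by (rule Bochner_Integration.integrable_abs[OF Bochner_Integration.integrable_diff[OF iI iE]])
      show "AE \<xi> in lborel. \<bar>(dstrip (\<xi> / h) / h) * ?I \<xi> - (dstrip (\<xi> / h) / h) * ?E \<xi>\<bar> \<le> \<bar>dstrip (\<xi> / h)\<bar> * (\<eta> / (16 * h))"
        using dl(2) dr(2)
      proof eventually_elim
        case (elim \<xi>)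
        have eq: "\<bar>(dstrip (\<xi> / h) / h) * ?I \<xi> - (dstrip (\<xi> / h) / h) * ?E \<xi>\<bar> = (\<bar>dstrip (\<xi> / h)\<bar> / h) * \<bar>?I \<xi> - ?E \<xi>\<bar>"
          using h by (simp only: right_diff_distrib[symmetric] abs_mult abs_divide abs_of_pos)
        show ?case
        proof (cases "dstrip (\<xi> / h) = 0")
          case False
          have "\<xi> \<noteq> 0" using False by (auto simp: dstrip_def w_zero)
          moreover have "\<bar>\<xi> / h\<bar> < 2"
          proof (rule ccontr)
            assume "\<not> \<bar>\<xi> / h\<bar> < 2"
            then have "dstrip (\<xi> / h) = 0" by (auto simp: dstrip_def w_zero abs_if split: if_splits)
            then show False using False by simp
          qed
          then have "\<bar>\<xi>\<bar> < 2 * h" using h by (simp add: abs_divide field_simps)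
          ultimately have "\<bar>?I \<xi> - ?E \<xi>\<bar> \<le> \<eta> / 16" using elim h by (cases "\<xi> > 0") auto
          then have "(\<bar>dstrip (\<xi> / h)\<bar> / h) * \<bar>?I \<xi> - ?E \<xi>\<bar> \<le> (\<bar>dstrip (\<xi> / h)\<bar> / h) * (\<eta> / 16)"
            using h by (intro mult_left_mono) auto
          then show ?thesis unfolding eq using h by (simp add: field_simps)
        qed simp
      qed
    qed
    also have "\<dots> = \<eta> / 8"
      using scale(2)[OF bcs_abs[OF bcs_strip(2)]] h by (simp add: integral_dstrip(1))
    finally show ?thesis .
  qed

  obtain Y dY :: "nat \<Rightarrow> real \<Rightarrow> real" where
    Yd: "\<And>n t. (Y n has_real_derivative dY n t) (at t)" and dYc: "\<And>n. continuous_on UNIV (dY n)" and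
    Yu: "\<And>\<eta>. \<eta> > 0 \<Longrightarrow> \<exists>N. \<forall>n\<ge>N. \<forall>t\<in>{a..b}. \<bar>Y n t - y t\<bar> < \<eta>" and
    YL1: "(\<lambda>n. LBINT t. indicator {a..b} t * \<bar>dY n t - c t\<bar>) \<longlonglongrightarrow> 0"
    by (rule mollify_curve[OF y c ab(2) ab(4) ab(3)], rule wd, assumption+, rule that)
  have Yc: "continuous_on UNIV (Y n)" for n by (meson DERIV_continuous_on Yd has_field_derivative_at_within)
  have [measurable]: "Y n \<in> borel_measurable borel" "dY n \<in> borel_measurable borel" for n
    using Yc dYc borel_measurable_continuous_onI by blast+
  let ?Bn = "\<lambda>n. LBINT p. g p * (dstrip ((fst p - Y n (snd p)) / h) / h) * (P p - dY n (snd p) * D p)"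
  have bgdY: "bcs (\<lambda>p. g p * dY n (snd p))" for n
    by (rule bcs_continuous[where B=B]) 
      (use B C1_continuous[OF C1c_C1[OF g]] in \<open>auto intro!: continuous_intros continuous_on_compose2[OF dYc]\<close>)
  have bBn: "bcs (\<lambda>p. g p * (dstrip ((fst p - Y n (snd p)) / h) / h) * (P p - dY n (snd p) * D p))" for n
  proof -
    have "bcs (\<lambda>p. g p * (dstrip ((fst p - Y n (snd p)) / h) * (1 / h) * P p) - (g p * dY n (snd p)) * (dstrip ((fst p - Y n (snd p)) / h) * (1 / h) * D p))"
      by (intro bcs_diff bcs_mult1 cg(1) bgdY bb_mult bcY bcs_strip Yc bb_const Pb Db)
    then show ?thesis by (simp add: algebra_simps diff_divide_distrib)
  qed
  have Bn: "?Bn \<longlonglongrightarrow> J"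
  proof -
    \<comment> \<open>Two errors at fixed h: \<open>?T1\<close> from the displaced strip, which
      tends to 0 pointwise and boundedly, and \<open>?T2\<close> below from the wrong speed,
      controlled by the L1 convergence of the speeds.\<close>
    let ?T1 = "\<lambda>n p. g p * ((dstrip ((fst p - Y n (snd p)) / h) - dstrip ((fst p - y (snd p)) / h)) / h) * (P p - c (snd p) * D p)"
    have cD: "\<bar>P p - c (snd p) * D p\<bar> \<le> L + Cc" for p
    proof -
      have "\<bar>c (snd p) * D p\<bar> \<le> Cc * 1" unfolding abs_mult using Cc Db by (intro mult_mono) auto
      then show ?thesis using Pb(2)[of p] by linarith
    qed
    have t1: "(\<lambda>n. LBINT p. ?T1 n p) \<longlonglongrightarrow> (\<integral>p. 0 \<partial>(lborel :: (real \<times> real) measure))"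
    proof (rule bcs_dct)
      show "\<bar>?T1 n p\<bar> \<le> Cg * ((2 * Cz) / h) * (L + Cc)" for n p
      proof -
        have "\<bar>dstrip ((fst p - Y n (snd p)) / h) - dstrip ((fst p - y (snd p)) / h)\<bar> \<le> 2 * Cz"
          using Cz(2)[of "(fst p - Y n (snd p)) / h"] Cz(2)[of "(fst p - y (snd p)) / h"] by linarith
        then show ?thesis unfolding abs_mult abs_divide abs_of_pos[OF h(1)] using Cg Cz cD h by (intro mult_mono divide_right_mono) auto
      qed
      show "B < norm p \<Longrightarrow> ?T1 n p = 0" for n p using B by simp
      show "(\<lambda>n. ?T1 n p) \<longlonglongrightarrow> 0" for p
      proof (cases "snd p \<in> {a..b}")
        case True
        have "(\<lambda>n. Y n (snd p)) \<longlonglongrightarrow> y (snd p)"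
          by (rule LIMSEQ_I) (use Yu True in \<open>auto simp: dist_real_def; blast\<close>)
        then have "(\<lambda>n. (fst p - Y n (snd p)) / h) \<longlonglongrightarrow> (fst p - y (snd p)) / h" using h by (intro tendsto_intros) auto
        moreover have "isCont dstrip ((fst p - y (snd p)) / h)" using dstrip_continuous[of UNIV] by (simp add: continuous_on_eq_continuous_at)
        ultimately have "(\<lambda>n. dstrip ((fst p - Y n (snd p)) / h)) \<longlonglongrightarrow> dstrip ((fst p - y (snd p)) / h)"
          using isCont_tendsto_compose by blast
        then have "(\<lambda>n. ?T1 n p) \<longlonglongrightarrow> g p * ((dstrip ((fst p - y (snd p)) / h) - dstrip ((fst p - y (snd p)) / h)) / h) * (P p - c (snd p) * D p)"
          using h by (intro tendsto_intros) auto
        then show ?thesis by simp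
      qed (simp add: gz)
    qed measurable
    let ?R = "\<lambda>n. (Cg * Cz / h * (2 * B)) * (LBINT t. indicator {a..b} t * \<bar>dY n t - c t\<bar>)"
    have r: "?R \<longlonglongrightarrow> (Cg * Cz / h * (2 * B)) * 0" by (intro tendsto_mult tendsto_const YL1)
    have bT1: "bcs (?T1 n)" for n
      using bcs_mult1[OF bcs_mult1[OF cg(1) bb_mult[OF bb_diff[OF bcY[OF bcs_strip(2) Yc[of n]] bcY[OF bcs_strip(2) y]] bb_const[of "1/h"]]] bb_diff[OF Pb(1) bb_mult[OF bcsnd Db(1)]]] by simp
    have bdc: "bcs (\<lambda>t. indicator {a..b} t * \<bar>dY n t - c t\<bar>)" for n
    proof -
      have "bcs (\<lambda>t. \<bar>indicator {a..b} t * dY n t - indicator {a..b} t * c t\<bar>)"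
        by (intro bcs_abs bcs_diff bcs_indicator_continuous dYc bcs_mult1 bcs_indicator c) auto
      moreover have "(\<lambda>t. \<bar>indicator {a..b} t * dY n t - indicator {a..b} t * c t\<bar>) = (\<lambda>t. indicator {a..b} t * \<bar>dY n t - c t\<bar>)"
        by (auto simp: indicator_def)
      ultimately show ?thesis by simp
    qed
    have bJ: "bcs (\<lambda>p. g p * (dstrip ((fst p - y (snd p)) / h) / h) * (P p - c (snd p) * D p))"
      using bcs_mult1[OF bcs_mult1[OF cg(1) bb_mult[OF bcY[OF bcs_strip(2) y] bb_const[of "1/h"]]] bb_diff[OF Pb(1) bb_mult[OF bcsnd Db(1)]]] by simp
    have bound: "norm ((?Bn n - (LBINT p. ?T1 n p)) - J) \<le> ?R n" for n
    proof -
      let ?T2 = "\<lambda>p. g p * (dstrip ((fst p - Y n (snd p)) / h) / h) * ((c (snd p) - dY n (snd p)) * D p)"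
      let ?S = "\<lambda>p. (Cg * Cz / h) * (indicator {-B..B} (fst p) * (indicator {a..b} (snd p) * \<bar>dY n (snd p) - c (snd p)\<bar>))"
      have eq: "?Bn n - (LBINT p. ?T1 n p) - J = (LBINT p. ?T2 p)"
      proof -
        note i = bBn[of n, THEN bcs_integrable] bT1[of n, THEN bcs_integrable] bJ[THEN bcs_integrable]
        have "(LBINT p. ?T2 p) = (LBINT p. g p * (dstrip ((fst p - Y n (snd p)) / h) / h) * (P p - dY n (snd p) * D p)
            - ?T1 n p - g p * (dstrip ((fst p - y (snd p)) / h) / h) * (P p - c (snd p) * D p))"
          by (intro Bochner_Integration.integral_cong refl) (simp add: algebra_simps diff_divide_distrib)
        then show ?thesis
          unfolding J_def Bochner_Integration.integral_diff[OF Bochner_Integration.integrable_diff[OF i(1,2)] i(3)]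
            Bochner_Integration.integral_diff[OF i(1,2)] by (rule sym)
      qed
      have bS: "bcs ?S" by (intro bcs_mult2[OF bb_const] bcs_product bdc bcs_indicator) auto
      have pt: "\<bar>?T2 p\<bar> \<le> ?S p" for p
      proof (cases "snd p \<in> {a..b} \<and> norm p \<le> B")
        case True
        then have f: "\<bar>fst p\<bar> \<le> B" using norm_fst_le[of "fst p" "snd p"] by simp
        have "\<bar>?T2 p\<bar> = \<bar>g p\<bar> * (\<bar>dstrip ((fst p - Y n (snd p)) / h)\<bar> / h) * (\<bar>dY n (snd p) - c (snd p)\<bar> * \<bar>D p\<bar>)"
          using h by (simp add: abs_mult abs_minus_commute)
        also have "\<dots> \<le> Cg * (Cz / h) * (\<bar>dY n (snd p) - c (snd p)\<bar> * 1)"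
          using Cg Cz h Db by (intro mult_mono divide_right_mono) auto
        finally show ?thesis using True f by (simp add: indicator_def abs_le_iff)
      next
        case False
        then have "g p = 0" using gz[of p] B(2)[of p] by auto
        then show ?thesis using Cg Cz h by (simp add: indicator_def)
      qed
      have "\<bar>LBINT p. ?T2 p\<bar> \<le> (LBINT p. \<bar>?T2 p\<bar>)" by (rule integral_abs_bound)
      also have "\<dots> \<le> (LBINT p. ?S p)"
        by (rule integral_mono_AE'[OF bcs_integrable[OF bS]]) (use pt Cg Cz h in \<open>auto\<close>)
      also have "\<dots> = ?R n"
        using bcs_product_integral[OF bcs_indicator[of "{-B..B}"] bdc[of n]] B(1) by simp
      finally show ?thesis unfolding eq by simp
    qed
    have "(\<lambda>n. (?Bn n - (LBINT p. ?T1 n p)) - J) \<longlonglongrightarrow> 0"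
      by (rule Lim_null_comparison[OF always_eventually[OF allI[OF bound]]]) (use r in simp)
    from tendsto_add[OF this t1] have "(\<lambda>n. ?Bn n - J) \<longlonglongrightarrow> 0" by simp
    then show ?thesis by (rule LIM_zero_cancel)
  qed
  have "\<eta> / 8 > 0" using \<eta> by simp
  from LIMSEQ_D[OF Bn this] obtain N1 where N1: "\<And>n. n \<ge> N1 \<Longrightarrow> norm (?Bn n - J) < \<eta> / 8" by blast
  from Yu[OF h(1)] obtain N2 where N2: "\<And>n t. n \<ge> N2 \<Longrightarrow> t \<in> {a..b} \<Longrightarrow> \<bar>Y n t - y t\<bar> < h" by blast
  \<comment> \<open>\<open>N1\<close> brings the slope term close to \<open>J\<close>;
    \<open>N2\<close> keeps the exact curve inside the plateau of the strip.\<close>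
  define n where "n = max N1 N2"
  let ?A = "\<lambda>p. indicator {0<..} (snd p) * (D p * gt p + P p * gx p) * strip ((fst p - Y n (snd p)) / h)"
  have bind: "bb (\<lambda>q::real\<times>real. indicator {0<..} (snd q) :: real)"
    by (rule bbI[where C=1]) (auto simp: indicator_def)
  have bA: "bcs ?A"
    by (intro bcs_mult1 bcs_mult2[OF bind] bcs_add bcs_mult2[OF Db(1)] bcs_mult2[OF Pb(1)] cg bcY bcs_strip Yc)
  have Ab: "\<bar>LBINT p. ?A p\<bar> \<le> \<eta> / 4"
  proof -
    let ?G = "\<lambda>p. (Ct + L * Cx) * (strip (fst p / h) * indicator {-B..B} (snd p))"
    have bG: "bcs ?G" by (intro bcs_mult2[OF bb_const] bcs_product scale(1) bcs_strip bcs_indicator) auto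
    have mY: "continuous_on UNIV (\<lambda>t. - Y n t)" using Yc by (intro continuous_intros)
    have pt: "\<bar>?A p\<bar> \<le> ?G (- Y n (snd p) + fst p, snd p)" for p
    proof (cases "norm p \<le> B")
      case True
      then have f: "\<bar>snd p\<bar> \<le> B" using norm_snd_le[of "snd p" "fst p"] by simp
      have "\<bar>D p * gt p + P p * gx p\<bar> \<le> \<bar>D p\<bar> * \<bar>gt p\<bar> + \<bar>P p\<bar> * \<bar>gx p\<bar>" by (metis abs_mult abs_triangle_ineq)
      also have "\<dots> \<le> 1 * Ct + L * Cx" using Db Pb Ct Cx L_nonneg by (intro add_mono mult_mono) auto
      finally have "\<bar>?A p\<bar> \<le> (Ct + L * Cx) * strip ((fst p - Y n (snd p)) / h)"
        unfolding abs_mult using strip_bounds by (intro mult_mono) (auto simp: indicator_def)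
      then show ?thesis using f by (simp add: indicator_def abs_le_iff)
    next
      case False
      then have "gt p = 0" "gx p = 0" using B by auto
      then show ?thesis using Ct Cx L_nonneg strip_bounds by simp
    qed
    have "\<bar>LBINT p. ?A p\<bar> \<le> (LBINT p. \<bar>?A p\<bar>)" by (rule integral_abs_bound)
    also have "\<dots> \<le> (LBINT p. ?G (- Y n (snd p) + fst p, snd p))"
      using bcs_integrable[OF bA] bcs_integrable[OF bcs_shear(1)[OF bG mY]] pt
      by (intro Bochner_Integration.integral_mono Bochner_Integration.integrable_abs)
    also have "\<dots> = (LBINT p. ?G p)" by (rule bcs_shear(2)[OF bG mY, symmetric])
    also have "\<dots> = (Ct + L * Cx) * (h * (LBINT r. strip r) * (2 * B))"
      using bcs_product_integral[OF scale(1)[OF bcs_strip(1)] bcs_indicator[of "{-B..B}"]] scale(2)[OF bcs_strip(1)] B(1) by simp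
    also have "\<dots> = CA * h" by (simp add: CA_def)
    finally show ?thesis using h(4) by linarith
  qed
  have Keq: "weak_form u v (\<lambda>p. gx p * strip ((fst p - Y n (snd p)) / h) + g p * (dstrip ((fst p - Y n (snd p)) / h) * (1 / h)))
             (\<lambda>p. gt p * strip ((fst p - Y n (snd p)) / h) + g p * (dstrip ((fst p - Y n (snd p)) / h) * (- dY n (snd p) / h)))
     = (LBINT p. ?A p) + ?Bn n"
  proof -
    have "(LBINT p. ?A p) + ?Bn n = (LBINT p. ?A p + g p * (dstrip ((fst p - Y n (snd p)) / h) / h) * (P p - dY n (snd p) * D p))"
      using bcs_integrable[OF bA] bcs_integrable[OF bBn[of n]] by (rule Bochner_Integration.integral_add[symmetric])
    also have "\<dots> = weak_form u v (\<lambda>p. gx p * strip ((fst p - Y n (snd p)) / h) + g p * (dstrip ((fst p - Y n (snd p)) / h) * (1 / h)))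
             (\<lambda>p. gt p * strip ((fst p - Y n (snd p)) / h) + g p * (dstrip ((fst p - Y n (snd p)) / h) * (- dY n (snd p) / h)))"
      unfolding weak_form_def
    proof (rule Bochner_Integration.integral_cong[OF refl])
      fix p
      have "g p = indicator {0<..} (snd p) * g p" using gz[of p] ab by (cases "snd p > 0") (auto simp: indicator_def)
      then show "?A p + g p * (dstrip ((fst p - Y n (snd p)) / h) / h) * (P p - dY n (snd p) * D p) =
        indicator {0<..} (snd p) * (\<bar>u p - v p\<bar> * (gt p * strip ((fst p - Y n (snd p)) / h) + g p * (dstrip ((fst p - Y n (snd p)) / h) * (- dY n (snd p) / h)))
        + Phi (u p) (v p) * (gx p * strip ((fst p - Y n (snd p)) / h) + g p * (dstrip ((fst p - Y n (snd p)) / h) * (1 / h))))"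
        unfolding D_def[symmetric] P_def[symmetric] by (cases "snd p > 0") (auto simp: indicator_def algebra_simps diff_divide_distrib)
    qed
    finally show ?thesis by simp
  qed
  show ?thesis
  proof (rule that[of h "Y n" "dY n"])
    show "\<bar>Y n t - y t\<bar> < h" if "t \<in> {a..b}" for t using N2[of n t] that by (simp add: n_def)
    \<comment> \<open>The errors \<eta>/4 (gradient of g), \<eta>/8 (mollification) and \<eta>/8
      (traces) stay below \<eta>.\<close>
    have "\<bar>?Bn n - J\<bar> < \<eta> / 8" using N1[of n] by (simp add: n_def)
    then show "- (LBINT t. g (y t, t) * m t) - \<eta> \<le>
       weak_form u v (\<lambda>p. gx p * strip ((fst p - Y n (snd p)) / h) + g p * (dstrip ((fst p - Y n (snd p)) / h) * (1 / h)))
             (\<lambda>p. gt p * strip ((fst p - Y n (snd p)) / h) + g p * (dstrip ((fst p - Y n (snd p)) / h) * (- dY n (snd p) / h)))"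
      unfolding Keq using Ab J0 JJ \<eta> by linarith
  qed (use h Yd dYc in auto)
qed

end

section \<open>Removal of the interfaces\<close>

lemma C1c_diff:
  assumes "C1c g gx gt" "C1c h hx ht"
  shows "C1c (\<lambda>p. g p - h p) (\<lambda>p. gx p - hx p) (\<lambda>p. gt p - ht p)"
proof -
  obtain B where "\<And>p. norm p > B \<Longrightarrow> g p = 0" using assms(1) by (auto simp: C1c_def)
  moreover obtain B' where "\<And>p. norm p > B' \<Longrightarrow> h p = 0" using assms(2) by (auto simp: C1c_def)
  ultimately show ?thesis using C1_diff[OF C1c_C1[OF assms(1)] C1c_C1[OF assms(2)]]
    by (intro C1cI[where B="max B B'"]) auto
qed

text \<open>Zero within distance d of the end times and 1 from distance 2 d on: a strip may be used
  only where the traces and the weak derivative are available.\<close>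

definition time_bump :: "real \<Rightarrow> real \<Rightarrow> real \<Rightarrow> real \<Rightarrow> real" where
  "time_bump s T d t = (1 - wcut ((t - s) / d)) * (1 - wcut ((T - t) / d))"

lemma time_bump_C1:
  assumes "d > 0"
  obtains b' where "C1 (\<lambda>p. time_bump s T d (snd p)) (\<lambda>p. 0) b'"
proof -
  have w: "((\<lambda>t. wcut ((t - s) / d)) has_real_derivative - w ((t - s) / d) * (1 / d)) (at t)" for t s
    using assms by (intro DERIV_chain2[OF wcut_deriv]) (auto intro!: derivative_eq_intros)
  have w2: "((\<lambda>t. wcut ((T - t) / d)) has_real_derivative - w ((T - t) / d) * (- 1 / d)) (at t)" for t
    using assms by (intro DERIV_chain2[OF wcut_deriv]) (auto intro!: derivative_eq_intros)
  have "(time_bump s T d has_real_derivative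
     (0 - - w ((t - s) / d) * (1 / d)) * (1 - wcut ((T - t) / d)) + (0 - - w ((T - t) / d) * (- 1 / d)) * (1 - wcut ((t - s) / d))) (at t)" for t
    unfolding time_bump_def[abs_def] by (intro DERIV_mult DERIV_diff DERIV_const w w2)
  moreover have "continuous_on UNIV (\<lambda>t. (0 - - w ((t - s) / d) * (1 / d)) * (1 - wcut ((T - t) / d)) + (0 - - w ((T - t) / d) * (- 1 / d)) * (1 - wcut ((t - s) / d)))"
    using assms by (auto intro!: continuous_intros continuous_on_compose2[OF w_continuous[of UNIV]] continuous_on_compose2[OF Cinf_continuous[OF Cinf_wcut, of UNIV]])
  ultimately show ?thesis by (rule that[OF C1_snd])
qed

lemma time_bump_bounds: "0 \<le> time_bump s T d t" "time_bump s T d t \<le> 1"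
  unfolding time_bump_def using wcut_bounds[of "(t - s) / d"] wcut_bounds[of "(T - t) / d"] by (auto intro!: mult_le_one)

lemma time_bump_one: "d > 0 \<Longrightarrow> s + 2 * d \<le> t \<Longrightarrow> t \<le> T - 2 * d \<Longrightarrow> time_bump s T d t = 1"
  by (simp add: time_bump_def wcut_zero field_simps)

lemma time_bump_zero: "d > 0 \<Longrightarrow> t \<notin> {s + d..T - d} \<Longrightarrow> time_bump s T d t = 0"
  by (auto simp: time_bump_def wcut_one field_simps)

text \<open>Borel data for both solutions: \<open>y i\<close> is extended to the whole line,
  \<open>c i\<close> is its speed, \<open>ul\<close>, \<open>ur\<close>, \<open>vl\<close>,
  \<open>vr\<close> are the left and right traces of u and v, and \<open>m i\<close> majorizes the
  jump of the moving Kruzhkov flux across interface i.\<close>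

locale two_solutions = lipschitz_flux +
  fixes u v :: "real \<times> real \<Rightarrow> real" and u0 v0 :: "real \<Rightarrow> real"
    and I :: "nat set" and s T :: "nat \<Rightarrow> real" and y c m ul ur vl vr :: "nat \<Rightarrow> real \<Rightarrow> real"
  assumes fin: "finite I"
    and ent_u: "entropic (\<Union>i\<in>I. Gam (s i) (T i) (y i)) u0 u"
    and ent_v: "entropic (\<Union>i\<in>I. Gam (s i) (T i) (y i)) v0 v"
    and sT: "i \<in> I \<Longrightarrow> 0 \<le> s i" "i \<in> I \<Longrightarrow> s i < T i"
    and yc: "i \<in> I \<Longrightarrow> continuous_on UNIV (y i)" and cb: "i \<in> I \<Longrightarrow> bb (c i)"
    and wd: "i \<in> I \<Longrightarrow> 0 < e \<Longrightarrow> s i < t - e \<Longrightarrow> t + e < T i \<Longrightarrow>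
      (LBINT r. y i r * (deriv moll ((t - r) / e) / e)) = (LBINT r. c i r * moll ((t - r) / e))"
    and mb: "i \<in> I \<Longrightarrow> bb (m i)" and m0: "i \<in> I \<Longrightarrow> 0 \<le> m i t"
    and tru: "i \<in> I \<Longrightarrow> unitb (ul i)" "i \<in> I \<Longrightarrow> unitb (ur i)" "i \<in> I \<Longrightarrow> unitb (vl i)" "i \<in> I \<Longrightarrow> unitb (vr i)"
    and trl: "i \<in> I \<Longrightarrow> s i < a \<Longrightarrow> b < T i \<Longrightarrow> one_sided_trace (-1) a b (y i) u (ul i)" "i \<in> I \<Longrightarrow> s i < a \<Longrightarrow> b < T i \<Longrightarrow> one_sided_trace (-1) a b (y i) v (vl i)"
    and trr: "i \<in> I \<Longrightarrow> s i < a \<Longrightarrow> b < T i \<Longrightarrow> one_sided_trace 1 a b (y i) u (ur i)" "i \<in> I \<Longrightarrow> s i < a \<Longrightarrow> b < T i \<Longrightarrow> one_sided_trace 1 a b (y i) v (vr i)"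
    and germ: "i \<in> I \<Longrightarrow> AE t in lborel. t \<in> {s i<..<T i} \<longrightarrow> PhiS (c i t) (ur i t) (vr i t) - PhiS (c i t) (ul i t) (vl i t) \<le> m i t"
begin

definition endpoint_set :: "(real \<times> real) set" where "endpoint_set = (\<Union>i\<in>I. endpoints (s i) (T i) (y i))"

text \<open>The most that interface i can add to the weak form of g: g along the curve, weighted
  with the germ bound.\<close>

definition Q :: "nat \<Rightarrow> (real \<times> real \<Rightarrow> real) \<Rightarrow> real" where
  "Q i g = (LBINT t. indicator {s i<..<T i} t * (g (y i t, t) * m i t))"

lemma uu: "unitb u" and vv: "unitb v" and uu0: "unitb u0" and vv0: "unitb v0"
  using ent_u ent_v by (auto simp: entropic_def)

lemma curve_borel: "i \<in> I \<Longrightarrow> (\<lambda>t. (y i t, t)) \<in> borel_measurable borel"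
  using yc[of i] by (intro borel_measurable_continuous_onI continuous_intros) auto

lemma bcs_curve: 
  assumes "i \<in> I" "bcs g" shows "bcs (\<lambda>t. g (y i t, t))"
proof -
  obtain C where C: "C > 0" "\<And>x. \<bar>g x\<bar> \<le> C" "\<And>x. norm x > C \<Longrightarrow> g x = 0" using bcs_bound[OF assms(2)] by metis
  show ?thesis
  proof (rule bcsI[where C=C and B=C])
    show "(\<lambda>t. g (y i t, t)) \<in> borel_measurable borel"
      using measurable_compose[OF curve_borel[OF assms(1)] bcs_measurable[OF assms(2)]] by simp
    show "g (y i t, t) = 0" if "norm t > C" for t
      using C(3)[of "(y i t, t)"] norm_snd_le[of t "y i t"] that by auto
  qed (use C in auto)
qed

lemma Q_integrable: "i \<in> I \<Longrightarrow> bcs g \<Longrightarrow> integrable lborel (\<lambda>t. indicator {s i<..<T i} t * (g (y i t, t) * m i t))"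
  by (intro bcs_integrable bcs_mult2[OF bb_indicator] bcs_mult1 bcs_curve mb) auto

lemma Q_mono: 
  assumes "i \<in> I" "bcs g" "bcs h" "\<And>p. g p \<le> h p" shows "Q i g \<le> Q i h"
  unfolding Q_def using assms m0
  by (intro Bochner_Integration.integral_mono Q_integrable mult_left_mono mult_right_mono) auto

lemma weak_form_integrable: 
  assumes "bcs gx" "bcs gt" 
  shows "integrable lborel (\<lambda>p. indicator {0<..} (snd p) * (\<bar>u p - v p\<bar> * gt p + Phi (u p) (v p) * gx p))"
proof -
  have bind: "bb (\<lambda>q::real\<times>real. indicator {0<..} (snd q) :: real)"
    by (rule bbI[where C=1]) (auto simp: indicator_def)
  show ?thesis by (intro bcs_integrable bcs_mult2[OF bind] bcs_add bcs_mult2[OF bb_unitb_diff] bcs_mult2[OF bb_unitb_Phi] uu vv assms)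
qed

lemma weak_form_diff: 
  assumes "bcs gx" "bcs gt" "bcs hx" "bcs ht"
  shows "weak_form u v (\<lambda>p. gx p - hx p) (\<lambda>p. gt p - ht p) = weak_form u v gx gt - weak_form u v hx ht"
  unfolding weak_form_def Bochner_Integration.integral_diff[OF weak_form_integrable[OF assms(1,2)] weak_form_integrable[OF assms(3,4)], symmetric]
  by (intro Bochner_Integration.integral_cong) (auto simp: algebra_simps)

lemma compact_curves: "compact (\<Union>i\<in>I. Gam (s i) (T i) (y i))"
  unfolding Gam_def using fin yc
  by (intro compact_UN compact_continuous_image continuous_intros) (auto intro: continuous_on_subset)

text \<open>Induction on the set A of interfaces that g may charge, with \<open>kato\<close> as
  base. To discharge i, subtract from g its product with a time bump and a strip. The remainder
  vanishes near curve i and wherever g did, and lies between 0 and g, so the other \<open>Q\<close>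
  terms do not grow; the subtracted part costs \<open>Q i g\<close> up to \<eta>.\<close>

lemma removal:
  assumes "A \<subseteq> I" "C1c g gx gt" "\<And>p. 0 \<le> g p"
    and "open U" "endpoint_set \<union> (\<Union>i\<in>I - A. Gam (s i) (T i) (y i)) \<subseteq> U" "\<And>p. p \<in> U \<Longrightarrow> g p = 0"
    and "t0 > 0" "\<And>p. snd p < t0 \<Longrightarrow> g p = 0"
  shows "- (\<Sum>i\<in>A. Q i g) \<le> weak_form u v gx gt"
proof -
  have "finite A" using assms(1) fin finite_subset by blast
  then show ?thesis using assms
  proof (induction A arbitrary: g gx gt U rule: finite_induct)
    case empty
    show ?case using kato[OF ent_u ent_v compact_curves empty(2,3,4) _ empty(6,7,8)] empty(5) by auto
  next
    case (insert i A)
    note g = insert.prems(2) note g0 = insert.prems(3) note U = insert.prems(4-6) note t0 = insert.prems(7,8)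
    have i: "i \<in> I" and AI: "A \<subseteq> I" using insert.prems(1) by auto
    have yi: "continuous_on UNIV (\<lambda>t. (y i t, t))" using yc[OF i] by (intro continuous_intros)
    have endp: "(y i (s i), s i) \<in> U" "(y i (T i), T i) \<in> U"
      using U(2) i by (auto simp: endpoint_set_def endpoints_def)
    have oV: "open ((\<lambda>t. (y i t, t)) -` U)" using yi U(1) by (simp add: continuous_on_open_vimage)
    obtain d1 where d1: "d1 > 0" "\<And>t. dist t (s i) < d1 \<Longrightarrow> (y i t, t) \<in> U"
      using oV endp(1) unfolding open_dist by auto
    obtain d2 where d2: "d2 > 0" "\<And>t. dist t (T i) < d2 \<Longrightarrow> (y i t, t) \<in> U"
      using oV endp(2) unfolding open_dist by auto
    \<comment> \<open>Curve points at times within 2 d of an end time must already lie in U, where g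
      vanishes; the second bound leaves room for the time bump.\<close>
    define d where "d = min (min d1 d2 / 4) ((T i - s i) / 4)"
    have d: "d > 0" "4 * d \<le> d1" "4 * d \<le> d2" "4 * d \<le> T i - s i"
      using d1 d2 sT(2)[OF i] by (auto simp: d_def min_def)
    have nearU: "(y i t, t) \<in> U" if "s i \<le> t" "t \<le> T i" "\<not> (s i + 2 * d < t \<and> t < T i - 2 * d)" for t
      using that d d1(2)[of t] d2(2)[of t] by (auto simp: dist_real_def)
    define b where "b p = time_bump (s i) (T i) d (snd p)" for p :: "real \<times> real"
    obtain b' where b': "C1 b (\<lambda>p. 0) b'" unfolding b_def using time_bump_C1[OF d(1)] by metis
    define g1 where "g1 p = g p * b p" for p
    define g1x where "g1x p = gx p * b p + g p * 0" for p
    define g1t where "g1t p = gt p * b p + g p * b' p" for p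
    have g1: "C1c g1 g1x g1t" unfolding g1_def g1x_def g1t_def by (rule C1c_mult[OF g b'])
    have bb01: "0 \<le> b p" "b p \<le> 1" for p unfolding b_def by (rule time_bump_bounds)+
    have g10: "0 \<le> g1 p" for p using g0 bb01 by (simp add: g1_def)
    have g1z: "g1 p = 0" if "snd p \<notin> {s i + d..T i - d}" for p
      using time_bump_zero[OF d(1) that] by (simp add: g1_def b_def)
    have al: "s i < s i + d" and bl: "T i - d < T i" and abl: "s i + d \<le> T i - d" using d by auto
    have ge: "AE t in lborel. t \<in> {s i + d..T i - d} \<longrightarrow> PhiS (c i t) (ur i t) (vr i t) - PhiS (c i t) (ul i t) (vl i t) \<le> m i t"
      using germ[OF i] by eventually_elim (use d in auto)
    have "- (\<Sum>i\<in>insert i A. Q i g) - \<eta> \<le> weak_form u v gx gt" if \<eta>: "\<eta> > 0" for \<eta>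
    proof -
      obtain Y dY h where h: "h > 0" and Yd: "\<And>t. (Y has_real_derivative dY t) (at t)" "continuous_on UNIV dY"
        and Yy: "\<And>t. t \<in> {s i + d..T i - d} \<Longrightarrow> \<bar>Y t - y i t\<bar> < h"
        and Kb: "- (LBINT t. g1 (y i t, t) * m i t) - \<eta> \<le>
           weak_form u v (\<lambda>p. g1x p * strip ((fst p - Y (snd p)) / h) + g1 p * (dstrip ((fst p - Y (snd p)) / h) * (1 / h)))
             (\<lambda>p. g1t p * strip ((fst p - Y (snd p)) / h) + g1 p * (dstrip ((fst p - Y (snd p)) / h) * (- dY (snd p) / h)))"
        by (rule interface_limit[OF uu vv tru[OF i] cb[OF i] yc[OF i] trl[OF i al bl] trr[OF i al bl] sT(1)[OF i] al abl bl],
            rule wd[OF i], assumption+, rule mb[OF i], rule ge, rule g1, rule g10, erule g1z, rule \<eta>, rule that)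
      define z where "z p = strip ((fst p - Y (snd p)) / h)" for p
      let ?hx = "\<lambda>p. g1x p * strip ((fst p - Y (snd p)) / h) + g1 p * (dstrip ((fst p - Y (snd p)) / h) * (1 / h))"
      let ?ht = "\<lambda>p. g1t p * strip ((fst p - Y (snd p)) / h) + g1 p * (dstrip ((fst p - Y (snd p)) / h) * (- dY (snd p) / h))"
      have hh: "C1c (\<lambda>p. g1 p * z p) ?hx ?ht" unfolding z_def by (rule C1c_mult[OF g1 C1_strip[OF Yd h]])
      have g2: "C1c (\<lambda>p. g p - g1 p * z p) (\<lambda>p. gx p - ?hx p) (\<lambda>p. gt p - ?ht p)" by (rule C1c_diff[OF g hh])
      have z01: "0 \<le> z p" "z p \<le> 1" for p unfolding z_def by (rule strip_bounds)+
      have g2eq: "g p - g1 p * z p = g p * (1 - b p * z p)" for p by (simp add: g1_def algebra_simps)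
      have bz: "b p * z p \<le> 1" for p using bb01 z01 by (intro mult_le_one) auto
      have g2b: "0 \<le> g p - g1 p * z p" "g p - g1 p * z p \<le> g p" for p
        unfolding g2eq using g0[of p] bz[of p] bb01 z01 by (auto simp: mult_left_le)
      \<comment> \<open>An open neighbourhood of the middle part of the curve on which both the time
        bump and the strip equal 1.\<close>
      let ?S = "{p. s i + 2 * d < snd p \<and> snd p < T i - 2 * d \<and> \<bar>fst p - Y (snd p)\<bar> < h}"
      have Yc: "continuous_on UNIV Y" by (meson DERIV_continuous_on Yd(1) has_field_derivative_at_within)
      have oS: "open ?S"
        by (intro open_Collect_conj open_Collect_less continuous_intros continuous_on_compose2[OF Yc]) auto
      have "- (\<Sum>j\<in>A. Q j (\<lambda>p. g p - g1 p * z p)) \<le> weak_form u v (\<lambda>p. gx p - ?hx p) (\<lambda>p. gt p - ?ht p)"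
      proof (rule insert.IH[OF AI g2 g2b(1)])
        show "open (U \<union> ?S)" using U(1) oS by (rule open_Un)
        have "Gam (s i) (T i) (y i) \<subseteq> U \<union> ?S"
        proof
          fix p assume "p \<in> Gam (s i) (T i) (y i)"
          then obtain t where t: "p = (y i t, t)" "s i \<le> t" "t \<le> T i" by (auto simp: Gam_def)
          show "p \<in> U \<union> ?S"
          proof (cases "s i + 2 * d < t \<and> t < T i - 2 * d")
            case True
            then have "\<bar>Y t - y i t\<bar> < h" using d by (intro Yy) auto
            then show ?thesis using True t by (simp add: abs_minus_commute)
          qed (use nearU t in auto)
        qed
        then show "endpoint_set \<union> (\<Union>j\<in>I - A. Gam (s j) (T j) (y j)) \<subseteq> U \<union> ?S" using U(2) by auto
        show "g p - g1 p * z p = 0" if "p \<in> U \<union> ?S" for p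
        proof (cases "p \<in> U")
          case False
          then have p: "s i + 2 * d < snd p" "snd p < T i - 2 * d" "\<bar>fst p - Y (snd p)\<bar> < h" using that by auto
          have "b p = 1" unfolding b_def using p d by (intro time_bump_one) auto
          moreover have "z p = 1" unfolding z_def using p h by (intro strip_one) (simp add: abs_divide)
          ultimately show ?thesis by (simp add: g1_def)
        qed (simp add: U(3) g1_def)
        show "snd p < t0 \<Longrightarrow> g p - g1 p * z p = 0" for p using t0(2)[of p] by (simp add: g1_def)
      qed (rule t0(1))
      also have "\<dots> = weak_form u v gx gt - weak_form u v ?hx ?ht"
        by (rule weak_form_diff[OF C1c_bcs(2,3)[OF g] C1c_bcs(2,3)[OF hh]])
      finally have k: "- (\<Sum>j\<in>A. Q j (\<lambda>p. g p - g1 p * z p)) \<le> weak_form u v gx gt - weak_form u v ?hx ?ht" .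
      have "(\<Sum>j\<in>A. Q j (\<lambda>p. g p - g1 p * z p)) \<le> (\<Sum>j\<in>A. Q j g)"
        using AI by (intro sum_mono Q_mono C1c_bcs(1)[OF g] C1c_bcs(1)[OF g2] g2b) auto
      moreover have "(LBINT t. g1 (y i t, t) * m i t) \<le> Q i g"
        unfolding Q_def
      proof (rule Bochner_Integration.integral_mono[OF _ Q_integrable[OF i C1c_bcs(1)[OF g]]])
        show "integrable lborel (\<lambda>t. g1 (y i t, t) * m i t)"
          by (intro bcs_integrable bcs_mult1 bcs_curve i C1c_bcs(1)[OF g1] mb)
        fix t
        show "g1 (y i t, t) * m i t \<le> indicator {s i<..<T i} t * (g (y i t, t) * m i t)"
        proof (cases "t \<in> {s i<..<T i}")
          case True
          have "g1 (y i t, t) \<le> g (y i t, t)" using g0[of "(y i t, t)"] bb01 by (simp add: g1_def mult_left_le)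
          then show ?thesis using True m0[OF i] by (simp add: mult_right_mono)
        next
          case False
          then have "g1 (y i t, t) = 0" using d by (intro g1z) auto
          then show ?thesis using False by simp
        qed
      qed
      ultimately show ?thesis using k Kb insert.hyps by simp
    qed
    then have "- (\<Sum>i\<in>insert i A. Q i g) \<le> weak_form u v gx gt + \<eta>" if "\<eta> > 0" for \<eta>
      using that by (simp add: diff_le_eq)
    then show ?case by (rule field_le_epsilon)
  qed
qed

end

section \<open>Initial trace\<close>

lemma wt_facts:
  assumes "\<tau> > 0"
  shows "bcs (\<lambda>t. w (t / \<tau>) / \<tau>)" "(LBINT t. w (t / \<tau>) / \<tau>) = 1" "0 \<le> w (t / \<tau>) / \<tau>" "t \<notin> {\<tau>..2 * \<tau>} \<Longrightarrow> w (t / \<tau>) = 0"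
proof -
  show z: "w (t / \<tau>) = 0" if "t \<notin> {\<tau>..2 * \<tau>}" for t
    using that assms by (intro w_zero) (auto simp: field_simps)
  show "bcs (\<lambda>t. w (t / \<tau>) / \<tau>)"
  proof (rule bcs_continuous[where B="2 * \<tau>"])
    show "continuous_on UNIV (\<lambda>t. w (t / \<tau>) / \<tau>)"
      using assms by (auto intro!: continuous_intros continuous_on_compose2[OF w_continuous[of UNIV]])
    show "w (t / \<tau>) / \<tau> = 0" if "2 * \<tau> < norm t" for t
      using z[of t] that assms by (auto simp: abs_if split: if_splits)
  qed
  show "(LBINT t. w (t / \<tau>) / \<tau>) = 1"
    using lborel_integral_real_affine[of \<tau> "\<lambda>t. w (t / \<tau>) / \<tau>" 0] assms by (simp add: integral_w_lborel)
  show "0 \<le> w (t / \<tau>) / \<tau>" using w_nonneg assms by simp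
qed

lemma wcut_scale:
  assumes "\<tau> > 0"
  shows "((\<lambda>t. wcut (t / \<tau>)) has_real_derivative - w (t / \<tau>) / \<tau>) (at t)" "Cinf (\<lambda>t. wcut (t / \<tau>))"
    "bcs (\<lambda>t. indicator {0<..} t * wcut (t / \<tau>))" "0 \<le> (LBINT t. indicator {0<..} t * wcut (t / \<tau>))" 
    "(LBINT t. indicator {0<..} t * wcut (t / \<tau>)) \<le> 2 * \<tau>"
proof -
  show "((\<lambda>t. wcut (t / \<tau>)) has_real_derivative - w (t / \<tau>) / \<tau>) (at t)"
    using DERIV_chain2[OF wcut_deriv DERIV_cdivide[OF DERIV_ident]] by simp
  show C: "Cinf (\<lambda>t. wcut (t / \<tau>))" using Cinf_scale[OF Cinf_wcut, of "1/\<tau>" 0] by simp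
  have m: "(\<lambda>t. wcut (t / \<tau>)) \<in> borel_measurable borel"
    using Cinf_continuous[OF C] by (rule borel_measurable_continuous_onI)
  have le: "indicator {0<..} t * wcut (t / \<tau>) \<le> indicator {0..2 * \<tau>} t" for t
    using wcut_bounds[of "t / \<tau>"] wcut_zero[of "t / \<tau>"] assms by (auto simp: indicator_def field_simps)
  show b: "bcs (\<lambda>t. indicator {0<..} t * wcut (t / \<tau>))"
  proof (rule bcsI[where C=1 and B="2 * \<tau>"])
    show "indicator {0<..} t * wcut (t / \<tau>) = 0" if "norm t > 2 * \<tau>" for t
      using le[of t] that assms wcut_bounds[of "t / \<tau>"] by (auto simp: indicator_def split: if_splits)
  qed (use m wcut_bounds in \<open>auto simp: indicator_def\<close>)
  show "0 \<le> (LBINT t. indicator {0<..} t * wcut (t / \<tau>))"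
    using wcut_bounds by (intro integral_nonneg_AE) auto
  have "(LBINT t. indicator {0<..} t * wcut (t / \<tau>)) \<le> (LBINT t. indicator {0..2 * \<tau>} t)"
    by (intro Bochner_Integration.integral_mono bcs_integrable b bcs_indicator le) auto
  then show "(LBINT t. indicator {0<..} t * wcut (t / \<tau>)) \<le> 2 * \<tau>" using assms by simp
qed

context lipschitz_flux begin

text \<open>Use the Kruzhkov constant u0(x') and the cutoff \<open>wcut (t / \<tau>)\<close> in
  time. Its derivative is minus a probability density on [\<tau>, 2\<tau>], which yields the left
  side; the flux term lasts for a time at most 2\<tau> and costs 1/\<epsilon> through the spatial
  mollifier.\<close>

lemma initial_estimate:
  assumes u: "entropic G u0 u" and \<epsilon>: "\<epsilon> > 0" and \<tau>: "\<tau> > 0"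
    and G: "\<And>q. q \<in> G \<Longrightarrow> \<bar>fst q - x'\<bar> \<le> \<epsilon> \<Longrightarrow> 0 \<le> snd q \<Longrightarrow> snd q \<le> 2 * \<tau> \<Longrightarrow> False"
  shows "(LBINT p. (moll ((fst p - x') / \<epsilon>) / \<epsilon>) * (w (snd p / \<tau>) / \<tau>) * \<bar>u p - u0 x'\<bar>)
     \<le> 2 * \<tau> * L * (LBINT r. \<bar>deriv moll r\<bar>) / \<epsilon> + (LBINT x. (moll ((x - x') / \<epsilon>) / \<epsilon>) * \<bar>u0 x - u0 x'\<bar>)"
proof -
  have uu: "unitb u" and uu0: "unitb u0" using u by (auto simp: entropic_def)
  define \<kappa> where "\<kappa> = u0 x'"
  have \<kappa>: "\<kappa> \<in> {0..1}" using unitbD(4)[OF uu0] by (simp add: \<kappa>_def)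
  define a where "a x = moll ((x - x') / \<epsilon>) / \<epsilon>" for x
  define b where "b t = wcut (t / \<tau>)" for t
  have da: "deriv a x = deriv moll ((x - x') / \<epsilon>) / \<epsilon> / \<epsilon>" for x
    unfolding a_def using \<epsilon> by (intro DERIV_imp_deriv DERIV_cdivide moll_scale_deriv) auto
  have db: "deriv b t = - (w (t / \<tau>) / \<tau>)" for t
    unfolding b_def using DERIV_imp_deriv[OF wcut_scale(1)[OF \<tau>]] by simp
  have za: "a x = 0" "deriv a x = 0" if "x \<notin> {x' - \<epsilon>..x' + \<epsilon>}" for x
    using that \<epsilon> by (auto simp: a_def da field_simps abs_divide intro!: moll_zero moll'_zero)
  have ca: "continuous_on UNIV a" "continuous_on UNIV (deriv a)"
  proof -
    have da': "deriv a = (\<lambda>x. deriv moll ((x - x') / \<epsilon>) / \<epsilon> / \<epsilon>)" using da by auto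
    show "continuous_on UNIV a" "continuous_on UNIV (deriv a)"
      unfolding da' using \<epsilon>
      by (auto simp: a_def[abs_def] intro!: continuous_intros continuous_on_compose2[OF Cinf_continuous[OF Cinf_moll, of UNIV]]
       continuous_on_compose2[OF Cinf_continuous[OF Cinf_deriv(2)[OF Cinf_moll], of UNIV]])
  qed
  have ba: "bcs a" "bcs (deriv a)"
    by (rule bcs_continuous[where B="\<bar>x'\<bar> + \<epsilon>"]; use ca za \<epsilon> in force)+
  have "0 \<le> (LBINT p. indicator {0<..} (snd p) * (\<bar>u p - \<kappa>\<bar> * (a (fst p) * deriv b (snd p))
                 + Phi (u p) \<kappa> * (deriv a (fst p) * b (snd p)))) + (LBINT x. \<bar>u0 x - \<kappa>\<bar> * (a x * b 0))"
  proof (rule u[unfolded entropic_def, THEN conjunct2, THEN conjunct2, rule_format], intro conjI allI impI)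
    show "Cinf a" unfolding a_def using Cinf_mult[OF Cinf_moll_scale[of \<epsilon> x'] Cinf_const[of "1/\<epsilon>"]] \<epsilon> by simp
    show "Cinf b" unfolding b_def by (rule wcut_scale(2)[OF \<tau>])
    show "{x' - \<epsilon>..x' + \<epsilon>} \<times> {max 0 0..2 * \<tau>} \<inter> G = {}"
    proof (rule ccontr)
      assume "\<not> ?thesis"
      then obtain q where "q \<in> G" "q \<in> {x' - \<epsilon>..x' + \<epsilon>} \<times> {max 0 0..2 * \<tau>}" by blast
      then show False using G[of q] by (auto simp: mem_Times_iff abs_le_iff)
    qed
    show "b t = 0" if "0 \<le> t" "t \<notin> {0..2 * \<tau>}" for t
      unfolding b_def using that \<tau> by (intro wcut_zero) (auto simp: field_simps)
  qed (use za \<kappa> \<epsilon> in \<open>auto simp: a_def b_def moll_nonneg wcut_bounds\<close>)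
  moreover have "b 0 = 1" by (simp add: b_def wcut_one)
  moreover have "(LBINT p. indicator {0<..} (snd p) * (\<bar>u p - \<kappa>\<bar> * (a (fst p) * deriv b (snd p))
                 + Phi (u p) \<kappa> * (deriv a (fst p) * b (snd p))))
      = (LBINT p. Phi (u p) \<kappa> * (deriv a (fst p) * (indicator {0<..} (snd p) * b (snd p))))
        - (LBINT p. a (fst p) * (w (snd p / \<tau>) / \<tau>) * \<bar>u p - \<kappa>\<bar>)"
  proof -
    have "bcs (\<lambda>p. deriv a (fst p) * (indicator {0<..} (snd p) * b (snd p)))"
      unfolding b_def by (intro bcs_product[OF ba(2) wcut_scale(3)[OF \<tau>]])
    then have i1: "integrable lborel (\<lambda>p. Phi (u p) \<kappa> * (deriv a (fst p) * (indicator {0<..} (snd p) * b (snd p))))"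
      by (rule bcs_integrable[OF bcs_mult2[OF bb_unitb_Phi[OF uu unitb_const[OF \<kappa>]]]])
    have i2: "integrable lborel (\<lambda>p. a (fst p) * (w (snd p / \<tau>) / \<tau>) * \<bar>u p - \<kappa>\<bar>)"
      by (intro bcs_integrable bcs_mult1 bcs_product[OF ba(1) wt_facts(1)[OF \<tau>]] bb_unitb_diff uu unitb_const \<kappa>)
    show ?thesis
      unfolding Bochner_Integration.integral_diff[OF i1 i2, symmetric]
    proof (rule Bochner_Integration.integral_cong[OF refl])
      fix p :: "real \<times> real"
      have "indicator {0<..} (snd p) * w (snd p / \<tau>) = w (snd p / \<tau>)"
        using wt_facts(4)[OF \<tau>, of "snd p"] \<tau> by (cases "snd p > 0") auto
      then show "indicator {0<..} (snd p) * (\<bar>u p - \<kappa>\<bar> * (a (fst p) * deriv b (snd p))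
                 + Phi (u p) \<kappa> * (deriv a (fst p) * b (snd p)))
         = Phi (u p) \<kappa> * (deriv a (fst p) * (indicator {0<..} (snd p) * b (snd p))) - a (fst p) * (w (snd p / \<tau>) / \<tau>) * \<bar>u p - \<kappa>\<bar>"
        unfolding db by (cases "snd p > 0") (auto simp: algebra_simps)
    qed
  qed
  moreover have "(LBINT p. Phi (u p) \<kappa> * (deriv a (fst p) * (indicator {0<..} (snd p) * b (snd p))))
     \<le> 2 * \<tau> * L * (LBINT r. \<bar>deriv moll r\<bar>) / \<epsilon>"
  proof -
    let ?F = "\<lambda>p. \<bar>deriv a (fst p)\<bar> * (indicator {0<..} (snd p) * b (snd p))"
    have bF: "bcs ?F" unfolding b_def by (intro bcs_product bcs_abs ba wcut_scale(3)[OF \<tau>])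
    have "(LBINT p. Phi (u p) \<kappa> * (deriv a (fst p) * (indicator {0<..} (snd p) * b (snd p)))) \<le> (LBINT p. L * ?F p)"
    proof (rule integral_mono_AE')
      show "integrable lborel (\<lambda>p. L * ?F p)" by (intro bcs_integrable bcs_mult2[OF bb_const] bF)
      have "Phi (u p) \<kappa> * (deriv a (fst p) * (indicator {0<..} (snd p) * b (snd p))) \<le> L * ?F p" for p
      proof -
        have "Phi (u p) \<kappa> * (deriv a (fst p) * (indicator {0<..} (snd p) * b (snd p)))
           \<le> \<bar>Phi (u p) \<kappa>\<bar> * \<bar>deriv a (fst p) * (indicator {0<..} (snd p) * b (snd p))\<bar>"
          unfolding abs_mult[symmetric] by (rule abs_ge_self)
        also have "\<dots> \<le> L * \<bar>deriv a (fst p) * (indicator {0<..} (snd p) * b (snd p))\<bar>"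
          using unitb_Phi[OF uu unitb_const[OF \<kappa>]] by (intro mult_right_mono) auto
        also have "\<bar>deriv a (fst p) * (indicator {0<..} (snd p) * b (snd p))\<bar> = ?F p"
          using wcut_bounds by (simp add: abs_mult b_def)
        finally show ?thesis .
      qed
      then show "AE p in lborel. Phi (u p) \<kappa> * (deriv a (fst p) * (indicator {0<..} (snd p) * b (snd p))) \<le> L * ?F p" by simp
      show "AE p in lborel. 0 \<le> L * ?F p" using L_nonneg wcut_bounds by (intro AE_I2) (simp add: b_def)
    qed
    also have "\<dots> = L * ((LBINT x. \<bar>deriv a x\<bar>) * (LBINT t. indicator {0<..} t * b t))"
      using bcs_product_integral[OF bcs_abs[OF ba(2)] wcut_scale(3)[OF \<tau>]] by (simp add: b_def)
    also have "(LBINT x. \<bar>deriv a x\<bar>) = (LBINT r. \<bar>deriv moll r\<bar>) / \<epsilon>"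
      unfolding da using \<epsilon> lborel_integral_real_affine[of \<epsilon> "\<lambda>x. \<bar>deriv moll ((x - x') / \<epsilon>) / \<epsilon> / \<epsilon>\<bar>" x'] by simp
    also have "L * ((LBINT r. \<bar>deriv moll r\<bar>) / \<epsilon> * (LBINT t. indicator {0<..} t * b t)) \<le>
       L * ((LBINT r. \<bar>deriv moll r\<bar>) / \<epsilon> * (2 * \<tau>))"
    proof -
      have "0 \<le> (LBINT r. \<bar>deriv moll r\<bar>)" by (intro integral_nonneg_AE) auto
      then show ?thesis unfolding b_def using wcut_scale(5)[OF \<tau>] L_nonneg \<epsilon> by (intro mult_left_mono) auto
    qed
    finally show ?thesis by (simp add: mult_ac)
  qed
  ultimately show ?thesis by (simp add: \<kappa>_def a_def mult.commute mult.assoc)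
qed

text \<open>Average the preceding estimate over x' with weight g: the constant u0(x') is then
  exchanged for u0(x) at the price of the oscillation of the datum at scale \<epsilon>. The flux
  error is of order \<tau>/\<epsilon>, so \<epsilon> is fixed before \<tau>.\<close>

lemma initial_trace:
  assumes u: "entropic G u0 u" and g: "bcs g" and g0: "\<And>x. 0 \<le> g x" and Cl: "\<And>x x'. \<bar>g x - g x'\<bar> \<le> Cl * \<bar>x - x'\<bar>"
    and d: "d > 0" and G: "\<And>x' q. g x' \<noteq> 0 \<Longrightarrow> q \<in> G \<Longrightarrow> \<bar>fst q - x'\<bar> \<le> d \<Longrightarrow> 0 \<le> snd q \<Longrightarrow> snd q \<le> d \<Longrightarrow> False"
    and \<eta>: "\<eta> > 0"
  shows "\<exists>\<tau>0>0. \<forall>\<tau>. 0 < \<tau> \<and> \<tau> < \<tau>0 \<longrightarrow> (LBINT p. g (fst p) * (w (snd p / \<tau>) / \<tau>) * \<bar>u p - u0 (fst p)\<bar>) \<le> \<eta>"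
proof -
  have uu: "unitb u" and uu0: "unitb u0" using u by (auto simp: entropic_def)
  obtain B where B: "B > 0" "\<And>x. \<bar>g x\<bar> \<le> B" "\<And>x. norm x > B \<Longrightarrow> g x = 0" using bcs_bound[OF g] by metis
  have Cl0: "0 \<le> Cl" using Cl[of 0 1] by simp
  \<comment> \<open>The oscillation \<open>C'\<close> is at most B \<eta>1 = \<eta>/8 and enters
    twice, once through \<open>initial_estimate\<close> and once through \<open>?F3\<close>.\<close>
  define \<eta>1 where "\<eta>1 = \<eta> / (8 * B)"
  have \<eta>1: "\<eta>1 > 0" using \<eta> B by (simp add: \<eta>1_def)
  obtain e1 where e1: "e1 > 0" "\<And>v. norm v < e1 \<Longrightarrow> (LBINT x. indicator (cball 0 B) x * \<bar>u0 (x + v) - u0 x\<bar>) < \<eta>1"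
    using L1_translation[OF unitb_bb[OF uu0] \<eta>1] by metis
  define k where "k = Cl * (2 * (B + 1)) + 1"
  have k: "k > 0" using Cl0 B by (simp add: k_def add_nonneg_pos)
  define \<epsilon> where "\<epsilon> = min (min 1 d) (min e1 (\<eta> / (4 * k)))"
  have \<epsilon>: "\<epsilon> > 0" "\<epsilon> \<le> 1" "\<epsilon> \<le> d" "\<epsilon> \<le> e1" "\<epsilon> \<le> \<eta> / (4 * k)" using e1 d k \<eta> by (auto simp: \<epsilon>_def)
  define M where "M = (LBINT r. \<bar>deriv moll r\<bar>)"
  have M0: "0 \<le> M" unfolding M_def by (intro integral_nonneg_AE) auto
  have Ig: "0 \<le> (LBINT x. g x)" using g0 by (intro integral_nonneg_AE) auto
  define N where "N = 2 * L * M / \<epsilon> * (LBINT x. g x)"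
  have N0: "0 \<le> N" unfolding N_def using L_nonneg M0 Ig \<epsilon> by simp
  \<comment> \<open>N contains 1/\<epsilon>; this bound makes \<tau> N at most \<eta>/4. The other
    one keeps the time support [\<tau>, 2\<tau>] below d, clear of G.\<close>
  define \<tau>0 where "\<tau>0 = min (d / 2) (\<eta> / (4 * (N + 1)))"
  have \<tau>0: "\<tau>0 > 0" using d \<eta> N0 by (simp add: \<tau>0_def)
  show ?thesis
  proof (intro exI[of _ \<tau>0] conjI allI impI \<tau>0)
    fix \<tau> assume \<tau>: "0 < \<tau> \<and> \<tau> < \<tau>0"
    then have \<tau>p: "\<tau> > 0" "2 * \<tau> \<le> d" and \<tau>N: "\<tau> \<le> \<eta> / (4 * (N + 1))" by (auto simp: \<tau>0_def)
    define W where "W t = w (t / \<tau>) / \<tau>" for t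
    define ke where "ke r = moll (r / \<epsilon>) / \<epsilon>" for r
    have W: "bcs W" "(LBINT t. W t) = 1" "0 \<le> W t" for t
      unfolding W_def using wt_facts[OF \<tau>p(1)] by auto
    have kez: "ke r = 0" if "\<bar>r\<bar> \<ge> \<epsilon>" for r unfolding ke_def using that \<epsilon> by (simp add: moll_zero abs_divide)
    have ken: "0 \<le> ke r" for r unfolding ke_def using moll_nonneg \<epsilon> by simp
    have kec: "continuous_on UNIV ke" unfolding ke_def[abs_def] using \<epsilon>
      by (auto intro!: continuous_intros continuous_on_compose2[OF Cinf_continuous[OF Cinf_moll, of UNIV]])
    have keb: "bcs ke" by (rule bcs_continuous[OF kec, of \<epsilon>]) (use kez in auto)
    have ke1: "(LBINT r. ke r) = 1" unfolding ke_def
      using lborel_integral_real_affine[of \<epsilon> "\<lambda>r. moll (r / \<epsilon>) / \<epsilon>" 0] \<epsilon> by (simp add: integral_moll)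
    have kes: "(LBINT x'. ke (x - x')) = 1" for x
      using lborel_integral_real_affine[of "-1" "\<lambda>x'. ke (x - x')" x] ke1 by simp
    have kem [measurable]: "ke \<in> borel_measurable borel" using bcs_measurable[OF keb] .
    have kebb: "bb (\<lambda>q. ke (a q - b q))" if "a \<in> borel_measurable borel" "b \<in> borel_measurable borel" for a b :: "'z::euclidean_space \<Rightarrow> real"
      by (rule bb_compose[OF bcs_bb[OF keb]]) (use that in measurable)
    \<comment> \<open>Mean oscillation of the datum at scale \<epsilon>, weighted by g.\<close>
    define C' where "C' = (LBINT x'. LBINT x. g x' * ke (x - x') * \<bar>u0 x - u0 x'\<bar>)"
    \<comment> \<open>Here \<open>q = (x', x)\<close>.\<close>
    let ?H = "\<lambda>q. (g (fst q) * indicator (cball 0 (B + 1)) (snd q)) * (ke (snd q - fst q) * \<bar>u0 (snd q) - u0 (fst q)\<bar>)"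
    have us: "unitb (\<lambda>q::real\<times>real. u0 (snd q))" "unitb (\<lambda>q::real\<times>real. u0 (fst q))"
      by (rule unitb_compose[OF uu0]; measurable)+
    have bH: "bcs ?H" by (intro bcs_mult1 bcs_product g bcs_indicator bb_mult kebb bb_unitb_diff us) auto
    have near: "x \<in> cball 0 (B + 1)" if "g x' * ke (x - x') \<noteq> 0" for x x'
    proof -
      have "\<bar>x'\<bar> \<le> B" using B(3)[of x'] that by force
      moreover have "\<bar>x - x'\<bar> < \<epsilon>" using kez[of "x - x'"] that by force
      ultimately show ?thesis using \<epsilon> by auto
    qed
    have Heq: "?H (x', x) = g x' * ke (x - x') * \<bar>u0 x - u0 x'\<bar>" for x x'
      using near[of x' x] by (cases "g x' * ke (x - x') = 0") (auto simp: indicator_def)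
    have C'H: "C' = (LBINT q. ?H q)" unfolding C'_def bcs_fubini(1)[OF bH] Heq ..
    have C': "C' \<le> B * \<eta>1"
    proof -
      have "(LBINT x. g x' * ke (x - x') * \<bar>u0 x - u0 x'\<bar>) = (LBINT r. ?H (x', x' + \<epsilon> * r) * \<epsilon>)" for x'
        unfolding Heq using lborel_integral_real_affine[of \<epsilon> "\<lambda>x. g x' * ke (x - x') * \<bar>u0 x - u0 x'\<bar>" x'] \<epsilon>
        by (simp add: mult.commute)
      then have "C' = (LBINT x'. LBINT r. g x' * moll r * \<bar>u0 (x' + \<epsilon> * r) - u0 x'\<bar>)"
        unfolding C'_def Heq using \<epsilon> by (simp add: ke_def)
      also have "\<dots> = (LBINT r. LBINT x'. g x' * moll r * \<bar>u0 (x' + \<epsilon> * r) - u0 x'\<bar>)"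
      proof -
        have u2: "unitb (\<lambda>q::real\<times>real. u0 (fst q + \<epsilon> * snd q))" by (rule unitb_compose[OF uu0]) measurable
        have "bcs (\<lambda>q. g (fst q) * moll (snd q) * \<bar>u0 (fst q + \<epsilon> * snd q) - u0 (fst q)\<bar>)"
          by (intro bcs_mult1 bcs_product g bcs_moll bb_unitb_diff u2 us)
        from bcs_fubini[OF this] show ?thesis by simp
      qed
      also have "\<dots> = (LBINT r. moll r * (LBINT x'. g x' * \<bar>u0 (x' + \<epsilon> * r) - u0 x'\<bar>))"
        unfolding integral_mult_right_zero[symmetric] by (simp add: mult_ac)
      also have "\<dots> \<le> B * \<eta>1"
      proof (rule order_trans[OF abs_ge_self moll_average_bound])
        have [measurable]: "g \<in> borel_measurable borel" "u0 \<in> borel_measurable borel" using bcs_measurable[OF g] unitbD(1)[OF uu0] by auto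
        show "(\<lambda>r. LBINT x'. g x' * \<bar>u0 (x' + \<epsilon> * r) - u0 x'\<bar>) \<in> borel_measurable borel" by measurable
        fix r :: real assume r: "\<bar>r\<bar> < 1"
        have v: "norm (\<epsilon> * r) < e1" using less_le_trans[OF mult_strict_left_mono[OF r \<epsilon>(1)], of e1] \<epsilon> by (simp add: abs_mult)
        have u3: "unitb (\<lambda>x'. u0 (x' + \<epsilon> * r))" by (rule unitb_compose[OF uu0]) measurable
        have i: "integrable lborel (\<lambda>x'. B * (indicator (cball 0 B) x' * \<bar>u0 (x' + \<epsilon> * r) - u0 x'\<bar>))"
          by (intro bcs_integrable bcs_mult2[OF bb_const] bcs_mult1 bcs_indicator bb_unitb_diff u3 uu0) auto
        have nn: "0 \<le> (LBINT x'. g x' * \<bar>u0 (x' + \<epsilon> * r) - u0 x'\<bar>)" using g0 by (intro integral_nonneg_AE) auto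
        have "(LBINT x'. g x' * \<bar>u0 (x' + \<epsilon> * r) - u0 x'\<bar>) \<le> (LBINT x'. B * (indicator (cball 0 B) x' * \<bar>u0 (x' + \<epsilon> * r) - u0 x'\<bar>))"
        proof (rule integral_mono_AE'[OF i])
          show "AE x' in lborel. g x' * \<bar>u0 (x' + \<epsilon> * r) - u0 x'\<bar> \<le> B * (indicator (cball 0 B) x' * \<bar>u0 (x' + \<epsilon> * r) - u0 x'\<bar>)"
          proof (rule AE_I2)
            fix x' :: real
            show "g x' * \<bar>u0 (x' + \<epsilon> * r) - u0 x'\<bar> \<le> B * (indicator (cball 0 B) x' * \<bar>u0 (x' + \<epsilon> * r) - u0 x'\<bar>)"
              using B(2)[of x'] B(3)[of x'] by (cases "norm x' > B") (auto intro!: mult_right_mono)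
          qed
        qed (use B in auto)
        also have "\<dots> = B * (LBINT x'. indicator (cball 0 B) x' * \<bar>u0 (x' + \<epsilon> * r) - u0 x'\<bar>)" by simp
        also have "\<dots> \<le> B * \<eta>1" using e1(2)[OF v] B by (intro mult_left_mono) auto
        finally show "\<bar>LBINT x'. g x' * \<bar>u0 (x' + \<epsilon> * r) - u0 x'\<bar>\<bar> \<le> B * \<eta>1" using nn by simp
      qed
      finally show ?thesis .
    qed
    \<comment> \<open>Here \<open>q = ((x, t), x')\<close>.\<close>
    let ?F = "\<lambda>q. (((indicator (cball 0 (B + 1)) (fst (fst q)) * W (snd (fst q))) * g (snd q)) * ke (fst (fst q) - snd q)) * \<bar>u (fst q) - u0 (snd q)\<bar>"
    let ?F1 = "\<lambda>q. (((g (fst (fst q)) * W (snd (fst q))) * indicator (cball 0 (B + 1)) (snd q)) * ke (fst (fst q) - snd q)) * \<bar>u (fst q) - u0 (fst (fst q))\<bar>"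
    let ?F2 = "\<lambda>q. ((indicator (cball 0 (B + 1)) (fst (fst q)) * W (snd (fst q))) * indicator (cball 0 (B + 2)) (snd q)) * (ke (fst (fst q) - snd q) * (Cl * \<epsilon>))"
    let ?F3 = "\<lambda>q. (((indicator (cball 0 (B + 1)) (fst (fst q)) * W (snd (fst q))) * g (snd q)) * ke (fst (fst q) - snd q)) * \<bar>u0 (fst (fst q)) - u0 (snd q)\<bar>"
    have m3 [measurable]: "(\<lambda>q::(real\<times>real)\<times>real. fst (fst q)) \<in> borel_measurable borel" by measurable
    have us3: "unitb (\<lambda>q::(real\<times>real)\<times>real. u (fst q))" "unitb (\<lambda>q::(real\<times>real)\<times>real. u0 (snd q))" "unitb (\<lambda>q::(real\<times>real)\<times>real. u0 (fst (fst q)))"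
      by (rule unitb_compose[OF uu] unitb_compose[OF uu0]; measurable)+
    have bi: "bcs (\<lambda>x. indicator (cball 0 r) x :: real)" for r :: real by (rule bcs_indicator) auto
    have bP: "bcs (\<lambda>p. a (fst p) * W (snd p))" if "bcs a" for a by (rule bcs_product[OF that W(1)])
    have kb3: "bb (\<lambda>q::(real\<times>real)\<times>real. ke (fst (fst q) - snd q))" by (rule kebb) measurable
    have bF: "bcs ?F" "bcs ?F1" "bcs ?F2" "bcs ?F3"
      by (intro bcs_mult1[OF bcs_mult1[OF bcs_product kb3]] bcs_mult1[OF bcs_product bb_mult[OF kb3 bb_const]] bP bi g bb_unitb_diff us3)+
    \<comment> \<open>\<open>?F1\<close> is the wanted integrand at x and \<open>?F\<close> the one
      that \<open>initial_estimate\<close> controls, at x'. \<open>?F2\<close> pays for replacing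
      g(x) by g(x'), \<open>?F3\<close> for replacing u0(x) by u0(x').\<close>
    have pt: "?F1 q - ?F2 q - ?F3 q \<le> ?F q" for q
    proof (cases "\<bar>fst (fst q) - snd q\<bar> < \<epsilon>")
      case True
      obtain x t x' where q: "q = ((x, t), x')" by (metis surj_pair)
      have xx: "\<bar>x - x'\<bar> < \<epsilon>" using True q by simp
      have "\<bar>g x - g x'\<bar> \<le> Cl * \<epsilon>" using order_trans[OF Cl[of x x'] mult_left_mono[of "\<bar>x - x'\<bar>" \<epsilon> Cl]] xx Cl0 by simp
      have main: "g x * \<bar>u (x, t) - u0 x\<bar> - Cl * \<epsilon> - g x' * \<bar>u0 x - u0 x'\<bar> \<le> g x' * \<bar>u (x, t) - u0 x'\<bar>"
      proof -
        have "g x * \<bar>u (x, t) - u0 x\<bar> \<le> g x' * \<bar>u (x, t) - u0 x\<bar> + Cl * \<epsilon> * 1"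
        proof -
          have "(g x - g x') * \<bar>u (x, t) - u0 x\<bar> \<le> (Cl * \<epsilon>) * 1"
            using \<open>\<bar>g x - g x'\<bar> \<le> Cl * \<epsilon>\<close> unitb_abs_diff[OF uu uu0] Cl0 \<epsilon> by (intro mult_mono) auto
          then show ?thesis by (simp add: algebra_simps)
        qed
        also have "g x' * \<bar>u (x, t) - u0 x\<bar> \<le> g x' * (\<bar>u (x, t) - u0 x'\<bar> + \<bar>u0 x - u0 x'\<bar>)"
          using g0 by (intro mult_left_mono) auto
        finally show ?thesis by (simp add: algebra_simps)
      qed
      show ?thesis
      proof (cases "\<bar>x\<bar> \<le> B + 1")
        case x: True
        have i: "indicator (cball 0 (B + 2)) x' = (1::real)" "indicator (cball 0 (B + 1)) x = (1::real)"
          using x xx \<epsilon> by (auto simp: indicator_def)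
        have "?F1 q \<le> W t * ke (x - x') * (g x * \<bar>u (x, t) - u0 x\<bar>)"
          using W(3)[of t] ken[of "x - x'"] g0[of x] by (simp add: q indicator_def mult_ac)
        moreover have "W t * ke (x - x') * (g x * \<bar>u (x, t) - u0 x\<bar> - Cl * \<epsilon> - g x' * \<bar>u0 x - u0 x'\<bar>) \<le> W t * ke (x - x') * (g x' * \<bar>u (x, t) - u0 x'\<bar>)"
          using W(3)[of t] ken[of "x - x'"] by (intro mult_left_mono main) auto
        ultimately show ?thesis using i by (simp add: q algebra_simps)
      next
        case False
        then have "g x = 0" using B(3)[of x] by simp
        then show ?thesis using False by (simp add: q)
      qed
    next
      case False
      then have "ke (fst (fst q) - snd q) = 0" by (intro kez) auto
      then show ?thesis by (simp only: mult_zero_left mult_zero_right)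
    qed
    have I1: "(LBINT q. ?F1 q) = (LBINT p. g (fst p) * W (snd p) * \<bar>u p - u0 (fst p)\<bar>)"
    proof -
      have "(LBINT x'. ?F1 (p, x')) = g (fst p) * W (snd p) * \<bar>u p - u0 (fst p)\<bar>" for p
      proof -
        have "(LBINT x'. ?F1 (p, x')) = (LBINT x'. (g (fst p) * W (snd p) * \<bar>u p - u0 (fst p)\<bar>) * ke (fst p - x'))"
        proof (rule Bochner_Integration.integral_cong[OF refl])
          fix x' :: real
          have "g (fst p) * ke (fst p - x') * indicator (cball 0 (B + 1)) x' = g (fst p) * ke (fst p - x')"
          proof (cases "g (fst p) * ke (fst p - x') = 0")
            case False
            have "\<bar>fst p\<bar> \<le> B" using B(3)[of "fst p"] False by force
            moreover have "\<bar>fst p - x'\<bar> < \<epsilon>" using kez[of "fst p - x'"] False by force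
            ultimately have "x' \<in> cball 0 (B + 1)" using \<epsilon> by auto
            then show ?thesis by simp
          qed simp
          then show "?F1 (p, x') = (g (fst p) * W (snd p) * \<bar>u p - u0 (fst p)\<bar>) * ke (fst p - x')"
            by (simp add: mult_ac) (metis mult.assoc mult.commute)
        qed
        then show ?thesis by (simp add: kes)
      qed
      then show ?thesis by (simp only: bcs_fubini(1)[OF bF(2)])
    qed
    have I2: "(LBINT q. ?F2 q) \<le> Cl * \<epsilon> * (2 * (B + 1))"
    proof -
      have "(LBINT x'. ?F2 (p, x')) \<le> (Cl * \<epsilon>) * (indicator (cball 0 (B + 1)) (fst p) * W (snd p))" for p
      proof -
        have "(LBINT x'. ?F2 (p, x')) \<le> (LBINT x'. ((Cl * \<epsilon>) * (indicator (cball 0 (B + 1)) (fst p) * W (snd p))) * ke (fst p - x'))"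
        proof (rule integral_mono_AE')
          have "integrable lborel (\<lambda>x'. ke (fst p - x'))" 
            using lborel_integrable_real_affine[of ke "-1" "fst p"] bcs_integrable[OF keb] by simp
          then show "integrable lborel (\<lambda>x'. ((Cl * \<epsilon>) * (indicator (cball 0 (B + 1)) (fst p) * W (snd p))) * ke (fst p - x'))" by simp
        qed (use Cl0 \<epsilon> W(3) ken in \<open>auto intro!: AE_I2 simp: indicator_def\<close>)
        then show ?thesis by (simp add: kes)
      qed
      then have "(LBINT p. LBINT x'. ?F2 (p, x')) \<le> (LBINT p. (Cl * \<epsilon>) * (indicator (cball (0::real) (B + 1)) (fst p) * W (snd p)))"
        using bF(3) by (intro Bochner_Integration.integral_mono bcs_integrable bcs_inner bcs_mult2[OF bb_const] bP bi) auto
      also have "\<dots> = (Cl * \<epsilon>) * (2 * (B + 1))"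
        unfolding integral_mult_right_zero bcs_product_integral[OF bi W(1)] W(2) using B(1) by (simp add: cball_eq_atLeastAtMost)
      finally show ?thesis by (simp add: bcs_fubini(1)[OF bF(3)])
    qed
    have sw: "(LBINT q. X q) = (LBINT x'. LBINT p. X (p, x'))" if "bcs X" for X :: "(real\<times>real)\<times>real \<Rightarrow> real"
      by (rule bcs_fubini(2)[OF that])
    have in3: "(LBINT p. ?F3 (p, x')) = (LBINT x. g x' * ke (x - x') * \<bar>u0 x - u0 x'\<bar>)" for x'
    proof -
      let ?h = "\<lambda>x. ?H (x', x)"
      have bh: "bcs ?h" using bcs_section1[OF bH] .
      have "(LBINT p. ?F3 (p, x')) = (LBINT p. ?h (fst p) * W (snd p))"
        by (intro Bochner_Integration.integral_cong) (auto simp: mult_ac)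
      also have "\<dots> = (LBINT x. ?h x)" unfolding bcs_product_integral[OF bh W(1)] W(2) by simp
      finally show ?thesis unfolding Heq .
    qed
    have I3: "(LBINT q. ?F3 q) = C'" unfolding sw[OF bF(4)] in3 C'_def ..
    have I0: "(LBINT q. ?F q) \<le> \<tau> * N + C'"
    proof -
      have "(LBINT p. ?F (p, x')) \<le> g x' * (2 * \<tau> * L * M / \<epsilon>) + (LBINT x. g x' * ke (x - x') * \<bar>u0 x - u0 x'\<bar>)" for x'
      proof (cases "g x' = 0")
        case False
        have eq: "?F (p, x') = g x' * ((moll ((fst p - x') / \<epsilon>) / \<epsilon>) * (w (snd p / \<tau>) / \<tau>) * \<bar>u p - u0 x'\<bar>)" for p
        proof -
          have "g x' * ke (fst p - x') * indicator (cball 0 (B + 1)) (fst p) = g x' * ke (fst p - x')"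
            using near[of x' "fst p"] by (cases "g x' * ke (fst p - x') = 0") auto
          then have "?F (p, x') = g x' * ke (fst p - x') * (W (snd p) * \<bar>u p - u0 x'\<bar>)"
            by (simp add: mult_ac) (metis mult.assoc mult.commute)
          then show ?thesis by (simp add: ke_def W_def mult_ac)
        qed
        have "(LBINT p. (moll ((fst p - x') / \<epsilon>) / \<epsilon>) * (w (snd p / \<tau>) / \<tau>) * \<bar>u p - u0 x'\<bar>)
          \<le> 2 * \<tau> * L * M / \<epsilon> + (LBINT x. (moll ((x - x') / \<epsilon>) / \<epsilon>) * \<bar>u0 x - u0 x'\<bar>)"
          unfolding M_def using G[OF False] \<epsilon> \<tau>p by (intro initial_estimate[OF u]) (auto intro: order_trans)
        from mult_left_mono[OF this g0[of x']] show ?thesis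
          unfolding eq integral_mult_right_zero by (simp add: ke_def distrib_left mult.assoc)
      qed simp
      then have "(LBINT x'. LBINT p. ?F (p, x')) \<le> (LBINT x'. g x' * (2 * \<tau> * L * M / \<epsilon>) + (LBINT x. ?H (x', x)))"
        unfolding Heq[symmetric] using bcs_inner[OF bcs_swap[OF bF(1)]]
        by (intro Bochner_Integration.integral_mono bcs_integrable bcs_add bcs_mult1[OF g bb_const] bcs_inner[OF bH]) auto
      also have "\<dots> = (LBINT x'. g x' * (2 * \<tau> * L * M / \<epsilon>)) + (LBINT x'. LBINT x. ?H (x', x))"
        by (intro Bochner_Integration.integral_add bcs_integrable bcs_mult1[OF g bb_const] bcs_inner[OF bH])
      also have "\<dots> = \<tau> * N + C'" unfolding C'_def Heq by (simp add: N_def)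
      finally show ?thesis unfolding sw[OF bF(1)] .
    qed
    have "(LBINT q. ?F1 q - ?F2 q - ?F3 q) \<le> (LBINT q. ?F q)"
      by (intro Bochner_Integration.integral_mono bcs_integrable bcs_diff bF pt)
    moreover have "(LBINT q. ?F1 q - ?F2 q - ?F3 q) = (LBINT q. ?F1 q) - (LBINT q. ?F2 q) - (LBINT q. ?F3 q)"
      using bF(2-4)[THEN bcs_integrable]
      by (simp only: Bochner_Integration.integral_diff Bochner_Integration.integrable_diff)
    ultimately have "(LBINT p. g (fst p) * W (snd p) * \<bar>u p - u0 (fst p)\<bar>) \<le> \<tau> * N + 2 * C' + Cl * \<epsilon> * (2 * (B + 1))"
      using I0 I1 I2 I3 by linarith
    also have "\<tau> * N \<le> \<eta> / 4"
    proof -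
      have "\<tau> * (4 * (N + 1)) \<le> \<eta>" using \<tau>N N0 by (simp add: pos_le_divide_eq)
      then show ?thesis using \<tau>p by (simp add: algebra_simps)
    qed
    also have "2 * C' \<le> \<eta> / 4" using C' B by (simp add: \<eta>1_def)
    also have "Cl * \<epsilon> * (2 * (B + 1)) \<le> \<eta> / 4"
    proof -
      have "Cl * \<epsilon> * (2 * (B + 1)) \<le> k * (\<eta> / (4 * k))"
        using \<epsilon> Cl0 B k mult_mono[of "Cl * (2 * (B + 1))" k \<epsilon> "\<eta> / (4 * k)"] by (simp add: k_def mult_ac)
      then show ?thesis using k by simp
    qed
    finally have "(LBINT p. g (fst p) * W (snd p) * \<bar>u p - u0 (fst p)\<bar>) \<le> \<eta>" using \<eta> by linarith
    then show "(LBINT p. g (fst p) * (w (snd p / \<tau>) / \<tau>) * \<bar>u p - u0 (fst p)\<bar>) \<le> \<eta>" unfolding W_def .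
  qed
qed

end

section \<open>Contraction along backward cones\<close>

lemma abs_lin: "0 \<le> a \<Longrightarrow> \<bar>a * b + c * d\<bar> \<le> a * \<bar>b\<bar> + \<bar>c\<bar> * \<bar>d\<bar>" for a b c d :: real
  using abs_triangle_ineq[of "a * b" "c * d"] by (simp add: abs_mult)

context two_solutions begin

definition I0 :: "(real \<times> real \<Rightarrow> real) \<Rightarrow> real" where
  "I0 g = (LBINT x. g (x, 0) * \<bar>u0 x - v0 x\<bar>)"

lemma I0_mono: 
  assumes "bcs g" "bcs h" "\<And>p. g p \<le> h p" shows "I0 g \<le> I0 h"
  unfolding I0_def using assms
  by (intro Bochner_Integration.integral_mono bcs_integrable bcs_mult1 bcs_section2 bb_unitb_diff uu0 vv0 mult_right_mono) auto

text \<open>Multiplying g by \<open>1 - wcut (t / \<tau>)\<close> makes \<open>removal\<close>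
  applicable. The new time derivative is a density on [\<tau>, 2\<tau>] weighting |u - v|, and the
  averaged initial traces turn it into the initial term.\<close>

lemma time_cutoff:
  assumes g: "C1c g gx gt" and g0: "\<And>p. 0 \<le> g p" and U: "open U" "endpoint_set \<subseteq> U" "\<And>p. p \<in> U \<Longrightarrow> g p = 0"
  shows "0 \<le> weak_form u v gx gt + I0 g + (\<Sum>i\<in>I. Q i g)"
proof -
  note cg = C1c_bcs[OF g]
  obtain B where B: "B > 0" "\<And>p. norm p > B \<Longrightarrow> g p = 0" "\<And>p. norm p > B \<Longrightarrow> gx p = 0" "\<And>p. norm p > B \<Longrightarrow> gt p = 0"
  proof -
    obtain B where "\<And>p. norm p > B \<Longrightarrow> g p = 0 \<and> gx p = 0 \<and> gt p = 0" using g unfolding C1c_def by metis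
    then show ?thesis using that[of "max B 1"] by auto
  qed
  obtain Cl where Cl: "Cl > 0" "\<And>p q. \<bar>g p - g q\<bar> \<le> Cl * norm (p - q)" using C1c_lipschitz[OF g] by metis
  obtain Cx where Cx: "Cx > 0" "\<And>t. \<bar>gx t\<bar> \<le> Cx" using bcs_bound[OF cg(2)] by metis
  obtain Ct where Ct: "Ct > 0" "\<And>t. \<bar>gt t\<bar> \<le> Ct" using bcs_bound[OF cg(3)] by metis
  define D where "D p = \<bar>u p - v p\<bar>" for p
  define P where "P p = Phi (u p) (v p)" for p
  have Db: "bb D" "\<bar>D p\<bar> \<le> 1" "0 \<le> D p" for p unfolding D_def[abs_def] using bb_unitb_diff[OF uu vv] unitb_abs_diff[OF uu vv, of p p] by auto
  have Pb: "bb P" "\<bar>P p\<bar> \<le> L" for p unfolding P_def[abs_def] using bb_unitb_Phi[OF uu vv] unitb_Phi[OF uu vv, of p p] by auto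
  let ?G = "\<Union>i\<in>I. Gam (s i) (T i) (y i)"
  \<comment> \<open>The part of the initial line that g may charge. Since 0 \<le>
    \<open>s i\<close>, a curve meets this line only at its starting point, which lies in U; hence
    the compact sets have positive distance.\<close>
  let ?S = "{-B..B} \<times> {0} - U"
  have "compact ?S" using U(1) by (intro compact_diff compact_Times) auto
  moreover have "?S \<inter> ?G = {}"
  proof (rule ccontr)
    assume "?S \<inter> ?G \<noteq> {}"
    then obtain p i where p: "p \<in> ?S" "i \<in> I" "p \<in> Gam (s i) (T i) (y i)" by blast
    then obtain t where t: "p = (y i t, t)" "s i \<le> t" by (auto simp: Gam_def)
    then have "t = 0" "s i = 0" using p(1) sT(1)[OF p(2)] by auto
    then have "p \<in> endpoints (s i) (T i) (y i)" using t by (simp add: endpoints_def)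
    then have "p \<in> endpoint_set" using p(2) by (auto simp: endpoint_set_def)
    then show False using p(1) U(2) by auto
  qed
  ultimately obtain d0 where d0: "d0 > 0" "\<And>p q. p \<in> ?S \<Longrightarrow> q \<in> ?G \<Longrightarrow> d0 \<le> dist p q"
    using separate_compact_closed[of ?S ?G] compact_imp_closed[OF compact_curves] by blast
  \<comment> \<open>Two coordinates of size at most d0/3 give a distance below d0.\<close>
  have far: False if "g (x', 0) \<noteq> 0" "q \<in> ?G" "\<bar>fst q - x'\<bar> \<le> d0 / 3" "0 \<le> snd q" "snd q \<le> d0 / 3" for x' q
  proof -
    have "norm (x', 0::real) \<le> B" using B(2)[of "(x', 0)"] that(1) by force
    then have "(x', 0) \<in> ?S" using U(3)[of "(x', 0)"] that(1) by (auto simp: norm_Pair)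
    then have "d0 \<le> dist (x', 0) q" using d0(2) that(2) by blast
    also have "\<dots> \<le> \<bar>x' - fst q\<bar> + \<bar>0 - snd q\<bar>"
      using sqrt_sum_squares_le_sum[of "\<bar>x' - fst q\<bar>" "\<bar>0 - snd q\<bar>"] by (simp add: dist_prod_def dist_real_def)
    also have "\<dots> < d0" using that d0(1) by (auto simp: abs_minus_commute)
    finally show False by simp
  qed
  have gs: "bcs (\<lambda>x. g (x, 0))" by (rule bcs_section2[OF cg(1)])
  have gsl: "\<bar>g (x, 0) - g (x', 0)\<bar> \<le> Cl * \<bar>x - x'\<bar>" for x x'
    using Cl(2)[of "(x, 0)" "(x', 0)"] by (simp add: norm_Pair)
  have "- (weak_form u v gx gt + I0 g + (\<Sum>i\<in>I. Q i g)) \<le> 0 + \<eta>" if \<eta>: "\<eta> > 0" for \<eta>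
  proof -
    have \<eta>4: "\<eta> / 4 > 0" using \<eta> by simp
    have d3: "d0 / 3 > 0" using d0(1) by simp
    have ex_u: "\<exists>\<tau>0>0. \<forall>\<tau>. 0 < \<tau> \<and> \<tau> < \<tau>0 \<longrightarrow> (LBINT p. g (fst p, 0) * (w (snd p / \<tau>) / \<tau>) * \<bar>u p - u0 (fst p)\<bar>) \<le> \<eta> / 4"
      by (rule initial_trace[OF ent_u gs g0 gsl d3 _ \<eta>4]) (rule far)
    obtain \<tau>u where \<tau>u: "\<tau>u > 0" "\<And>\<tau>. 0 < \<tau> \<Longrightarrow> \<tau> < \<tau>u \<Longrightarrow> (LBINT p. g (fst p, 0) * (w (snd p / \<tau>) / \<tau>) * \<bar>u p - u0 (fst p)\<bar>) \<le> \<eta> / 4"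
      using ex_u by blast
    have ex_v: "\<exists>\<tau>0>0. \<forall>\<tau>. 0 < \<tau> \<and> \<tau> < \<tau>0 \<longrightarrow> (LBINT p. g (fst p, 0) * (w (snd p / \<tau>) / \<tau>) * \<bar>v p - v0 (fst p)\<bar>) \<le> \<eta> / 4"
      by (rule initial_trace[OF ent_v gs g0 gsl d3 _ \<eta>4]) (rule far)
    obtain \<tau>v where \<tau>v: "\<tau>v > 0" "\<And>\<tau>. 0 < \<tau> \<Longrightarrow> \<tau> < \<tau>v \<Longrightarrow> (LBINT p. g (fst p, 0) * (w (snd p / \<tau>) / \<tau>) * \<bar>v p - v0 (fst p)\<bar>) \<le> \<eta> / 4"
      using ex_v by blast
    \<comment> \<open>\<open>CC * \<tau>\<close> collects the gradient of g over times below 2\<tau>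
      and the change of g between times 0 and 2\<tau>. It gets \<eta>/2, the initial traces of u and
      v get \<eta>/4 each.\<close>
    define CC where "CC = (Ct + L * Cx) * (2 * B) * 2 + Cl * 2 * (2 * B)"
    have CC: "CC > 0" using Ct Cx B Cl L_nonneg by (auto simp: CC_def intro!: add_nonneg_pos mult_pos_pos)
    define \<tau> where "\<tau> = min (min \<tau>u \<tau>v) (\<eta> / CC) / 2"
    have \<tau>: "\<tau> > 0" "\<tau> < \<tau>u" "\<tau> < \<tau>v" using \<tau>u \<tau>v CC \<eta> by (auto simp: \<tau>_def)
    have \<tau>C: "CC * \<tau> \<le> \<eta> / 2" 
    proof -
      have "\<tau> \<le> \<eta> / CC / 2" by (auto simp: \<tau>_def)
      then show ?thesis using CC by (simp add: field_simps)
    qed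
    define W where "W t = w (t / \<tau>) / \<tau>" for t
    define V where "V t = wcut (t / \<tau>)" for t
    have W: "bcs W" "(LBINT t. W t) = 1" "0 \<le> W t" "t \<notin> {\<tau>..2*\<tau>} \<Longrightarrow> W t = 0" for t
      unfolding W_def using wt_facts[OF \<tau>(1)] by auto
    have V: "0 \<le> V t" "V t \<le> 1" for t unfolding V_def using wcut_bounds by auto
    have "C1 (\<lambda>p. 1 - V (snd p)) (\<lambda>p. 0) (\<lambda>p. W (snd p))"
    proof (rule C1_snd)
      show "((\<lambda>t. 1 - V t) has_real_derivative W t) (at t)" for t
        unfolding V_def W_def using DERIV_diff[OF DERIV_const[of 1] wcut_scale(1)[OF \<tau>(1), of t]] by simp
      show "continuous_on UNIV W" unfolding W_def[abs_def] using \<tau>(1)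
        by (auto intro!: continuous_intros continuous_on_compose2[OF w_continuous[of UNIV]])
    qed
    from C1c_mult[OF g this] have gV: "C1c (\<lambda>p. g p * (1 - V (snd p))) (\<lambda>p. gx p * (1 - V (snd p)) + g p * 0) (\<lambda>p. gt p * (1 - V (snd p)) + g p * W (snd p))" .
    have "- (\<Sum>i\<in>I. Q i (\<lambda>p. g p * (1 - V (snd p)))) \<le> weak_form u v (\<lambda>p. gx p * (1 - V (snd p)) + g p * 0) (\<lambda>p. gt p * (1 - V (snd p)) + g p * W (snd p))"
    proof (rule removal[OF subset_refl gV _ U(1) _ _ \<tau>(1)])
      show "0 \<le> g p * (1 - V (snd p))" for p using g0 V by simp
      show "endpoint_set \<union> (\<Union>i\<in>I - I. Gam (s i) (T i) (y i)) \<subseteq> U" using U(2) by auto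
      show "g p * (1 - V (snd p)) = 0" if "p \<in> U" for p using U(3)[OF that] by simp
      show "g p * (1 - V (snd p)) = 0" if "snd p < \<tau>" for p
        unfolding V_def using that \<tau>(1) by (simp add: wcut_one)
    qed
    moreover have "(\<Sum>i\<in>I. Q i (\<lambda>p. g p * (1 - V (snd p)))) \<le> (\<Sum>i\<in>I. Q i g)"
      using g0 V by (intro sum_mono Q_mono cg C1c_bcs(1)[OF gV]) (auto simp: mult_left_le)
    moreover have "weak_form u v (\<lambda>p. gx p * (1 - V (snd p)) + g p * 0) (\<lambda>p. gt p * (1 - V (snd p)) + g p * W (snd p))
       \<le> weak_form u v gx gt + (Ct + L * Cx) * (2 * B * (2 * \<tau>)) + (LBINT p. D p * (g p * W (snd p)))"
    proof -
      have bI: "bcs (\<lambda>p. (Ct + L * Cx) * (indicator {-B..B} (fst p) * (indicator {0<..} (snd p) * V (snd p))))"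
        unfolding V_def by (intro bcs_mult2[OF bb_const] bcs_product[OF bcs_indicator wcut_scale(3)[OF \<tau>(1)]]) auto
      have Ws: "bb (\<lambda>p::real\<times>real. W (snd p))" by (rule bb_compose[OF bcs_bb[OF W(1)]]) measurable
      have bW: "bcs (\<lambda>p. D p * (g p * W (snd p)))"
        by (intro bcs_mult2[OF Db(1)] bcs_mult1[OF cg(1)] Ws)
      have iK: "integrable lborel (\<lambda>p. indicator {0<..} (snd p) * (D p * gt p + P p * gx p))"
        using weak_form_integrable[OF cg(2,3)] by (simp add: D_def P_def)
      have "weak_form u v (\<lambda>p. gx p * (1 - V (snd p)) + g p * 0) (\<lambda>p. gt p * (1 - V (snd p)) + g p * W (snd p))
        \<le> (LBINT p. indicator {0<..} (snd p) * (D p * gt p + P p * gx p)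
           + (Ct + L * Cx) * (indicator {-B..B} (fst p) * (indicator {0<..} (snd p) * V (snd p))) + D p * (g p * W (snd p)))"
        unfolding weak_form_def
      proof (rule Bochner_Integration.integral_mono)
        show "integrable lborel (\<lambda>p. indicator {0<..} (snd p) * (\<bar>u p - v p\<bar> * (gt p * (1 - V (snd p)) + g p * W (snd p)) + Phi (u p) (v p) * (gx p * (1 - V (snd p)) + g p * 0)))"
          by (rule weak_form_integrable[OF C1c_bcs(2,3)[OF gV]])
        show "integrable lborel (\<lambda>p. indicator {0<..} (snd p) * (D p * gt p + P p * gx p)
           + (Ct + L * Cx) * (indicator {-B..B} (fst p) * (indicator {0<..} (snd p) * V (snd p))) + D p * (g p * W (snd p)))"
          by (intro Bochner_Integration.integrable_add iK bcs_integrable bI bW)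
        fix p :: "real \<times> real"
        show "indicator {0<..} (snd p) * (\<bar>u p - v p\<bar> * (gt p * (1 - V (snd p)) + g p * W (snd p)) + Phi (u p) (v p) * (gx p * (1 - V (snd p)) + g p * 0))
          \<le> indicator {0<..} (snd p) * (D p * gt p + P p * gx p)
           + (Ct + L * Cx) * (indicator {-B..B} (fst p) * (indicator {0<..} (snd p) * V (snd p))) + D p * (g p * W (snd p))"
        proof (cases "snd p > 0")
          case True
          have "- (D p * gt p + P p * gx p) * V (snd p) \<le> (Ct + L * Cx) * (indicator {-B..B} (fst p) * V (snd p))"
          proof (cases "norm p \<le> B")
            case n: True
            then have f: "fst p \<in> {-B..B}" using norm_fst_le[of "fst p" "snd p"] by (auto simp: abs_le_iff)
            have "\<bar>D p * gt p\<bar> \<le> 1 * Ct" unfolding abs_mult using Db Ct by (intro mult_mono) auto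
            moreover have "\<bar>P p * gx p\<bar> \<le> L * Cx" unfolding abs_mult using Pb Cx L_nonneg by (intro mult_mono) auto
            ultimately have "- (D p * gt p + P p * gx p) \<le> Ct + L * Cx" by linarith
            then show ?thesis using f V by (simp add: mult_right_mono)
          qed (use B V Ct Cx L_nonneg in \<open>auto intro!: mult_nonneg_nonneg\<close>)
          then show ?thesis using True unfolding D_def[symmetric] P_def[symmetric] by (simp add: algebra_simps)
        next
          case False
          then have "W (snd p) = 0" using \<tau>(1) by (intro W(4)) auto
          then show ?thesis using False by simp
        qed
      qed
      also have "\<dots> = weak_form u v gx gt + (LBINT p. (Ct + L * Cx) * (indicator {-B..B} (fst p) * (indicator {0<..} (snd p) * V (snd p))))
           + (LBINT p. D p * (g p * W (snd p)))"
        using iK bcs_integrable[OF bI] bcs_integrable[OF bW]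
        by (simp only: Bochner_Integration.integral_add Bochner_Integration.integrable_add weak_form_def D_def P_def)
      also have "(LBINT p. (Ct + L * Cx) * (indicator {-B..B} (fst p) * (indicator {0<..} (snd p) * V (snd p))))
          = (Ct + L * Cx) * (2 * B * (LBINT t. indicator {0<..} t * V t))"
        unfolding integral_mult_right_zero V_def
        using bcs_product_integral[OF bcs_indicator[of "{-B..B}"] wcut_scale(3)[OF \<tau>(1)]] B(1) by simp
      also have "\<dots> \<le> (Ct + L * Cx) * (2 * B * (2 * \<tau>))"
        unfolding V_def using wcut_scale(5)[OF \<tau>(1)] Ct Cx L_nonneg B(1) by (intro mult_left_mono) auto
      finally show ?thesis by simp
    qed
    moreover have "(LBINT p. D p * (g p * W (snd p))) \<le> I0 g + \<eta> / 4 + \<eta> / 4 + Cl * (2 * \<tau>) * (2 * B)"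
    proof -
      have us: "unitb (\<lambda>p::real\<times>real. u0 (fst p))" "unitb (\<lambda>p::real\<times>real. v0 (fst p))"
        by (rule unitb_compose[OF uu0] unitb_compose[OF vv0]; measurable)+
      have Ws: "bb (\<lambda>p::real\<times>real. W (snd p))" by (rule bb_compose[OF bcs_bb[OF W(1)]]) measurable
      have bg: "bcs (\<lambda>p. g (fst p, 0) * W (snd p))" by (rule bcs_product[OF gs W(1)])
      let ?A1 = "\<lambda>p. (g (fst p, 0) * \<bar>u0 (fst p) - v0 (fst p)\<bar>) * W (snd p)"
      let ?A2 = "\<lambda>p. g (fst p, 0) * W (snd p) * \<bar>u p - u0 (fst p)\<bar>"
      let ?A3 = "\<lambda>p. g (fst p, 0) * W (snd p) * \<bar>v p - v0 (fst p)\<bar>"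
      let ?A4 = "\<lambda>p. (Cl * (2 * \<tau>)) * (indicator {-B..B} (fst p) * W (snd p))"
      have b0: "bcs (\<lambda>x. g (x, 0) * \<bar>u0 x - v0 x\<bar>)" by (intro bcs_mult1[OF gs] bb_unitb_diff uu0 vv0)
      have b1: "bcs ?A1" by (rule bcs_product[OF b0 W(1)])
      have b2: "bcs ?A2" "bcs ?A3" by (intro bcs_mult1[OF bg] bb_unitb_diff uu vv us)+
      have b4: "bcs ?A4" by (intro bcs_mult2[OF bb_const] bcs_product[OF bcs_indicator W(1)]) auto
      note ii = b1[THEN bcs_integrable] b2[THEN bcs_integrable] b4[THEN bcs_integrable]
      have "(LBINT p. D p * (g p * W (snd p))) \<le> (LBINT p. ?A1 p + ?A2 p + ?A3 p + ?A4 p)"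
      proof (rule Bochner_Integration.integral_mono)
        show "integrable lborel (\<lambda>p. D p * (g p * W (snd p)))"
          by (intro bcs_integrable bcs_mult2[OF Db(1)] bcs_mult1[OF cg(1)] Ws)
        show "integrable lborel (\<lambda>p. ?A1 p + ?A2 p + ?A3 p + ?A4 p)"
          by (intro Bochner_Integration.integrable_add ii)
        fix p
        show "D p * (g p * W (snd p)) \<le> ?A1 p + ?A2 p + ?A3 p + ?A4 p"
        proof (cases "snd p \<in> {\<tau>..2*\<tau>}")
          case True
          have gd: "D p * g p \<le> D p * g (fst p, 0) + Cl * (2 * \<tau>) * indicator {-B..B} (fst p)"
          proof (cases "norm (fst p) \<le> B")
            case n: True
            have "\<bar>g p - g (fst p, 0)\<bar> \<le> Cl * norm (p - (fst p, 0))" by (rule Cl(2))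
            also have "norm (p - (fst p, 0)) = \<bar>snd p\<bar>" by (cases p) (simp add: norm_Pair)
            also have "Cl * \<bar>snd p\<bar> \<le> Cl * (2 * \<tau>)" using True \<tau>(1) Cl by (intro mult_left_mono) auto
            finally have "g p \<le> g (fst p, 0) + Cl * (2 * \<tau>)" by simp
            then have "D p * g p \<le> D p * (g (fst p, 0) + Cl * (2 * \<tau>))" using Db(3) by (intro mult_left_mono)
            also have "D p * (g (fst p, 0) + Cl * (2 * \<tau>)) \<le> D p * g (fst p, 0) + 1 * (Cl * (2 * \<tau>))"
              using Db(2)[of p] Cl \<tau>(1) mult_right_mono[of "D p" 1 "Cl * (2 * \<tau>)"] by (simp add: distrib_left)
            finally show ?thesis using n by (simp add: indicator_def abs_le_iff)
          next
            case False
            then have "norm p > B" using norm_fst_le[of "fst p" "snd p"] by simp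
            then have "g p = 0" by (rule B(2))
            then show ?thesis using g0 Db Cl \<tau>(1) by simp
          qed
          have "D p \<le> \<bar>u0 (fst p) - v0 (fst p)\<bar> + \<bar>u p - u0 (fst p)\<bar> + \<bar>v p - v0 (fst p)\<bar>" unfolding D_def by linarith
          then have "D p * g (fst p, 0) \<le> (\<bar>u0 (fst p) - v0 (fst p)\<bar> + \<bar>u p - u0 (fst p)\<bar> + \<bar>v p - v0 (fst p)\<bar>) * g (fst p, 0)"
            using g0 by (intro mult_right_mono)
          then have "D p * g p \<le> (\<bar>u0 (fst p) - v0 (fst p)\<bar> + \<bar>u p - u0 (fst p)\<bar> + \<bar>v p - v0 (fst p)\<bar>) * g (fst p, 0) + Cl * (2 * \<tau>) * indicator {-B..B} (fst p)"
            using gd by linarith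
          from mult_right_mono[OF this W(3)[of "snd p"]] show ?thesis by (simp add: algebra_simps)
        qed (simp add: W(4))
      qed
      also have "\<dots> = (LBINT p. ?A1 p) + (LBINT p. ?A2 p) + (LBINT p. ?A3 p) + (LBINT p. ?A4 p)"
        using ii by (simp only: Bochner_Integration.integral_add Bochner_Integration.integrable_add)
      also have "(LBINT p. ?A1 p) = I0 g" unfolding bcs_product_integral[OF b0 W(1)] W(2) I0_def by simp
      also have "(LBINT p. ?A4 p) = Cl * (2 * \<tau>) * (2 * B)"
        unfolding integral_mult_right_zero using bcs_product_integral[OF bcs_indicator[of "{-B..B}"] W(1)] W(2) B(1) by simp
      finally show ?thesis using \<tau>u(2)[OF \<tau>(1,2)] \<tau>v(2)[OF \<tau>(1,3)] unfolding W_def by linarith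
    qed
    ultimately show ?thesis using \<tau>C unfolding CC_def by (simp add: algebra_simps)
  qed
  then have "- (weak_form u v gx gt + I0 g + (\<Sum>i\<in>I. Q i g)) \<le> 0" by (rule field_le_epsilon)
  then show ?thesis by linarith
qed

text \<open>Induction on the set E of end points that g may charge. Removing a product strip of size
  \<delta> around one of them changes the weak form by at most CC/\<delta> on a square of area 16
  \<delta>^2, hence by 16 CC \<delta>, which is arbitrarily small; the initial and interface terms
  only decrease.\<close>

lemma endpoint_cutoff:
  assumes "E \<subseteq> endpoint_set" "C1c g gx gt" "\<And>p. 0 \<le> g p" "open U" "endpoint_set - E \<subseteq> U" "\<And>p. p \<in> U \<Longrightarrow> g p = 0"
  shows "0 \<le> weak_form u v gx gt + I0 g + (\<Sum>i\<in>I. Q i g)"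
proof -
  have "finite endpoint_set" unfolding endpoint_set_def endpoints_def using fin by auto
  then have "finite E" using assms(1) finite_subset by blast
  then show ?thesis using assms
  proof (induction E arbitrary: g gx gt U rule: finite_induct)
    case empty
    then show ?case using time_cutoff[of g gx gt U] by auto
  next
    case (insert e E)
    note g = insert.prems(2) note g0 = insert.prems(3) note U = insert.prems(4-6)
    note cg = C1c_bcs[OF g]
    obtain Cg where Cg: "Cg > 0" "\<And>t. \<bar>g t\<bar> \<le> Cg" using bcs_bound[OF cg(1)] by metis
    obtain Cx where Cx: "Cx > 0" "\<And>t. \<bar>gx t\<bar> \<le> Cx" using bcs_bound[OF cg(2)] by metis
    obtain Ct where Ct: "Ct > 0" "\<And>t. \<bar>gt t\<bar> \<le> Ct" using bcs_bound[OF cg(3)] by metis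
    obtain Cz where Cz: "Cz > 0" "\<And>t. \<bar>dstrip t\<bar> \<le> Cz" using bcs_bound[OF bcs_strip(2)] by metis
    obtain xe te where e: "e = (xe, te)" by (cases e)
    \<comment> \<open>\<open>CC / \<delta>\<close> bounds the integrand of the subtracted part; the
      terms with the gradient of g fit in because \<delta> is at most 1.\<close>
    define CC where "CC = (Ct + Cg * Cz) + L * (Cx + Cg * Cz)"
    have CC: "CC > 0" using Ct Cx Cg Cz L_nonneg by (auto simp: CC_def intro!: add_pos_nonneg)
    have key: "- (weak_form u v gx gt + I0 g + (\<Sum>i\<in>I. Q i g)) \<le> 16 * CC * \<delta>" if \<delta>: "0 < \<delta>" "\<delta> \<le> 1" for \<delta>
    proof -
      define X where "X p = (fst p - xe) / \<delta>" for p :: "real \<times> real"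
      define Y where "Y p = (snd p - te) / \<delta>" for p :: "real \<times> real"
      have zX: "C1 (\<lambda>p. strip (X p)) (\<lambda>p. dstrip (X p) * (1 / \<delta>)) (\<lambda>p. 0)"
        using C1_strip[of "\<lambda>t. xe" "\<lambda>t. 0" \<delta>] \<delta> by (simp add: X_def)
      have "C1 (\<lambda>p. strip ((snd p - te) / \<delta>)) (\<lambda>p. 0) (\<lambda>p. dstrip ((snd p - te) / \<delta>) * (1 / \<delta>))"
      proof (rule C1_snd)
        show "((\<lambda>t. strip ((t - te) / \<delta>)) has_real_derivative dstrip ((t - te) / \<delta>) * (1 / \<delta>)) (at t)" for t
          using \<delta> by (intro DERIV_chain2[OF strip_deriv]) (auto intro!: derivative_eq_intros)
        show "continuous_on UNIV (\<lambda>t. dstrip ((t - te) / \<delta>) * (1 / \<delta>))"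
          using \<delta> by (auto intro!: continuous_intros continuous_on_compose2[OF dstrip_continuous[of UNIV]])
      qed
      then have zY: "C1 (\<lambda>p. strip (Y p)) (\<lambda>p. 0) (\<lambda>p. dstrip (Y p) * (1 / \<delta>))" by (simp add: Y_def)
      let ?zx = "\<lambda>p. dstrip (X p) * (1 / \<delta>) * strip (Y p) + strip (X p) * 0"
      let ?zt = "\<lambda>p. 0 * strip (Y p) + strip (X p) * (dstrip (Y p) * (1 / \<delta>))"
      let ?hx = "\<lambda>p. gx p * (strip (X p) * strip (Y p)) + g p * ?zx p"
      let ?ht = "\<lambda>p. gt p * (strip (X p) * strip (Y p)) + g p * ?zt p"
      have hh: "C1c (\<lambda>p. g p * (strip (X p) * strip (Y p))) ?hx ?ht"
        by (rule C1c_mult[OF g C1_mult[OF zX zY]])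
      have g2: "C1c (\<lambda>p. g p - g p * (strip (X p) * strip (Y p))) (\<lambda>p. gx p - ?hx p) (\<lambda>p. gt p - ?ht p)" by (rule C1c_diff[OF g hh])
      have z01: "0 \<le> strip (X p) * strip (Y p)" "strip (X p) * strip (Y p) \<le> 1" for p
        using strip_bounds by (auto intro!: mult_le_one)
      have g2b: "0 \<le> g p - g p * (strip (X p) * strip (Y p))" "g p - g p * (strip (X p) * strip (Y p)) \<le> g p" for p
        using z01[of p] g0[of p] by (auto simp: mult_left_le)
      let ?S = "{p. \<bar>fst p - xe\<bar> < \<delta> \<and> \<bar>snd p - te\<bar> < \<delta>}"
      have oS: "open ?S" by (intro open_Collect_conj open_Collect_less continuous_intros)
      have "0 \<le> weak_form u v (\<lambda>p. gx p - ?hx p) (\<lambda>p. gt p - ?ht p) + I0 (\<lambda>p. g p - g p * (strip (X p) * strip (Y p))) + (\<Sum>i\<in>I. Q i (\<lambda>p. g p - g p * (strip (X p) * strip (Y p))))"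
      proof (rule insert.IH[OF _ g2 g2b(1)])
        show "E \<subseteq> endpoint_set" using insert.prems(1) by auto
        show "open (U \<union> ?S)" by (rule open_Un[OF U(1) oS])
        show "endpoint_set - E \<subseteq> U \<union> ?S" using U(2) \<delta> by (auto simp: e)
        show "g p - g p * (strip (X p) * strip (Y p)) = 0" if "p \<in> U \<union> ?S" for p
        proof (cases "p \<in> U")
          case False
          then have "strip (X p) = 1" "strip (Y p) = 1" using that \<delta> by (auto simp: X_def Y_def abs_divide intro!: strip_one)
          then show ?thesis by simp
        qed (simp add: U(3))
      qed
      moreover have "weak_form u v (\<lambda>p. gx p - ?hx p) (\<lambda>p. gt p - ?ht p) = weak_form u v gx gt - weak_form u v ?hx ?ht"
        by (rule weak_form_diff[OF cg(2,3) C1c_bcs(2,3)[OF hh]])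
      moreover have "I0 (\<lambda>p. g p - g p * (strip (X p) * strip (Y p))) \<le> I0 g"
        by (rule I0_mono[OF C1c_bcs(1)[OF g2] cg(1) g2b(2)])
      moreover have "(\<Sum>i\<in>I. Q i (\<lambda>p. g p - g p * (strip (X p) * strip (Y p)))) \<le> (\<Sum>i\<in>I. Q i g)"
        by (intro sum_mono Q_mono C1c_bcs(1)[OF g2] cg(1) g2b(2))
      moreover have "\<bar>weak_form u v ?hx ?ht\<bar> \<le> 16 * CC * \<delta>"
      proof -
        let ?B = "\<lambda>p::real\<times>real. (CC / \<delta>) * (indicator {xe - 2 * \<delta>..xe + 2 * \<delta>} (fst p) * indicator {te - 2 * \<delta>..te + 2 * \<delta>} (snd p))"
        have bB: "bcs ?B" by (intro bcs_mult2[OF bb_const] bcs_product bcs_indicator) auto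
        have pt: "\<bar>indicator {0<..} (snd p) * (\<bar>u p - v p\<bar> * ?ht p + Phi (u p) (v p) * ?hx p)\<bar> \<le> ?B p" for p
        proof (cases "\<bar>X p\<bar> < 2 \<and> \<bar>Y p\<bar> < 2")
          case True
          then have box: "fst p \<in> {xe - 2 * \<delta>..xe + 2 * \<delta>}" "snd p \<in> {te - 2 * \<delta>..te + 2 * \<delta>}"
            using \<delta> by (auto simp: X_def Y_def abs_divide field_simps abs_less_iff)
          have d1: "1 \<le> 1 / \<delta>" using \<delta> by simp
          have dz: "\<bar>dstrip r * (1 / \<delta>) * strip r'\<bar> \<le> Cz * (1 / \<delta>) * 1" for r r'
            unfolding abs_mult using Cz strip_bounds \<delta> by (intro mult_mono) auto
          have gb: "\<bar>a * (strip (X p) * strip (Y p)) + g p * b\<bar> \<le> (C + Cg * Cz) / \<delta>"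
            if "\<bar>a\<bar> \<le> C" "C > 0" "\<bar>b\<bar> \<le> Cz * (1 / \<delta>)" for a b C
          proof -
            have "\<bar>a * (strip (X p) * strip (Y p)) + g p * b\<bar> \<le> \<bar>a\<bar> * \<bar>strip (X p) * strip (Y p)\<bar> + \<bar>g p\<bar> * \<bar>b\<bar>"
              by (metis abs_mult abs_triangle_ineq)
            also have "\<dots> \<le> C * 1 + Cg * (Cz * (1 / \<delta>))"
              using that z01[of p] Cg by (intro add_mono mult_mono) auto
            also have "C * 1 \<le> C * (1 / \<delta>)" using d1 that by (intro mult_left_mono) auto
            finally show ?thesis by (simp add: add_divide_distrib)
          qed
          have hx: "\<bar>?hx p\<bar> \<le> (Cx + Cg * Cz) / \<delta>" using dz[of "X p" "Y p"] Cx by (intro gb) auto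
          have ht: "\<bar>?ht p\<bar> \<le> (Ct + Cg * Cz) / \<delta>" using dz[of "Y p" "X p"] Ct by (intro gb) (auto simp: mult_ac)
          have "\<bar>\<bar>u p - v p\<bar> * ?ht p + Phi (u p) (v p) * ?hx p\<bar> \<le> \<bar>u p - v p\<bar> * \<bar>?ht p\<bar> + \<bar>Phi (u p) (v p)\<bar> * \<bar>?hx p\<bar>"
            by (rule abs_lin) simp
          also have "\<dots> \<le> 1 * ((Ct + Cg * Cz) / \<delta>) + L * ((Cx + Cg * Cz) / \<delta>)"
            using unitb_abs_diff[OF uu vv] unitb_Phi[OF uu vv] L_nonneg by (intro add_mono mult_mono hx ht) auto
          also have "\<dots> = CC / \<delta>"
            by (simp only: CC_def mult_1 times_divide_eq_right add_divide_distrib[symmetric])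
          finally show ?thesis using box CC \<delta> by (auto simp: indicator_def)
        next
          case False
          then have "strip (X p) = 0 \<or> strip (Y p) = 0" by (auto intro!: strip_zero)
          moreover have "dstrip r = 0" if "\<bar>r\<bar> \<ge> 2" for r using that by (auto simp: dstrip_def w_zero abs_if split: if_splits)
          then have "?hx p = 0" "?ht p = 0" using False strip_zero[of "X p"] strip_zero[of "Y p"] by auto
          then show ?thesis using CC \<delta> by simp
        qed
        have "\<bar>weak_form u v ?hx ?ht\<bar> \<le> (LBINT p. \<bar>indicator {0<..} (snd p) * (\<bar>u p - v p\<bar> * ?ht p + Phi (u p) (v p) * ?hx p)\<bar>)"
          unfolding weak_form_def by (rule integral_abs_bound)
        also have "\<dots> \<le> (LBINT p. ?B p)"
          by (intro Bochner_Integration.integral_mono Bochner_Integration.integrable_abs weak_form_integrable C1c_bcs(2,3)[OF hh] bcs_integrable bB pt)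
        also have "\<dots> = (CC / \<delta>) * ((4 * \<delta>) * (4 * \<delta>))"
          unfolding integral_mult_right_zero
          using bcs_product_integral[OF bcs_indicator[of "{xe - 2 * \<delta>..xe + 2 * \<delta>}"] bcs_indicator[of "{te - 2 * \<delta>..te + 2 * \<delta>}"]] \<delta> by simp
        also have "\<dots> = 16 * CC * \<delta>" using \<delta> by (simp add: field_simps)
        finally show ?thesis .
      qed
      ultimately show ?thesis by linarith
    qed
    have "- (weak_form u v gx gt + I0 g + (\<Sum>i\<in>I. Q i g)) \<le> 0 + \<eta>" if \<eta>: "\<eta> > 0" for \<eta>
    proof -
      define \<delta> where "\<delta> = min 1 (\<eta> / (16 * CC))"
      have \<delta>: "0 < \<delta>" "\<delta> \<le> 1" "\<delta> \<le> \<eta> / (16 * CC)" using \<eta> CC by (auto simp: \<delta>_def)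
      have "16 * CC * \<delta> \<le> \<eta>" using \<delta>(3) CC by (simp add: field_simps)
      then show ?thesis using key[OF \<delta>(1,2)] by linarith
    qed
    then have "- (weak_form u v gx gt + I0 g + (\<Sum>i\<in>I. Q i g)) \<le> 0" by (rule field_le_epsilon)
    then show ?case by linarith
  qed
qed

lemma kato_full:
  assumes "C1c g gx gt" "\<And>p. 0 \<le> g p"
  shows "0 \<le> weak_form u v gx gt + I0 g + (\<Sum>i\<in>I. Q i g)"
  using endpoint_cutoff[OF subset_refl assms, of "{}"] by simp

text \<open>The test function is a cutoff of the backward cone of slope \<open>L\<close>; along its lateral boundary
  the inequality \<open>|Phi| \<le> L |u - v|\<close> gives the right sign.\<close>

lemma contraction_average:
  assumes int: "integrable lborel (\<lambda>x. \<bar>u0 x - v0 x\<bar>)" and \<tau>: "0 \<le> \<tau>" and \<mu>: "0 < \<mu>" and r: "0 \<le> r"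
  shows "(LBINT p. indicator {-r..r} (fst p) * (w ((snd p - \<tau>) / \<mu> + 1) / \<mu>) * \<bar>u p - v p\<bar>)
     \<le> (LBINT x. \<bar>u0 x - v0 x\<bar>) + (\<Sum>i\<in>I. LBINT t. indicator {s i<..<T i} t * m i t)"
proof -
  \<comment> \<open>The base of a cone of slope L that still covers [-r, r] at time \<tau> +
    \<mu>.\<close>
  define R where "R = r + L * (\<tau> + \<mu>)"
  have R0: "0 \<le> R" using r L_nonneg \<tau> \<mu> by (simp add: R_def)
  \<comment> \<open>The first factor decreases from 1 to 0 during [\<tau>, \<tau> + \<mu>]; minus
    its derivative is the averaging weight. The second is 1 for t \<ge> -1 and only makes the
    support compact.\<close>
  define \<theta> where "\<theta> t = wcut ((t - \<tau>) / \<mu> + 1) * wcut (- t)" for t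
  define \<theta>' where "\<theta>' t = - w ((t - \<tau>) / \<mu> + 1) * (1 / \<mu>) * wcut (- t) + w (- t) * wcut ((t - \<tau>) / \<mu> + 1)" for t
  have wc: "continuous_on UNIV wcut" by (rule Cinf_continuous[OF Cinf_wcut])
  have th: "C1 (\<lambda>p. \<theta> (snd p)) (\<lambda>p. 0) (\<lambda>p. \<theta>' (snd p))"
  proof (rule C1_snd)
    have 1: "((\<lambda>t. wcut ((t - \<tau>) / \<mu> + 1)) has_real_derivative - w ((t - \<tau>) / \<mu> + 1) * (1 / \<mu>)) (at t)" for t
      using \<mu> by (intro DERIV_chain2[OF wcut_deriv]) (auto intro!: derivative_eq_intros)
    have 2: "((\<lambda>t. wcut (- t)) has_real_derivative w (- t)) (at t)" for t
      using DERIV_chain2[OF wcut_deriv[of "- t"] DERIV_minus[OF DERIV_ident]] by simp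
    show "(\<theta> has_real_derivative \<theta>' t) (at t)" for t
      unfolding \<theta>_def[abs_def] \<theta>'_def by (rule DERIV_mult[OF 1 2])
    show "continuous_on UNIV \<theta>'" unfolding \<theta>'_def[abs_def] using \<mu>
      by (auto intro!: continuous_intros continuous_on_compose2[OF wc] continuous_on_compose2[OF w_continuous[of UNIV]])
  qed
  \<comment> \<open>Composed with \<open>wcut\<close>, a and b cut off the right and the left side
    of the cone.\<close>
  define a where "a p = 1 * fst p + L * snd p + (- R)" for p :: "real \<times> real"
  define b where "b p = (-1) * fst p + L * snd p + (- R)" for p :: "real \<times> real"
  have wneg: "continuous_on UNIV (\<lambda>r. - w r)" by (intro continuous_intros w_continuous)
  have va: "C1 (\<lambda>p. wcut (a p)) (\<lambda>p. - w (a p) * 1) (\<lambda>p. - w (a p) * L)"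
    unfolding a_def by (rule C1_compose[OF C1_affine wcut_deriv wneg])
  have vb: "C1 (\<lambda>p. wcut (b p)) (\<lambda>p. - w (b p) * (-1)) (\<lambda>p. - w (b p) * L)"
    unfolding b_def by (rule C1_compose[OF C1_affine wcut_deriv wneg])
  let ?g = "\<lambda>p. \<theta> (snd p) * (wcut (a p) * wcut (b p))"
  let ?vx = "\<lambda>p. (- w (a p) * 1) * wcut (b p) + wcut (a p) * (- w (b p) * (-1))"
  let ?vt = "\<lambda>p. (- w (a p) * L) * wcut (b p) + wcut (a p) * (- w (b p) * L)"
  let ?gx = "\<lambda>p. 0 * (wcut (a p) * wcut (b p)) + \<theta> (snd p) * ?vx p"
  let ?gt = "\<lambda>p. \<theta>' (snd p) * (wcut (a p) * wcut (b p)) + \<theta> (snd p) * ?vt p"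
  have C: "C1 ?g ?gx ?gt" by (rule C1_mult[OF th C1_mult[OF va vb]])
  have \<theta>01: "0 \<le> \<theta> t" "\<theta> t \<le> 1" for t unfolding \<theta>_def using wcut_bounds by (auto intro!: mult_le_one)
  have g01: "0 \<le> ?g p" "?g p \<le> 1" for p using \<theta>01 wcut_bounds by (auto intro!: mult_le_one)
  have Cc: "C1c ?g ?gx ?gt"
  proof (rule C1cI[OF C, of "(2 + R + 2 * L) + (2 + \<tau> + \<mu>)"])
    fix p :: "real \<times> real" assume p: "norm p > (2 + R + 2 * L) + (2 + \<tau> + \<mu>)"
    show "?g p = 0"
    proof (rule ccontr)
      assume nz: "?g p \<noteq> 0"
      have "(snd p - \<tau>) / \<mu> + 1 < 2" using nz wcut_zero[of "(snd p - \<tau>) / \<mu> + 1"] by (force simp: \<theta>_def)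
      then have "snd p < \<tau> + \<mu>" using \<mu> by (simp add: field_simps)
      moreover have "- snd p < 2" using nz wcut_zero[of "- snd p"] by (force simp: \<theta>_def)
      ultimately have t: "\<bar>snd p\<bar> \<le> 2 + \<tau> + \<mu>" and tL: "- (2 * L) \<le> L * snd p"
        using \<tau> \<mu> mult_left_mono[of "-2" "snd p" L] L_nonneg by auto
      have "a p < 2" "b p < 2" using nz wcut_zero[of "a p"] wcut_zero[of "b p"] by force+
      then have "\<bar>fst p\<bar> \<le> 2 + R + 2 * L" using tL by (auto simp: a_def b_def)
      moreover have "norm p \<le> \<bar>fst p\<bar> + \<bar>snd p\<bar>" using norm_Pair_le[of "fst p" "snd p"] by simp
      ultimately show False using t p by linarith
    qed
  qed
  note cg = C1c_bcs[OF Cc]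
  let ?W = "\<lambda>t. w ((t - \<tau>) / \<mu> + 1) / \<mu>"
  have Wz: "?W t = 0" if "t \<notin> {\<tau>..\<tau> + \<mu>}" for t
  proof -
    have "(t - \<tau>) / \<mu> \<le> 0 \<or> (t - \<tau>) / \<mu> \<ge> 1" using that \<mu> by (auto simp: divide_le_0_iff le_divide_eq)
    then have "w ((t - \<tau>) / \<mu> + 1) = 0" by (intro w_zero) auto
    then show ?thesis by simp
  qed
  have bW: "bcs ?W"
    by (rule bcs_continuous[where B="\<tau> + \<mu>"])
      (use \<mu> \<tau> Wz in \<open>auto intro!: continuous_intros continuous_on_compose2[OF w_continuous[of UNIV]]\<close>, force)
  have bL: "bcs (\<lambda>p. indicator {-r..r} (fst p) * ?W (snd p) * \<bar>u p - v p\<bar>)"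
    by (intro bcs_mult1[OF bcs_product[OF bcs_indicator bW]] bb_unitb_diff uu vv) auto
  have "weak_form u v ?gx ?gt \<le> (LBINT p. - (indicator {-r..r} (fst p) * ?W (snd p) * \<bar>u p - v p\<bar>))"
    unfolding weak_form_def
  proof (rule Bochner_Integration.integral_mono[OF weak_form_integrable[OF cg(2,3)]])
    show "integrable lborel (\<lambda>p. - (indicator {-r..r} (fst p) * ?W (snd p) * \<bar>u p - v p\<bar>))"
      by (intro bcs_integrable bcs_uminus bL)
    fix p :: "real \<times> real"
    define D where "D = \<bar>u p - v p\<bar>"
    define P where "P = Phi (u p) (v p)"
    have D0: "0 \<le> D" by (simp add: D_def)
    have PD: "\<bar>P\<bar> \<le> L * D" unfolding P_def D_def by (rule Phi_bound)
    show "indicator {0<..} (snd p) * (\<bar>u p - v p\<bar> * ?gt p + Phi (u p) (v p) * ?gx p) \<le> - (indicator {-r..r} (fst p) * ?W (snd p) * \<bar>u p - v p\<bar>)"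
      unfolding D_def[symmetric] P_def[symmetric]
    proof (cases "snd p > 0")
      case True
      define A where "A = w (a p) * wcut (b p)"
      define B where "B = wcut (a p) * w (b p)"
      have AB: "0 \<le> A" "0 \<le> B" unfolding A_def B_def using w_nonneg wcut_bounds by auto
      have \<theta>': "\<theta>' (snd p) = - ?W (snd p)" using True by (simp add: \<theta>'_def wcut_one w_zero)
      \<comment> \<open>The lateral cutoffs contribute -L D (A + B) in time and P (B - A) in space;
        the bound |P| \<le> L D makes their sum nonpositive.\<close>
      have "P * (- A + B) \<le> \<bar>P\<bar> * (A + B)"
      proof -
        have "P * (- A + B) \<le> \<bar>P\<bar> * \<bar>- A + B\<bar>" unfolding abs_mult[symmetric] by (rule abs_ge_self)
        also have "\<dots> \<le> \<bar>P\<bar> * (A + B)" using AB by (intro mult_left_mono) auto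
        finally show ?thesis .
      qed
      also have "\<dots> \<le> (L * D) * (A + B)" using PD AB by (intro mult_right_mono) auto
      finally have "\<theta> (snd p) * (P * (- A + B)) \<le> \<theta> (snd p) * ((L * D) * (A + B))" using \<theta>01 by (intro mult_left_mono)
      moreover have "D * ?gt p + P * ?gx p = - ?W (snd p) * (wcut (a p) * wcut (b p)) * D - \<theta> (snd p) * ((L * D) * (A + B)) + \<theta> (snd p) * (P * (- A + B))"
        unfolding \<theta>' A_def B_def by (simp add: algebra_simps)
      ultimately have "D * ?gt p + P * ?gx p \<le> - ?W (snd p) * (wcut (a p) * wcut (b p)) * D" by linarith
      also have "\<dots> \<le> - (indicator {-r..r} (fst p) * ?W (snd p) * D)"
      proof (cases "fst p \<in> {-r..r} \<and> snd p \<in> {\<tau>..\<tau> + \<mu>}")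
        case T: True
        \<comment> \<open>By the choice of R, both lateral cutoffs equal 1 wherever the averaging
          weight acts on [-r, r].\<close>
        then have "L * snd p \<le> L * (\<tau> + \<mu>)" using L_nonneg by (intro mult_left_mono) auto
        then have "a p \<le> 1" "b p \<le> 1" using T by (auto simp: a_def b_def R_def)
        then show ?thesis using T by (simp add: wcut_one)
      next
        case False
        then have "indicator {-r..r} (fst p) * ?W (snd p) = 0" using Wz[of "snd p"] by auto
        then have "indicator {-r..r} (fst p) * ?W (snd p) * D = 0" by (simp only: mult_zero_left)
        moreover have "0 \<le> ?W (snd p) * (wcut (a p) * wcut (b p)) * D" using w_nonneg \<mu> wcut_bounds D0 by simp
        ultimately show ?thesis by linarith
      qed
      finally show "indicator {0<..} (snd p) * (D * ?gt p + P * ?gx p) \<le> - (indicator {-r..r} (fst p) * ?W (snd p) * D)" using True by simp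
    next
      case False
      have "(snd p - \<tau>) / \<mu> \<le> 0" using False \<tau> \<mu> by (simp add: divide_le_0_iff)
      then have "w ((snd p - \<tau>) / \<mu> + 1) = 0" by (intro w_zero) auto
      then show "indicator {0<..} (snd p) * (D * ?gt p + P * ?gx p) \<le> - (indicator {-r..r} (fst p) * ?W (snd p) * D)" using False by simp
    qed
  qed
  moreover have "0 \<le> weak_form u v ?gx ?gt + I0 ?g + (\<Sum>i\<in>I. Q i ?g)" by (rule kato_full[OF Cc g01(1)])
  moreover have "I0 ?g \<le> (LBINT x. \<bar>u0 x - v0 x\<bar>)"
    unfolding I0_def
  proof (rule Bochner_Integration.integral_mono[OF _ int])
    show "integrable lborel (\<lambda>x. ?g (x, 0) * \<bar>u0 x - v0 x\<bar>)"
      by (intro bcs_integrable bcs_mult1[OF bcs_section2[OF cg(1)]] bb_unitb_diff uu0 vv0)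
    show "?g (x, 0) * \<bar>u0 x - v0 x\<bar> \<le> \<bar>u0 x - v0 x\<bar>" for x
      using mult_right_mono[OF g01(2)[of "(x, 0)"], of "\<bar>u0 x - v0 x\<bar>"] by simp
  qed
  moreover have "(\<Sum>i\<in>I. Q i ?g) \<le> (\<Sum>i\<in>I. LBINT t. indicator {s i<..<T i} t * m i t)"
  proof (rule sum_mono)
    fix i assume i: "i \<in> I"
    show "Q i ?g \<le> (LBINT t. indicator {s i<..<T i} t * m i t)"
      unfolding Q_def
    proof (rule Bochner_Integration.integral_mono[OF Q_integrable[OF i cg(1)]])
      show "integrable lborel (\<lambda>t. indicator {s i<..<T i} t * m i t)"
        by (intro bcs_integrable bcs_mult1 bcs_indicator mb i) auto
      show "indicator {s i<..<T i} t * (?g (y i t, t) * m i t) \<le> indicator {s i<..<T i} t * m i t" for t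
        using mult_right_mono[OF g01(2)[of "(y i t, t)"] m0[OF i, of t]] by (simp add: indicator_def)
    qed
  qed
  ultimately show ?thesis by simp
qed

end

section \<open>Borel representatives and the germ\<close>

lemma AE_lebesgue_on:
  fixes A :: "'a::euclidean_space set"
  assumes "A \<in> sets borel"
  shows "(AE x in lebesgue_on A. P x) \<longleftrightarrow> (AE x in lborel. x \<in> A \<longrightarrow> P x)"
  using assms by (subst AE_restrict_space_iff) (auto simp: AE_completion_iff)

lemma borel_version:
  fixes u :: "'a::euclidean_space \<Rightarrow> real"
  assumes A: "A \<in> sets borel" and u: "Linf A u"
  obtains ub where "bb ub" "AE x in lborel. x \<in> A \<longrightarrow> ub x = u x"
proof -
  obtain C where C: "AE x in lborel. x \<in> A \<longrightarrow> \<bar>u x\<bar> \<le> C" using u AE_lebesgue_on[OF A] by (auto simp: Linf_def)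
  have "A \<in> sets lebesgue" using A by simp
  then have "(\<lambda>x. if x \<in> A then u x else 0) \<in> borel_measurable lebesgue"
    using u by (intro borel_measurable_if_I) (auto simp: Linf_def)
  then obtain u1 where u1: "u1 \<in> borel_measurable borel" "AE x in lborel. (if x \<in> A then u x else 0) = u1 x"
    using completion_ex_borel_measurable_real by force
  \<comment> \<open>Truncation at an essential bound turns it into a bound that holds
    everywhere.\<close>
  define ub where "ub x = max (- \<bar>C\<bar>) (min \<bar>C\<bar> (u1 x))" for x
  have "bb ub" unfolding ub_def using u1(1) by (intro bbI[where C="\<bar>C\<bar>"]) auto
  moreover have "AE x in lborel. x \<in> A \<longrightarrow> ub x = u x"
    using C u1(2) by eventually_elim (auto simp: ub_def)
  ultimately show ?thesis using that by blast
qed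

lemma borel_version_unit:
  fixes u :: "'a::euclidean_space \<Rightarrow> real"
  assumes A: "A \<in> sets borel" and u: "Linf A u" and u01: "AE x in lborel. x \<in> A \<longrightarrow> u x \<in> {0..1}"
  obtains ub where "unitb ub" "AE x in lborel. x \<in> A \<longrightarrow> ub x = u x"
proof -
  obtain u1 where u1: "bb u1" "AE x in lborel. x \<in> A \<longrightarrow> u1 x = u x" using borel_version[OF A u] by blast
  define ub where "ub x = max 0 (min 1 (u1 x))" for x
  have "unitb ub" unfolding ub_def unitb_def using bb_measurable[OF u1(1)] by auto
  moreover have "AE x in lborel. x \<in> A \<longrightarrow> ub x = u x"
    using u01 u1(2) by eventually_elim (auto simp: ub_def)
  ultimately show ?thesis using that by blast
qed

text \<open>Lebesgue measure is complete, so agreement almost everywhere on A with a Borel function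
  already makes F measurable there, with the same integral.\<close>

lemma lint_version:
  fixes F h :: "'a::euclidean_space \<Rightarrow> real"
  assumes A: "A \<in> sets borel" and h: "h \<in> borel_measurable borel" and eq: "AE x in lborel. x \<in> A \<longrightarrow> F x = h x"
  shows "(LINT x|lebesgue_on A. F x) = (LBINT x. indicator A x * h x)"
proof -
  have hm: "(\<lambda>x. indicator A x * h x) \<in> borel_measurable borel" using A h by auto
  then have hm': "(\<lambda>x. indicator A x * h x) \<in> borel_measurable lebesgue" by (auto intro: measurable_completion)
  have ae: "AE x in lebesgue. indicator A x * h x = indicator A x *\<^sub>R F x"
    by (rule AE_completion) (use eq in eventually_elim, auto simp: indicator_def)
  have "(LINT x|lebesgue_on A. F x) = (LINT x|lebesgue. indicator A x *\<^sub>R F x)"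
    using A by (intro integral_restrict_space) auto
  also have "\<dots> = (LINT x|lebesgue. indicator A x * h x)"
    using ae by (intro integral_cong_AE[OF borel_measurable_AE[OF hm' ae] hm']) auto
  also have "\<dots> = (LBINT x. indicator A x * h x)" using hm by (intro integral_completion) auto
  finally show ?thesis .
qed

text \<open>Extends the flux by its boundary values, which keeps the Lipschitz constant that it has
  on [0, 1].\<close>

definition clampf :: "(real \<Rightarrow> real) \<Rightarrow> real \<Rightarrow> real" where
  "clampf f r = f (max 0 (min 1 r))"

lemma clampf_eq: "r \<in> {0..1} \<Longrightarrow> clampf f r = f r"
  by (auto simp: clampf_def)

lemma flux_lipschitz:
  assumes "flux f" obtains L where "lipschitz_flux (clampf f) L"
proof -
  obtain f' f'' where d: "\<And>x. x \<in> {0..1} \<Longrightarrow> (f has_real_derivative f' x) (at x within {0..1})"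
    "\<And>x. x \<in> {0..1} \<Longrightarrow> (f' has_real_derivative f'' x) (at x within {0..1})"
    using assms unfolding flux_def C2_on_def by blast
  have "continuous_on {0..1} f'" using d(2) by (rule DERIV_continuous_on)
  then have "compact (f' ` {0..1})" by (intro compact_continuous_image) auto
  then obtain L where L: "L > 0" "\<And>x. x \<in> {0..1} \<Longrightarrow> \<bar>f' x\<bar> \<le> L"
    using compact_imp_bounded bounded_pos by (metis image_eqI real_norm_def)
  have lip: "\<bar>f a - f b\<bar> \<le> L * \<bar>a - b\<bar>" if "a \<in> {0..1}" "b \<in> {0..1}" for a b
    using field_differentiable_bound[of "{0..1}" f f' L a b] d(1) L that by auto
  have "lipschitz_flux (clampf f) L"
  proof
    fix a b
    have "\<bar>clampf f a - clampf f b\<bar> \<le> L * \<bar>max 0 (min 1 a) - max 0 (min 1 b)\<bar>"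
      unfolding clampf_def by (rule lip) auto
    also have "\<dots> \<le> L * \<bar>a - b\<bar>" using L(1) by (intro mult_left_mono) auto
    finally show "\<bar>clampf f a - clampf f b\<bar> \<le> L * \<bar>a - b\<bar>" .
  qed (use L in auto)
  then show ?thesis using that by blast
qed

lemma (in lipschitz_flux) Phis_eq:
  assumes "f = clampf h" "a \<in> {0..1}" "b \<in> {0..1}"
  shows "Phis h s a b = PhiS s a b" "Phis h 0 a b = Phi a b"
proof -
  have *: "Phis h s a b = sgn (a - b) * (h a - h b) - s * (sgn (a - b) * (a - b))" for s
    by (simp add: Phis_def Fs_def algebra_simps)
  have "sgn (a - b) * (a - b) = \<bar>a - b\<bar>" by (simp add: abs_sgn mult.commute)
  moreover have "f a = h a" "f b = h b" using assms by (simp_all add: clampf_eq)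
  ultimately show "Phis h s a b = PhiS s a b" "Phis h 0 a b = Phi a b"
    by (simp_all add: * PhiS_def Phi_def)
qed

section \<open>Concavity of the moving flux and dissipativity of the germ\<close>

lemma Fs_concave: 
  assumes "flux f" "a \<in> {0..1}" "b \<in> {0..1}" "0 \<le> l" "l \<le> 1"
  shows "l * Fs f s a + (1 - l) * Fs f s b \<le> Fs f s (l * a + (1 - l) * b)"
proof -
  have "concave_on {0..1} f" using assms(1) by (simp add: flux_def)
  then have "l * f a + (1 - l) * f b \<le> f (l * a + (1 - l) * b)"
    using concave_onD[of "{0..1}" f "1 - l" a b] assms by simp
  then show ?thesis by (simp add: Fs_def algebra_simps)
qed

text \<open>Write k as a convex combination of a and b. Concavity keeps the value above the smaller
  end value, strictly so when the larger end value carries positive weight.\<close>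

lemma Fs_between:
  assumes f: "flux f" and "a \<in> {0..1}" "b \<in> {0..1}" "a \<le> k" "k \<le> b"
  shows "min (Fs f s a) (Fs f s b) \<le> Fs f s k"
    and "a < k \<Longrightarrow> Fs f s b < Fs f s a \<Longrightarrow> k < b \<Longrightarrow> Fs f s b < Fs f s k"
    and "k < b \<Longrightarrow> Fs f s a < Fs f s b \<Longrightarrow> a < k \<Longrightarrow> Fs f s a < Fs f s k"
proof -
  have *: "\<exists>l. 0 \<le> l \<and> l \<le> 1 \<and> k = l * a + (1 - l) * b \<and> (k < b \<longrightarrow> 0 < l) \<and> (a < k \<longrightarrow> l < 1)"
  proof (cases "a = b")
    case True
    then show ?thesis using assms by (intro exI[of _ "1/2"]) auto
  next
    case False
    then have ab: "a < b" using assms by auto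
    define l where "l = (b - k) / (b - a)"
    have "l * (b - a) = b - k" using ab by (simp add: l_def)
    then have "k = l * a + (1 - l) * b" by (simp add: algebra_simps)
    moreover have "0 \<le> l" "l \<le> 1" "k < b \<longrightarrow> 0 < l" "a < k \<longrightarrow> l < 1" using ab assms by (auto simp: l_def field_simps)
    ultimately show ?thesis by blast
  qed
  then obtain l where l: "0 \<le> l" "l \<le> 1" "k = l * a + (1 - l) * b" "k < b \<longrightarrow> 0 < l" "a < k \<longrightarrow> l < 1" by blast
  have c: "l * Fs f s a + (1 - l) * Fs f s b \<le> Fs f s k" using Fs_concave[OF f assms(2,3) l(1,2)] l(3) by simp
  have "l * min (Fs f s a) (Fs f s b) + (1 - l) * min (Fs f s a) (Fs f s b) \<le> l * Fs f s a + (1 - l) * Fs f s b"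
    using l by (intro add_mono mult_left_mono) auto
  then show "min (Fs f s a) (Fs f s b) \<le> Fs f s k" using c by (simp add: algebra_simps)
  show "Fs f s b < Fs f s k" if "a < k" "Fs f s b < Fs f s a" "k < b"
  proof -
    have "l * Fs f s b < l * Fs f s a" using that l by (intro mult_strict_left_mono) auto
    then show ?thesis using c by (simp add: algebra_simps)
  qed
  show "Fs f s a < Fs f s k" if "k < b" "Fs f s a < Fs f s b" "a < k"
  proof -
    have "(1 - l) * Fs f s a < (1 - l) * Fs f s b" using that l by (intro mult_strict_left_mono) auto
    then show ?thesis using c by (simp add: algebra_simps)
  qed
qed

lemma Fs_continuous: assumes "flux f" shows "continuous_on {0..1} (Fs f s)"
proof -
  obtain f' where "\<And>x. x \<in> {0..1} \<Longrightarrow> (f has_real_derivative f' x) (at x within {0..1})"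
    using assms unfolding flux_def C2_on_def by blast
  then have "continuous_on {0..1} f" by (rule DERIV_continuous_on)
  then show ?thesis unfolding Fs_def[abs_def] by (intro continuous_intros)
qed

text \<open>A level strictly below the maximum is attained at most once on each side of a maximum point.\<close>

lemma level_set:
  assumes f: "flux f" and q: "(s \<ge> 0 \<longrightarrow> q \<in> {0..<maxF f s}) \<and> (s < 0 \<longrightarrow> q \<in> {- s..<maxF f s})"
  shows "finite {r \<in> {0..1}. Fs f s r = q}" "{r \<in> {0..1}. Fs f s r = q} \<noteq> {}"
proof -
  have c: "continuous_on {0..1} (Fs f s)" by (rule Fs_continuous[OF f])
  obtain k where k: "k \<in> {0..1}" "\<And>r. r \<in> {0..1} \<Longrightarrow> Fs f s r \<le> Fs f s k"
    using continuous_attains_sup[OF _ _ c] by auto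
  have "maxF f s \<le> Fs f s k" unfolding maxF_def by (rule cSUP_least) (use k in auto)
  then have qk: "q < Fs f s k" using q by (cases "s \<ge> 0") auto
  \<comment> \<open>The moving flux vanishes at 0, and the admissible levels are nonnegative for
    either sign of s; so the level is reached between 0 and the maximum point.\<close>
  have q0: "Fs f s 0 \<le> q" using q f by (cases "s \<ge> 0") (auto simp: Fs_def flux_def)
  obtain x where "0 \<le> x" "x \<le> k" "Fs f s x = q"
    using IVT'[of "Fs f s" 0 q k] q0 qk k(1) continuous_on_subset[OF c, of "{0..k}"] by auto
  then have "x \<in> {r \<in> {0..1}. Fs f s r = q}" using k(1) by auto
  then show "{r \<in> {0..1}. Fs f s r = q} \<noteq> {}" by blast
  \<comment> \<open>Of two solutions on the same side of k, the one nearer to k lies strictly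
    between the other and k, so concavity would lift it strictly above q.\<close>
  have one: "r = r'" if "r \<in> {0..1}" "r' \<in> {0..1}" "Fs f s r = q" "Fs f s r' = q" "r < k \<and> r' < k \<or> k < r \<and> k < r'" for r r'
  proof (rule ccontr)
    assume "r \<noteq> r'"
    then consider "r < r'" | "r' < r" by linarith
    then show False
    proof cases
      case 1
      show ?thesis
      proof (cases "k < r")
        case True
        then show ?thesis using Fs_between(2)[OF f k(1) that(2), of r s] 1 that qk by simp
      next
        case False
        then show ?thesis using Fs_between(3)[OF f that(1) k(1), of r' s] 1 that qk by auto
      qed
    next
      case 2
      show ?thesis
      proof (cases "k < r'")
        case True
        then show ?thesis using Fs_between(2)[OF f k(1) that(1), of r' s] 2 that qk by simp
      next
        case False
        then show ?thesis using Fs_between(3)[OF f that(2) k(1), of r s] 2 that qk by auto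
      qed
    qed
  qed
  have fin: "finite S" if "\<And>x y. x \<in> S \<Longrightarrow> y \<in> S \<Longrightarrow> x = y" for S :: "real set"
  proof (cases "S = {}")
    case False
    then obtain x where "x \<in> S" by blast
    then have "S \<subseteq> {x}" using that by blast
    then show ?thesis by (rule finite_subset) simp
  qed simp
  have "{r \<in> {0..1}. Fs f s r = q} = {r \<in> {0..1}. Fs f s r = q \<and> r < k} \<union> {r \<in> {0..1}. Fs f s r = q \<and> k < r}"
    using qk by (auto simp: not_less_iff_gr_or_eq)
  moreover have "finite {r \<in> {0..1}. Fs f s r = q \<and> r < k}"
    by (rule fin, rule one) auto
  moreover have "finite {r \<in> {0..1}. Fs f s r = q \<and> k < r}"
    by (rule fin, rule one) auto
  ultimately show "finite {r \<in> {0..1}. Fs f s r = q}" by simp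
qed

text \<open>Dissipation needs only two types of pairs: the nonclassical downward jump, which
  saturates the level, and the classical pairs, constant or increasing, whose flux stays below
  it.\<close>

lemma germ_cases:
  assumes f: "flux f" and q: "(s \<ge> 0 \<longrightarrow> q \<in> {0..<maxF f s}) \<and> (s < 0 \<longrightarrow> q \<in> {- s..<maxF f s})"
    and g: "(l, r) \<in> germ f s q"
  obtains "l \<in> {0..1}" "r \<in> {0..1}" "r \<le> l" "Fs f s l = q" "Fs f s r = q"
  | "l \<in> {0..1}" "r \<in> {0..1}" "l \<le> r" "Fs f s l = Fs f s r" "Fs f s r \<le> q"
proof -
  note ls = level_set[OF f q]
  have M: "rho_hat f s q \<in> {r \<in> {0..1}. Fs f s r = q}" unfolding rho_hat_def by (rule Max_in[OF ls])
  have m: "rho_check f s q \<in> {r \<in> {0..1}. Fs f s r = q}" unfolding rho_check_def by (rule Min_in[OF ls])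
  have "rho_check f s q \<le> rho_hat f s q" unfolding rho_check_def by (rule Min_le[OF ls(1) M])
  then show ?thesis using g M m that by (auto simp: germ_def)
qed

text \<open>The jump of the Kruzhkov flux across the interface is
  \<open>(sgn (r - r') - sgn (l - l')) (v - v')\<close> with \<open>v, v'\<close> the common flux values. It is positive only if
  the larger of the two values exceeds the constraint level that the other solution saturates.\<close>

lemma germ_dissipation:
  assumes f: "flux f" 
    and q: "(s \<ge> 0 \<longrightarrow> q \<in> {0..<maxF f s}) \<and> (s < 0 \<longrightarrow> q \<in> {- s..<maxF f s})"
    and q': "(s \<ge> 0 \<longrightarrow> q' \<in> {0..<maxF f s}) \<and> (s < 0 \<longrightarrow> q' \<in> {- s..<maxF f s})"
    and g: "(l, r) \<in> germ f s q" and g': "(l', r') \<in> germ f s q'"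
  shows "Phis f s r r' - Phis f s l l' \<le> 2 * \<bar>q - q'\<bar>"
proof -
  define v where "v = Fs f s r"
  define v' where "v' = Fs f s r'"
  have sg: "\<bar>sgn x - sgn y\<bar> \<le> 2" for x y :: real by (auto simp: sgn_real_def)
  have sm: "sgn x \<le> sgn y" if "x \<le> y" for x y :: real using that by (auto simp: sgn_real_def)
  \<comment> \<open>Every germ pair satisfies the Rankine-Hugoniot condition, so one flux value per
    solution suffices.\<close>
  have lv: "Fs f s l = v" "Fs f s l' = v'"
    using germ_cases[OF f q g] germ_cases[OF f q' g'] by (metis v_def, metis v'_def)
  have eq: "Phis f s r r' - Phis f s l l' = (sgn (r - r') - sgn (l - l')) * (v - v')"
    by (simp add: Phis_def lv v_def v'_def algebra_simps)
  have le2: "(sgn (r - r') - sgn (l - l')) * (v - v') \<le> 2 * \<bar>v - v'\<bar>"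
    using abs_ge_self[of "(sgn (r - r') - sgn (l - l')) * (v - v')"] mult_right_mono[OF sg[of "r - r'" "l - l'"], of "\<bar>v - v'\<bar>"]
    by (simp add: abs_mult)
  show ?thesis unfolding eq
  proof (rule germ_cases[OF f q g]; rule germ_cases[OF f q' g'])
    assume "Fs f s r = q" "Fs f s r' = q'"
    then show "(sgn (r - r') - sgn (l - l')) * (v - v') \<le> 2 * \<bar>q - q'\<bar>" using le2 by (simp add: v_def v'_def)
  next
    assume a: "r \<le> l" "Fs f s r = q" "l' \<le> r'" "Fs f s r' \<le> q'"
    show "(sgn (r - r') - sgn (l - l')) * (v - v') \<le> 2 * \<bar>q - q'\<bar>"
    \<comment> \<open>If v \<le> v', then q = v \<le> v' \<le> q' and the flux difference is at most
      |q - q'|. Otherwise r \<le> l and l' \<le> r' make the sign difference nonpositive while v -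
      v' is positive.\<close>
    proof (cases "v \<le> v'")
      case True
      then show ?thesis using le2 a by (auto simp: v_def v'_def)
    next
      case False
      have "sgn (r - r') - sgn (l - l') \<le> 0" using sm[of "r - r'" "l - l'"] a by auto
      then have "(sgn (r - r') - sgn (l - l')) * (v - v') \<le> 0" using False by (intro mult_nonpos_nonneg) auto
      then show ?thesis by (rule order_trans) simp
    qed
  next
    assume a: "r' \<le> l'" "Fs f s r' = q'" "l \<le> r" "Fs f s r \<le> q"
    show "(sgn (r - r') - sgn (l - l')) * (v - v') \<le> 2 * \<bar>q - q'\<bar>"
    proof (cases "v' \<le> v")
      case True
      then show ?thesis using le2 a by (auto simp: v_def v'_def)
    next
      case False
      have "0 \<le> sgn (r - r') - sgn (l - l')" using sm[of "l - l'" "r - r'"] a by auto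
      then have "(sgn (r - r') - sgn (l - l')) * (v - v') \<le> 0" using False by (intro mult_nonneg_nonpos) auto
      then show ?thesis by (rule order_trans) simp
    qed
  next
    assume a: "l \<in> {0..1}" "r \<in> {0..1}" "l \<le> r" "l' \<in> {0..1}" "r' \<in> {0..1}" "l' \<le> r'"
    \<comment> \<open>Two classical pairs: on the interval spanned by a pair the moving flux is at
      least its common value, so the states with the smaller flux lie outside the interval of the
      other pair. This orders the two signs.\<close>
    have bet: "v \<le> Fs f s k" if "l \<le> k" "k \<le> r" for k
      using Fs_between(1)[OF f a(1,2) that, of s] lv by (simp add: v_def)
    have bet': "v' \<le> Fs f s k" if "l' \<le> k" "k \<le> r'" for k
      using Fs_between(1)[OF f a(4,5) that, of s] lv by (simp add: v'_def)
    have "(sgn (r - r') - sgn (l - l')) * (v - v') \<le> 0"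
    proof (cases "v = v'")
      case False
      then consider "v < v'" | "v' < v" by linarith
      then show ?thesis
      proof cases
        case 1
        have "\<not> (l' \<le> l \<and> l \<le> r')" "\<not> (l' \<le> r \<and> r \<le> r')" using bet'[of l] bet'[of r] lv 1 by (auto simp: v_def)
        then have "l < l' \<or> l > r'" "r < l' \<or> r > r'" by auto
        then have "sgn (l - l') \<le> sgn (r - r')" using a by (auto simp: sgn_real_def)
        then show ?thesis using 1 by (intro mult_nonneg_nonpos) auto
      next
        case 2
        have "\<not> (l \<le> l' \<and> l' \<le> r)" "\<not> (l \<le> r' \<and> r' \<le> r)" using bet[of l'] bet[of r'] lv 2 by (auto simp: v'_def)
        then have "l' < l \<or> l' > r" "r' < l \<or> r' > r" by auto
        then have "sgn (r - r') \<le> sgn (l - l')" using a by (auto simp: sgn_real_def)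
        then show ?thesis using 2 by (intro mult_nonpos_nonneg) auto
      qed
    qed simp
    then show "(sgn (r - r') - sgn (l - l')) * (v - v') \<le> 2 * \<bar>q - q'\<bar>" by (rule order_trans) simp
  qed
qed

text \<open>The reflected mollifier is admissible because its support [t - e, t + e] lies in the
  open interval; the sign from the reflection cancels that of the integration by parts.\<close>

lemma weak_derivative_moll:
  assumes wdv: "weak_derivative {s<..<T} y dy" and e: "0 < e" "s < t - e" "t + e < T"
    and yb: "yb \<in> borel_measurable borel" "\<And>r. r \<in> {s<..<T} \<Longrightarrow> yb r = y r"
    and c: "c \<in> borel_measurable borel" "AE r in lborel. r \<in> {s<..<T} \<longrightarrow> c r = dy r"
  shows "(LBINT r. yb r * (deriv moll ((t - r) / e) / e)) = (LBINT r. c r * moll ((t - r) / e))"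
proof -
  define g where "g r = moll ((t - r) / e)" for r
  have mc: "continuous_on UNIV moll" "continuous_on UNIV (deriv moll)"
    using Cinf_continuous[OF Cinf_moll] Cinf_continuous[OF Cinf_deriv(2)[OF Cinf_moll]] .
  have [measurable]: "moll \<in> borel_measurable borel" "deriv moll \<in> borel_measurable borel"
    using mc borel_measurable_continuous_onI by auto
  note [measurable] = yb(1) c(1)
  have out: "\<bar>(t - r) / e\<bar> \<ge> 1" if "r \<notin> {t - e..t + e}" for r
    using that e by (auto simp: abs_divide field_simps)
  have gz: "g r = 0" "deriv moll ((t - r) / e) = 0" if "r \<notin> {t - e..t + e}" for r
    unfolding g_def using out[OF that] by (auto simp: moll_zero moll'_zero)
  have d: "deriv g r = - (deriv moll ((t - r) / e) / e)" for r
    unfolding g_def using e by (intro DERIV_imp_deriv DERIV_cong[OF DERIV_chain2[OF moll_deriv]]) (auto intro!: derivative_eq_intros)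
  have supp: "{r. g r \<noteq> 0} \<subseteq> {t - e..t + e}" using gz(1) by blast
  have cl: "closure {r. g r \<noteq> 0} \<subseteq> {t - e..t + e}"
    by (rule closure_minimal[OF supp]) simp
  have "test_on {s<..<T} g"
    unfolding test_on_def
  proof (intro conjI)
    show "Cinf g" unfolding g_def using Cinf_scale[OF Cinf_moll, of "-1/e" "t/e"] by (simp add: diff_divide_distrib)
    show "compact (closure {r. g r \<noteq> 0})" by (intro compact_closure[THEN iffD2] bounded_subset[OF bounded_closed_interval supp])
    show "closure {r. g r \<noteq> 0} \<subseteq> {s<..<T}" using cl e by (auto simp: subset_iff)
  qed
  then have "(LINT r|lebesgue_on {s<..<T}. y r * deriv g r) = - (LINT r|lebesgue_on {s<..<T}. dy r * g r)"
    using wdv by (auto simp: weak_derivative_def)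
  moreover have "(LINT r|lebesgue_on {s<..<T}. y r * deriv g r) = (LBINT r. indicator {s<..<T} r * (yb r * (- (deriv moll ((t - r) / e) / e))))"
    by (rule lint_version) (use yb(2) d in auto)
  moreover have "(LINT r|lebesgue_on {s<..<T}. dy r * g r) = (LBINT r. indicator {s<..<T} r * (c r * moll ((t - r) / e)))"
    by (rule lint_version) (use c(2) in \<open>auto simp: g_def elim: eventually_mono\<close>)
  moreover have "(LBINT r. indicator {s<..<T} r * (c r * moll ((t - r) / e))) = (LBINT r. c r * moll ((t - r) / e))"
    by (intro Bochner_Integration.integral_cong refl) (use gz(1) e in \<open>force simp: indicator_def g_def\<close>)
  moreover have "(LBINT r. indicator {s<..<T} r * (yb r * (- (deriv moll ((t - r) / e) / e)))) = (LBINT r. - (yb r * (deriv moll ((t - r) / e) / e)))"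
    by (intro Bochner_Integration.integral_cong refl) (use gz(2) e in \<open>force simp: indicator_def\<close>)
  ultimately show ?thesis by simp
qed

section \<open>Null sets along shifted curves\<close>

lemma AE_shift:
  fixes c :: "'a::euclidean_space"
  assumes "AE x in lborel. P x" shows "AE x in lborel. P (c + x)"
proof -
  have "AE x in distr lborel borel ((+) c). P x" using assms unfolding lborel_distr_plus .
  then show ?thesis by (rule AE_distrD[rotated]) simp
qed

lemma AE_reflect:
  fixes \<epsilon> :: real
  assumes "AE x in lborel. P x" "\<bar>\<epsilon>\<bar> = 1" shows "AE x in lborel. P (\<epsilon> * x)"
proof (cases "\<epsilon> = 1")
  case False
  then have \<epsilon>: "\<epsilon> = -1" using assms(2) by auto
  have "AE x in distr lborel borel (uminus :: real \<Rightarrow> real). P x" using assms(1) unfolding lborel_distr_uminus .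
  then have "AE x in lborel. P (- x)" by (rule AE_distrD[rotated]) simp
  then show ?thesis by (simp add: \<epsilon>)
qed (use assms in simp)

text \<open>The exceptional set is enlarged to a Borel null set, for which almost all sections in
  either direction are null.\<close>

lemma AE_sections:
  assumes "AE p in (lborel :: (real \<times> real) measure). P p"
  obtains N where "N \<in> sets borel" "\<And>p. p \<notin> N \<Longrightarrow> P p" "AE x in lborel. AE t in lborel. (x, t) \<notin> N" "AE t in lborel. AE x in lborel. (x, t) \<notin> N"
proof -
  obtain N where N: "{p \<in> space lborel. \<not> P p} \<subseteq> N" "emeasure lborel N = 0" "N \<in> sets (lborel :: (real\<times>real) measure)"
    using AE_E[OF assms] by blast
  have Ns: "N \<in> sets borel" using N by simp
  have "N \<in> null_sets lborel" using N by auto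
  then have ae: "AE p in lborel. p \<notin> N" by (rule AE_not_in)
  then have a1: "AE x in lborel. AE t in lborel. (x, t) \<notin> N"
    using lborel_pair.AE_pair[of "\<lambda>p. p \<notin> N"] unfolding lborel_prod by blast
  have "{p \<in> space (lborel \<Otimes>\<^sub>M lborel). (fst p, snd p) \<notin> N} \<in> sets ((lborel :: real measure) \<Otimes>\<^sub>M (lborel :: real measure))"
  proof -
    have "{p \<in> space (lborel \<Otimes>\<^sub>M lborel). (fst p, snd p) \<notin> N} = - N" by (auto simp: space_pair_measure)
    also have "- N \<in> sets (lborel :: (real\<times>real) measure)" using Ns by auto
    finally show ?thesis by (simp only: lborel_prod)
  qed
  then have "AE t in lborel. AE x in lborel. (x, t) \<notin> N"
    using lborel_pair.AE_commute[of "\<lambda>x t. (x, t) \<notin> N"] a1 by simp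
  then show ?thesis using that[OF Ns _ a1] N(1) by auto
qed

text \<open>For almost every offset the shifted curve meets a null set of the plane in a null set of
  times, so changing the representative of a solution does not affect its traces.\<close>

lemma AE_shear:
  fixes y :: "real \<Rightarrow> real"
  assumes y: "continuous_on UNIV y" and P: "AE p in lborel. P p"
  shows "AE \<xi> in lborel. AE t in lborel. P (y t + \<xi>, t)"
proof -
  obtain N where N: "N \<in> sets borel" "\<And>p. p \<notin> N \<Longrightarrow> P p" "AE t in lborel. AE x in lborel. (x, t) \<notin> N"
    using AE_sections[OF P] by metis
  have [measurable]: "y \<in> borel_measurable borel" using y by (rule borel_measurable_continuous_onI)
  have a: "AE t in lborel. AE \<xi> in lborel. (y t + \<xi>, t) \<notin> N"
    using N(3) by eventually_elim (rule AE_shift)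
  have m: "(\<lambda>p::real\<times>real. (y (fst p) + snd p, fst p)) \<in> borel_measurable borel" by measurable
  have "{p \<in> space (lborel \<Otimes>\<^sub>M lborel). (y (fst p) + snd p, fst p) \<notin> N} \<in> sets ((lborel :: real measure) \<Otimes>\<^sub>M (lborel :: real measure))"
  proof -
    have "{p \<in> space (lborel \<Otimes>\<^sub>M lborel). (y (fst p) + snd p, fst p) \<notin> N} = (\<lambda>p. (y (fst p) + snd p, fst p)) -` (- N)" by (auto simp: space_pair_measure)
    also have "\<dots> \<in> sets (lborel :: (real\<times>real) measure)" using measurable_sets[OF m, of "- N"] N(1) by auto
    finally show ?thesis by (simp only: lborel_prod)
  qed
  then have "AE \<xi> in lborel. AE t in lborel. (y t + \<xi>, t) \<notin> N"
    using lborel_pair.AE_commute[of "\<lambda>t \<xi>. (y t + \<xi>, t) \<notin> N"] a by simp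
  then show ?thesis
  proof eventually_elim
    case (elim \<xi>)
    then show ?case by eventually_elim (rule N(2))
  qed
qed

section \<open>From the definitions to Borel data\<close>

lemma open_Omega: "Omega \<in> sets borel"
  unfolding Omega_def by (intro borel_open open_Times) auto

context lipschitz_flux begin

lemma entropic_conversion:
  assumes h: "f = clampf h" and ei: "entropy_ineq h G \<rho>o \<rho>"
    and u: "unitb u" "AE p in lborel. p \<in> Omega \<longrightarrow> u p = \<rho> p" and u0: "unitb u0" "AE x in lborel. u0 x = \<rho>o x"
  shows "entropic G u0 u"
  unfolding entropic_def
proof (intro conjI allI impI u(1) u0(1))
  fix a b :: "real \<Rightarrow> real" and \<kappa> X1 X2 T1 T2 :: real
  assume H: "Cinf a \<and> Cinf b \<and> (\<forall>x. 0 \<le> a x) \<and> (\<forall>t. 0 \<le> b t) \<and> (\<forall>x. x \<notin> {X1..X2} \<longrightarrow> a x = 0) \<and>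
        (\<forall>t\<ge>0. t \<notin> {T1..T2} \<longrightarrow> b t = 0) \<and> {X1..X2} \<times> {max 0 T1..T2} \<inter> G = {} \<and> \<kappa> \<in> {0..1}"
  define g where "g p = a (fst p) * b (snd p)" for p :: "real \<times> real"
  let ?S = "{X1..X2} \<times> {max 0 T1..T2}"
  \<comment> \<open>Only the closed half plane counts for the support, so b may be nonzero at all
    negative times.\<close>
  have supp: "{p \<in> Omega_bar. g p \<noteq> 0} \<subseteq> ?S"
  proof
    fix p assume p: "p \<in> {p \<in> Omega_bar. g p \<noteq> 0}"
    then have "0 \<le> snd p" "a (fst p) \<noteq> 0" "b (snd p) \<noteq> 0" by (auto simp: Omega_bar_def g_def)
    then have "fst p \<in> {X1..X2}" "snd p \<in> {T1..T2}" using H by blast+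
    then show "p \<in> ?S" using \<open>0 \<le> snd p\<close> by (auto simp: mem_Times_iff)
  qed
  have cS: "compact ?S" by (intro compact_Times) auto
  have cl: "closure {p \<in> Omega_bar. g p \<noteq> 0} \<subseteq> ?S"
    using supp cS by (intro closure_minimal compact_imp_closed)
  have "test_half_plane G g"
    unfolding test_half_plane_def
  proof (intro conjI)
    have "Cinf (\<lambda>p::real\<times>real. a (fst p))" "Cinf (\<lambda>p::real\<times>real. b (snd p))"
      using Cinf_affine[OF bounded_linear_fst, of a 0] Cinf_affine[OF bounded_linear_snd, of b 0] H by auto
    then show "Cinf g" unfolding g_def[abs_def] by (rule Cinf_mult)
    show "\<forall>p\<in>Omega_bar. 0 \<le> g p" using H by (auto simp: g_def)
    show "compact (closure {p \<in> Omega_bar. g p \<noteq> 0})" using closed_Int_compact[OF closed_closure cS] cl by (metis Int_absorb2)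
    show "closure {p \<in> Omega_bar. g p \<noteq> 0} \<inter> G = {}" using cl H by blast
  qed
  then have "0 \<le> (LINT p|lebesgue_on Omega. \<bar>\<rho> p - \<kappa>\<bar> * partial_t g p + Phis h 0 (\<rho> p) \<kappa> * partial_x g p)
        + (LINT x|lebesgue. \<bar>\<rho>o x - \<kappa>\<bar> * g (x, 0))"
    using ei H by (auto simp: entropy_ineq_def)
  moreover have "(LINT p|lebesgue_on Omega. \<bar>\<rho> p - \<kappa>\<bar> * partial_t g p + Phis h 0 (\<rho> p) \<kappa> * partial_x g p)
     = (LBINT p. indicator Omega p * (\<bar>u p - \<kappa>\<bar> * (a (fst p) * deriv b (snd p)) + Phi (u p) \<kappa> * (deriv a (fst p) * b (snd p))))"
  proof (rule lint_version[OF open_Omega])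
    have da: "(a has_real_derivative deriv a x) (at x)" and db: "(b has_real_derivative deriv b x) (at x)" for x
      using H Cinf_deriv(1) by blast+
    have c: "a \<in> borel_measurable borel" "b \<in> borel_measurable borel" "deriv a \<in> borel_measurable borel" "deriv b \<in> borel_measurable borel"
      using H Cinf_continuous Cinf_deriv(2) borel_measurable_continuous_onI by blast+
    note [measurable] = c unitbD(1)[OF u(1)]
    show "(\<lambda>p. \<bar>u p - \<kappa>\<bar> * (a (fst p) * deriv b (snd p)) + Phi (u p) \<kappa> * (deriv a (fst p) * b (snd p))) \<in> borel_measurable borel" by measurable
    have pp: "partial_x g p = deriv a (fst p) * b (snd p)" "partial_t g p = a (fst p) * deriv b (snd p)" for p
      unfolding partial_x_def partial_t_def g_def
      using DERIV_imp_deriv[OF DERIV_cmult_right[OF da]] DERIV_imp_deriv[OF DERIV_cmult[OF db]] by auto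
    show "AE p in lborel. p \<in> Omega \<longrightarrow> \<bar>\<rho> p - \<kappa>\<bar> * partial_t g p + Phis h 0 (\<rho> p) \<kappa> * partial_x g p
       = \<bar>u p - \<kappa>\<bar> * (a (fst p) * deriv b (snd p)) + Phi (u p) \<kappa> * (deriv a (fst p) * b (snd p))"
      using u(2)
    proof eventually_elim
      case (elim p)
      have "Phis h 0 (u p) \<kappa> = Phi (u p) \<kappa>" using H by (intro Phis_eq(2)[OF h] unitbD(4)[OF u(1)]) auto
      then show ?case using elim by (auto simp: pp)
    qed
  qed
  moreover have "(LINT x|lebesgue. \<bar>\<rho>o x - \<kappa>\<bar> * g (x, 0)) = (LBINT x. indicator UNIV x * (\<bar>u0 x - \<kappa>\<bar> * (a x * b 0)))"
  proof -
    have [measurable]: "a \<in> borel_measurable borel" "u0 \<in> borel_measurable borel"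
      using H Cinf_continuous borel_measurable_continuous_onI unitbD(1)[OF u0(1)] by blast+
    have "(LINT x|lebesgue_on UNIV. \<bar>\<rho>o x - \<kappa>\<bar> * g (x, 0)) = (LBINT x. indicator UNIV x * (\<bar>u0 x - \<kappa>\<bar> * (a x * b 0)))"
      by (rule lint_version) (use u0(2) in \<open>auto simp: g_def elim!: eventually_mono\<close>)
    then show ?thesis unfolding lebesgue_on_UNIV_eq .
  qed
  moreover have "indicator Omega p = (indicator {0<..} (snd p) :: real)" for p by (auto simp: Omega_def indicator_def mem_Times_iff)
  ultimately show "0 \<le> (LBINT p. indicator {0<..} (snd p) * (\<bar>u p - \<kappa>\<bar> * (a (fst p) * deriv b (snd p))
                 + Phi (u p) \<kappa> * (deriv a (fst p) * b (snd p))))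
           + (LBINT x. \<bar>u0 x - \<kappa>\<bar> * (a x * b 0))" by simp
qed

lemma trace_conversion:
  assumes st: "strong_trace \<epsilon> s T y \<rho> \<gamma>" and \<epsilon>: "\<bar>\<epsilon>\<bar> = 1" and s: "0 \<le> s" and ab: "s < a" "b < T"
    and u: "unitb u" "AE p in lborel. p \<in> Omega \<longrightarrow> u p = \<rho> p"
    and g: "unitb \<gamma>b" "AE t in lborel. t \<in> {s<..<T} \<longrightarrow> \<gamma>b t = \<gamma> t"
    and yb: "continuous_on UNIV yb" "\<And>t. t \<in> {s<..<T} \<Longrightarrow> yb t = y t"
  shows "one_sided_trace \<epsilon> a b yb u \<gamma>b"
  unfolding one_sided_trace_def
proof (intro allI impI)
  fix \<eta> :: real assume \<eta>: "\<eta> > 0"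
  have "compact {a..b} \<and> {a..b} \<subseteq> {s<..<T}" using ab by auto
  then obtain \<delta> where \<delta>: "\<delta> > 0" "AE h in lebesgue. 0 < h \<and> h < \<delta> \<longrightarrow>
           (\<integral>\<^sup>+t\<in>{a..b}. ennreal \<bar>\<rho> (y t + \<epsilon> * h, t) - \<gamma> t\<bar> \<partial>lebesgue) \<le> ennreal \<eta>"
    using st \<eta> unfolding strong_trace_def by blast
  have "AE h in lborel. 0 < h \<and> h < \<delta> \<longrightarrow>
           (\<integral>\<^sup>+t\<in>{a..b}. ennreal \<bar>\<rho> (y t + \<epsilon> * h, t) - \<gamma> t\<bar> \<partial>lebesgue) \<le> ennreal \<eta>"
    using \<delta>(2) by (simp add: AE_completion_iff)
  \<comment> \<open>The distance h > 0 to the curve becomes the signed offset \<xi> = \<epsilon>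
    h.\<close>
  from AE_reflect[OF this \<epsilon>] have A: "AE \<xi> in lborel. 0 < \<epsilon> * \<xi> \<and> \<epsilon> * \<xi> < \<delta> \<longrightarrow>
           (\<integral>\<^sup>+t\<in>{a..b}. ennreal \<bar>\<rho> (y t + \<epsilon> * (\<epsilon> * \<xi>), t) - \<gamma> t\<bar> \<partial>lebesgue) \<le> ennreal \<eta>" .
  have \<epsilon>2: "\<epsilon> * (\<epsilon> * \<xi>) = \<xi>" for \<xi> using \<epsilon> by (auto simp: abs_if split: if_splits)
  show "\<exists>\<delta>>0. AE \<xi> in lborel. 0 < \<epsilon> * \<xi> \<and> \<epsilon> * \<xi> < \<delta> \<longrightarrow>
     (LBINT t. indicator {a..b} t * \<bar>u (yb t + \<xi>, t) - \<gamma>b t\<bar>) \<le> \<eta>"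
  proof (intro exI[of _ \<delta>] conjI \<delta>(1))
    show "AE \<xi> in lborel. 0 < \<epsilon> * \<xi> \<and> \<epsilon> * \<xi> < \<delta> \<longrightarrow> (LBINT t. indicator {a..b} t * \<bar>u (yb t + \<xi>, t) - \<gamma>b t\<bar>) \<le> \<eta>"
      using A AE_shear[OF yb(1) u(2)]
    proof eventually_elim
      case (elim \<xi>)
      show ?case
      proof
        assume "0 < \<epsilon> * \<xi> \<and> \<epsilon> * \<xi> < \<delta>"
        then have le: "(\<integral>\<^sup>+t\<in>{a..b}. ennreal \<bar>\<rho> (y t + \<xi>, t) - \<gamma> t\<bar> \<partial>lebesgue) \<le> ennreal \<eta>"
          using elim(1) by (simp add: \<epsilon>2)
        have ae: "AE t in lborel. ennreal (indicator {a..b} t * \<bar>u (yb t + \<xi>, t) - \<gamma>b t\<bar>) = ennreal \<bar>\<rho> (y t + \<xi>, t) - \<gamma> t\<bar> * indicator {a..b} t"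
          using elim(2) g(2)
        proof eventually_elim
          case (elim t)
          show ?case
          proof (cases "t \<in> {a..b}")
            case True
            then have t: "t \<in> {s<..<T}" using ab by auto
            then have "(yb t + \<xi>, t) \<in> Omega" using s by (auto simp: Omega_def)
            then show ?thesis using elim t yb(2)[OF t] True by simp
          qed simp
        qed
        have us: "unitb (\<lambda>t. u (yb t + \<xi>, t))"
        proof (rule unitb_compose[OF u(1)])
          have [measurable]: "yb \<in> borel_measurable borel" using yb(1) by (rule borel_measurable_continuous_onI)
          show "(\<lambda>t. (yb t + \<xi>, t)) \<in> borel_measurable borel" by measurable
        qed
        have i: "integrable lborel (\<lambda>t. indicator {a..b} t * \<bar>u (yb t + \<xi>, t) - \<gamma>b t\<bar>)"
          by (intro bcs_integrable bcs_mult1 bcs_indicator bb_unitb_diff us g(1)) auto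
        have "ennreal (LBINT t. indicator {a..b} t * \<bar>u (yb t + \<xi>, t) - \<gamma>b t\<bar>)
            = (\<integral>\<^sup>+t. ennreal (indicator {a..b} t * \<bar>u (yb t + \<xi>, t) - \<gamma>b t\<bar>) \<partial>lborel)"
          by (rule nn_integral_eq_integral[OF i, symmetric]) auto
        also have "\<dots> = (\<integral>\<^sup>+t\<in>{a..b}. ennreal \<bar>\<rho> (y t + \<xi>, t) - \<gamma> t\<bar> \<partial>lborel)"
          by (rule nn_integral_cong_AE[OF ae])
        also have "\<dots> \<le> ennreal \<eta>" using le by (simp add: nn_integral_completion)
        finally show "(LBINT t. indicator {a..b} t * \<bar>u (yb t + \<xi>, t) - \<gamma>b t\<bar>) \<le> \<eta>"
          using \<eta> by (simp add: ennreal_le_iff)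
      qed
    qed
  qed
qed

end

lemma germ_unit:
  assumes "flux f" "(s \<ge> 0 \<longrightarrow> q \<in> {0..<maxF f s}) \<and> (s < 0 \<longrightarrow> q \<in> {- s..<maxF f s})" "(l, r) \<in> germ f s q"
  shows "l \<in> {0..1}" "r \<in> {0..1}"
  using germ_cases[OF assms] by blast+

text \<open>Bundles everything chosen for one interface, so that a single choice over the interfaces
  produces all the families of \<open>two_solutions\<close> at once.\<close>

definition interface_data where
  "interface_data f s T y q q' u v yb c m ul ur vl vr \<longleftrightarrow> continuous_on UNIV yb \<and> (\<forall>t\<in>{s..T}. yb t = y t) \<and> bb c \<and>
    (\<forall>t e. 0 < e \<longrightarrow> s < t - e \<longrightarrow> t + e < T \<longrightarrow>
      (LBINT r. yb r * (deriv moll ((t - r) / e) / e)) = (LBINT r. c r * moll ((t - r) / e))) \<and>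
    bb m \<and> (\<forall>t. 0 \<le> m t) \<and> (AE t in lborel. t \<in> {s<..<T} \<longrightarrow> m t = 2 * \<bar>q t - q' t\<bar>) \<and>
    unitb ul \<and> unitb ur \<and> unitb vl \<and> unitb vr \<and>
    (\<forall>a b. s < a \<longrightarrow> b < T \<longrightarrow> one_sided_trace (-1) a b yb u ul \<and> one_sided_trace (-1) a b yb v vl \<and> one_sided_trace 1 a b yb u ur \<and> one_sided_trace 1 a b yb v vr) \<and>
    (AE t in lborel. t \<in> {s<..<T} \<longrightarrow> lipschitz_flux.PhiS (clampf f) (c t) (ur t) (vr t) - lipschitz_flux.PhiS (clampf f) (c t) (ul t) (vl t) \<le> m t)"

lemma interface_conversion:
  assumes f: "flux f" and lf: "lipschitz_flux (clampf f) L" and sT: "0 \<le> s" "s < T" and W: "W1inf s T y dy"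
    and q: "Linf {s<..<T} q" "assumption_Q f s T dy q" and q': "Linf {s<..<T} q'" "assumption_Q f s T dy q'"
    and tr: "strong_trace (-1) s T y \<rho> \<gamma>l" "strong_trace 1 s T y \<rho> \<gamma>r" "AE t in lebesgue_on {s<..<T}. (\<gamma>l t, \<gamma>r t) \<in> germ f (dy t) (q t)"
    and tr': "strong_trace (-1) s T y \<sigma> \<gamma>l'" "strong_trace 1 s T y \<sigma> \<gamma>r'" "AE t in lebesgue_on {s<..<T}. (\<gamma>l' t, \<gamma>r' t) \<in> germ f (dy t) (q' t)"
    and u: "unitb u" "AE p in lborel. p \<in> Omega \<longrightarrow> u p = \<rho> p"
    and v: "unitb v" "AE p in lborel. p \<in> Omega \<longrightarrow> v p = \<sigma> p"
  shows "\<exists>yb c m ul ur vl vr. interface_data f s T y q q' u v yb c m ul ur vl vr"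
proof -
  interpret lipschitz_flux "clampf f" L by (rule lf)
  have O: "{s<..<T} \<in> sets borel" by simp
  obtain c where c: "bb c" "AE t in lborel. t \<in> {s<..<T} \<longrightarrow> c t = dy t"
    using borel_version[OF O, of dy] W by (auto simp: W1inf_def)
  obtain qb where qb: "bb qb" "AE t in lborel. t \<in> {s<..<T} \<longrightarrow> qb t = q t" using borel_version[OF O q(1)] by blast
  obtain qb' where qb': "bb qb'" "AE t in lborel. t \<in> {s<..<T} \<longrightarrow> qb' t = q' t" using borel_version[OF O q'(1)] by blast
  have Q: "AE t in lborel. t \<in> {s<..<T} \<longrightarrow> (dy t \<ge> 0 \<longrightarrow> q t \<in> {0..<maxF f (dy t)}) \<and> (dy t < 0 \<longrightarrow> q t \<in> {- dy t..<maxF f (dy t)})"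
    using q(2) unfolding assumption_Q_def AE_lebesgue_on[OF O] .
  have Q': "AE t in lborel. t \<in> {s<..<T} \<longrightarrow> (dy t \<ge> 0 \<longrightarrow> q' t \<in> {0..<maxF f (dy t)}) \<and> (dy t < 0 \<longrightarrow> q' t \<in> {- dy t..<maxF f (dy t)})"
    using q'(2) unfolding assumption_Q_def AE_lebesgue_on[OF O] .
  have G: "AE t in lborel. t \<in> {s<..<T} \<longrightarrow> (\<gamma>l t, \<gamma>r t) \<in> germ f (dy t) (q t)" using tr(3) unfolding AE_lebesgue_on[OF O] .
  have G': "AE t in lborel. t \<in> {s<..<T} \<longrightarrow> (\<gamma>l' t, \<gamma>r' t) \<in> germ f (dy t) (q' t)" using tr'(3) unfolding AE_lebesgue_on[OF O] .
  \<comment> \<open>\<open>strong_trace\<close> does not confine a trace to [0, 1]; membership in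
    the germ does.\<close>
  have U: "AE t in lborel. t \<in> {s<..<T} \<longrightarrow> \<gamma>l t \<in> {0..1}" "AE t in lborel. t \<in> {s<..<T} \<longrightarrow> \<gamma>r t \<in> {0..1}"
    using Q G by (eventually_elim, use germ_unit[OF f] in blast)+
  have U': "AE t in lborel. t \<in> {s<..<T} \<longrightarrow> \<gamma>l' t \<in> {0..1}" "AE t in lborel. t \<in> {s<..<T} \<longrightarrow> \<gamma>r' t \<in> {0..1}"
    using Q' G' by (eventually_elim, use germ_unit[OF f] in blast)+
  obtain ul where ul: "unitb ul" "AE t in lborel. t \<in> {s<..<T} \<longrightarrow> ul t = \<gamma>l t"
    using borel_version_unit[OF O _ U(1)] tr(1) unfolding strong_trace_def by blast
  obtain ur where ur: "unitb ur" "AE t in lborel. t \<in> {s<..<T} \<longrightarrow> ur t = \<gamma>r t"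
    using borel_version_unit[OF O _ U(2)] tr(2) unfolding strong_trace_def by blast
  obtain vl where vl: "unitb vl" "AE t in lborel. t \<in> {s<..<T} \<longrightarrow> vl t = \<gamma>l' t"
    using borel_version_unit[OF O _ U'(1)] tr'(1) unfolding strong_trace_def by blast
  obtain vr where vr: "unitb vr" "AE t in lborel. t \<in> {s<..<T} \<longrightarrow> vr t = \<gamma>r' t"
    using borel_version_unit[OF O _ U'(2)] tr'(2) unfolding strong_trace_def by blast
  \<comment> \<open>Constant continuation beyond the time interval, which makes the curve continuous
    on the line.\<close>
  define yb where "yb t = y (max s (min T t))" for t
  have ybc: "continuous_on UNIV yb"
  proof -
    have "continuous_on {s..T} y" using W by (simp add: W1inf_def)
    then show ?thesis unfolding yb_def by (rule continuous_on_compose2) (use sT in \<open>auto intro!: continuous_intros\<close>)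
  qed
  have yb: "yb t = y t" if "t \<in> {s..T}" for t using that by (auto simp: yb_def)
  have yb': "yb t = y t" if "t \<in> {s<..<T}" for t using that by (intro yb) auto
  define m where "m t = 2 * \<bar>qb t - qb' t\<bar>" for t
  have m: "bb m" unfolding m_def by (intro bb_mult[OF bb_const] bb_abs bb_diff qb qb')
  have mae: "AE t in lborel. t \<in> {s<..<T} \<longrightarrow> m t = 2 * \<bar>q t - q' t\<bar>"
    using qb(2) qb'(2) by eventually_elim (auto simp: m_def)
  have gd: "AE t in lborel. t \<in> {s<..<T} \<longrightarrow> PhiS (c t) (ur t) (vr t) - PhiS (c t) (ul t) (vl t) \<le> m t"
    using c(2) mae Q Q' G G' ul(2) ur(2) vl(2) vr(2)
  proof eventually_elim
    case (elim t)
    show ?case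
    proof
      assume t: "t \<in> {s<..<T}"
      have "Phis f (dy t) (\<gamma>r t) (\<gamma>r' t) - Phis f (dy t) (\<gamma>l t) (\<gamma>l' t) \<le> 2 * \<bar>q t - q' t\<bar>"
        using germ_dissipation[OF f] elim t by blast
      moreover have "Phis f (dy t) (\<gamma>r t) (\<gamma>r' t) = PhiS (c t) (ur t) (vr t)" "Phis f (dy t) (\<gamma>l t) (\<gamma>l' t) = PhiS (c t) (ul t) (vl t)"
        using elim t unitbD(4)[OF ul(1), of t] unitbD(4)[OF ur(1), of t] unitbD(4)[OF vl(1), of t] unitbD(4)[OF vr(1), of t]
        by (auto intro!: Phis_eq(1)[OF refl])
      ultimately show "PhiS (c t) (ur t) (vr t) - PhiS (c t) (ul t) (vl t) \<le> m t" using elim t by simp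
    qed
  qed
  have wd: "(LBINT r. yb r * (deriv moll ((t - r) / e) / e)) = (LBINT r. c r * moll ((t - r) / e))"
    if "0 < e" "s < t - e" "t + e < T" for t e
    by (rule weak_derivative_moll[OF _ that _ yb' bb_measurable[OF c(1)] c(2)])
      (use W borel_measurable_continuous_onI[OF ybc] in \<open>auto simp: W1inf_def\<close>)
  have tc: "one_sided_trace (-1) a b yb u ul \<and> one_sided_trace (-1) a b yb v vl \<and> one_sided_trace 1 a b yb u ur \<and> one_sided_trace 1 a b yb v vr"
    if "s < a" "b < T" for a b
    using trace_conversion[OF tr(1) _ sT(1) that u ul ybc yb'] trace_conversion[OF tr(2) _ sT(1) that u ur ybc yb']
      trace_conversion[OF tr'(1) _ sT(1) that v vl ybc yb'] trace_conversion[OF tr'(2) _ sT(1) that v vr ybc yb'] by simp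
  have m0: "0 \<le> m t" for t by (simp add: m_def)
  show ?thesis unfolding interface_data_def
    by (intro exI[of _ yb] exI[of _ c] exI[of _ m] exI[of _ ul] exI[of _ ur] exI[of _ vl] exI[of _ vr] conjI allI impI ballI)
       (rule ybc yb c(1) m m0 mae gd wd ul(1) ur(1) vl(1) vr(1) tc[THEN conjunct1] tc[THEN conjunct2, THEN conjunct1]
         tc[THEN conjunct2, THEN conjunct2, THEN conjunct1] tc[THEN conjunct2, THEN conjunct2, THEN conjunct2] | assumption)+
qed

section \<open>Stability\<close>

context two_solutions begin

definition contraction_bound :: real where
  "contraction_bound = (LBINT x. \<bar>u0 x - v0 x\<bar>) + (\<Sum>i\<in>I. LBINT t. indicator {s i<..<T i} t * m i t)"

text \<open>\<open>contraction_average\<close> bounds means over [\<tau>, \<tau> + \<mu>] for every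
  \<mu> > 0. The local L1 distance is continuous in time, so exceeding the bound at \<tau> would
  mean exceeding it in the mean over a short interval.\<close>

lemma local_contraction:
  assumes int: "integrable lborel (\<lambda>x. \<bar>u0 x - v0 x\<bar>)"
    and R: "continuous_L1loc R" and S: "continuous_L1loc S"
    and RS: "AE p in lborel. p \<in> Omega \<longrightarrow> R (snd p) (fst p) = u p \<and> S (snd p) (fst p) = v p"
    and \<tau>: "\<tau> > 0" and r: "0 \<le> r"
  shows "(LINT x|lebesgue_on {-r..r}. \<bar>R \<tau> x - S \<tau> x\<bar>) \<le> contraction_bound"
proof (rule ccontr)
  assume neg: "\<not> ?thesis"
  let ?L = "lebesgue_on {-r..r}"
  define D where "D t = (LINT x|?L. \<bar>R t x - S t x\<bar>)" for t
  define d where "d t = (LBINT x. indicator {-r..r} x * \<bar>u (x, t) - v (x, t)\<bar>)" for t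
  have iR: "integrable ?L (R t)" "integrable ?L (S t)" if "0 \<le> t" for t
    using R S that unfolding continuous_L1loc_def by auto
  have lim: "(D \<longlongrightarrow> D \<tau>) (at \<tau> within {0..})"
  proof -
    have l: "((\<lambda>t. (LINT x|?L. \<bar>R t x - R \<tau> x\<bar>) + (LINT x|?L. \<bar>S t x - S \<tau> x\<bar>)) \<longlongrightarrow> 0 + 0) (at \<tau> within {0..})"
      using R S \<tau> unfolding continuous_L1loc_def by (intro tendsto_add) auto
    have "\<forall>\<^sub>F t in at \<tau> within {0..}. norm (D t - D \<tau>) \<le> (LINT x|?L. \<bar>R t x - R \<tau> x\<bar>) + (LINT x|?L. \<bar>S t x - S \<tau> x\<bar>)"
      unfolding eventually_at_filter
    proof (rule always_eventually, intro allI impI)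
      fix t :: real assume "t \<in> {0..}"
      then have t: "0 \<le> t" "0 \<le> \<tau>" using \<tau> by auto
      note ii = iR[OF t(1)] iR[OF t(2)]
      have "D t - D \<tau> = (LINT x|?L. \<bar>R t x - S t x\<bar> - \<bar>R \<tau> x - S \<tau> x\<bar>)"
        unfolding D_def using ii by (intro Bochner_Integration.integral_diff[symmetric]) auto
      then have "\<bar>D t - D \<tau>\<bar> \<le> (LINT x|?L. \<bar>\<bar>R t x - S t x\<bar> - \<bar>R \<tau> x - S \<tau> x\<bar>\<bar>)"
        by (simp only: integral_abs_bound)
      also have "\<dots> \<le> (LINT x|?L. \<bar>R t x - R \<tau> x\<bar> + \<bar>S t x - S \<tau> x\<bar>)"
        using ii by (intro Bochner_Integration.integral_mono) auto
      also have "\<dots> = (LINT x|?L. \<bar>R t x - R \<tau> x\<bar>) + (LINT x|?L. \<bar>S t x - S \<tau> x\<bar>)"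
        using ii by (intro Bochner_Integration.integral_add) auto
      finally show "norm (D t - D \<tau>) \<le> (LINT x|?L. \<bar>R t x - R \<tau> x\<bar>) + (LINT x|?L. \<bar>S t x - S \<tau> x\<bar>)" by simp
    qed
    from Lim_null_comparison[OF this] l have "((\<lambda>t. D t - D \<tau>) \<longlongrightarrow> 0) (at \<tau> within {0..})" by simp
    then show ?thesis by (rule LIM_zero_cancel)
  qed
  \<comment> \<open>The time representatives agree with u and v only almost everywhere in the plane,
    hence on almost every time slice; the averaging in time needs no more.\<close>
  have Dd: "AE t in lborel. t > 0 \<longrightarrow> D t = d t"
  proof -
    obtain N where N: "\<And>p. p \<notin> N \<Longrightarrow> p \<in> Omega \<longrightarrow> R (snd p) (fst p) = u p \<and> S (snd p) (fst p) = v p"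
      "AE t in lborel. AE x in lborel. (x, t) \<notin> N"
      using AE_sections[OF RS] by metis
    show ?thesis using N(2)
    proof eventually_elim
      case (elim t)
      show ?case
      proof
        assume t: "t > 0"
        show "D t = d t"
          unfolding D_def d_def
        proof (rule lint_version)
          have [measurable]: "u \<in> borel_measurable borel" "v \<in> borel_measurable borel" using unitbD(1) uu vv by auto
          show "(\<lambda>x. \<bar>u (x, t) - v (x, t)\<bar>) \<in> borel_measurable borel" by measurable
          show "AE x in lborel. x \<in> {-r..r} \<longrightarrow> \<bar>R t x - S t x\<bar> = \<bar>u (x, t) - v (x, t)\<bar>"
            using elim
          proof eventually_elim
            case (elim x)
            have "(x, t) \<in> Omega" using t by (simp add: Omega_def)
            then show ?case using N(1)[OF elim] by simp
          qed
        qed simp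
      qed
    qed
  qed
  \<comment> \<open>Half of the excess over the bound: lowering \<open>D \<tau>\<close> by e still
    leaves it above.\<close>
  define e where "e = (D \<tau> - contraction_bound) / 2"
  have e: "e > 0" "D \<tau> - e > contraction_bound" using neg by (auto simp: e_def D_def field_simps)
  have "\<forall>\<^sub>F t in at \<tau> within {0..}. D t > D \<tau> - e" using lim e(1) by (intro order_tendstoD(1)) auto
  then obtain \<delta> where \<delta>: "\<delta> > 0" "\<And>t. 0 \<le> t \<Longrightarrow> t \<noteq> \<tau> \<Longrightarrow> dist t \<tau> < \<delta> \<Longrightarrow> D t > D \<tau> - e"
    unfolding eventually_at by auto
  define \<mu> where "\<mu> = \<delta> / 2"
  have \<mu>: "\<mu> > 0" "\<mu> < \<delta>" using \<delta> by (auto simp: \<mu>_def)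
  have low: "D \<tau> - e \<le> D t" if "\<tau> \<le> t" "t \<le> \<tau> + \<mu>" for t
    using \<delta>(2)[of t] that \<mu> \<tau> e by (cases "t = \<tau>") (auto simp: dist_real_def)
  define W where "W t = w ((t - \<tau>) / \<mu> + 1) / \<mu>" for t
  have Wz: "W t = 0" if "t \<notin> {\<tau>..\<tau> + \<mu>}" for t
  proof -
    have "(t - \<tau>) / \<mu> \<le> 0 \<or> (t - \<tau>) / \<mu> \<ge> 1" using that \<mu> by (auto simp: divide_le_0_iff le_divide_eq)
    then have "w ((t - \<tau>) / \<mu> + 1) = 0" by (intro w_zero) auto
    then show ?thesis by (simp add: W_def)
  qed
  have bW: "bcs W"
  proof (rule bcs_continuous[where B="\<tau> + \<mu>"])
    show "continuous_on UNIV W" unfolding W_def[abs_def] using \<mu>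
      by (auto intro!: continuous_intros continuous_on_compose2[OF w_continuous[of UNIV]])
    show "W t = 0" if "norm t > \<tau> + \<mu>" for t using that \<tau> \<mu> by (intro Wz) auto
  qed
  have W1: "(LBINT t. W t) = 1"
    using lborel_integral_real_affine[of \<mu> W "\<tau> - \<mu>"] \<mu> by (simp add: W_def diff_divide_distrib add_divide_distrib integral_w_lborel)
  have W0: "0 \<le> W t" for t using w_nonneg \<mu> by (simp add: W_def)
  have bF: "bcs (\<lambda>p. indicator {-r..r} (fst p) * W (snd p) * \<bar>u p - v p\<bar>)"
    by (intro bcs_mult1[OF bcs_product[OF bcs_indicator bW]] bb_unitb_diff uu vv) auto
  have "(LBINT p. indicator {-r..r} (fst p) * W (snd p) * \<bar>u p - v p\<bar>) \<le> contraction_bound"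
    using contraction_average[OF int _ \<mu>(1) r, of \<tau>] \<tau> by (simp add: W_def contraction_bound_def)
  moreover have "(LBINT p. indicator {-r..r} (fst p) * W (snd p) * \<bar>u p - v p\<bar>) = (LBINT t. W t * d t)"
    unfolding bcs_fubini(2)[OF bF] d_def integral_mult_right_zero[symmetric] by (simp add: mult_ac)
  moreover have "(LBINT t. W t * (D \<tau> - e)) \<le> (LBINT t. W t * d t)"
  proof (rule integral_mono_AE)
    show "integrable lborel (\<lambda>t. W t * (D \<tau> - e))" by (intro bcs_integrable bcs_mult1 bW bb_const)
    have "(\<lambda>t. W t * d t) = (\<lambda>t. LBINT x. indicator {-r..r} x * W t * \<bar>u (x, t) - v (x, t)\<bar>)"
      unfolding d_def integral_mult_right_zero[symmetric] by (simp add: mult_ac)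
    then show "integrable lborel (\<lambda>t. W t * d t)" using bcs_integrable[OF bcs_inner[OF bcs_swap[OF bF]]] by simp
    show "AE t in lborel. W t * (D \<tau> - e) \<le> W t * d t"
      using Dd
    proof eventually_elim
      case (elim t)
      show ?case
      proof (cases "t \<in> {\<tau>..\<tau> + \<mu>}")
        case True
        then show ?thesis using elim \<tau> low[of t] W0[of t] by (intro mult_left_mono) auto
      qed (simp add: Wz)
    qed
  qed
  moreover have "(LBINT t. W t * (D \<tau> - e)) = D \<tau> - e" by (simp add: W1)
  ultimately show False using e by linarith
qed

lemma global_contraction:
  assumes int: "integrable lborel (\<lambda>x. \<bar>u0 x - v0 x\<bar>)"
    and R: "continuous_L1loc R" and S: "continuous_L1loc S"
    and RS: "AE p in lborel. p \<in> Omega \<longrightarrow> R (snd p) (fst p) = u p \<and> S (snd p) (fst p) = v p"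
    and \<tau>: "\<tau> > 0"
  shows "(\<integral>\<^sup>+x. ennreal \<bar>R \<tau> x - S \<tau> x\<bar> \<partial>lebesgue) \<le> ennreal contraction_bound"
proof -
  define g where "g n x = ennreal (if x \<in> {- real n..real n} then \<bar>R \<tau> x - S \<tau> x\<bar> else 0)" for n :: nat and x
  have i: "integrable (lebesgue_on {- real n..real n}) (\<lambda>x. \<bar>R \<tau> x - S \<tau> x\<bar>)" for n :: nat
    using R S \<tau> unfolding continuous_L1loc_def by auto
  have gm: "g n \<in> borel_measurable lebesgue" for n
    unfolding g_def using borel_measurable_integrable[OF i[of n]]
    by (intro measurable_compose[OF borel_measurable_if_I measurable_ennreal]) auto
  have "incseq g" unfolding g_def incseq_def le_fun_def by (auto intro!: ennreal_leI)
  then have "(\<integral>\<^sup>+x. (SUP n. g n x) \<partial>lebesgue) = (SUP n. \<integral>\<^sup>+x. g n x \<partial>lebesgue)"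
    using gm by (rule nn_integral_monotone_convergence_SUP)
  moreover have "(SUP n. g n x) = ennreal \<bar>R \<tau> x - S \<tau> x\<bar>" for x
  proof (rule antisym)
    show "(SUP n. g n x) \<le> ennreal \<bar>R \<tau> x - S \<tau> x\<bar>" by (rule SUP_least) (auto simp: g_def)
    obtain n :: nat where "\<bar>x\<bar> \<le> real n" using real_arch_simple by blast
    then have "g n x = ennreal \<bar>R \<tau> x - S \<tau> x\<bar>" by (auto simp: g_def abs_le_iff)
    then show "ennreal \<bar>R \<tau> x - S \<tau> x\<bar> \<le> (SUP n. g n x)" by (metis SUP_upper UNIV_I)
  qed
  moreover have "(\<integral>\<^sup>+x. g n x \<partial>lebesgue) \<le> ennreal contraction_bound" for n
  proof -
    have "(\<integral>\<^sup>+x. g n x \<partial>lebesgue) = (\<integral>\<^sup>+x. ennreal \<bar>R \<tau> x - S \<tau> x\<bar> * indicator {- real n..real n} x \<partial>lebesgue)"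
      by (intro nn_integral_cong) (auto simp: g_def)
    also have "\<dots> = (\<integral>\<^sup>+x. ennreal \<bar>R \<tau> x - S \<tau> x\<bar> \<partial>lebesgue_on {- real n..real n})"
      by (rule nn_integral_restrict_space[symmetric]) auto
    also have "\<dots> = ennreal (LINT x|lebesgue_on {- real n..real n}. \<bar>R \<tau> x - S \<tau> x\<bar>)"
      by (rule nn_integral_eq_integral[OF i]) auto
    also have "\<dots> \<le> ennreal contraction_bound"
      by (intro ennreal_leI local_contraction[OF int R S RS \<tau>]) auto
    finally show ?thesis .
  qed
  ultimately show ?thesis by (simp add: SUP_least)
qed

text \<open>Uses \<open>contraction_average\<close> with \<tau> = 0 and r = \<mu> = n, so no
  time-continuous representative enters. The weight is positive for |x| \<le> n and 0 < t < n, and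
  these boxes exhaust \<open>Omega\<close>.\<close>

lemma uniqueness:
  assumes int: "integrable lborel (\<lambda>x. \<bar>u0 x - v0 x\<bar>)" and M: "contraction_bound \<le> 0"
  shows "AE p in lborel. p \<in> Omega \<longrightarrow> u p = v p"
proof -
  define F where "F n p = indicator {- real n..real n} (fst p) * (w ((snd p - 0) / real n + 1) / real n) * \<bar>u p - v p\<bar>" for n :: nat and p :: "real \<times> real"
  have "AE p in lborel. F (Suc k) p = 0" for k
  proof -
    define n where "n = Suc k"
    have n: "real n > 0" by (simp add: n_def)
    have bW: "bcs (\<lambda>t. w ((t - 0) / real n + 1) / real n)"
    proof (rule bcs_continuous[where B="real n"])
      show "continuous_on UNIV (\<lambda>t. w ((t - 0) / real n + 1) / real n)" using n
        by (auto intro!: continuous_intros continuous_on_compose2[OF w_continuous[of UNIV]])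
      show "w ((t - 0) / real n + 1) / real n = 0" if "norm t > real n" for t
      proof -
        have "t / real n \<le> 0 \<or> 1 \<le> t / real n" using that n by (auto simp: divide_le_0_iff le_divide_eq abs_if split: if_splits)
        then have "w (t / real n + 1) = 0" by (intro w_zero) auto
        then show ?thesis by simp
      qed
    qed
    have "bcs (F n)" unfolding F_def
      by (intro bcs_mult1[OF bcs_product[OF bcs_indicator bW]] bb_unitb_diff uu vv) auto
    then have i: "integrable lborel (F n)" by (rule bcs_integrable)
    have F0: "0 \<le> F n p" for p using w_nonneg by (simp add: F_def)
    have "(LBINT p. F n p) \<le> 0"
      using contraction_average[OF int order_refl n, of "real n"] M by (simp add: F_def contraction_bound_def)
    moreover have "0 \<le> (LBINT p. F n p)" using F0 by (intro integral_nonneg_AE) auto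
    ultimately have "(LBINT p. F n p) = 0" by simp
    then show ?thesis using integral_nonneg_eq_0_iff_AE[OF i] F0 by (simp add: n_def)
  qed
  then have "AE p in lborel. \<forall>k. F (Suc k) p = 0" by (simp add: AE_all_countable)
  then show ?thesis
  proof eventually_elim
    case (elim p)
    show ?case
    proof
      assume p: "p \<in> Omega"
      obtain k where k: "real k > \<bar>fst p\<bar> + \<bar>snd p\<bar>" using reals_Archimedean2 by blast
      have "0 < w (snd p / real (Suc k) + 1)"
        using p k by (intro w_pos) (auto simp: Omega_def mem_Times_iff field_simps)
      moreover have "fst p \<in> {- real (Suc k)..real (Suc k)}" using k by auto
      ultimately show "u p = v p" using elim[rule_format, of k] by (simp add: F_def)
    qed
  qed
qed

end

lemma reduction:
  assumes f: "flux f" and tr: "trajectories J s T y dy"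
    and o: "Linf_in UNIV {0..1} \<rho>o" "Linf_in UNIV {0..1} \<sigma>o"
    and q: "constraints f J s T dy q" and q': "constraints f J s T dy q'"
    and \<rho>: "G_entropy_solution f J s T y dy q \<rho>o \<rho>" and \<sigma>: "G_entropy_solution f J s T y dy q' \<sigma>o \<sigma>"
  obtains L u v u0 v0 yb c m ul ur vl vr where
    "two_solutions (clampf f) L u v u0 v0 {1..J} s T yb c m ul ur vl vr"
    "AE p in lborel. p \<in> Omega \<longrightarrow> u p = \<rho> p" "AE p in lborel. p \<in> Omega \<longrightarrow> v p = \<sigma> p"
    "AE x in lborel. u0 x = \<rho>o x" "AE x in lborel. v0 x = \<sigma>o x"
    "\<And>i. i \<in> {1..J} \<Longrightarrow> AE t in lborel. t \<in> {s i<..<T i} \<longrightarrow> m i t = 2 * \<bar>q i t - q' i t\<bar>"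
proof -
  obtain L where lf: "lipschitz_flux (clampf f) L" using flux_lipschitz[OF f] by blast
  interpret lipschitz_flux "clampf f" L by (rule lf)
  have r: "\<exists>ub. unitb ub \<and> (AE p in lborel. p \<in> Omega \<longrightarrow> ub p = \<rho>' p)" if "Linf_in Omega {0..1} \<rho>'" for \<rho>' :: "real \<times> real \<Rightarrow> real"
  proof -
    have "Linf Omega \<rho>'" "AE p in lborel. p \<in> Omega \<longrightarrow> \<rho>' p \<in> {0..1}"
      using that unfolding Linf_in_def AE_lebesgue_on[OF open_Omega] by blast+
    from borel_version_unit[OF open_Omega this] show ?thesis by blast
  qed
  obtain u where u: "unitb u" "AE p in lborel. p \<in> Omega \<longrightarrow> u p = \<rho> p" using r[of \<rho>] \<rho> unfolding G_entropy_solution_def by blast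
  obtain v where v: "unitb v" "AE p in lborel. p \<in> Omega \<longrightarrow> v p = \<sigma> p" using r[of \<sigma>] \<sigma> unfolding G_entropy_solution_def by blast
  have r0: "\<exists>ub. unitb ub \<and> (AE x in lborel. ub x = \<rho>' x)" if "Linf_in UNIV {0..1} \<rho>'" for \<rho>' :: "real \<Rightarrow> real"
  proof -
    have U: "(UNIV :: real set) \<in> sets borel" by simp
    have "Linf UNIV \<rho>'" "AE x in lborel. x \<in> UNIV \<longrightarrow> \<rho>' x \<in> {0..1}"
      using that unfolding Linf_in_def AE_lebesgue_on[OF U] by blast+
    from borel_version_unit[OF U this] obtain ub where "unitb ub" "AE x in lborel. x \<in> UNIV \<longrightarrow> ub x = \<rho>' x" by blast
    then show ?thesis by auto
  qed
  obtain u0 where u0: "unitb u0" "AE x in lborel. u0 x = \<rho>o x" using r0[OF o(1)] by blast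
  obtain v0 where v0: "unitb v0" "AE x in lborel. v0 x = \<sigma>o x" using r0[OF o(2)] by blast
  \<comment> \<open>The seven witnesses are packed into one tuple, so that a single application of
    \<open>bchoice\<close> selects them for all i.\<close>
  have "\<forall>i\<in>{1..J}. \<exists>X. case X of (yb, c, m, ul, ur, vl, vr) \<Rightarrow>
     interface_data f (s i) (T i) (y i) (q i) (q' i) u v yb c m ul ur vl vr"
  proof
    fix i assume i: "i \<in> {1..J}"
    obtain gl gr where g: "strong_trace (-1) (s i) (T i) (y i) \<rho> gl" "strong_trace 1 (s i) (T i) (y i) \<rho> gr"
        "AE t in lebesgue_on {s i<..<T i}. (gl t, gr t) \<in> germ f (dy i t) (q i t)"
      using \<rho> i unfolding G_entropy_solution_def by blast
    obtain gl' gr' where g': "strong_trace (-1) (s i) (T i) (y i) \<sigma> gl'" "strong_trace 1 (s i) (T i) (y i) \<sigma> gr'"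
        "AE t in lebesgue_on {s i<..<T i}. (gl' t, gr' t) \<in> germ f (dy i t) (q' i t)"
      using \<sigma> i unfolding G_entropy_solution_def by blast
    have t: "0 \<le> s i" "s i < T i" "W1inf (s i) (T i) (y i) (dy i)" using tr i by (auto simp: trajectories_def)
    have qq: "Linf {s i<..<T i} (q i)" "assumption_Q f (s i) (T i) (dy i) (q i)" "Linf {s i<..<T i} (q' i)" "assumption_Q f (s i) (T i) (dy i) (q' i)"
      using q q' i by (auto simp: constraints_def)
    from interface_conversion[OF f lf t qq g g' u v]
    show "\<exists>X. case X of (yb, c, m, ul, ur, vl, vr) \<Rightarrow> interface_data f (s i) (T i) (y i) (q i) (q' i) u v yb c m ul ur vl vr" by auto
  qed
  then obtain X where X: "\<forall>i\<in>{1..J}. case X i of (yb, c, m, ul, ur, vl, vr) \<Rightarrow>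
     interface_data f (s i) (T i) (y i) (q i) (q' i) u v yb c m ul ur vl vr"
    by (rule bchoice[THEN exE])
  define yb where "yb i = fst (X i)" for i
  define c where "c i = fst (snd (X i))" for i
  define m where "m i = fst (snd (snd (X i)))" for i
  define ul where "ul i = fst (snd (snd (snd (X i))))" for i
  define ur where "ur i = fst (snd (snd (snd (snd (X i)))))" for i
  define vl where "vl i = fst (snd (snd (snd (snd (snd (X i))))))" for i
  define vr where "vr i = snd (snd (snd (snd (snd (snd (X i))))))" for i
  have d: "interface_data f (s i) (T i) (y i) (q i) (q' i) u v (yb i) (c i) (m i) (ul i) (ur i) (vl i) (vr i)" if "i \<in> {1..J}" for i
    using X that by (auto simp: yb_def c_def m_def ul_def ur_def vl_def vr_def split_beta)
  note dd = d[unfolded interface_data_def]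
  have "Gam (s i) (T i) (yb i) = Gam (s i) (T i) (y i)" if "i \<in> {1..J}" for i
    using dd[OF that] unfolding Gam_def by (intro image_cong) auto
  then have G: "(\<Union>i\<in>{1..J}. Gam (s i) (T i) (yb i)) = (\<Union>i\<in>{1..J}. Gam (s i) (T i) (y i))" by auto
  have "two_solutions (clampf f) L u v u0 v0 {1..J} s T yb c m ul ur vl vr"
  proof (intro_locales, unfold_locales)
    show "entropic (\<Union>i\<in>{1..J}. Gam (s i) (T i) (yb i)) u0 u"
      unfolding G using \<rho> by (intro entropic_conversion[OF refl _ u u0]) (auto simp: G_entropy_solution_def)
    show "entropic (\<Union>i\<in>{1..J}. Gam (s i) (T i) (yb i)) v0 v"
      unfolding G using \<sigma> by (intro entropic_conversion[OF refl _ v v0]) (auto simp: G_entropy_solution_def)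
    show "0 \<le> s i" "s i < T i" if "i \<in> {1..J}" for i using tr that by (auto simp: trajectories_def)
  qed (use dd in \<open>simp_all\<close>)
  moreover have "AE t in lborel. t \<in> {s i<..<T i} \<longrightarrow> m i t = 2 * \<bar>q i t - q' i t\<bar>" if "i \<in> {1..J}" for i
    using dd[OF that] by blast
  ultimately show ?thesis using that u(2) v(2) u0(2) v0(2) by blast
qed

lemma time_representative_lborel:
  assumes "time_representative \<rho> R" "AE p in lborel. p \<in> Omega \<longrightarrow> u p = \<rho> p"
  shows "AE p in lborel. p \<in> Omega \<longrightarrow> R (snd p) (fst p) = u p"
proof -
  have "AE p in lborel. p \<in> Omega \<longrightarrow> R (snd p) (fst p) = \<rho> p"
    using assms(1) unfolding time_representative_def AE_lebesgue_on[OF open_Omega] by blast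
  then show ?thesis using assms(2) by eventually_elim auto
qed

theorem theorem4p3:
  fixes f :: "real \<Rightarrow> real" and J :: nat
    and s T :: "nat \<Rightarrow> real" and y dy q q' :: "nat \<Rightarrow> real \<Rightarrow> real"
    and \<rho>o \<sigma>o :: "real \<Rightarrow> real"
  assumes "flux f"
    and "trajectories J s T y dy"
    and "Linf_in UNIV {0..1} \<rho>o" and "Linf_in UNIV {0..1} \<sigma>o"
    and "constraints f J s T dy q" and "constraints f J s T dy q'"
  shows "(\<forall>\<rho> \<sigma> R S.
            G_entropy_solution f J s T y dy q \<rho>o \<rho> \<and> time_representative \<rho> R \<and>
            G_entropy_solution f J s T y dy q' \<sigma>o \<sigma> \<and> time_representative \<sigma> S \<longrightarrow>
            (\<forall>\<tau>>0. (\<integral>\<^sup>+x. ennreal \<bar>R \<tau> x - S \<tau> x\<bar> \<partial>lebesgue)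
                \<le> (\<integral>\<^sup>+x. ennreal \<bar>\<rho>o x - \<sigma>o x\<bar> \<partial>lebesgue)
                   + (\<Sum>i=1..J. 2 * (\<integral>\<^sup>+t\<in>{s i<..<T i}. ennreal \<bar>q i t - q' i t\<bar> \<partial>lebesgue))))
       \<and> (\<forall>\<rho> \<sigma>.
            G_entropy_solution f J s T y dy q \<rho>o \<rho> \<and> G_entropy_solution f J s T y dy q \<rho>o \<sigma> \<longrightarrow>
            (AE p in lebesgue_on Omega. \<rho> p = \<sigma> p))"
proof (intro conjI allI impI)
  fix \<rho> \<sigma> R S and \<tau> :: real
  assume H: "G_entropy_solution f J s T y dy q \<rho>o \<rho> \<and> time_representative \<rho> R \<and>
            G_entropy_solution f J s T y dy q' \<sigma>o \<sigma> \<and> time_representative \<sigma> S" and \<tau>: "\<tau> > 0"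
  let ?X = "\<integral>\<^sup>+x. ennreal \<bar>\<rho>o x - \<sigma>o x\<bar> \<partial>lebesgue"
  obtain L u v u0 v0 yb c m ul ur vl vr where
    ts: "two_solutions (clampf f) L u v u0 v0 {1..J} s T yb c m ul ur vl vr" and
    u: "AE p in lborel. p \<in> Omega \<longrightarrow> u p = \<rho> p" and v: "AE p in lborel. p \<in> Omega \<longrightarrow> v p = \<sigma> p" and
    o: "AE x in lborel. u0 x = \<rho>o x" "AE x in lborel. v0 x = \<sigma>o x" and
    m: "\<And>i. i \<in> {1..J} \<Longrightarrow> AE t in lborel. t \<in> {s i<..<T i} \<longrightarrow> m i t = 2 * \<bar>q i t - q' i t\<bar>"
    using reduction[OF assms] H by blast
  interpret two_solutions "clampf f" L u v u0 v0 "{1..J}" s T yb c m ul ur vl vr by (rule ts)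
  show "(\<integral>\<^sup>+x. ennreal \<bar>R \<tau> x - S \<tau> x\<bar> \<partial>lebesgue) \<le> ?X
                   + (\<Sum>i=1..J. 2 * (\<integral>\<^sup>+t\<in>{s i<..<T i}. ennreal \<bar>q i t - q' i t\<bar> \<partial>lebesgue))"
  \<comment> \<open>With an infinite initial distance there is nothing to prove; a finite one gives
    the integrability that the contraction estimate assumes.\<close>
  proof (cases "?X = \<infinity>")
    case False
    have X: "?X = (\<integral>\<^sup>+x. ennreal \<bar>u0 x - v0 x\<bar> \<partial>lborel)"
      unfolding nn_integral_completion using o by (intro nn_integral_cong_AE) (auto elim: eventually_elim2)
    have [measurable]: "u0 \<in> borel_measurable borel" "v0 \<in> borel_measurable borel" using unitbD(1) uu0 vv0 by auto
    have int: "integrable lborel (\<lambda>x. \<bar>u0 x - v0 x\<bar>)"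
      using False X by (intro integrableI_nonneg) (auto simp: less_top)
    have e0: "ennreal (LBINT x. \<bar>u0 x - v0 x\<bar>) = ?X"
      unfolding X by (rule nn_integral_eq_integral[OF int, symmetric]) auto
    have mi: "integrable lborel (\<lambda>t. indicator {s i<..<T i} t * m i t)" if "i \<in> {1..J}" for i
      by (intro bcs_integrable bcs_mult1 bcs_indicator mb that) auto
    have e1: "ennreal (LBINT t. indicator {s i<..<T i} t * m i t) = 2 * (\<integral>\<^sup>+t\<in>{s i<..<T i}. ennreal \<bar>q i t - q' i t\<bar> \<partial>lebesgue)"
      if i: "i \<in> {1..J}" for i
    proof -
      have [measurable]: "m i \<in> borel_measurable borel" using bb_measurable[OF mb[OF i]] .
      have "ennreal (LBINT t. indicator {s i<..<T i} t * m i t) = (\<integral>\<^sup>+t. ennreal (indicator {s i<..<T i} t * m i t) \<partial>lborel)"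
        using m0[OF i] by (intro nn_integral_eq_integral[OF mi[OF i], symmetric]) auto
      also have "\<dots> = (\<integral>\<^sup>+t. 2 * ennreal (indicator {s i<..<T i} t * m i t / 2) \<partial>lborel)"
        using m0[OF i] by (intro nn_integral_cong) (simp add: ennreal_mult'[symmetric, of 2, simplified])
      also have "\<dots> = 2 * (\<integral>\<^sup>+t. ennreal (indicator {s i<..<T i} t * m i t / 2) \<partial>lborel)"
        by (rule nn_integral_cmult) measurable
      also have "(\<integral>\<^sup>+t. ennreal (indicator {s i<..<T i} t * m i t / 2) \<partial>lborel) = (\<integral>\<^sup>+t\<in>{s i<..<T i}. ennreal \<bar>q i t - q' i t\<bar> \<partial>lborel)"
        by (rule nn_integral_cong_AE) (use m[OF i] in eventually_elim, auto simp: indicator_def)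
      finally show ?thesis by (simp add: nn_integral_completion)
    qed
    have c1: "continuous_L1loc R" "continuous_L1loc S" using H by (auto simp: time_representative_def)
    have "AE p in lborel. p \<in> Omega \<longrightarrow> R (snd p) (fst p) = u p \<and> S (snd p) (fst p) = v p"
      using time_representative_lborel[of \<rho> R, OF _ u] time_representative_lborel[of \<sigma> S, OF _ v] H by (auto elim: eventually_elim2)
    then have "(\<integral>\<^sup>+x. ennreal \<bar>R \<tau> x - S \<tau> x\<bar> \<partial>lebesgue) \<le> ennreal contraction_bound"
      by (rule global_contraction[OF int c1 _ \<tau>])
    also have "\<dots> = ennreal (LBINT x. \<bar>u0 x - v0 x\<bar>) + (\<Sum>i=1..J. ennreal (LBINT t. indicator {s i<..<T i} t * m i t))"
    proof -
      have n: "0 \<le> (LBINT t. indicator {s i<..<T i} t * m i t)" if "i \<in> {1..J}" for i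
        using m0[OF that] by (intro integral_nonneg_AE) auto
      have s: "(\<Sum>i=1..J. ennreal (LBINT t. indicator {s i<..<T i} t * m i t)) = ennreal (\<Sum>i=1..J. LBINT t. indicator {s i<..<T i} t * m i t)"
        by (rule sum_ennreal) (rule n)
      have "0 \<le> (LBINT x. \<bar>u0 x - v0 x\<bar>)" by (intro integral_nonneg_AE) auto
      then show ?thesis unfolding contraction_bound_def s by (intro ennreal_plus sum_nonneg n)
    qed
    also have "\<dots> = ?X + (\<Sum>i=1..J. 2 * (\<integral>\<^sup>+t\<in>{s i<..<T i}. ennreal \<bar>q i t - q' i t\<bar> \<partial>lebesgue))"
      unfolding e0 using e1 by simp
    finally show ?thesis .
  qed simp
next
  fix \<rho> \<sigma>
  assume H: "G_entropy_solution f J s T y dy q \<rho>o \<rho> \<and> G_entropy_solution f J s T y dy q \<rho>o \<sigma>"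
  obtain L u v u0 v0 yb c m ul ur vl vr where
    ts: "two_solutions (clampf f) L u v u0 v0 {1..J} s T yb c m ul ur vl vr" and
    u: "AE p in lborel. p \<in> Omega \<longrightarrow> u p = \<rho> p" and v: "AE p in lborel. p \<in> Omega \<longrightarrow> v p = \<sigma> p" and
    o: "AE x in lborel. u0 x = \<rho>o x" "AE x in lborel. v0 x = \<rho>o x" and
    m: "\<And>i. i \<in> {1..J} \<Longrightarrow> AE t in lborel. t \<in> {s i<..<T i} \<longrightarrow> m i t = 2 * \<bar>q i t - q i t\<bar>"
    using reduction[OF assms(1,2,3,3,5,5)] H by blast
  interpret two_solutions "clampf f" L u v u0 v0 "{1..J}" s T yb c m ul ur vl vr by (rule ts)
  have z: "AE x in lborel. \<bar>u0 x - v0 x\<bar> = 0" using o by eventually_elim auto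
  have [measurable]: "u0 \<in> borel_measurable borel" "v0 \<in> borel_measurable borel" using unitbD(1) uu0 vv0 by auto
  have int: "integrable lborel (\<lambda>x. \<bar>u0 x - v0 x\<bar>)"
    using z by (subst integrable_cong_AE[where g="\<lambda>x. 0"]) auto
  have "(LBINT x. \<bar>u0 x - v0 x\<bar>) = 0" using z by (rule integral_eq_zero_AE)
  moreover have "(LBINT t. indicator {s i<..<T i} t * m i t) = 0" if "i \<in> {1..J}" for i
    by (rule integral_eq_zero_AE) (use m[OF that] in eventually_elim, auto simp: indicator_def)
  ultimately have "contraction_bound \<le> 0" unfolding contraction_bound_def by simp
  from uniqueness[OF int this] show "AE p in lebesgue_on Omega. \<rho> p = \<sigma> p"
    unfolding AE_lebesgue_on[OF open_Omega] using u v by eventually_elim auto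
qed

end
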